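(* Let $\Omega\subset\mathbb{R}^2$ be a strictly convex planar domain with $C^\infty$ boundary, let $s$ be the arc-length parameter on $\partial\Omega$, let $k(s)>0$ be the curvature of $\partial\Omega$, let $\ell_0:=|\partial\Omega|$ be the length of the boundary, and let dots denote derivatives with respect to $s$. Put $$\mathcal I_1:=\int_0^{\ell_0}ds=\ell_0,\qquad \mathcal I_3:=\int_0^{\ell_0}k^{2/3}\,ds,\qquad \mathcal I_5:=\int_0^{\ell_0}\Big(9k^{4/3}+\frac{8\dot k^2}{k^{8/3}}\Big)ds,$$ $$\mathcal I_7:=\int_0^{\ell_0}\Big(9k^2+\frac{24\dot k^2}{k^2}+\frac{24\ddot k^2}{k^4}-\frac{144\dot k^2\ddot k}{k^5}+\frac{176\dot k^4}{k^6}\Big)ds,$$ $$\begin{aligned}\mathcal I_9:=\int_0^{\ell_0}\Big[&\frac{281}{44800}k^{8/3}+\frac{281\,\dot k^2}{8400\,k^{4/3}}+\frac{167\,\ddot k^2}{4200\,k^{10/3}}-\frac{167\,\dot k^2\ddot k}{700\,k^{13/3}}+\frac{\dddot k^2}{42\,k^{16/3}}+\frac{559\,\dot k^4}{2100\,k^{16/3}}\\&-\frac{473\,\ddot k^3}{4725\,k^{19/3}}-\frac{10\,\dddot k\,\dot k\,\ddot k}{21\,k^{19/3}}+\frac{5\,\dddot k\,\dot k^3}{7\,k^{22/3}}+\frac{13142\,\dot k^2\ddot k^2}{4725\,k^{22/3}}-\frac{10777\,\dot k^4\ddot k}{1575\,k^{25/3}}+\frac{521897\,\dot k^6}{127575\,k^{28/3}}\Big]ds.\end{aligned}$$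 Let $\beta$ and $\alpha$ be Mather's $\beta$- and $\alpha$-functions of the billiard in $\Omega$. Then: (1) The formal Taylor expansion of $\beta$ at $\omega=0$, $\beta(\omega)\sim\sum_{k=0}^\infty\beta_k\frac{\omega^k}{k!}$, has coefficients $\beta_{2k}=0$ for all $k\ge 0$, and $$\beta_1=-\mathcal I_1,\qquad \beta_3=\frac14\mathcal I_3^3,\qquad \beta_5=-\frac1{144}\mathcal I_3^4\mathcal I_5,\qquad \beta_7=\frac{\mathcal I_3^5\,(14\,\mathcal I_5^2-81\,\mathcal I_3\mathcal I_7)}{25920},$$ $$\beta_9=-7\,\mathcal I_3^6\Big(\mathcal I_3^2\mathcal I_9-\frac1{5600}\mathcal I_3\mathcal I_5\mathcal I_7+\frac{7}{583200}\mathcal I_5^3\Big).$$ (2) The formal Taylor expansion of $(c+\ell_0)^{-3/2}\alpha(c)$ at $c=-\ell_0$, $(c+\ell_0)^{-3/2}\alpha(c)\sim\sum_{k=0}^\infty\alpha_k\,(c+\ell_0)^k$, has coefficients $$\alpha_0=\frac{4\sqrt2}{3}\,\mathcal I_3^{-3/2},\qquad \alpha_1=\frac{\sqrt2}{135}\,\mathcal I_3^{-7/2}\,\mathcal I_5,\qquad \alpha_2=\frac{1}{56700\sqrt2}\cdot\frac{72\,\mathcal I_3\mathcal I_7+7\,\mathcal I_5^2}{\mathcal I_3^{11/2}},$$ $$\alpha_3=\frac{1}{826686000\sqrt2}\cdot\frac{261273600\,\mathcal I_3^2\mathcal I_9+21384\,\mathcal I_3\mathcal I_5\mathcal I_7+1001\,\mathcal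 I_5^3}{\mathcal I_3^{15/2}}.$$
   Context: Billiard. $\Omega$ is a strictly convex planar domain with $C^\infty$ boundary (curvature $k>0$ everywhere), $\gamma$ is a positively oriented arc-length parametrization of $\partial\Omega$, extended $\ell_0$-periodically to $\mathbb{R}$. A point mass moves with unit speed along straight segments in $\Omega$ and reflects at the boundary with angle of incidence equal to angle of reflection. The billiard map is a twist map with generating function $h(s,s')=-\|\gamma(s)-\gamma(s')\|$ (minus the Euclidean distance), for lifts $s\le s'\le s+\ell_0$ of consecutive impact points. Rotation number. A billiard orbit with lifted impact points $(s_i)_{i\in\mathbb{Z}}$ has rotation number $\omega=\lim_{i\to\pm\infty}\frac{s_i}{i\,\ell_0}$ if the limit exists; for a periodic orbit this is $p/q$ with $p$ the winding number around $\partial\Omega$ and $q$ the number of reflections. $\beta$-function. An orbit $(s_i)$ is minimal if every finite segment of it minimizes $\sum h(s_i,s_{i+1})$ among sequences with the same endpoints. Minimal orbits exist for every rotation number, and $$\beta(\omega):=\lim_{N\to\infty}\frac1{2N}\sum_{i=-N}^{N-1}h(s_i,s_{i+1})$$ for any minimal orbit of rotation number $\omega$ (the value does not depend on the choice). Thus, for $p/q\in(0,1/2]$ in lowest terms, $\beta(p/q)=-\frac1q\max\{\text{length of periodic billiard orbits of rotation number }p/q\}$; also $\beta(0)=0$ and $\beta(1-\omega)=\beta(\omega)$ for $\omega\in[0,1]$. The function $\beta$ is strictly convex. $\alpha$-function. $\alpha$ is the convex conjugate $\alpha(c)=\sup_{\omega}[\omega c-\beta(\omega)]$, the supremum being over the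 rotation numbers $\omega\in[0,1]$. Caustics. A caustic is a smooth convex closed curve in $\Omega$ such that a trajectory tangent to it remains tangent to it after each reflection; its rotation number is that of the trajectories tangent to it. By Lazutkin's theorem, there is a positive-measure Cantor set of rotation numbers $\omega$, accumulating at $0$, for which a caustic $\Gamma_\omega$ exists; on this set $\beta$ is $C^\infty$ in the sense of Whitney, and $\beta'(\omega)=-|\Gamma_\omega|$ (minus the length of $\Gamma_\omega$). Formal Taylor expansion. "$\beta(\omega)\sim\sum_k\beta_k\omega^k/k!$" means that for every $n$, $\beta(\omega)=\sum_{k=0}^n\beta_k\frac{\omega^k}{k!}+O(\omega^{n+1})$ as $\omega\to0^+$ along rotation numbers $\omega$ for which a caustic exists. Similarly "$(c+\ell_0)^{-3/2}\alpha(c)\sim\sum_k\alpha_k(c+\ell_0)^k$" means that for every $n$ the difference between the left side and the partial sum up to $k=n$ is $O((c+\ell_0)^{n+1})$ as $c\to-\ell_0^+$ along the values $c=-|\Gamma_\omega|$ with $\Gamma_\omega$ a caustic of rotation number $\omega\to0^+$. *)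

theory Defs
  imports
    "HOL-Analysis.Analysis"
    "HOL-Complex_Analysis.Winding_Numbers"
    "HOL-Library.Landau_Symbols"
begin

text \<open>The plane is \<^typ>\<open>complex\<close>, regarded as a two-dimensional Euclidean space.\<close>

definition velocity :: "(real \<Rightarrow> complex) \<Rightarrow> real \<Rightarrow> complex" where
  "velocity c = (\<lambda>t. vector_derivative c (at t))"

definition smooth_curve :: "(real \<Rightarrow> complex) \<Rightarrow> bool" where
  "smooth_curve c \<longleftrightarrow> (\<forall>n t. (velocity ^^ n) c differentiable (at t))"

text \<open>Simple closed smooth curves with a positively oriented arc-length parametrization,
  extended periodically to the whole line. Because of the unit speed, the period \<open>L\<close>
  is the length of the curve.\<close>

definition smooth_closed_curve :: "(real \<Rightarrow> complex) \<Rightarrow> real \<Rightarrow> bool" where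
  "smooth_closed_curve c L \<longleftrightarrow>
     0 < L \<and> smooth_curve c \<and>
     (\<forall>t. norm (velocity c t) = 1) \<and>
     (\<forall>t. c (t + L) = c t) \<and>
     inj_on c {0..<L} \<and>
     (\<forall>z \<in> inside (range c). winding_number (\<lambda>u. c (L * u)) z = 1)"

text \<open>Signed curvature with respect to arc length: the determinant of the first two derivatives.\<close>

definition curvature :: "(real \<Rightarrow> complex) \<Rightarrow> real \<Rightarrow> real" where
  "curvature c t = Im (cnj (velocity c t) * velocity (velocity c) t)"

definition strictly_convex :: "complex set \<Rightarrow> bool" where
  "strictly_convex S \<longleftrightarrow>
     (\<forall>x \<in> closure S. \<forall>y \<in> closure S. x \<noteq> y \<longrightarrow> open_segment x y \<subseteq> interior S)"

definition billiard_table :: "complex set \<Rightarrow> (real \<Rightarrow> complex) \<Rightarrow> real \<Rightarrow> bool" where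
  "billiard_table \<Omega> \<gamma> l \<longleftrightarrow>
     open \<Omega> \<and> connected \<Omega> \<and> bounded \<Omega> \<and> \<Omega> \<noteq> {} \<and> strictly_convex \<Omega> \<and>
     smooth_closed_curve \<gamma> l \<and> frontier \<Omega> = range \<gamma> \<and>
     (\<forall>s. 0 < curvature \<gamma> s)"

definition generating :: "(real \<Rightarrow> complex) \<Rightarrow> real \<Rightarrow> real \<Rightarrow> real" where
  "generating \<gamma> s s' = - norm (\<gamma> s - \<gamma> s')"

text \<open>Reflection in the tangent line: the outgoing direction keeps the tangential component
  of the incoming direction and reverses the normal one.\<close>

definition reflects :: "(real \<Rightarrow> complex) \<Rightarrow> real \<Rightarrow> real \<Rightarrow> real \<Rightarrow> bool" where
  "reflects \<gamma> a b c \<longleftrightarrow>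
     (let u = sgn (\<gamma> b - \<gamma> a); v = sgn (\<gamma> c - \<gamma> b); T = velocity \<gamma> b
      in v = (2 * (u \<bullet> T)) *\<^sub>R T - u)"

text \<open>Bi-infinite sequences of lifted impact points. The last two disjuncts are the fixed points
  of the billiard map on the two boundary components of the phase space (zero angle
  with the boundary); they are the orbits of rotation numbers 0 and 1.\<close>

definition billiard_orbit :: "(real \<Rightarrow> complex) \<Rightarrow> real \<Rightarrow> (int \<Rightarrow> real) \<Rightarrow> bool" where
  "billiard_orbit \<gamma> l s \<longleftrightarrow>
     (\<forall>i. s i < s (i + 1) \<and> s (i + 1) < s i + l \<and> reflects \<gamma> (s (i - 1)) (s i) (s (i + 1))) \<or>
     (\<forall>i. s (i + 1) = s i) \<or>
     (\<forall>i. s (i + 1) = s i + l)"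

definition has_rotation_number :: "real \<Rightarrow> (int \<Rightarrow> real) \<Rightarrow> real \<Rightarrow> bool" where
  "has_rotation_number l s \<omega> \<longleftrightarrow>
     ((\<lambda>i. s i / (of_int i * l)) \<longlongrightarrow> \<omega>) at_top \<and>
     ((\<lambda>i. s i / (of_int i * l)) \<longlongrightarrow> \<omega>) at_bot"

definition minimal_orbit :: "(real \<Rightarrow> complex) \<Rightarrow> real \<Rightarrow> (int \<Rightarrow> real) \<Rightarrow> bool" where
  "minimal_orbit \<gamma> l s \<longleftrightarrow> billiard_orbit \<gamma> l s \<and>
     (\<forall>m n t. m < n \<and> t m = s m \<and> t n = s n \<and>
        (\<forall>i \<in> {m..<n}. t i \<le> t (i + 1) \<and> t (i + 1) \<le> t i + l) \<longrightarrow>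
        (\<Sum>i \<in> {m..<n}. generating \<gamma> (s i) (s (i + 1)))
          \<le> (\<Sum>i \<in> {m..<n}. generating \<gamma> (t i) (t (i + 1))))"

definition mather_beta :: "(real \<Rightarrow> complex) \<Rightarrow> real \<Rightarrow> real \<Rightarrow> real" where
  "mather_beta \<gamma> l \<omega> =
     (THE b. \<exists>s. minimal_orbit \<gamma> l s \<and> has_rotation_number l s \<omega> \<and>
        (\<lambda>N. (\<Sum>i \<in> {- int N..<int N}. generating \<gamma> (s i) (s (i + 1))) / (2 * real N))
          \<longlonglongrightarrow> b)"

definition mather_alpha :: "(real \<Rightarrow> complex) \<Rightarrow> real \<Rightarrow> real \<Rightarrow> real" where
  "mather_alpha \<gamma> l c = (SUP \<omega> \<in> {0..1}. \<omega> * c - mather_beta \<gamma> l \<omega>)"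

definition tangent_segment :: "(real \<Rightarrow> complex) \<Rightarrow> complex \<Rightarrow> complex \<Rightarrow> bool" where
  "tangent_segment \<sigma> a b \<longleftrightarrow>
     (\<exists>t r. \<sigma> t \<in> closed_segment a b \<and> b - a = r *\<^sub>R velocity \<sigma> t)"

definition positively_tangent_segment :: "(real \<Rightarrow> complex) \<Rightarrow> complex \<Rightarrow> complex \<Rightarrow> bool" where
  "positively_tangent_segment \<sigma> a b \<longleftrightarrow>
     (\<exists>t r. 0 < r \<and> \<sigma> t \<in> closed_segment a b \<and> b - a = r *\<^sub>R velocity \<sigma> t)"

text \<open>A caustic is given by its positively oriented arc-length parametrization \<open>\<sigma>\<close> and its
  length \<open>L\<close>.\<close>

definition caustic ::
    "complex set \<Rightarrow> (real \<Rightarrow> complex) \<Rightarrow> real \<Rightarrow> (real \<Rightarrow> complex) \<Rightarrow> real \<Rightarrow> bool" where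
  "caustic \<Omega> \<gamma> l \<sigma> L \<longleftrightarrow>
     smooth_closed_curve \<sigma> L \<and>
     range \<sigma> = frontier (convex hull (range \<sigma>)) \<and>
     range \<sigma> \<subseteq> \<Omega> \<and>
     (\<forall>s i. billiard_orbit \<gamma> l s \<and> tangent_segment \<sigma> (\<gamma> (s i)) (\<gamma> (s (i + 1))) \<longrightarrow>
        tangent_segment \<sigma> (\<gamma> (s (i + 1))) (\<gamma> (s (i + 2))))"

text \<open>A tangent trajectory and its reversal have rotation numbers \<open>\<omega>\<close> and \<open>1 - \<omega>\<close>. The rotation
  number of the caustic is that of the trajectories which follow its positive orientation.\<close>

definition caustic_of_rotation_number ::
    "complex set \<Rightarrow> (real \<Rightarrow> complex) \<Rightarrow> real \<Rightarrow> (real \<Rightarrow> complex) \<Rightarrow> real \<Rightarrow> real \<Rightarrow> bool" where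
  "caustic_of_rotation_number \<Omega> \<gamma> l \<sigma> L \<omega> \<longleftrightarrow> caustic \<Omega> \<gamma> l \<sigma> L \<and>
     (\<exists>s i. billiard_orbit \<gamma> l s \<and> positively_tangent_segment \<sigma> (\<gamma> (s i)) (\<gamma> (s (i + 1)))) \<and>
     (\<forall>s i. billiard_orbit \<gamma> l s \<and> positively_tangent_segment \<sigma> (\<gamma> (s i)) (\<gamma> (s (i + 1))) \<longrightarrow>
        has_rotation_number l s \<omega>)"

definition caustic_rotation_numbers ::
    "complex set \<Rightarrow> (real \<Rightarrow> complex) \<Rightarrow> real \<Rightarrow> real set" where
  "caustic_rotation_numbers \<Omega> \<gamma> l = {\<omega>. \<exists>\<sigma> L. caustic_of_rotation_number \<Omega> \<gamma> l \<sigma> L \<omega>}"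

definition beta_expansion ::
    "complex set \<Rightarrow> (real \<Rightarrow> complex) \<Rightarrow> real \<Rightarrow> (nat \<Rightarrow> real) \<Rightarrow> bool" where
  "beta_expansion \<Omega> \<gamma> l b \<longleftrightarrow>
     (\<forall>n. (\<lambda>\<omega>. mather_beta \<gamma> l \<omega> - (\<Sum>k\<le>n. b k * \<omega> ^ k / fact k))
        \<in> O[at 0 within ({0<..} \<inter> caustic_rotation_numbers \<Omega> \<gamma> l)](\<lambda>\<omega>. \<omega> ^ (n + 1)))"

text \<open>The filter on pairs \<open>(\<omega>, c)\<close> for \<open>\<omega> \<rightarrow> 0+\<close> and \<open>c \<rightarrow> -l+\<close>
  along the values \<open>c = -L\<close> with \<open>L\<close> the length of a caustic of rotation number \<open>\<omega>\<close>.\<close>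

definition caustic_length_filter ::
    "complex set \<Rightarrow> (real \<Rightarrow> complex) \<Rightarrow> real \<Rightarrow> (real \<times> real) filter" where
  "caustic_length_filter \<Omega> \<gamma> l =
     inf (at_right 0 \<times>\<^sub>F at_right (- l))
         (principal {(\<omega>, c). \<exists>\<sigma> L. caustic_of_rotation_number \<Omega> \<gamma> l \<sigma> L \<omega> \<and> c = - L})"

definition alpha_expansion ::
    "complex set \<Rightarrow> (real \<Rightarrow> complex) \<Rightarrow> real \<Rightarrow> (nat \<Rightarrow> real) \<Rightarrow> bool" where
  "alpha_expansion \<Omega> \<gamma> l a \<longleftrightarrow>
     (\<forall>n. (\<lambda>(\<omega>, c). (c + l) powr (-3/2) * mather_alpha \<gamma> l c - (\<Sum>k\<le>n. a k * (c + l) ^ k))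
        \<in> O[caustic_length_filter \<Omega> \<gamma> l](\<lambda>(\<omega>, c). (c + l) ^ (n + 1)))"

text \<open>In the following \<open>k\<close> is a function of the arc length and \<open>l\<close> the length of the boundary.\<close>

definition I1 :: "real \<Rightarrow> real" where
  "I1 l = integral {0..l} (\<lambda>s. 1)"

definition I3 :: "(real \<Rightarrow> real) \<Rightarrow> real \<Rightarrow> real" where
  "I3 k l = integral {0..l} (\<lambda>s. k s powr (2/3))"

definition I5 :: "(real \<Rightarrow> real) \<Rightarrow> real \<Rightarrow> real" where
  "I5 k l = integral {0..l} (\<lambda>s.
     let k0 = k s; k1 = deriv k s
     in 9 * k0 powr (4/3) + 8 * k1^2 / k0 powr (8/3))"

definition I7 :: "(real \<Rightarrow> real) \<Rightarrow> real \<Rightarrow> real" where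
  "I7 k l = integral {0..l} (\<lambda>s.
     let k0 = k s; k1 = deriv k s; k2 = (deriv ^^ 2) k s
     in 9 * k0^2 + 24 * k1^2 / k0^2 + 24 * k2^2 / k0^4
        - 144 * k1^2 * k2 / k0^5 + 176 * k1^4 / k0^6)"

definition I9 :: "(real \<Rightarrow> real) \<Rightarrow> real \<Rightarrow> real" where
  "I9 k l = integral {0..l} (\<lambda>s.
     let k0 = k s; k1 = deriv k s; k2 = (deriv ^^ 2) k s; k3 = (deriv ^^ 3) k s
     in 281/44800 * k0 powr (8/3)
        + 281 * k1^2 / (8400 * k0 powr (4/3))
        + 167 * k2^2 / (4200 * k0 powr (10/3))
        - 167 * k1^2 * k2 / (700 * k0 powr (13/3))
        + k3^2 / (42 * k0 powr (16/3))
        + 559 * k1^4 / (2100 * k0 powr (16/3))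
        - 473 * k2^3 / (4725 * k0 powr (19/3))
        - 10 * k3 * k1 * k2 / (21 * k0 powr (19/3))
        + 5 * k3 * k1^3 / (7 * k0 powr (22/3))
        + 13142 * k1^2 * k2^2 / (4725 * k0 powr (22/3))
        - 10777 * k1^4 * k2 / (1575 * k0 powr (25/3))
        + 521897 * k1^6 / (127575 * k0 powr (28/3)))"

end

theory Submission
  imports Defs
begin

text \<open>
  The expansions hold for every rotation number \<open>\<omega> \<rightarrow> 0+\<close> and every \<open>c \<rightarrow> -l+\<close>, without
  caustics. Fix a small \<open>\<epsilon>\<close> and compare the deficit \<open>s' - s - \<bar>\<gamma>(s) - \<gamma>(s')\<bar>\<close> of a chord with
  \<open>\<epsilon>^2\<close> times the integral of a function \<open>G(x, \<epsilon>^2)\<close> over \<open>[s, s']\<close>. A polynomial \<open>G\<close> in \<open>\<epsilon>^2\<close> with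
  smooth periodic coefficients can be determined order by order such that the difference (\<open>gap\<close>)
  has, up to \<open>O(\<epsilon>^(2I+5))\<close>, the minimum \<open>-(2/3) \<epsilon>^3\<close>, attained once for every midpoint of \<open>[s, s']\<close>.
  The lower bound on the gap is a weak KAM inequality: it bounds the length of any sequence of impact
  points and hence \<open>\<beta>\<close> from below. Envelope reasoning shows that the minimum is
  attained where the integral of \<open>H = 2 \<partial>(t G)/\<partial>t\<close> at \<open>t = \<epsilon>^2\<close> over \<open>[s, s']\<close> equals \<open>2 \<epsilon>\<close>, so the
  sequence which is equidistributed with respect to \<open>H\<close> almost realizes this bound. Thus, with bars
  denoting integrals over a period,
  \<open>\<alpha>(\<epsilon>^2 Gbar - l) = (2/3) \<epsilon>^3\<close> and \<open>\<beta>(\<omega>) = (\<epsilon>^2 Gbar - l) \<omega> - (2/3) \<epsilon>^3\<close> for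
  \<open>\<omega> = 2 \<epsilon> / Hbar\<close> up to \<open>O(\<epsilon>^(2I+5))\<close>, and \<open>\<epsilon>\<close> is eliminated. The first coefficients
  of \<open>G\<close> are computed in terms of \<open>w = k^(1/3)\<close> and the invariants \<open>uu n\<close> of degree \<open>0\<close>; their
  integrals are multiples of \<open>I3\<close>, \<open>I5\<close>, \<open>I7\<close>, \<open>I9\<close>.

  For \<open>\<beta>\<close> to be meaningful, minimal orbits of every rotation number are constructed in the manner of
  Aubry and Mather, as limits of well-ordered periodic maximizers of the length.
\<close>

subsection \<open>Smooth periodic functions\<close>

text \<open>Reversibility of the billiard is the source of the parity. Around the midpoint of an
  arc, both the deficit of the chord and the integral of a density are odd in the length of the arc;
  so only powers of \<epsilon>^2 enter, and the even coefficients of \<beta> vanish.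

  Requiring the same minimal value at every midpoint turns the search for \<open>G\<close> into
  algebra: the derivatives of \<open>G\<close> carry additional factors \<epsilon>^2, so in each
  order only coefficients already known are differentiated. In lowest order, with D = k^2/24 the
  cubic coefficient of the deficit, D y^3 - G y must have a critical point with value -2/3. Hence y
  = 2 k^(-2/3) and G = k^(2/3)/2, Lazutkin's density, whose integral is I3/2. The constant 2/3 makes
  \<open>H\<close> start with k^(2/3).

  Two obstacles shape the estimates. Expansions near the diagonal say nothing about long chords,
  whereas the lower bound must hold for all of them; a global cubic bound for the deficit fills this
  gap. And every order has its own polynomial \<open>G\<close>; uniqueness of asymptotic
  coefficients joins the results to one expansion.\<close>

coinductive psmooth :: "(real \<Rightarrow> real) \<Rightarrow> bool" where
  psmoothI: "\<forall>x. f (x + 1) = f x \<Longrightarrow> \<forall>x. (f has_real_derivative f' x) (at x) \<Longrightarrow> psmooth f' \<Longrightarrow> psmooth f"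

text \<open>Coinduction needs a single class that contains the smooth periodic functions and is
  closed under the ring operations, real powers and differentiation at the same time. This closure
  is such a class, because the sum, product and power rules express derivatives inside it; all
  closure properties of \<open>psmooth\<close> follow at once.\<close>

inductive palg :: "(real \<Rightarrow> real) \<Rightarrow> bool" where
  palg_base: "psmooth f \<Longrightarrow> palg f"
| palg_const: "palg (\<lambda>_. c)"
| palg_add: "palg f \<Longrightarrow> palg g \<Longrightarrow> palg (\<lambda>x. f x + g x)"
| palg_mult: "palg f \<Longrightarrow> palg g \<Longrightarrow> palg (\<lambda>x. f x * g x)"
| palg_powr: "palg f \<Longrightarrow> \<forall>x. f x > 0 \<Longrightarrow> palg (\<lambda>x. f x powr a)"

lemma palg_deriv:
  "palg f \<Longrightarrow> (\<forall>x. f (x + 1) = f x) \<and> (\<exists>f'. (\<forall>x. (f has_real_derivative f' x) (at x)) \<and> palg f')"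
proof (induction rule: palg.induct)
  case (palg_base f)
  then show ?case by cases (use palg.palg_base in blast)
next
  case (palg_const c)
  show ?case by (auto intro!: exI[of _ "\<lambda>_. 0"] palg.palg_const)
next
  case (palg_add f g)
  then obtain f' g' where *: "\<forall>x. (f has_real_derivative f' x) (at x)" "palg f'"
    "\<forall>x. (g has_real_derivative g' x) (at x)" "palg g'" by auto
  have "((\<lambda>x. f x + g x) has_real_derivative f' x + g' x) (at x)" for x
    using * by (auto intro!: derivative_eq_intros)
  moreover have "palg (\<lambda>x. f' x + g' x)" using * by (intro palg.palg_add)
  ultimately show ?case using palg_add by (auto intro!: exI[of _ "\<lambda>x. f' x + g' x"])
next
  case (palg_mult f g)
  then obtain f' g' where *: "\<forall>x. (f has_real_derivative f' x) (at x)" "palg f'"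
    "\<forall>x. (g has_real_derivative g' x) (at x)" "palg g'" by auto
  have "((\<lambda>x. f x * g x) has_real_derivative f' x * g x + f x * g' x) (at x)" for x
    using *(1,3) by (auto intro!: derivative_eq_intros)
  moreover have "palg (\<lambda>x. f' x * g x + f x * g' x)"
    using * palg_mult by (intro palg.palg_add palg.palg_mult) auto
  ultimately show ?case using palg_mult by (auto intro!: exI[of _ "\<lambda>x. f' x * g x + f x * g' x"])
next
  case (palg_powr f a)
  then obtain f' where *: "\<forall>x. (f has_real_derivative f' x) (at x)" "palg f'" by auto
  have "((\<lambda>x. f x powr a) has_real_derivative a * (f x powr (a - 1) * f' x)) (at x)" for x
    using DERIV_chain2[OF has_real_derivative_powr[of "f x" a] *(1)[rule_format, of x]] palg_powr(2)
    by (simp add: mult.assoc)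
  moreover have "palg (\<lambda>x. a * (f x powr (a - 1) * f' x))"
    using * palg_powr by (intro palg.palg_mult palg.palg_powr palg.palg_const) auto
  ultimately show ?case using palg_powr by (auto intro!: exI[of _ "\<lambda>x. a * (f x powr (a - 1) * f' x)"])
qed

lemma palg_psmooth: "palg f \<Longrightarrow> psmooth f"
  by (coinduction arbitrary: f) (use palg_deriv in blast)

lemma psmooth_const: "psmooth (\<lambda>_. c)"
  by (rule palg_psmooth[OF palg_const])

lemma psmooth_add: "psmooth f \<Longrightarrow> psmooth g \<Longrightarrow> psmooth (\<lambda>x. f x + g x)"
  by (rule palg_psmooth[OF palg_add[OF palg_base palg_base]])

lemma psmooth_mult: "psmooth f \<Longrightarrow> psmooth g \<Longrightarrow> psmooth (\<lambda>x. f x * g x)"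
  by (rule palg_psmooth[OF palg_mult[OF palg_base palg_base]])

lemma psmooth_powr: "psmooth f \<Longrightarrow> \<forall>x. f x > 0 \<Longrightarrow> psmooth (\<lambda>x. f x powr a)"
  by (rule palg_psmooth[OF palg_powr[OF palg_base]])

text \<open>A type with a ring structure makes polynomials over these functions available; they
  serve as truncated power series in \<epsilon>^2 with periodic coefficients. A type cannot depend
  on the length \<open>l\<close>, so the period is normalized to 1, and \<open>val\<close> restores
  arc length.\<close>

typedef psm = "{f. psmooth f}" morphisms ev Abs_psm
  using palg_psmooth[OF palg_const[of 0]] by auto

setup_lifting type_definition_psm

instantiation psm :: comm_ring_1
begin
lift_definition zero_psm :: psm is "\<lambda>_. 0" by (rule psmooth_const)
lift_definition one_psm :: psm is "\<lambda>_. 1" by (rule psmooth_const)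
lift_definition plus_psm :: "psm \<Rightarrow> psm \<Rightarrow> psm" is "\<lambda>f g x. f x + g x"
  by (rule psmooth_add)
lift_definition times_psm :: "psm \<Rightarrow> psm \<Rightarrow> psm" is "\<lambda>f g x. f x * g x"
  by (rule psmooth_mult)
lift_definition uminus_psm :: "psm \<Rightarrow> psm" is "\<lambda>f x. (-1) * f x"
  by (intro psmooth_mult psmooth_const)
lift_definition minus_psm :: "psm \<Rightarrow> psm \<Rightarrow> psm" is "\<lambda>f g x. f x + (-1) * g x"
  by (intro psmooth_add psmooth_mult psmooth_const)
instance
proof
  fix a b c :: psm
  note R = zero_psm.rep_eq one_psm.rep_eq plus_psm.rep_eq times_psm.rep_eq uminus_psm.rep_eq
    minus_psm.rep_eq
  have E: "a = b" if "\<And>x. ev a x = ev b x" for a b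
    using that by (metis ev_inject ext)
  show "a * b * c = a * (b * c)" by (rule E) (simp add: R mult.assoc)
  show "a * b = b * a" by (rule E) (simp add: R mult.commute)
  show "1 * a = a" by (rule E) (simp add: R)
  show "a + b + c = a + (b + c)" by (rule E) (simp add: R)
  show "a + b = b + a" by (rule E) (simp add: R)
  show "0 + a = a" by (rule E) (simp add: R)
  show "- a + a = 0" by (rule E) (simp add: R)
  show "a - b = a + - b" by (rule E) (simp add: R)
  show "(a + b) * c = a * c + b * c" by (rule E) (simp add: R ring_distribs)
  show "(0::psm) \<noteq> 1"
  proof
    assume "(0::psm) = 1"
    then have "ev 0 0 = ev 1 0" by simp
    then show False by (simp add: R)
  qed
qed
end

instantiation psm :: real_algebra_1
begin
lift_definition scaleR_psm :: "real \<Rightarrow> psm \<Rightarrow> psm" is "\<lambda>c f x. c * f x"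
  by (intro psmooth_mult psmooth_const)
instance
proof
  fix a b :: real and x y :: psm
  note R = scaleR_psm.rep_eq plus_psm.rep_eq times_psm.rep_eq
  have E: "a = b" if "\<And>x. ev a x = ev b x" for a b
    using that by (metis ev_inject ext)
  show "a *\<^sub>R (x + y) = a *\<^sub>R x + a *\<^sub>R y" by (rule E) (simp add: R ring_distribs)
  show "(a + b) *\<^sub>R x = a *\<^sub>R x + b *\<^sub>R x" by (rule E) (simp add: R ring_distribs)
  show "a *\<^sub>R b *\<^sub>R x = (a * b) *\<^sub>R x" by (rule E) (simp add: R mult.assoc)
  show "1 *\<^sub>R x = x" by (rule E) (simp add: R)
  show "a *\<^sub>R x * y = a *\<^sub>R (x * y)" by (rule E) (simp add: R mult.assoc)
  show "x * a *\<^sub>R y = a *\<^sub>R (x * y)" by (rule E) (simp add: R mult.left_commute)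
qed
end

lift_definition ddx :: "psm \<Rightarrow> psm" is deriv
proof -
  fix f assume "psmooth f"
  then obtain f' where *: "\<forall>x. (f has_real_derivative f' x) (at x)" "psmooth f'"
    by (auto elim: psmooth.cases)
  have "deriv f = f'" using *(1) DERIV_imp_deriv by blast
  with * show "psmooth (deriv f)" by simp
qed

lemma ev_simps [simp]:
  "ev 0 x = 0" "ev 1 x = 1" "ev (f + g) x = ev f x + ev g x" "ev (f - g) x = ev f x - ev g x"
  "ev (f * g) x = ev f x * ev g x" "ev (- f) x = - ev f x" "ev (c *\<^sub>R f) x = c * ev f x"
  by (simp_all add: zero_psm.rep_eq one_psm.rep_eq plus_psm.rep_eq times_psm.rep_eq
    uminus_psm.rep_eq minus_psm.rep_eq scaleR_psm.rep_eq)

lemma ev_of_real [simp]: "ev (of_real c) x = c"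
  by (simp add: of_real_def)

lemma ev_of_nat [simp]: "ev (of_nat n) x = of_nat n"
  by (induction n) auto

lemma ev_numeral [simp]: "ev (numeral n) x = numeral n"
  using ev_of_nat[of "numeral n" x] by simp

lemma ev_power [simp]: "ev (f ^ n) x = ev f x ^ n"
  by (induction n) auto

lemma ev_sum [simp]: "ev (sum f A) x = (\<Sum>i\<in>A. ev (f i) x)"
  by (induction A rule: infinite_finite_induct) auto

lemma psm_eqI: "(\<And>x. ev f x = ev g x) \<Longrightarrow> f = g"
  by transfer auto

lemma ev_periodic: "ev f (x + 1) = ev f x"
  by transfer (auto elim: psmooth.cases)

lemma ev_periodic_int: "ev f (x + of_int n) = ev f x"
proof (induction n rule: int_induct[where k = 0])
  case (step1 i)
  then show ?case using ev_periodic[of f "x + of_int i"] by (simp add: add.assoc)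
next
  case (step2 i)
  then show ?case using ev_periodic[of f "x + of_int (i - 1)"] by (simp add: add.assoc)
qed simp

lemma ev_ddx: "(ev f has_real_derivative ev (ddx f) x) (at x)"
  by transfer (metis DERIV_imp_deriv psmooth.cases)

lemma ddx_eqI:
  assumes "\<And>x. (ev f has_real_derivative ev g x) (at x)"
  shows "ddx f = g"
  by (rule psm_eqI) (use assms ev_ddx DERIV_unique in blast)

lemma ddx_simps:
  "ddx 0 = 0" "ddx 1 = 0" "ddx (f + g) = ddx f + ddx g" "ddx (f - g) = ddx f - ddx g"
  "ddx (- f) = - ddx f" "ddx (c *\<^sub>R f) = c *\<^sub>R ddx f" "ddx (f * g) = ddx f * g + f * ddx g"
  "ddx (of_real c) = 0"
proof -
  have [derivative_intros]: "(ev h has_real_derivative ev (ddx h) x) (at x)" for h x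
    by (rule ev_ddx)
  have E: "ddx h = h'" if "\<And>x. ((\<lambda>x. ev h x) has_real_derivative ev h' x) (at x)" for h h'
    using that by (intro ddx_eqI) simp
  show "ddx 0 = 0" "ddx 1 = 0" "ddx (of_real c) = 0"
    by (rule E; simp)+
  show "ddx (f + g) = ddx f + ddx g" "ddx (f - g) = ddx f - ddx g"
    "ddx (- f) = - ddx f" "ddx (c *\<^sub>R f) = c *\<^sub>R ddx f" "ddx (f * g) = ddx f * g + f * ddx g"
    by (rule E; simp only: ev_simps; auto intro!: derivative_eq_intros)+
qed

lemma ev_continuous: "continuous_on A (ev f)"
  by (meson DERIV_isCont continuous_at_imp_continuous_on ev_ddx)

lemma ev_bounded: "\<exists>C\<ge>0. \<forall>x. \<bar>ev f x\<bar> \<le> C"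
proof -
  have "bounded (ev f ` {0..1})"
    by (intro compact_imp_bounded compact_continuous_image ev_continuous) auto
  then obtain C where C: "\<And>x. x \<in> {0..1} \<Longrightarrow> \<bar>ev f x\<bar> \<le> C"
    unfolding bounded_real by (meson imageI)
  have "\<bar>ev f x\<bar> \<le> C" for x
  proof -
    have "ev f x = ev f (frac x)"
      using ev_periodic_int[of f "frac x" "\<lfloor>x\<rfloor>"] by (simp add: frac_def)
    then show ?thesis using C[of "frac x"] frac_ge_0[of x] frac_lt_1[of x] by auto
  qed
  moreover have "C \<ge> 0" using C[of 0] by auto
  ultimately show ?thesis by blast
qed

lemma psm_powr:
  assumes "\<And>x. ev f x > 0"
  obtains g where "\<And>x. ev g x = ev f x powr a"
proof -
  have "psmooth (\<lambda>x. ev f x powr a)"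
    by (intro psmooth_powr) (use assms ev[of f] in auto)
  then show ?thesis using that[of "Abs_psm (\<lambda>x. ev f x powr a)"] by (simp add: Abs_psm_inverse)
qed

lemma ev_poly: "ev (poly p (of_real t)) x = (\<Sum>i\<le>degree p. ev (coeff p i) x * t ^ i)"
  by (simp add: poly_altdef flip: of_real_power)

text \<open>The later error terms have to be uniform in the base point \<open>x\<close> as well as
  in \<open>t\<close>; periodicity provides this coefficient by coefficient.\<close>

lemma poly_bounded:
  "\<exists>C\<ge>0. \<forall>t x. 0 \<le> t \<longrightarrow> t \<le> 1 \<longrightarrow> \<bar>ev (poly p (of_real t)) x\<bar> \<le> C"
proof (induction p)
  case 0
  show ?case by auto
next
  case (pCons a p)
  then obtain C where C: "C \<ge> 0" "\<And>t x. 0 \<le> t \<Longrightarrow> t \<le> 1 \<Longrightarrow> \<bar>ev (poly p (of_real t)) x\<bar> \<le> C"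
    by auto
  obtain B where B: "B \<ge> 0" "\<And>x. \<bar>ev a x\<bar> \<le> B" using ev_bounded by blast
  have "\<bar>ev (poly (pCons a p) (of_real t)) x\<bar> \<le> B + C" if "0 \<le> t" "t \<le> 1" for t x
  proof -
    have "\<bar>t * ev (poly p (of_real t)) x\<bar> \<le> 1 * C"
      unfolding abs_mult using that C by (intro mult_mono) auto
    then show ?thesis using B(2)[of x] by simp
  qed
  then show ?case using B(1) C(1) by (intro exI[of _ "B + C"]) auto
qed

lemma poly_dvd_bounded:
  assumes "monom 1 n dvd p"
  shows "\<exists>C\<ge>0. \<forall>t x. 0 \<le> t \<longrightarrow> t \<le> 1 \<longrightarrow> \<bar>ev (poly p (of_real t)) x\<bar> \<le> C * t ^ n"
proof -
  from assms obtain q where q: "p = monom 1 n * q" by (elim dvdE)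
  obtain C where C: "C \<ge> 0" "\<And>t x. 0 \<le> t \<Longrightarrow> t \<le> 1 \<Longrightarrow> \<bar>ev (poly q (of_real t)) x\<bar> \<le> C"
    using poly_bounded by blast
  have "\<bar>ev (poly p (of_real t)) x\<bar> \<le> C * t ^ n" if "0 \<le> t" "t \<le> 1" for t x
    using mult_left_mono[OF C(2)[OF that, of x], of "t ^ n"] that
    by (simp add: q poly_monom abs_mult mult.commute flip: of_real_power)
  then show ?thesis using C(1) by blast
qed

section \<open>Functions of arc length with period \<open>l\<close>\<close>

locale period =
  fixes l :: real
  assumes l_pos: "l > 0"
begin

definition val :: "psm \<Rightarrow> real \<Rightarrow> real" where "val f s = ev f (s / l)"

definition d :: "psm \<Rightarrow> psm" where "d f = (1 / l) *\<^sub>R ddx f"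

definition dP :: "psm poly \<Rightarrow> psm poly" where "dP = map_poly d"

abbreviation pval :: "psm poly \<Rightarrow> real \<Rightarrow> real \<Rightarrow> real" where
  "pval p t s \<equiv> val (poly p (of_real t)) s"

lemma val_simps [simp]:
  "val 0 x = 0" "val 1 x = 1" "val (f + g) x = val f x + val g x" "val (f - g) x = val f x - val g x"
  "val (f * g) x = val f x * val g x" "val (- f) x = - val f x" "val (c *\<^sub>R f) x = c * val f x"
  "val (of_real c) x = c" "val (of_nat n) x = of_nat n" "val (numeral m) x = numeral m"
  "val (f ^ n) x = val f x ^ n" "val (sum F A) x = (\<Sum>i\<in>A. val (F i) x)"
  by (simp_all add: val_def)

lemma val_eqI: "(\<And>x. val f x = val g x) \<Longrightarrow> f = g"
proof (rule psm_eqI)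
  fix x assume "\<And>x. val f x = val g x"
  from this[of "x * l"] show "ev f x = ev g x" using l_pos by (simp add: val_def)
qed

lemma val_periodic_int: "val f (x + of_int n * l) = val f x"
  using l_pos ev_periodic_int[of f "x / l" n] by (simp add: val_def add_divide_distrib)

lemma val_deriv: "(val f has_real_derivative val (d f) x) (at x)"
proof -
  have "((\<lambda>x. ev f (x / l)) has_real_derivative ev (ddx f) (x / l) * (1 / l)) (at x)"
    using l_pos by (intro DERIV_chain2[OF ev_ddx]) (auto intro!: derivative_eq_intros)
  then show ?thesis by (simp add: val_def[abs_def] d_def)
qed

lemma d_eqI:
  assumes "\<And>x. (val f has_real_derivative val g x) (at x)"
  shows "d f = g"
  by (rule val_eqI) (use assms val_deriv DERIV_unique in blast)

lemma d_simps:
  "d 0 = 0" "d 1 = 0" "d (f + g) = d f + d g" "d (f - g) = d f - d g"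
  "d (- f) = - d f" "d (c *\<^sub>R f) = c *\<^sub>R d f" "d (f * g) = d f * g + f * d g"
  "d (of_real c) = 0"
  by (simp_all add: d_def ddx_simps scaleR_add_right scaleR_diff_right)

lemma val_continuous: "continuous_on A (val f)"
  by (meson DERIV_isCont continuous_at_imp_continuous_on val_deriv)

lemma val_bounded: "\<exists>C\<ge>0. \<forall>x. \<bar>val f x\<bar> \<le> C"
  using ev_bounded unfolding val_def by blast

lemma pval_bounded: "\<exists>C\<ge>0. \<forall>t x. 0 \<le> t \<longrightarrow> t \<le> 1 \<longrightarrow> \<bar>pval p t x\<bar> \<le> C"
  using poly_bounded unfolding val_def by blast

lemma pval_sum: "pval p t x = (\<Sum>i\<le>degree p. val (coeff p i) x * t ^ i)"
  by (simp add: val_def ev_poly)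

lemma coeff_dP [simp]: "coeff (dP p) n = d (coeff p n)"
  by (simp add: dP_def coeff_map_poly d_simps)

lemma dP_simps:
  "dP 0 = 0" "dP (p + q) = dP p + dP q" "dP (p - q) = dP p - dP q" "dP (- p) = - dP p"
  "dP (pCons a p) = pCons (d a) (dP p)" "dP (smult a p) = smult (d a) p + smult a (dP p)"
  by (auto simp: poly_eq_iff d_simps coeff_pCons split: nat.splits)

lemma coeff_dP_funpow [simp]: "coeff ((dP ^^ n) p) i = (d ^^ n) (coeff p i)"
  by (induction n) auto

lemma d_poly_of_real: "d (poly p (of_real t)) = poly (dP p) (of_real t)"
  by (induction p) (auto simp: dP_simps d_simps)

lemma d_funpow_poly_of_real: "(d ^^ n) (poly p (of_real t)) = poly ((dP ^^ n) p) (of_real t)"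
  by (induction n) (auto simp: d_poly_of_real)

end

subsection \<open>Geometry of the table\<close>

definition wedge :: "complex \<Rightarrow> complex \<Rightarrow> real" where "wedge a b = Im (cnj a * b)"

lemma wedge_simps: "wedge a (b + c) = wedge a b + wedge a c" "wedge a (b - c) = wedge a b - wedge a c"
  "wedge a (c' *\<^sub>R b) = c' * wedge a b" "wedge a (- b) = - wedge a b" "wedge a 0 = 0"
  by (simp_all add: wedge_def algebra_simps)

text \<open>This planar identity turns the mixed second derivative of a distance into a product of
  two sines, see \<open>slope_deriv\<close>.\<close>

lemma inner_wedge: "(a \<bullet> b) * (v \<bullet> v) - (a \<bullet> v) * (b \<bullet> v) = wedge a v * wedge b v"
  by (simp add: wedge_def inner_complex_def algebra_simps)

lemma inner_sq_wedge: "(a \<bullet> v)\<^sup>2 + (wedge a v)\<^sup>2 = (norm a)\<^sup>2 * (norm v)\<^sup>2"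
  unfolding cmod_power2 by (simp add: wedge_def inner_complex_def algebra_simps power2_eq_square)

locale table =
  fixes \<Omega> :: "complex set" and \<gamma> :: "real \<Rightarrow> complex" and l :: real
  assumes table: "billiard_table \<Omega> \<gamma> l"
begin

abbreviation T :: "real \<Rightarrow> complex" where "T \<equiv> velocity \<gamma>"

definition r :: "real \<Rightarrow> real \<Rightarrow> real" where "r s t = norm (\<gamma> s - \<gamma> t)"

lemma smooth_closed: "smooth_closed_curve \<gamma> l"
  using table by (simp add: billiard_table_def)

lemma l_pos: "l > 0"
  using smooth_closed by (simp add: smooth_closed_curve_def)

lemma velocity_deriv:
  "((velocity ^^ n) \<gamma> has_vector_derivative (velocity ^^ Suc n) \<gamma> t) (at t)"
  using smooth_closed
  by (simp add: smooth_closed_curve_def smooth_curve_def velocity_def vector_derivative_works)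

lemma gamma_deriv: "(\<gamma> has_vector_derivative T t) (at t)"
  using velocity_deriv[of 0 t] by simp

lemma T_deriv: "(T has_vector_derivative velocity T t) (at t)"
  using velocity_deriv[of 1 t] by simp

lemma norm_T [simp]: "norm (T t) = 1"
  using smooth_closed by (simp add: smooth_closed_curve_def)

lemma gamma_period: "\<gamma> (t + l) = \<gamma> t"
  using smooth_closed by (simp add: smooth_closed_curve_def)

lemma gamma_period_int: "\<gamma> (t + of_int n * l) = \<gamma> t"
proof (induction n rule: int_induct[where k = 0])
  case (step1 i)
  then show ?case using gamma_period[of "t + of_int i * l"] by (simp add: algebra_simps)
next
  case (step2 i)
  then show ?case using gamma_period[of "t + of_int (i - 1) * l"] by (simp add: algebra_simps)
qed simp

lemma velocity_shift:
  assumes "\<And>t. f (t + l) = f t"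
  shows "velocity f (t + l) = velocity f t"
proof -
  have "(f has_vector_derivative x) (at (t + l)) \<longleftrightarrow> (f has_vector_derivative x) (at t)" for x
  proof
    assume "(f has_vector_derivative x) (at (t + l))"
    then have "(f \<circ> (\<lambda>t. t + l) has_vector_derivative 1 *\<^sub>R x) (at t)"
      by (intro vector_diff_chain_at) (auto intro!: derivative_eq_intros)
    then show "(f has_vector_derivative x) (at t)" using assms by (simp add: o_def)
  next
    assume "(f has_vector_derivative x) (at t)"
    then have "(f \<circ> (\<lambda>t. t - l) has_vector_derivative 1 *\<^sub>R x) (at (t + l))"
      by (intro vector_diff_chain_at) (auto intro!: derivative_eq_intros)
    moreover have "f \<circ> (\<lambda>t. t - l) = f" using assms[of "_ - l"] by (auto simp: o_def)
    ultimately show "(f has_vector_derivative x) (at (t + l))" by simp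
  qed
  then show ?thesis by (simp add: velocity_def vector_derivative_def)
qed

lemma velocity_pow_period: "(velocity ^^ n) \<gamma> (t + l) = (velocity ^^ n) \<gamma> t"
  by (induction n arbitrary: t) (auto simp: gamma_period intro: velocity_shift)

lemma gamma_eqD:
  assumes "\<gamma> s = \<gamma> t"
  shows "\<exists>n::int. t = s + of_int n * l"
proof -
  define red where "red s = s - of_int \<lfloor>s / l\<rfloor> * l" for s
  have 1: "red s \<in> {0..<l}" for s
  proof -
    have "of_int \<lfloor>s / l\<rfloor> \<le> s / l" "s / l < of_int \<lfloor>s / l\<rfloor> + 1" by linarith+
    then have "of_int \<lfloor>s / l\<rfloor> * l \<le> s" "s < (of_int \<lfloor>s / l\<rfloor> + 1) * l"
      using l_pos by (simp_all only: pos_le_divide_eq pos_divide_less_eq)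
    then show ?thesis by (simp add: red_def algebra_simps)
  qed
  have 2: "\<gamma> (red s) = \<gamma> s" for s
    using gamma_period_int[of "red s" "\<lfloor>s / l\<rfloor>"] by (simp add: red_def)
  have "red s = red t"
    using smooth_closed 1 2 assms unfolding smooth_closed_curve_def by (metis inj_onD)
  then have "t = s + of_int (\<lfloor>t / l\<rfloor> - \<lfloor>s / l\<rfloor>) * l" by (simp add: red_def algebra_simps)
  then show ?thesis by blast
qed

lemma gamma_neq: "s < t \<Longrightarrow> t < s + l \<Longrightarrow> \<gamma> s \<noteq> \<gamma> t"
proof
  assume *: "s < t" "t < s + l" "\<gamma> s = \<gamma> t"
  then obtain n :: int where n: "t = s + of_int n * l" using gamma_eqD by blast
  with * l_pos have "0 < of_int n * l" "of_int n * l < 1 * l" by auto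
  then have "0 < n" "n < 1" using l_pos
    by (simp add: zero_less_mult_iff, simp only: mult_less_cancel_right, auto)
  then show False by simp
qed

lemma curv_pos: "0 < curvature \<gamma> s"
  using table by (simp add: billiard_table_def)

lemma inner_T_T': "T t \<bullet> velocity T t = 0"
proof -
  have "((\<lambda>t. T t \<bullet> T t) has_vector_derivative T t \<bullet> velocity T t + velocity T t \<bullet> T t) (at t)"
    by (rule bounded_bilinear.has_vector_derivative[OF bounded_bilinear_inner T_deriv T_deriv])
  moreover have "(\<lambda>t. T t \<bullet> T t) = (\<lambda>t. 1)"
    by (simp add: fun_eq_iff flip: power2_norm_eq_inner)
  ultimately have "((\<lambda>t. 1::real) has_vector_derivative 2 * (T t \<bullet> velocity T t)) (at t)"
    by (simp add: inner_commute)
  moreover have "((\<lambda>t. 1::real) has_vector_derivative 0) (at t)" by simp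
  ultimately show ?thesis using vector_derivative_unique_at by fastforce
qed

lemma T_unit: "T t * cnj (T t) = 1"
  by (metis complex_norm_square norm_T of_real_1 one_power2)

lemma T': "velocity T t = \<i> * of_real (curvature \<gamma> t) * T t"
proof -
  have "cnj (T t) * velocity T t = \<i> * of_real (curvature \<gamma> t)"
    using inner_T_T'[of t] by (simp add: complex_eq_iff curvature_def inner_complex_def)
  then have "T t * cnj (T t) * velocity T t = T t * (\<i> * of_real (curvature \<gamma> t))"
    by (simp add: mult.assoc)
  then show ?thesis by (simp add: T_unit mult_ac)
qed

lemma range_frontier: "\<gamma> s \<in> frontier \<Omega>"
  using table by (auto simp: billiard_table_def)

lemma open_table: "open \<Omega>" and strict: "strictly_convex \<Omega>" and table_ne: "\<Omega> \<noteq> {}"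
  using table by (auto simp: billiard_table_def)

lemma gamma_not_in: "\<gamma> s \<notin> \<Omega>"
  using range_frontier[of s] open_table by (simp add: frontier_def interior_open)

lemma gamma_closure: "\<gamma> s \<in> closure \<Omega>"
  using range_frontier[of s] by (simp add: frontier_def)

lemma convex_table: "convex \<Omega>"
proof (rule convexI)
  fix x y u v assume *: "x \<in> \<Omega>" "y \<in> \<Omega>" "0 \<le> u" "0 \<le> v" "u + v = (1::real)"
  then have cs: "u *\<^sub>R x + v *\<^sub>R y \<in> closed_segment x y"
    by (auto simp: in_segment algebra_simps intro!: exI[of _ v] simp flip: scaleR_add_left)
  show "u *\<^sub>R x + v *\<^sub>R y \<in> \<Omega>"
  proof (cases "x = y")
    case True
    with * show ?thesis by (simp flip: scaleR_add_left)
  next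
    case False
    then have "open_segment x y \<subseteq> \<Omega>"
      using strict * open_table closure_subset unfolding strictly_convex_def
      by (metis interior_open subsetD)
    with cs * show ?thesis by (auto simp: open_segment_def)
  qed
qed

text \<open>A supporting line of the table at \<open>\<gamma> s\<close> has a normal
  \<open>a\<close> for which \<open>a \<bullet> \<gamma>\<close> is maximal at \<open>s\<close>; so
  the line is the tangent. The second derivative test and the positive curvature decide that the
  table is on its left.\<close>

lemma wedge_nonneg_closure:
  "\<exists>a. (\<forall>x\<in>closure \<Omega>. 0 \<le> wedge (T s) (x - \<gamma> s))"
proof -
  define p where "p = \<gamma> s"
  have "\<exists>a b. a \<noteq> 0 \<and> (\<forall>x\<in>\<Omega>. a \<bullet> x \<le> b) \<and> (\<forall>x\<in>{p}. a \<bullet> x \<ge> b)"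
    using gamma_not_in[of s] table_ne by (intro separating_hyperplane_sets convex_table) (auto simp: p_def)
  then obtain a where a: "a \<noteq> 0" "\<And>x. x \<in> \<Omega> \<Longrightarrow> a \<bullet> x \<le> a \<bullet> p" by fastforce
  have "closure \<Omega> \<subseteq> {x. a \<bullet> x \<le> a \<bullet> p}"
    using a by (intro closure_minimal closed_halfspace_le) auto
  then have a_cl: "a \<bullet> x \<le> a \<bullet> p" if "x \<in> closure \<Omega>" for x using that by auto
  define f where "f t = a \<bullet> \<gamma> t" for t
  have f': "(f has_real_derivative a \<bullet> T t) (at t)" for t
    unfolding f_def has_real_derivative_iff_has_vector_derivative
    by (rule bounded_linear.has_vector_derivative[OF bounded_linear_inner_right gamma_deriv])
  have f'': "((\<lambda>t. a \<bullet> T t) has_real_derivative a \<bullet> velocity T t) (at t)" for t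
    unfolding has_real_derivative_iff_has_vector_derivative
    by (rule bounded_linear.has_vector_derivative[OF bounded_linear_inner_right T_deriv])
  have max: "f t \<le> f s" for t
    using a_cl[OF gamma_closure[of t]] by (simp add: f_def p_def)
  have z: "a \<bullet> T s = 0"
    using DERIV_local_max[OF f', of 1 s] max by auto
  \<comment> \<open>Otherwise the first derivative, which vanishes at \<open>s\<close>, would be
    positive just after \<open>s\<close>, and \<open>f\<close> would exceed its maximum.\<close>
  have le: "a \<bullet> velocity T s \<le> 0"
  proof (rule ccontr)
    assume "\<not> ?thesis"
    then obtain e where e: "e > 0" "\<And>h. 0 < h \<Longrightarrow> h < e \<Longrightarrow> a \<bullet> T s < a \<bullet> T (s + h)"
      using DERIV_pos_inc_right[OF f''[of s]] by auto
    have "f s < f (s + e / 2)"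
    proof (rule DERIV_pos_imp_increasing_open[of s "s + e / 2" f])
      show "s < s + e / 2" using e by simp
      show "\<exists>y. (f has_real_derivative y) (at x) \<and> 0 < y" if "s < x" "x < s + e / 2" for x
        using e(2)[of "x - s"] that f'[of x] z by auto
      show "continuous_on {s..s + e / 2} f"
        using f' by (meson DERIV_isCont continuous_at_imp_continuous_on)
    qed
    with max[of "s + e / 2"] show False by simp
  qed
  \<comment> \<open>\<open>a\<close> is orthogonal to \<open>T s\<close> and hence the multiple
    \<open>m\<close> of the normal \<open>\<i> * T s\<close>; the second derivative is
    \<open>m\<close> times the curvature.\<close>
  define m where "m = wedge (T s) a"
  have "cnj (T s) * a = \<i> * of_real m"
    using z by (simp add: complex_eq_iff m_def wedge_def inner_complex_def algebra_simps)
  then have "T s * cnj (T s) * a = T s * (\<i> * of_real m)" by (simp add: mult.assoc)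
  then have am: "a = \<i> * of_real m * T s" by (simp add: T_unit mult_ac)
  have "a \<bullet> velocity T s = m * curvature \<gamma> s"
  proof -
    have "a \<bullet> velocity T s = m * curvature \<gamma> s * (T s \<bullet> T s)"
      by (simp add: am T' inner_complex_def algebra_simps)
    then show ?thesis by (simp flip: power2_norm_eq_inner)
  qed
  with le curv_pos[of s] have "m \<le> 0" by (simp add: mult_le_0_iff)
  moreover have "m \<noteq> 0" using a am by auto
  ultimately have m: "m < 0" by simp
  have "0 \<le> wedge (T s) (x - p)" if "x \<in> closure \<Omega>" for x
  proof -
    have "a \<bullet> (x - p) = m * wedge (T s) (x - p)"
      by (simp add: am wedge_def inner_complex_def algebra_simps)
    moreover have "a \<bullet> (x - p) \<le> 0" using a_cl[OF that] by (simp add: inner_diff_right)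
    ultimately show ?thesis using m by (simp add: mult_le_0_iff)
  qed
  then show ?thesis by (simp add: p_def)
qed

text \<open>If the chord lay on the tangent line, its midpoint would be an interior point by strict
  convexity. A small displacement to the right of the tangent would then stay in the table, against
  \<open>wedge_nonneg_closure\<close>.\<close>

lemma wedge_pos:
  assumes "\<gamma> t \<noteq> \<gamma> s"
  shows "wedge (T s) (\<gamma> t - \<gamma> s) > 0"
proof (rule ccontr)
  assume "\<not> ?thesis"
  then have w0: "wedge (T s) (\<gamma> t - \<gamma> s) = 0"
    using wedge_nonneg_closure[of s] gamma_closure[of t] by fastforce
  define z where "z = midpoint (\<gamma> s) (\<gamma> t)"
  have "z \<in> open_segment (\<gamma> s) (\<gamma> t)" using assms by (simp add: z_def)
  then have "z \<in> interior \<Omega>"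
    using strict gamma_closure assms unfolding strictly_convex_def by (metis subsetD)
  then obtain e where e: "e > 0" "ball z e \<subseteq> \<Omega>" by (meson mem_interior)
  define x where "x = z - (e / 2) *\<^sub>R (\<i> * T s)"
  have "dist z x = e / 2" using e by (simp add: x_def dist_norm norm_mult)
  then have "x \<in> ball z e" using e(1) by simp
  then have "x \<in> closure \<Omega>" using e(2) closure_subset by blast
  then have "0 \<le> wedge (T s) (x - \<gamma> s)" using wedge_nonneg_closure[of s] by auto
  moreover have "x - \<gamma> s = (1/2) *\<^sub>R (\<gamma> t - \<gamma> s) - (e / 2) *\<^sub>R (\<i> * T s)"
    by (simp add: x_def z_def midpoint_def complex_eq_iff)
  then have "wedge (T s) (x - \<gamma> s) = - (e / 2) * wedge (T s) (\<i> * T s)"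
    using w0 by (simp only: wedge_simps)
  moreover have "wedge (T s) (\<i> * T s) = T s \<bullet> T s"
    by (simp add: wedge_def inner_complex_def)
  then have "wedge (T s) (\<i> * T s) = 1" by (simp flip: power2_norm_eq_inner)
  ultimately show False using e by simp
qed

lemma strict_triangle:
  assumes "\<gamma> a \<noteq> \<gamma> b" "\<gamma> b \<noteq> \<gamma> c" "\<gamma> a \<noteq> \<gamma> c"
  shows "r a c < r a b + r b c"
proof (rule ccontr)
  assume "\<not> ?thesis"
  moreover have "r a c \<le> r a b + r b c"
    unfolding r_def by (metis dist_norm dist_triangle)
  ultimately have "dist (\<gamma> a) (\<gamma> c) = dist (\<gamma> a) (\<gamma> b) + dist (\<gamma> b) (\<gamma> c)"
    by (simp add: r_def dist_norm)
  then have "\<gamma> b \<in> closed_segment (\<gamma> a) (\<gamma> c)" by (simp add: between between_mem_segment[symmetric])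
  then have "\<gamma> b \<in> open_segment (\<gamma> a) (\<gamma> c)" using assms by (auto simp: open_segment_def)
  then have "\<gamma> b \<in> interior \<Omega>"
    using strict gamma_closure assms unfolding strictly_convex_def by (metis subsetD)
  then show False using gamma_not_in open_table by (simp add: interior_open)
qed

lemma r_commute: "r a b = r b a"
  by (simp add: r_def norm_minus_commute)

lemma r_nonneg [simp]: "0 \<le> r a b" and r_self [simp]: "r a a = 0"
  by (simp_all add: r_def)

lemma r_triangle: "r a c \<le> r a b + r b c"
  unfolding r_def by (metis dist_norm dist_triangle)

lemma r_period [simp]: "r (a + of_int n * l) b = r a b" "r a (b + of_int n * l) = r a b"
  by (simp_all add: r_def gamma_period_int)

lemma r_period1 [simp]: "r (a + l) b = r a b" "r a (b + l) = r a b"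
  by (simp_all add: r_def gamma_period)

lemma r_le: "r a b \<le> \<bar>b - a\<bar>"
proof -
  have "norm (\<gamma> b - \<gamma> a) \<le> 1 * norm (b - a)"
    using gamma_deriv
    by (intro differentiable_bound[of UNIV \<gamma> "\<lambda>x h. h *\<^sub>R T x"])
       (auto simp: has_vector_derivative_def intro!: onorm_le)
  then show ?thesis by (simp add: r_def norm_minus_commute)
qed

lemma r_pos: "a < b \<Longrightarrow> b < a + l \<Longrightarrow> 0 < r a b"
  using gamma_neq[of a b] by (simp add: r_def)

text \<open>A third point \<open>c\<close> close to \<open>a\<close> is certainly different from
  \<open>\<gamma> a\<close> on the curve, so the strict triangle inequality applies unless two of
  the points coincide. There is no upper bound on the arc.\<close>

lemma r_less:
  assumes "a < b"
  shows "r a b < b - a"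
proof -
  define e where "e = min ((b - a) / 2) (l / 2)"
  have e: "e > 0" "e < b - a" "e < l" using assms l_pos by (auto simp: e_def min_def)
  define c where "c = a + e"
  have 1: "\<gamma> a \<noteq> \<gamma> c" using gamma_neq[of a c] e by (auto simp: c_def)
  show ?thesis
  proof (cases "\<gamma> a = \<gamma> b")
    case True
    with assms show ?thesis by (simp add: r_def)
  next
    case False
    show ?thesis
    proof (cases "\<gamma> c = \<gamma> b")
      case True
      then have "r a b = r a c" by (simp add: r_def)
      also have "\<dots> \<le> e" using r_le[of a c] e by (simp add: c_def)
      finally show ?thesis using e by simp
    next
      case nb: False
      have "r a b < r a c + r c b" by (rule strict_triangle) (use 1 nb False in auto)
      also have "\<dots> \<le> \<bar>c - a\<bar> + \<bar>b - c\<bar>" by (intro add_mono r_le)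
      finally show ?thesis using e by (simp add: c_def)
    qed
  qed
qed

lemma r_le_l: "a \<le> b \<Longrightarrow> b \<le> a + l \<Longrightarrow> r a b \<le> a + l - b"
  using r_le[of "a + l" b] by simp

definition slope :: "real \<Rightarrow> real \<Rightarrow> real" where
  "slope s t = (T t \<bullet> (\<gamma> t - \<gamma> s)) / norm (\<gamma> t - \<gamma> s)"

lemma r_deriv:
  assumes "\<gamma> s \<noteq> \<gamma> t"
  shows "((\<lambda>t. r s t) has_real_derivative slope s t) (at t)"
proof -
  have "((\<lambda>t. (\<gamma> t - \<gamma> s) \<bullet> (\<gamma> t - \<gamma> s)) has_vector_derivative
      (\<gamma> t - \<gamma> s) \<bullet> T t + T t \<bullet> (\<gamma> t - \<gamma> s)) (at t)"
    by (rule bounded_bilinear.has_vector_derivative[OF bounded_bilinear_inner])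
       (auto intro!: derivative_eq_intros gamma_deriv)
  then have *: "((\<lambda>t. (\<gamma> t - \<gamma> s) \<bullet> (\<gamma> t - \<gamma> s)) has_real_derivative 2 * (T t \<bullet> (\<gamma> t - \<gamma> s))) (at t)"
    by (simp add: has_real_derivative_iff_has_vector_derivative inner_commute)
  have "((\<lambda>t. sqrt ((\<gamma> t - \<gamma> s) \<bullet> (\<gamma> t - \<gamma> s))) has_real_derivative
      inverse (sqrt ((\<gamma> t - \<gamma> s) \<bullet> (\<gamma> t - \<gamma> s))) / 2 * (2 * (T t \<bullet> (\<gamma> t - \<gamma> s)))) (at t)"
    by (rule DERIV_chain2[OF DERIV_real_sqrt *]) (use assms in auto)
  then show ?thesis
    by (simp add: r_def norm_eq_sqrt_inner[symmetric] norm_minus_commute slope_def field_simps)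
qed

text \<open>The twist condition: the mixed second derivative of the length of a chord is the product
  of the sines of its two angles with the boundary divided by its length. The sines are positive by
  \<open>wedge_pos\<close>, as each end of the chord lies to the left of the tangent at the
  other.\<close>

lemma slope_deriv:
  assumes "\<gamma> s \<noteq> \<gamma> t"
  shows "\<exists>y>0. ((\<lambda>s. slope s t) has_real_derivative y) (at s)"
proof -
  define v where "v = \<gamma> t - \<gamma> s"
  have nv: "norm v \<noteq> 0" using assms by (simp add: v_def)
  have 1: "((\<lambda>s. norm (\<gamma> t - \<gamma> s)) has_real_derivative slope t s) (at s)"
    using r_deriv[of t s] assms by (simp add: r_def)
  have "((\<lambda>s. T t \<bullet> (\<gamma> t - \<gamma> s)) has_vector_derivative T t \<bullet> (- T s)) (at s)"
    by (rule bounded_linear.has_vector_derivative[OF bounded_linear_inner_right])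
       (auto intro!: derivative_eq_intros gamma_deriv)
  then have 2: "((\<lambda>s. T t \<bullet> (\<gamma> t - \<gamma> s)) has_real_derivative - (T t \<bullet> T s)) (at s)"
    by (simp add: has_real_derivative_iff_has_vector_derivative)
  define y where "y = (- (T t \<bullet> T s) * norm v - (T t \<bullet> v) * slope t s) / (norm v * norm v)"
  have d: "((\<lambda>s. slope s t) has_real_derivative y) (at s)"
    unfolding slope_def using DERIV_divide[OF 2 1] nv by (simp add: y_def v_def)
  have sl: "slope t s = - (T s \<bullet> v) / norm v"
  proof -
    have "\<gamma> s - \<gamma> t = - v" by (simp add: v_def)
    then show ?thesis unfolding slope_def by simp
  qed
  have "y = ((T t \<bullet> v) * (T s \<bullet> v) - (T t \<bullet> T s) * (norm v)\<^sup>2) / norm v ^ 3"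
    using nv by (simp add: y_def sl field_simps power2_eq_square power3_eq_cube)
  also have "\<dots> = - (wedge (T t) v * wedge (T s) v) / norm v ^ 3"
    by (simp add: power2_norm_eq_inner flip: inner_wedge)
  finally have y: "y = - (wedge (T t) v * wedge (T s) v) / norm v ^ 3" .
  have "wedge (T s) v > 0" using wedge_pos[of t s] assms by (simp add: v_def)
  moreover have "wedge (T t) (- v) > 0" using wedge_pos[of s t] assms by (simp add: v_def)
  then have "wedge (T t) v < 0" by (simp add: wedge_simps)
  ultimately have "wedge (T t) v * wedge (T s) v < 0" by (simp add: mult_neg_pos)
  then have "y > 0" using nv by (simp add: y divide_neg_pos)
  with d show ?thesis by blast
qed

text \<open>Integrating the positive mixed derivative over a rectangle gives this exchange
  inequality of Aubry and Mather. Geometrically, the diagonals of a quadrilateral inscribed in the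
  boundary are together no shorter than two opposite sides.\<close>

lemma crossing:
  assumes "a \<le> a'" "a' \<le> b'" "b' \<le> b" "b \<le> a + l"
  shows "r a b + r a' b' \<le> r a b' + r a' b"
\<comment> \<open>In these two cases a chord shrinks to a point, where the distance is not
  differentiable; the triangle inequality takes over.\<close>
proof (cases "a' = b' \<or> b = a + l")
  case True
  then show ?thesis
  proof
    assume "a' = b'"
    then show ?thesis using r_triangle[of a b a'] by simp
  next
    assume "b = a + l"
    then show ?thesis using r_triangle[of a' b' a] r_commute[of a a'] by simp
  qed
next
  case False
  with assms have ab: "a' < b'" "b < a + l" by auto
  define f where "f t = r a' t - r a t" for t
  have "f b' \<le> f b"
  proof (rule DERIV_nonneg_imp_nondecreasing[OF assms(3)])
    fix t assume t: "b' \<le> t" "t \<le> b"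
    have ne: "\<gamma> s \<noteq> \<gamma> t" if "a \<le> s" "s \<le> a'" for s
      using gamma_neq[of s t] that t ab by auto
    have "slope a t \<le> slope a' t"
      by (rule DERIV_nonneg_imp_nondecreasing[OF assms(1)]) (use slope_deriv ne less_imp_le in blast)
    moreover have "(f has_real_derivative slope a' t - slope a t) (at t)"
      unfolding f_def by (intro DERIV_diff r_deriv ne) (use assms in auto)
    ultimately show "\<exists>y. (f has_real_derivative y) (at t) \<and> 0 \<le> y" by auto
  qed
  then show ?thesis by (simp add: f_def)
qed


section \<open>Admissible sequences and their lengths\<close>

definition adm :: "(int \<Rightarrow> real) \<Rightarrow> bool" where
  "adm t \<longleftrightarrow> (\<forall>i. t i \<le> t (i + 1) \<and> t (i + 1) \<le> t i + l)"

definition len :: "(int \<Rightarrow> real) \<Rightarrow> int \<Rightarrow> int \<Rightarrow> real" where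
  "len t m n = (\<Sum>i\<in>{m..<n}. r (t i) (t (i + 1)))"

text \<open>The variational half of \<open>minimal_orbit\<close>, with lengths instead of actions.
  The reflection law is recovered from it later, so the constructions can be carried out with
  inequalities that survive limits.\<close>

definition maximal :: "(int \<Rightarrow> real) \<Rightarrow> bool" where
  "maximal s \<longleftrightarrow> adm s \<and> (\<forall>m n t. m < n \<and> t m = s m \<and> t n = s n \<and>
     (\<forall>i\<in>{m..<n}. t i \<le> t (i + 1) \<and> t (i + 1) \<le> t i + l) \<longrightarrow> len t m n \<le> len s m n)"

lemma maximalD:
  assumes "maximal s" "m < n" "t m = s m" "t n = s n"
    "\<And>i. m \<le> i \<Longrightarrow> i < n \<Longrightarrow> t i \<le> t (i + 1) \<and> t (i + 1) \<le> t i + l"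
  shows "len t m n \<le> len s m n"
  using assms unfolding maximal_def by force

lemma len_split: "a \<le> b \<Longrightarrow> b \<le> c \<Longrightarrow> len t a c = len t a b + len t b c"
  unfolding len_def by (subst sum.union_disjoint [symmetric]) (auto simp: ivl_disj_un)

lemma len_cong: "(\<And>i. m \<le> i \<Longrightarrow> i \<le> n \<Longrightarrow> s i = t i) \<Longrightarrow> len s m n = len t m n"
  unfolding len_def by (intro sum.cong) auto

lemma len_nonneg [simp]: "0 \<le> len t m n"
  unfolding len_def by (intro sum_nonneg) auto

lemma len_shift: "len (\<lambda>i. t (i + a) + of_int b * l) m n = len t (m + a) (n + a)"
  unfolding len_def r_period
  by (rule sum.reindex_bij_witness[where i = "\<lambda>i. i - a" and j = "\<lambda>i. i + a"])
     (auto simp: add.commute add.left_commute)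

lemma adm_shift: "adm t \<Longrightarrow> adm (\<lambda>i. t (i + a) + c)"
  unfolding adm_def by (auto simp: algebra_simps) (metis add.commute add.left_commute)+

lemma adm_mono:
  assumes "adm t" "m \<le> n"
  shows "t m \<le> t n \<and> t n \<le> t m + of_int (n - m) * l"
  using assms(2)
proof (induction n rule: int_ge_induct)
  case (step i)
  then show ?case using assms(1)[unfolded adm_def, rule_format, of i] by (auto simp: algebra_simps)
qed simp

lemma adm_r_le: "adm t \<Longrightarrow> r (t i) (t (i + 1)) \<le> l"
  using r_le[of "t i" "t (i + 1)"] unfolding adm_def by (smt (verit, best))

lemma len_le:
  assumes "adm t" "m \<le> n"
  shows "len t m n \<le> of_int (n - m) * l"
proof -
  have "len t m n \<le> (\<Sum>i\<in>{m..<n}. l)"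
    unfolding len_def by (intro sum_mono adm_r_le assms)
  then show ?thesis using assms by simp
qed

text \<open>Discarding \<open>K\<close> steps at each end of \<open>t\<close> leaves room to join
  the rest to the end points of \<open>s\<close> by equal steps. The resulting \<open>u\<close>
  competes with \<open>s\<close>. Each of the \<open>2 * K\<close> discarded steps has length at
  most \<open>l\<close>, which is the loss in the bound.\<close>

lemma bridging:
  fixes m n K :: int
  assumes s: "maximal s" and t: "adm t" and K: "K \<ge> 1" "m + K \<le> n - K"
    and a: "s m \<le> t (m + K)" "t (m + K) \<le> s m + of_int K * l"
    and b: "t (n - K) \<le> s n" "s n \<le> t (n - K) + of_int K * l"
  shows "len t m n \<le> len s m n + 2 * of_int K * l"
proof -
  define p where "p = (t (m + K) - s m) / of_int K"
  define q where "q = (s n - t (n - K)) / of_int K"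
  have K0: "(of_int K :: real) > 0" using K by simp
  have p: "0 \<le> p" "p \<le> l" "s m + of_int K * p = t (m + K)"
    using a K0 by (auto simp: p_def field_simps)
  have q: "0 \<le> q" "q \<le> l" "t (n - K) + of_int K * q = s n"
    using b K0 by (auto simp: q_def field_simps)
  define u where "u i = (if i \<le> m + K then s m + of_int (i - m) * p
    else if i \<le> n - K then t i else t (n - K) + of_int (i - (n - K)) * q)" for i
  have u1: "u i = s m + of_int (i - m) * p" if "i \<le> m + K" for i using that by (simp add: u_def)
  have u2: "u i = t i" if "m + K \<le> i" "i \<le> n - K" for i
    using that p(3) by (auto simp: u_def)
  have u3: "u i = t (n - K) + of_int (i - (n - K)) * q" if "n - K \<le> i" for i
    using that K u2[of i] by (cases "i = n - K") (auto simp: u_def)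
  have len_u: "len u m n \<le> len s m n"
  proof (rule maximalD[OF s])
    show "m < n" using K by linarith
    show "u m = s m" using u1[of m] K by simp
    show "u n = s n" using u3[of n] K q by simp
    fix i assume "m \<le> i" "i < n"
    then consider "i + 1 \<le> m + K" | "m + K \<le> i" "i + 1 \<le> n - K" | "n - K \<le> i" using K by linarith
    then show "u i \<le> u (i + 1) \<and> u (i + 1) \<le> u i + l"
    proof cases
      case 1
      then show ?thesis using u1[of i] u1[of "i + 1"] p by (simp add: algebra_simps)
    next
      case 2
      then show ?thesis using u2[of i] u2[of "i + 1"] t by (simp add: adm_def)
    next
      case 3
      then show ?thesis using u3[of i] u3[of "i + 1"] q by (simp add: algebra_simps)
    qed
  qed
  have "len t m n = len t m (m + K) + len t (m + K) (n - K) + len t (n - K) n"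
    using K len_split[of m "m + K" n t] len_split[of "m + K" "n - K" n t] by simp
  also have "len t m (m + K) \<le> of_int K * l" using len_le[OF t, of m "m + K"] K by simp
  also have "len t (n - K) n \<le> of_int K * l" using len_le[OF t, of "n - K" n] K by simp
  also have "len t (m + K) (n - K) = len u (m + K) (n - K)"
    by (rule len_cong) (simp add: u2)
  also have "len u (m + K) (n - K) \<le> len u m n"
    using K len_split[of m "m + K" n u] len_split[of "m + K" "n - K" n u] by simp
  finally show ?thesis using len_u by (simp add: algebra_simps)
qed

subsection \<open>Periodic maximizers\<close>

definition Per :: "int \<Rightarrow> int \<Rightarrow> (int \<Rightarrow> real) set" where
  "Per p q = {s. adm s \<and> (\<forall>i. s (i + q) = s i + of_int p * l)}"

definition MPer :: "int \<Rightarrow> int \<Rightarrow> (int \<Rightarrow> real) set" where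
  "MPer p q = {x \<in> Per p q. \<forall>y\<in>Per p q. len y 0 q \<le> len x 0 q}"

lemma gamma_continuous: "continuous_on A \<gamma>"
  by (meson continuous_at_imp_continuous_on gamma_deriv has_vector_derivative_continuous)

lemma len_continuous: "continuous_on UNIV (\<lambda>s. len s m n)"
  unfolding len_def r_def
  by (intro continuous_intros continuous_on_compose2[OF gamma_continuous[of UNIV]]
      continuous_on_product_coordinates) auto

lemma compact_box: "compact (PiE UNIV (\<lambda>i::int. {a i..b i::real}))"
proof -
  have "compactin (product_topology (\<lambda>i::int. euclidean :: real topology) UNIV) (PiE UNIV (\<lambda>i. {a i..b i}))"
    by (subst compactin_PiE) auto
  then show ?thesis by (simp add: euclidean_product_topology)
qed

lemma Per_shift: "t \<in> Per p q \<Longrightarrow> (\<lambda>i. t (i + a) + of_int b * l) \<in> Per p q"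
  unfolding Per_def using adm_shift[of t a "of_int b * l"]
  by (auto simp: add.assoc) (metis add.commute add.left_commute add.assoc)

text \<open>Adding a multiple of \<open>l\<close> brings \<open>s 0\<close> into one period. Then
  \<open>adm\<close> confines every coordinate to an interval, and Tychonoff's theorem gives a
  compact set on which the length is continuous.\<close>

lemma MPer_exists:
  assumes "q > 0" "0 \<le> p" "p \<le> q"
  shows "\<exists>x. x \<in> MPer p q"
proof -
  define S where "S = Per p q \<inter> {s. 0 \<le> s 0 \<and> s 0 \<le> l}"
  define B where "B = PiE UNIV (\<lambda>i::int. {- \<bar>of_int i\<bar> * l..\<bar>of_int i\<bar> * l + l})"
  have "S \<subseteq> B"
  proof
    fix s assume s: "s \<in> S"
    have "s i \<in> {- \<bar>of_int i\<bar> * l..\<bar>of_int i\<bar> * l + l}" for i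
    proof (cases "i \<ge> 0")
      case True
      then show ?thesis using s adm_mono[of s 0 i] l_pos by (auto simp: S_def Per_def)
    next
      case False
      then show ?thesis using s adm_mono[of s i 0] l_pos
        by (auto simp: S_def Per_def intro: order_trans)
    qed
    then show "s \<in> B" by (simp add: B_def PiE_iff)
  qed
  moreover have "closed S"
  proof -
    have c: "continuous_on UNIV (\<lambda>s::int \<Rightarrow> real. s i)" for i
      by (rule continuous_on_product_coordinates)
    have "S = {s. (\<forall>i. s i \<le> s (i + 1)) \<and> (\<forall>i. s (i + 1) \<le> s i + l) \<and>
        (\<forall>i. s (i + q) = s i + of_int p * l) \<and> 0 \<le> s 0 \<and> s 0 \<le> l}"
      by (auto simp: S_def Per_def adm_def)
    moreover have "closed \<dots>"
      by (intro closed_Collect_conj closed_Collect_all closed_Collect_le closed_Collect_eq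
          continuous_intros c)
    ultimately show ?thesis by simp
  qed
  ultimately have "compact S"
    using compact_box compact_Int_closed unfolding B_def by (metis inf.absorb_iff2)
  moreover have "(\<lambda>i. of_int i * (of_int p / of_int q * l)) \<in> S"
  proof -
    define c where "c = of_int p / of_int q * l"
    have "c \<ge> 0" "c \<le> 1 * l"
      unfolding c_def using assms l_pos by (auto intro!: mult_right_mono simp: divide_simps)
    moreover have "of_int q * c = of_int p * l" using assms by (simp add: c_def)
    ultimately show ?thesis using l_pos
      unfolding c_def[symmetric] by (auto simp: S_def Per_def adm_def algebra_simps)
  qed
  then have "S \<noteq> {}" by blast
  ultimately obtain x where x: "x \<in> S" "\<And>y. y \<in> S \<Longrightarrow> len y 0 q \<le> len x 0 q"
    using continuous_attains_sup[of S "\<lambda>s. len s 0 q"] continuous_on_subset[OF len_continuous]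
    by (metis subset_UNIV)
  have "len y 0 q \<le> len x 0 q" if y: "y \<in> Per p q" for y
  proof -
    define b where "b = - \<lfloor>y 0 / l\<rfloor>"
    have "of_int \<lfloor>y 0 / l\<rfloor> \<le> y 0 / l" "y 0 / l \<le> of_int \<lfloor>y 0 / l\<rfloor> + 1" by linarith+
    then have "of_int \<lfloor>y 0 / l\<rfloor> * l \<le> y 0" "y 0 \<le> (of_int \<lfloor>y 0 / l\<rfloor> + 1) * l"
      using l_pos by (simp_all only: pos_le_divide_eq pos_divide_le_eq)
    then have "(\<lambda>i. y (i + 0) + of_int b * l) \<in> S"
      using Per_shift[OF y, of 0 b] by (simp add: S_def b_def algebra_simps)
    then show ?thesis using x(2) len_shift[of y 0 b 0 q] by fastforce
  qed
  then show ?thesis using x(1) by (auto simp: MPer_def S_def)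
qed

lemma Per_window:
  assumes "t \<in> Per p q" "q \<ge> 0"
  shows "len t m (m + q) = len t 0 q"
proof -
  have per: "r (t (i + q)) (t (i + q + 1)) = r (t i) (t (i + 1))" for i
  proof -
    have "t (i + q) = t i + of_int p * l" "t (i + q + 1) = t (i + 1) + of_int p * l"
      using assms(1) unfolding Per_def by (auto) (metis add.commute add.left_commute)
    then show ?thesis by simp
  qed
  have step: "len t (m + 1) (m + 1 + q) = len t m (m + q)" for m
  proof -
    have "len t m (m + 1 + q) = len t m (m + 1) + len t (m + 1) (m + 1 + q)"
      using assms by (intro len_split) auto
    moreover have "len t m (m + 1 + q) = len t m (m + q) + len t (m + q) (m + 1 + q)"
      using assms by (intro len_split) auto
    moreover have "{m + q..<m + 1 + q} = {m + q}" "{m..<m + 1} = {m}" by auto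
    then have "len t (m + q) (m + 1 + q) = len t m (m + 1)"
      using per[of m] by (simp add: len_def)
    ultimately show ?thesis by simp
  qed
  show ?thesis
  proof (induction m rule: int_induct[where k = 0])
    case (step1 i)
    then show ?case using step[of i] by simp
  next
    case (step2 i)
    then show ?case using step[of "i - 1"] by simp
  qed simp
qed

lemma Per_min_max:
  assumes "x \<in> Per p q" "y \<in> Per p q"
  shows "(\<lambda>i. min (x i) (y i)) \<in> Per p q" "(\<lambda>i. max (x i) (y i)) \<in> Per p q"
proof -
  have "x i \<le> x (i + 1)" "x (i + 1) \<le> x i + l" "y i \<le> y (i + 1)" "y (i + 1) \<le> y i + l"
    "x (i + q) = x i + of_int p * l" "y (i + q) = y i + of_int p * l" for i
    using assms by (auto simp: Per_def adm_def)
  then show "(\<lambda>i. min (x i) (y i)) \<in> Per p q" "(\<lambda>i. max (x i) (y i)) \<in> Per p q"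
    unfolding Per_def adm_def by (auto simp: min_def max_def) (smt (verit))+
qed

text \<open>Where the sequences cross between \<open>i\<close> and \<open>i + 1\<close>, passing to
  minimum and maximum exchanges the end points of the two steps, which is the situation of
  \<open>crossing\<close>.\<close>

lemma len_min_max:
  assumes "adm x" "adm y"
  shows "len x m n + len y m n \<le> len (\<lambda>i. min (x i) (y i)) m n + len (\<lambda>i. max (x i) (y i)) m n"
  unfolding len_def sum.distrib [symmetric]
proof (rule sum_mono)
  fix i
  have *: "x i \<le> x (i + 1)" "x (i + 1) \<le> x i + l" "y i \<le> y (i + 1)" "y (i + 1) \<le> y i + l"
    using assms by (auto simp: adm_def)
  consider "x i \<le> y i" "x (i + 1) \<le> y (i + 1)" | "y i \<le> x i" "y (i + 1) \<le> x (i + 1)"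
    | "x i \<le> y i" "y (i + 1) \<le> x (i + 1)" | "y i \<le> x i" "x (i + 1) \<le> y (i + 1)" by linarith
  then show "r (x i) (x (i + 1)) + r (y i) (y (i + 1))
    \<le> r (min (x i) (y i)) (min (x (i + 1)) (y (i + 1))) + r (max (x i) (y i)) (max (x (i + 1)) (y (i + 1)))"
  proof cases
    case 3
    then show ?thesis using crossing[of "x i" "y i" "y (i + 1)" "x (i + 1)"] * by simp
  next
    case 4
    then show ?thesis using crossing[of "y i" "x i" "x (i + 1)" "y (i + 1)"] * by simp
  qed simp_all
qed

text \<open>The maximum cannot be longer than the maximizer \<open>y\<close>; so by
  \<open>len_min_max\<close> the minimum is at least as long as \<open>x\<close>.\<close>

lemma MPer_min:
  assumes "x \<in> MPer p q" "y \<in> MPer p q"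
  shows "(\<lambda>i. min (x i) (y i)) \<in> MPer p q"
proof -
  have P: "x \<in> Per p q" "y \<in> Per p q" using assms by (auto simp: MPer_def)
  have "len x 0 q + len y 0 q \<le> len (\<lambda>i. min (x i) (y i)) 0 q + len (\<lambda>i. max (x i) (y i)) 0 q"
    using P by (intro len_min_max) (auto simp: Per_def)
  moreover have "len (\<lambda>i. max (x i) (y i)) 0 q \<le> len y 0 q"
    using assms(2) Per_min_max[OF P] by (auto simp: MPer_def)
  ultimately have "len x 0 q \<le> len (\<lambda>i. min (x i) (y i)) 0 q" by simp
  then show ?thesis using assms(1) Per_min_max[OF P] unfolding MPer_def by force
qed

text \<open>A competitor \<open>y\<close> of double period and its translate \<open>y'\<close> by
  half of that period change places after \<open>q\<close> steps. Their minimum and maximum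
  therefore have the simple period, and neither is longer than \<open>x\<close>.\<close>

lemma MPer_double:
  assumes x: "x \<in> MPer p q" and q: "q > 0"
  shows "x \<in> MPer (2 * p) (2 * q)"
proof -
  have sub: "z \<in> Per (2 * p) (2 * q) \<and> len z 0 (2 * q) = 2 * len z 0 q" if "z \<in> Per p q" for z
  proof
    have *: "adm z" "\<And>i. z (i + q) = z i + of_int p * l" using that by (auto simp: Per_def)
    have "z (i + 2 * q) = z i + of_int (2 * p) * l" for i
    proof -
      have "i + 2 * q = i + q + q" by simp
      then have "z (i + 2 * q) = z i + of_int p * l + of_int p * l" by (simp only: *(2))
      then show ?thesis by (simp add: algebra_simps)
    qed
    with *(1) have "adm z \<and> (\<forall>i. z (i + 2 * q) = z i + of_int (2 * p) * l)" by blast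
    then show "z \<in> Per (2 * p) (2 * q)" unfolding Per_def by blast
    show "len z 0 (2 * q) = 2 * len z 0 q"
      using len_split[of 0 q "2 * q" z] Per_window[OF that, of q] q by simp
  qed
  have xP: "x \<in> Per p q" using x by (simp add: MPer_def)
  have "len y 0 (2 * q) \<le> len x 0 (2 * q)" if y: "y \<in> Per (2 * p) (2 * q)" for y
  proof -
    define y' where "y' i = y (i + q) + of_int (- p) * l" for i
    have y': "y' \<in> Per (2 * p) (2 * q)" unfolding y'_def by (rule Per_shift[OF y])
    have ly': "len y' 0 (2 * q) = len y 0 (2 * q)"
      unfolding y'_def len_shift using Per_window[OF y, of q] q by (simp add: add.commute)
    have rel: "y' (i + q) = y i + of_int p * l" "y (i + q) = y' i + of_int p * l" for i
    proof -
      have "y (i + 2 * q) = y i + 2 * of_int p * l" using y by (auto simp: Per_def)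
      moreover have "i + q + q = i + 2 * q" by simp
      ultimately show "y' (i + q) = y i + of_int p * l" unfolding y'_def by (simp only:)
      show "y (i + q) = y' i + of_int p * l" by (simp add: y'_def)
    qed
    let ?u = "\<lambda>i. min (y i) (y' i)" and ?v = "\<lambda>i. max (y i) (y' i)"
    have u: "?u \<in> Per p q" "?v \<in> Per p q"
      using Per_min_max[OF y y'] by (auto simp: Per_def rel)
    have "len y 0 (2 * q) + len y' 0 (2 * q) \<le> len ?u 0 (2 * q) + len ?v 0 (2 * q)"
      using y y' by (intro len_min_max) (auto simp: Per_def)
    also have "\<dots> = 2 * len ?u 0 q + 2 * len ?v 0 q" using sub u by simp
    also have "\<dots> \<le> 4 * len x 0 q"
    proof -
      have "len ?u 0 q \<le> len x 0 q" "len ?v 0 q \<le> len x 0 q" using x u by (auto simp: MPer_def)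
      then show ?thesis by simp
    qed
    finally show ?thesis using ly' sub[OF xP] by simp
  qed
  then show ?thesis using sub[OF xP] by (simp add: MPer_def)
qed

lemma MPer_pow2: "x \<in> MPer p q \<Longrightarrow> q > 0 \<Longrightarrow> x \<in> MPer (2 ^ k * p) (2 ^ k * q)"
proof (induction k)
  case (Suc k)
  then show ?case using MPer_double[of x "2 ^ k * p" "2 ^ k * q"] by (simp add: mult.assoc)
qed simp

text \<open>Repeated doubling makes the period \<open>Q\<close> longer than any given segment. A
  competitor on the segment then extends to an element of \<open>Per P Q\<close>, where
  \<open>x\<close> is known to be a maximizer.\<close>

lemma MPer_maximal:
  assumes x: "x \<in> MPer p q" and q: "q > 0"
  shows "maximal x"
  unfolding maximal_def
proof (intro conjI allI impI; (elim conjE)?)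
  show adm: "adm x" using x by (simp add: MPer_def Per_def)
  fix m n t
  assume mn: "m < n" and tm: "t m = x m" and tn: "t n = x n"
    and st: "\<forall>i\<in>{m..<n}. t i \<le> t (i + 1) \<and> t (i + 1) \<le> t i + l"
  define k where "k = nat (n - m)"
  define P where "P = 2 ^ k * p"
  define Q where "Q = 2 ^ k * q"
  have "int k < 2 ^ k" using of_nat_less_two_power[of k, where 'a = int] by simp
  also have "(2::int) ^ k \<le> Q" using q by (simp add: Q_def)
  finally have Q: "n - m < Q" using mn by (simp add: k_def)
  have xM: "x \<in> MPer P Q" unfolding P_def Q_def by (rule MPer_pow2[OF x q])
  then have xP: "x (i + Q) = x i + of_int P * l" for i by (simp add: MPer_def Per_def)
  \<comment> \<open>\<open>w\<close> follows the competitor up to \<open>n\<close> and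
    \<open>x\<close> afterwards; \<open>u\<close> repeats the window from \<open>m\<close> to
    \<open>m + Q\<close>. Since \<open>n - m < Q\<close>, the window ends on \<open>x\<close> and
    closes up.\<close>
  define w where "w i = (if i \<le> n then t i else x i)" for i
  define u where "u i = w (m + (i - m) mod Q) + of_int ((i - m) div Q) * of_int P * l" for i
  have Q0: "Q > 0" using Q mn by simp
  have wst: "w i \<le> w (i + 1) \<and> w (i + 1) \<le> w i + l" if "m \<le> i" for i
    using st that adm tn unfolding w_def adm_def by (cases "i = n") auto
  have uw: "u i = w i" if "m \<le> i" "i \<le> m + Q" for i
  proof (cases "i = m + Q")
    case True
    then have "u i = w m + of_int P * l" using Q0 by (simp add: u_def)
    then show ?thesis using True xP[of m] mn tm Q by (simp add: w_def)
  next
    case False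
    then have "(i - m) mod Q = i - m" "(i - m) div Q = 0" using that by auto
    then show ?thesis by (simp add: u_def)
  qed
  have uper: "u (i + Q) = u i + of_int P * l" for i
  proof -
    have "i + Q - m = (i - m) + Q" by simp
    then have "(i + Q - m) mod Q = (i - m) mod Q" "(i + Q - m) div Q = (i - m) div Q + 1"
      using Q0 by (simp_all only: mod_add_self2 div_add_self2)
    then show ?thesis by (simp add: u_def algebra_simps)
  qed
  have u_int: "u (i + of_int j * Q) = u i + of_int j * of_int P * l" for i j :: int
  proof (induction j rule: int_induct[where k = 0])
    case (step1 j)
    then show ?case using uper[of "i + of_int j * Q"] by (simp add: algebra_simps)
  next
    case (step2 j)
    then show ?case using uper[of "i + of_int (j - 1) * Q"] by (simp add: algebra_simps)
  qed simp
  have "adm u" unfolding adm_def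
  proof
    fix i
    define j where "j = (i - m) div Q"
    define i0 where "i0 = m + (i - m) mod Q"
    have i: "i = i0 + of_int j * Q" by (simp add: i0_def j_def)
    have i0: "m \<le> i0" "i0 < m + Q" using Q0 by (auto simp: i0_def)
    have "i + 1 = (i0 + 1) + of_int j * Q" using i by simp
    then have "u i = u i0 + of_int j * of_int P * l" "u (i + 1) = u (i0 + 1) + of_int j * of_int P * l"
      using i u_int by metis+
    then show "u i \<le> u (i + 1) \<and> u (i + 1) \<le> u i + l"
      using wst[of i0] uw[of i0] uw[of "i0 + 1"] i0 by simp
  qed
  then have uP: "u \<in> Per P Q" using uper by (simp add: Per_def)
  have "len u m (m + Q) \<le> len x m (m + Q)"
    using Per_window[OF uP, of m] Per_window[of x P Q m] xM uP Q0 by (auto simp: MPer_def)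
  moreover have "len u m (m + Q) = len t m n + len x n (m + Q)"
  proof -
    have "len u m (m + Q) = len u m n + len u n (m + Q)" using mn Q by (intro len_split) auto
    moreover have "len u m n = len t m n" by (rule len_cong) (use uw Q in \<open>auto simp: w_def\<close>)
    moreover have "len u n (m + Q) = len x n (m + Q)"
      by (rule len_cong) (use uw mn tn in \<open>auto simp: w_def\<close>)
    ultimately show ?thesis by simp
  qed
  moreover have "len x m (m + Q) = len x m n + len x n (m + Q)" using mn Q by (intro len_split) auto
  ultimately show "len t m n \<le> len x m n" by simp
qed

lemma MPer_shift:
  assumes "t \<in> MPer p q" "q > 0"
  shows "(\<lambda>i. t (i + a) + of_int b * l) \<in> MPer p q"
proof -
  have t: "t \<in> Per p q" and max: "\<And>y. y \<in> Per p q \<Longrightarrow> len y 0 q \<le> len t 0 q"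
    using assms(1) by (auto simp: MPer_def)
  have "len (\<lambda>i. t (i + a) + of_int b * l) 0 q = len t a (a + q)"
    by (simp only: len_shift) (simp add: add.commute)
  also have "\<dots> = len t 0 q" using Per_window[OF t] assms(2) by simp
  finally show ?thesis using Per_shift[OF t, of a b] max by (simp add: MPer_def)
qed

text \<open>Instead of ordering the translates of one maximizer, take the minimum \<open>z\<close>
  of all of them, which is a maximizer by \<open>MPer_min\<close>. By construction \<open>z\<close>
  moves at least the integer part of \<open>a p / q\<close> turns in \<open>a\<close> steps. The
  resulting bound by one turn does not depend on \<open>q\<close>, which makes the later limit
  possible.\<close>

lemma well_ordered:
  assumes q: "q > 0" and p: "0 \<le> p" "p \<le> q"
  obtains z where "maximal z" "\<And>i j. \<bar>z j - z i - of_int (j - i) * (of_int p / of_int q) * l\<bar> \<le> l"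
proof -
  obtain x where x: "x \<in> MPer p q" using MPer_exists[OF q p] by blast
  \<comment> \<open>Translation by \<open>a\<close> indices and back by the integer part of
    \<open>a p / q\<close> turns depends only on \<open>a\<close> modulo \<open>q\<close>, so the
    minimum is over a finite set.\<close>
  define X where "X a i = x (i + a) + of_int (- ((a * p) div q)) * l" for a i
  have X_M: "X a \<in> MPer p q" for a
    using MPer_shift[OF x q, of a "- ((a * p) div q)"] by (simp add: X_def[abs_def])
  have Xper: "X (a + q) i = X a i" for a i
  proof -
    have "x (i + a + q) = x (i + a) + of_int p * l" using x by (simp add: MPer_def Per_def)
    moreover have "((a + q) * p) div q = (a * p) div q + p" using q by (simp add: distrib_right)
    ultimately show ?thesis by (simp add: X_def algebra_simps)
  qed
  define z where "z i = Min ((\<lambda>a. X a i) ` {0..<q})" for i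
  have zM: "z \<in> MPer p q"
  proof -
    have "(\<lambda>i. Min ((\<lambda>a. X a i) ` {0..int n})) \<in> MPer p q" for n
    proof (induction n)
      case 0
      then show ?case using X_M by simp
    next
      case (Suc n)
      have "{0..int (Suc n)} = insert (int (Suc n)) {0..int n}" by auto
      then have "(\<lambda>i. Min ((\<lambda>a. X a i) ` {0..int (Suc n)}))
          = (\<lambda>i. min (X (int (Suc n)) i) (Min ((\<lambda>a. X a i) ` {0..int n})))"
        by (auto simp del: of_nat_Suc)
      then show ?case using MPer_min[OF X_M Suc] by simp
    qed
    from this[of "nat (q - 1)"] q have "(\<lambda>i. Min ((\<lambda>a. X a i) ` {0..q - 1})) \<in> MPer p q" by simp
    moreover have "{0..q - 1} = {0..<q}" by auto
    ultimately show ?thesis by (simp add: z_def[abs_def])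
  qed
  have Xmult: "X (a + of_int j * q) i = X a i" for a i and j :: int
  proof (induction j rule: int_induct[where k = 0])
    case (step1 j)
    then show ?case using Xper[of "a + of_int j * q"] by (simp add: algebra_simps)
  next
    case (step2 j)
    then show ?case using Xper[of "a + of_int (j - 1) * q"] by (simp add: algebra_simps)
  qed simp
  have z_le: "z i \<le> X a i" for i a
  proof -
    have "X a i = X (a mod q) i"
      using Xmult[of "a mod q" "a div q" i] by simp
    moreover have "a mod q \<in> {0..<q}" using q by simp
    ultimately show ?thesis unfolding z_def by (metis Min_le finite_atLeastLessThan_int finite_imageI imageI)
  qed
  have z_ex: "\<exists>a. z i = X a i" for i
  proof -
    have "z i \<in> (\<lambda>a. X a i) ` {0..<q}" unfolding z_def using q by (intro Min_in) auto
    then show ?thesis by auto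
  qed
  have z_ord: "z i + of_int ((a * p) div q) * l \<le> z (i + a)" for i a
  proof -
    obtain a' where a': "z (i + a) = X a' (i + a)" using z_ex by blast
    have "z i \<le> X (a + a') i" by (rule z_le)
    \<comment> \<open>Superadditivity of the integer part is what lets the minimum inherit the order
      relation.\<close>
    moreover have "((a * p) div q) + ((a' * p) div q) \<le> ((a + a') * p) div q"
      using div_add1_eq[of "a * p" "a' * p" q] q pos_imp_zdiv_nonneg_iff[of q "(a * p) mod q + (a' * p) mod q"]
      by (simp only: distrib_right) simp
    then have "of_int ((a * p) div q) * l + of_int ((a' * p) div q) * l \<le> of_int (((a + a') * p) div q) * l"
      using l_pos by (metis distrib_right mult_right_mono of_int_add of_int_le_iff less_imp_le)
    moreover have "x (i + a + a') = x (i + (a + a'))" by (simp add: add.assoc)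
    ultimately show ?thesis unfolding a' X_def by (simp only: of_int_minus)
  qed
  have z_low: "z i + (of_int a * (of_int p / of_int q) - 1) * l \<le> z (i + a)" for i a
  proof -
    have "of_int a * (of_int p / of_int q) - 1 \<le> (of_int ((a * p) div q) :: real)"
      using floor_divide_of_int_eq[of "a * p" q, where ?'a = real] by simp linarith
    then show ?thesis using z_ord[of i a] l_pos by (smt (verit) mult_right_mono)
  qed
  have "\<bar>z j - z i - of_int (j - i) * (of_int p / of_int q) * l\<bar> \<le> l" for i j
  proof -
    define c where "c = (of_int p / of_int q :: real)"
    \<comment> \<open>The lower bound from \<open>i\<close> to \<open>j\<close> and the one from
      \<open>j\<close> to \<open>i\<close> are the two halves of the absolute value.\<close>
    show ?thesis using z_low[of i "j - i"] z_low[of j "i - j"]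
      unfolding c_def[symmetric] by (simp add: abs_le_iff algebra_simps)
  qed
  then show ?thesis using that MPer_maximal[OF zM q] by blast
qed


section \<open>Limits of maximal sequences\<close>

lemma r_tendsto:
  assumes "(f \<longlongrightarrow> a) F" "(g \<longlongrightarrow> b) F"
  shows "((\<lambda>x. r (f x) (g x)) \<longlongrightarrow> r a b) F"
proof -
  have "isCont \<gamma> x" for x using gamma_continuous[of UNIV] by (simp add: continuous_on_eq_continuous_at)
  then show ?thesis unfolding r_def
    by (intro tendsto_norm tendsto_diff isCont_tendsto_compose[of _ \<gamma>] assms)
qed

lemma len_tendsto:
  assumes "\<And>i. m \<le> i \<Longrightarrow> i \<le> n \<Longrightarrow> ((\<lambda>k. u k i) \<longlongrightarrow> t i) F"
  shows "((\<lambda>k. len (u k) m n) \<longlongrightarrow> len t m n) F"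
  unfolding len_def by (intro tendsto_sum r_tendsto assms) auto

text \<open>If the total displacement is the least or the greatest possible, so is every single
  step, and its chord is a point.\<close>

lemma len_extreme:
  assumes st: "\<And>i. m \<le> i \<Longrightarrow> i < n \<Longrightarrow> t i \<le> t (i + 1) \<and> t (i + 1) \<le> t i + l" and mn: "m \<le> n"
    and ex: "t n - t m = 0 \<or> t n - t m = of_int (n - m) * l"
  shows "len t m n = 0"
proof -
  have mono: "t i \<le> t j \<and> t j \<le> t i + of_int (j - i) * l" if "m \<le> i" "i \<le> j" "j \<le> n" for i j
    using that(2,3)
  proof (induction j rule: int_ge_induct)
    case (step j)
    then show ?case using st[of j] that(1) by (auto simp: algebra_simps)
  qed simp
  have "r (t i) (t (i + 1)) = 0" if i: "i \<in> {m..<n}" for i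
  proof -
    have a: "t m \<le> t i \<and> t i \<le> t m + of_int (i - m) * l"
      and b: "t i \<le> t (i + 1) \<and> t (i + 1) \<le> t i + l"
      and c: "t (i + 1) \<le> t n \<and> t n \<le> t (i + 1) + of_int (n - (i + 1)) * l"
      using i mono[of m i] mono[of "i + 1" n] st[of i] by auto
    from ex show ?thesis
    proof
      assume "t n - t m = 0"
      with a b c have "t (i + 1) = t i" by linarith
      then show ?thesis by simp
    next
      assume "t n - t m = of_int (n - m) * l"
      moreover have "of_int (n - m) * l = of_int (i - m) * l + l + of_int (n - (i + 1)) * l"
        by (simp add: algebra_simps)
      ultimately have "t (i + 1) = t i + l" using a b c by linarith
      then show ?thesis by simp
    qed
  qed
  then show ?thesis by (simp add: len_def)
qed

text \<open>A competitor \<open>t\<close> of the limit has the wrong end points for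
  \<open>z k\<close>, and correcting them might violate the bounds on the steps. Mixing in a small
  part of the sequence with constant step \<rho>, strictly between 0 and \<open>l\<close>, creates
  the necessary slack. If \<rho> is 0 or \<open>l\<close> there is no slack, but then
  \<open>t\<close> has length 0.\<close>

lemma maximal_limit:
  assumes z: "\<And>k. maximal (z k)" and lim: "\<And>i. (\<lambda>k. z k i) \<longlonglongrightarrow> s i"
  shows "maximal s"
  unfolding maximal_def
proof (intro conjI allI impI; (elim conjE)?)
  have zs: "z k i \<le> z k (i + 1)" "z k (i + 1) \<le> z k i + l" for k i
    using z[of k] by (auto simp: maximal_def adm_def)
  show adm: "adm s" unfolding adm_def
  proof (intro allI conjI)
    fix i
    show "s i \<le> s (i + 1)" by (rule LIMSEQ_le[OF lim lim]) (use zs in auto)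
    show "s (i + 1) \<le> s i + l"
      by (rule LIMSEQ_le[OF lim tendsto_add[OF lim tendsto_const]]) (use zs in auto)
  qed
  fix m n t
  assume mn: "m < n" and tm: "t m = s m" and tn: "t n = s n"
    and st: "\<forall>i\<in>{m..<n}. t i \<le> t (i + 1) \<and> t (i + 1) \<le> t i + l"
  define D where "D = s n - s m"
  have D: "0 \<le> D" "D \<le> of_int (n - m) * l" using adm_mono[OF adm, of m n] mn by (auto simp: D_def)
  show "len t m n \<le> len s m n"
  proof (cases "D = 0 \<or> D = of_int (n - m) * l")
    case True
    have "len t m n = 0"
      by (rule len_extreme) (use st mn True tm tn in \<open>auto simp: D_def\<close>)
    then show ?thesis by simp
  next
    case False
    define N where "N = (of_int (n - m) :: real)"
    have N: "N > 0" using mn by (simp add: N_def)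
    define \<rho> where "\<rho> = D / N"
    have \<rho>: "0 < \<rho>" "\<rho> < l" using False D N by (auto simp: \<rho>_def N_def field_simps)
    define c where "c = min \<rho> (l - \<rho>)"
    have c: "c > 0" "c \<le> \<rho>" "c \<le> l - \<rho>" using \<rho> by (auto simp: c_def)
    define em where "em k = z k m - s m" for k
    define en where "en k = z k n - s n" for k
    \<comment> \<open>\<open>\<theta> k * c\<close> is the slack gained in each step; the choice
      makes it at least the correction \<open>(en k - em k) / N\<close> which is distributed over
      the steps.\<close>
    define \<theta> where "\<theta> k = (\<bar>em k\<bar> + \<bar>en k\<bar>) / (N * c)" for k
    define u where "u k i = (1 - \<theta> k) * t i + \<theta> k * (s m + of_int (i - m) * \<rho>)
      + (em k + of_int (i - m) / N * (en k - em k))" for k i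
    have em0: "em \<longlonglongrightarrow> 0" and en0: "en \<longlonglongrightarrow> 0"
      unfolding em_def en_def using LIM_zero[OF lim[of m]] LIM_zero[OF lim[of n]] by auto
    have l0: "\<theta> \<longlonglongrightarrow> 0"
      unfolding \<theta>_def using tendsto_divide[OF tendsto_add[OF tendsto_rabs[OF em0] tendsto_rabs[OF en0]] tendsto_const, of "N * c"] N c
      by simp
    have ul: "(\<lambda>k. u k i) \<longlonglongrightarrow> t i" for i
    proof -
      have "(\<lambda>k. u k i) \<longlonglongrightarrow> (1 - 0) * t i + 0 * (s m + of_int (i - m) * \<rho>)
          + (0 + of_int (i - m) / N * (0 - 0))"
        unfolding u_def by (intro tendsto_intros em0 en0 l0)
      then show ?thesis by simp
    qed
    have "eventually (\<lambda>k. \<theta> k < 1) sequentially" using l0 by (rule order_tendstoD) simp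
    then have "eventually (\<lambda>k. len (u k) m n \<le> len (z k) m n) sequentially"
    proof eventually_elim
      case (elim k)
      have lk: "0 \<le> \<theta> k" using N c by (simp add: \<theta>_def)
      have lNc: "\<theta> k * c * N = \<bar>em k\<bar> + \<bar>en k\<bar>" using N c by (simp add: \<theta>_def)
      show ?case
      proof (rule maximalD[OF z mn])
        show "u k m = z k m" by (simp add: u_def tm em_def algebra_simps)
        have "s m + of_int (n - m) * \<rho> = s n" using N by (simp add: \<rho>_def D_def N_def)
        moreover have "of_int (n - m) / N = 1" using N by (simp add: N_def)
        ultimately show "u k n = z k n" unfolding u_def tn
          by (simp only: distrib_left[symmetric]) (simp add: en_def left_diff_distrib)
        fix i assume i: "m \<le> i" "i < n"
        define \<tau> where "\<tau> = t (i + 1) - t i"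
        have \<tau>: "0 \<le> \<tau>" "\<tau> \<le> l" using bspec[OF st, of i] i by (auto simp: \<tau>_def)
        define e where "e = (en k - em k) / N"
        have "\<bar>e\<bar> \<le> \<theta> k * c"
        proof -
          have "\<bar>en k - em k\<bar> \<le> \<theta> k * c * N" using lNc by linarith
          then show ?thesis using N by (simp add: e_def abs_divide field_simps)
        qed
        moreover have d: "u k (i + 1) - u k i = (1 - \<theta> k) * \<tau> + \<theta> k * \<rho> + e"
          unfolding u_def \<tau>_def e_def
            by (simp add: algebra_simps add_divide_distrib diff_divide_distrib)
        moreover have "\<theta> k * c \<le> \<theta> k * \<rho>" "\<theta> k * c \<le> \<theta> k * (l - \<rho>)"
          using c lk by (auto intro: mult_left_mono)
        moreover have "0 \<le> (1 - \<theta> k) * \<tau>" "(1 - \<theta> k) * \<tau> \<le> (1 - \<theta> k) * l"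
          using \<tau> elim by (auto intro: mult_left_mono)
        ultimately have "0 \<le> u k (i + 1) - u k i" "u k (i + 1) - u k i \<le> l"
          by (simp_all only: right_diff_distrib left_diff_distrib)
        then show "u k i \<le> u k (i + 1) \<and> u k (i + 1) \<le> u k i + l" by simp
      qed
    qed
    then show ?thesis
      by (intro tendsto_le[OF _ len_tendsto len_tendsto]) (use ul lim in auto)
  qed
qed

lemma maximal_shift:
  assumes "maximal s"
  shows "maximal (\<lambda>i. s i + of_int b * l)"
  unfolding maximal_def
proof (intro conjI allI impI; (elim conjE)?)
  show "adm (\<lambda>i. s i + of_int b * l)" using assms adm_shift[of s 0 "of_int b * l"] by (simp add: maximal_def)
  fix m n t
  assume *: "m < n" "t m = s m + of_int b * l" "t n = s n + of_int b * l"
    "\<forall>i\<in>{m..<n}. t i \<le> t (i + 1) \<and> t (i + 1) \<le> t i + l"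
  have "len (\<lambda>i. t (i + 0) + of_int (- b) * l) m n \<le> len s m n"
    by (rule maximalD[OF assms]) (use * in auto)
  then show "len t m n \<le> len (\<lambda>i. s i + of_int b * l) m n"
    using len_shift[of s 0 b m n] len_shift[of t 0 "- b" m n] by simp
qed

text \<open>Approximate \<omega> by the fractions
  \<open>\<lfloor>\<omega> * real (Suc k)\<rfloor> / real (Suc k)\<close>. The deviation bound of
  \<open>well_ordered\<close> is the same for all of them, so a subsequence converges in the compact
  product and the limit keeps the bound.\<close>

lemma maximal_exists:
  assumes w: "0 \<le> \<omega>" "\<omega> \<le> 1"
  obtains s where "maximal s" "\<And>i j. \<bar>s j - s i - of_int (j - i) * \<omega> * l\<bar> \<le> l"
proof -
  define P where "P k z \<longleftrightarrow> maximal z \<and> (\<forall>i j. \<bar>z j - z i - of_int (j - i) * (of_int \<lfloor>\<omega> * real (Suc k)\<rfloor> / real (Suc k)) * l\<bar> \<le> l)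
    \<and> 0 \<le> z 0 \<and> z 0 \<le> l" for k z
  have "\<exists>z. P k z" for k
  proof -
    define p q where "p = \<lfloor>\<omega> * real (Suc k)\<rfloor>" and "q = int (Suc k)"
    have "\<omega> * real (Suc k) \<le> 1 * real (Suc k)" using w by (intro mult_right_mono) auto
    moreover from this have "real_of_int p \<le> real_of_int q"
      unfolding p_def q_def using order_trans[OF of_int_floor_le[of "\<omega> * real (Suc k)"]] by simp
    ultimately have "q > 0" "0 \<le> p" "p \<le> q" using w by (auto simp: p_def q_def)
    then obtain z where z: "maximal z" "\<And>i j. \<bar>z j - z i - of_int (j - i) * (of_int p / of_int q) * l\<bar> \<le> l"
      using well_ordered[of q p] by blast
    define b where "b = - \<lfloor>z 0 / l\<rfloor>"
    have "of_int \<lfloor>z 0 / l\<rfloor> \<le> z 0 / l" "z 0 / l \<le> of_int \<lfloor>z 0 / l\<rfloor> + 1" by linarith+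
    then have "of_int \<lfloor>z 0 / l\<rfloor> * l \<le> z 0" "z 0 \<le> (of_int \<lfloor>z 0 / l\<rfloor> + 1) * l"
      using l_pos by (simp_all only: pos_le_divide_eq pos_divide_le_eq)
    then have "P k (\<lambda>i. z i + of_int b * l)"
      unfolding P_def using maximal_shift[OF z(1), of b] z(2)
      by (auto simp: b_def algebra_simps p_def q_def)
    then show ?thesis by blast
  qed
  then obtain z where z: "\<And>k. P k (z k)" by metis
  define B where "B = PiE UNIV (\<lambda>i::int. {- \<bar>of_int i\<bar> * l..\<bar>of_int i\<bar> * l + l})"
  have "z k \<in> B" for k
  proof -
    have s: "adm (z k)" "0 \<le> z k 0" "z k 0 \<le> l" using z[of k] by (auto simp: P_def maximal_def)
    have "z k i \<in> {- \<bar>of_int i\<bar> * l..\<bar>of_int i\<bar> * l + l}" for i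
    proof (cases "i \<ge> 0")
      case True
      then show ?thesis using s adm_mono[of "z k" 0 i] l_pos by auto
    next
      case False
      then show ?thesis using s adm_mono[of "z k" i 0] l_pos by auto
    qed
    then show ?thesis by (simp add: B_def PiE_iff)
  qed
  moreover have "seq_compact B"
    unfolding B_def by (intro compact_imp_seq_compact compact_box)
  ultimately obtain s \<sigma> where s: "strict_mono (\<sigma> :: nat \<Rightarrow> nat)" "(z \<circ> \<sigma>) \<longlonglongrightarrow> s"
    by (meson seq_compactE)
  have lim: "(\<lambda>k. z (\<sigma> k) i) \<longlonglongrightarrow> s i" for i
  proof -
    have "isCont (\<lambda>x::int \<Rightarrow> real. x i) s"
      by (rule continuous_on_interior[OF continuous_on_product_coordinates]) simp
    from isCont_tendsto_compose[OF this s(2)] show ?thesis by (simp add: o_def)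
  qed
  have "maximal s"
    by (rule maximal_limit[OF _ lim]) (use z in \<open>auto simp: P_def\<close>)
  moreover have "\<bar>s j - s i - of_int (j - i) * \<omega> * l\<bar> \<le> l" for i j
  proof -
    have fl: "(\<lambda>k. of_int \<lfloor>\<omega> * real (Suc k)\<rfloor> / real (Suc k)) \<longlonglongrightarrow> \<omega>"
    proof (rule tendsto_sandwich[of "\<lambda>k. \<omega> - 1 / real (Suc k)" _ _ "\<lambda>k. \<omega>"])
      have "\<omega> - 1 / real (Suc k) \<le> of_int \<lfloor>\<omega> * real (Suc k)\<rfloor> / real (Suc k)" for k
      proof -
        have "(\<omega> * real (Suc k) - 1) / real (Suc k) \<le> of_int \<lfloor>\<omega> * real (Suc k)\<rfloor> / real (Suc k)"
          by (intro divide_right_mono) linarith+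
        then show ?thesis by (simp add: diff_divide_distrib)
      qed
      then show "\<forall>\<^sub>F k in sequentially. \<omega> - 1 / real (Suc k) \<le> of_int \<lfloor>\<omega> * real (Suc k)\<rfloor> / real (Suc k)"
        by simp
      have "of_int \<lfloor>\<omega> * real (Suc k)\<rfloor> / real (Suc k) \<le> \<omega>" for k
      proof -
        have "of_int \<lfloor>\<omega> * real (Suc k)\<rfloor> / real (Suc k) \<le> (\<omega> * real (Suc k)) / real (Suc k)"
          by (intro divide_right_mono) linarith+
        then show ?thesis by simp
      qed
      then show "\<forall>\<^sub>F k in sequentially. of_int \<lfloor>\<omega> * real (Suc k)\<rfloor> / real (Suc k) \<le> \<omega>"
        by simp
      show "(\<lambda>k. \<omega> - 1 / real (Suc k)) \<longlonglongrightarrow> \<omega>"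
        using tendsto_diff[OF tendsto_const[of \<omega>] LIMSEQ_inverse_real_of_nat] by (simp add: inverse_eq_divide)
    qed simp
    have fl': "(\<lambda>k. of_int \<lfloor>\<omega> * real (Suc (\<sigma> k))\<rfloor> / real (Suc (\<sigma> k))) \<longlonglongrightarrow> \<omega>"
      using LIMSEQ_subseq_LIMSEQ[OF fl s(1)] by (simp add: o_def)
    have "(\<lambda>k. \<bar>z (\<sigma> k) j - z (\<sigma> k) i - of_int (j - i) * (of_int \<lfloor>\<omega> * real (Suc (\<sigma> k))\<rfloor> / real (Suc (\<sigma> k))) * l\<bar>)
        \<longlonglongrightarrow> \<bar>s j - s i - of_int (j - i) * \<omega> * l\<bar>"
      by (intro tendsto_intros lim fl')
    then show ?thesis
      by (rule LIMSEQ_le_const2) (use z in \<open>auto simp: P_def\<close>)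
  qed
  ultimately show ?thesis using that by blast
qed

subsection \<open>Maximal sequences are billiard orbits\<close>

text \<open>The parameter midpoint differs on the curve from both ends, so inserting it gains length
  strictly. This is what forbids degenerate steps in maximal sequences.\<close>

lemma midpoint_gain:
  assumes "a < c" "c < a + 2 * l"
  shows "r a c < r a ((a + c) / 2) + r ((a + c) / 2) c"
proof -
  define b where "b = (a + c) / 2"
  have b: "a < b" "b < a + l" "b < c" "c < b + l"
  proof -
    have "2 * b = a + c" by (simp add: b_def)
    then show "a < b" "b < a + l" "b < c" "c < b + l" using assms by auto
  qed
  show ?thesis
  proof (cases "\<gamma> a = \<gamma> c")
    case True
    then have "r a c = 0" by (simp add: r_def)
    then show ?thesis using r_pos[OF b(1,2)] r_nonneg[of b c] by (simp add: b_def del: r_nonneg)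
  next
    case False
    show ?thesis using strict_triangle[of a b c] False gamma_neq[OF b(1,2)] gamma_neq[OF b(3,4)]
      by (simp add: b_def)
  qed
qed

lemma len_2: "len t i (i + 2) = r (t i) (t (i + 1)) + r (t (i + 1)) (t (i + 2))"
proof -
  have "{i..<i + 2} = {i, i + 1}" by auto
  then show ?thesis by (simp add: len_def add.commute)
qed

lemma maximal_replace:
  assumes s: "maximal s" and b: "s i \<le> b" "b \<le> s i + l" "b \<le> s (i + 2)" "s (i + 2) \<le> b + l"
  shows "r (s i) b + r b (s (i + 2)) \<le> r (s i) (s (i + 1)) + r (s (i + 1)) (s (i + 2))"
proof -
  define t where "t = s(i + 1 := b)"
  have "len t i (i + 2) \<le> len s i (i + 2)"
  proof (rule maximalD[OF s])
    fix j assume "i \<le> j" "j < i + 2"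
    then have "j = i \<or> j = i + 1" by linarith
    moreover have "i + 1 + 1 = i + 2" by simp
    moreover have "t i = s i" "t (i + 1) = b" "t (i + 2) = s (i + 2)" by (auto simp: t_def)
    ultimately show "t j \<le> t (j + 1) \<and> t (j + 1) \<le> t j + l"
      using b by (elim disjE) (simp_all only:)
  qed (auto simp: t_def)
  then show ?thesis by (simp add: len_2 t_def)
qed

text \<open>By \<open>midpoint_gain\<close> a degenerate step, 0 or \<open>l\<close>, can only be
  next to an equal one. A single degenerate step would thus spread to the whole sequence and make
  the rotation number 0 or 1.\<close>

lemma maximal_strict:
  assumes s: "maximal s" and dev: "\<And>i j. \<bar>s j - s i - of_int (j - i) * \<omega> * l\<bar> \<le> l"
    and w: "0 < \<omega>" "\<omega> < 1"
  shows "s i < s (i + 1) \<and> s (i + 1) < s i + l"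
proof -
  have adm: "s i \<le> s (i + 1)" "s (i + 1) \<le> s i + l" for i using s by (auto simp: maximal_def adm_def)
  have ne: "\<gamma> (s i) \<noteq> \<gamma> (s (i + 1)) \<and> \<gamma> (s (i + 1)) \<noteq> \<gamma> (s (i + 2))"
    if "s i < s (i + 2)" "s (i + 2) < s i + 2 * l" for i
  proof -
    have "r (s i) (s (i + 2)) < r (s i) ((s i + s (i + 2)) / 2) + r ((s i + s (i + 2)) / 2) (s (i + 2))"
      using that by (intro midpoint_gain)
    also have "\<dots> \<le> r (s i) (s (i + 1)) + r (s (i + 1)) (s (i + 2))"
    proof -
      define b where "b = (s i + s (i + 2)) / 2"
      have "2 * b = s i + s (i + 2)" by (simp add: b_def)
      then show ?thesis using that unfolding b_def[symmetric] by (intro maximal_replace[OF s]) auto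
    qed
    finally show ?thesis by (auto simp: r_def)
  qed
  have two: "i + 1 + 1 = i + 2" for i :: int by simp
  define d where "d i = s (i + 1) - s i" for i
  have dd: "s (i + 2) - s i = d i + d (i + 1)" for i unfolding d_def two by simp
  have d01: "0 \<le> d i" "d i \<le> l" for i using adm[of i] by (auto simp: d_def)
  have bad: "d i \<noteq> 0 \<and> d (i + 1) \<noteq> 0 \<and> d i \<noteq> l \<and> d (i + 1) \<noteq> l" if "0 < d i + d (i + 1)" "d i + d (i + 1) < 2 * l" for i
  proof -
    from that have "s i < s (i + 2)" "s (i + 2) < s i + 2 * l" using dd[of i] by auto
    from ne[OF this] have "s i \<noteq> s (i + 1)" "s (i + 1) \<noteq> s (i + 2)" "s (i + 1) \<noteq> s i + l" "s (i + 2) \<noteq> s (i + 1) + l"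
      using gamma_period by metis+
    then show ?thesis unfolding d_def two by auto
  qed
  have all: "d j = c" if "d i = c" "c = 0 \<or> c = l" for i j c
  proof (induction j rule: int_induct[where k = i])
    case base
    then show ?case using that by simp
  next
    case (step1 j)
    show ?case
    proof (rule ccontr)
      assume "d (j + 1) \<noteq> c"
      then have "0 < d j + d (j + 1)" "d j + d (j + 1) < 2 * l"
        using step1 that(2) d01[of j] d01[of "j + 1"] l_pos by auto
      from bad[OF this] step1 that(2) show False by auto
    qed
  next
    case (step2 j)
    show ?case
    proof (rule ccontr)
      assume "d (j - 1) \<noteq> c"
      then have "0 < d (j - 1) + d (j - 1 + 1)" "d (j - 1) + d (j - 1 + 1) < 2 * l"
        using step2 that(2) d01[of j] d01[of "j - 1"] l_pos by auto
      from bad[OF this] step2 that(2) show False by auto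
    qed
  qed
  have False if "d i = c" "c = 0 \<or> c = l" for i c
  proof -
    have st: "s (j + 1) = s j + c" for j using all[OF that, of j] by (simp add: d_def)
    have lin: "s (int n) = s 0 + real n * c" for n
    proof (induction n)
      case (Suc n)
      then show ?case using st[of "int n"] by (simp add: add.commute algebra_simps)
    qed simp
    \<comment> \<open>Equal steps \<open>c\<close> drift away from the rotation at a positive rate
      per step, against the bounded deviation.\<close>
    have "\<bar>real n * c - real n * \<omega> * l\<bar> \<le> l" for n
      using dev[of "int n" 0] lin[of n] by simp
    moreover have "\<bar>real n * c - real n * \<omega> * l\<bar> = real n * (\<bar>c / l - \<omega>\<bar> * l)" for n
    proof -
      have "real n * c - real n * \<omega> * l = real n * ((c / l - \<omega>) * l)" using l_pos by (simp add: field_simps)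
      then show ?thesis using l_pos by (simp add: abs_mult)
    qed
    moreover have pos: "\<bar>c / l - \<omega>\<bar> * l > 0" using that(2) w l_pos by auto
    ultimately have "real n * (\<bar>c / l - \<omega>\<bar> * l) \<le> l" for n by simp
    moreover obtain n where "real n * (\<bar>c / l - \<omega>\<bar> * l) > l"
      using reals_Archimedean3[OF pos] by blast
    ultimately show False by (simp add: not_le[symmetric])
  qed
  then have "d i \<noteq> 0" "d i \<noteq> l" by blast+
  with d01[of i] show ?thesis by (auto simp: d_def)
qed

text \<open>The derivative of the two lengths with respect to \<open>b\<close> vanishes, so both
  directions have the same tangential component. The normal components then agree up to sign, and
  the sign follows from \<open>wedge_pos\<close>: both neighbours lie to the left of the tangent at
  \<open>b\<close>.\<close>

lemma reflection_law:
  assumes ab: "a < b" "b < a + l" and bc: "b < c" "c < b + l"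
    and max: "\<And>b'. a \<le> b' \<Longrightarrow> b' \<le> a + l \<Longrightarrow> b' \<le> c \<Longrightarrow> c \<le> b' + l \<Longrightarrow> r a b' + r b' c \<le> r a b + r b c"
  shows "reflects \<gamma> a b c"
proof -
  have ne: "\<gamma> a \<noteq> \<gamma> b" "\<gamma> b \<noteq> \<gamma> c" using gamma_neq[OF ab] gamma_neq[OF bc] by auto
  have "((\<lambda>t. r a t + r c t) has_real_derivative slope a b + slope c b) (at b)"
    by (intro DERIV_add r_deriv) (use ne in auto)
  moreover define e where "e = Min {b - a, a + l - b, c - b, b + l - c}"
  have e: "e > 0" "e \<le> b - a" "e \<le> a + l - b" "e \<le> c - b" "e \<le> b + l - c"
    using ab bc by (auto simp: e_def)
  have "\<forall>y. \<bar>b - y\<bar> < e \<longrightarrow> r a y + r c y \<le> r a b + r c b"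
  proof (intro allI impI)
    fix y assume "\<bar>b - y\<bar> < e"
    then have "r a y + r y c \<le> r a b + r b c" using e by (intro max) auto
    then show "r a y + r c y \<le> r a b + r c b" by (simp add: r_commute)
  qed
  ultimately have sl: "slope a b + slope c b = 0" using DERIV_local_max e(1) by blast
  define u v where "u = sgn (\<gamma> b - \<gamma> a)" and "v = sgn (\<gamma> c - \<gamma> b)"
  have su: "slope a b = u \<bullet> T b" by (simp add: slope_def u_def sgn_div_norm inner_commute divide_inverse mult.commute)
  have "\<gamma> b - \<gamma> c = - (\<gamma> c - \<gamma> b)" by simp
  then have sv: "slope c b = - (v \<bullet> T b)"
    unfolding slope_def v_def by (simp only: norm_minus_cancel inner_minus_right)
      (simp add: sgn_div_norm inner_commute divide_inverse mult.commute)
  define x where "x = u \<bullet> T b"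
  have vx: "v \<bullet> T b = x" using sl su sv by (simp add: x_def)
  have nu: "norm u = 1" "norm v = 1" using ne by (auto simp: u_def v_def norm_sgn)
  have "(wedge (T b) u)\<^sup>2 = (wedge (T b) v)\<^sup>2"
    using inner_sq_wedge[of "T b" u] inner_sq_wedge[of "T b" v] nu vx by (simp add: x_def inner_commute)
  moreover have "wedge (T b) v > 0"
    using wedge_pos[of c b] ne by (simp add: v_def sgn_div_norm wedge_simps)
  moreover have "wedge (T b) u < 0"
  proof -
    have "wedge (T b) (- (\<gamma> b - \<gamma> a)) > 0" using wedge_pos[of a b] ne by simp
    then have "wedge (T b) (\<gamma> b - \<gamma> a) < 0" by (simp only: wedge_simps)
    then show ?thesis using ne by (simp add: u_def sgn_div_norm wedge_simps mult_pos_neg)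
  qed
  ultimately have w: "wedge (T b) v = - wedge (T b) u"
    by (metis abs_of_neg abs_of_pos power2_eq_iff_nonneg abs_ge_zero power2_abs)
  \<comment> \<open>Multiplication by the conjugate of the unit tangent makes the tangential and
    normal components real and imaginary parts.\<close>
  have "cnj (T b) * v = cnj (T b) * ((2 * x) *\<^sub>R T b - u)"
  proof (rule complex_eqI)
    have "Re (cnj (T b) * T b) = 1" "Im (cnj (T b) * T b) = 0"
      using T_unit[of b] by (simp_all add: mult.commute)
    moreover have "cnj (T b) * ((2 * x) *\<^sub>R T b - u) = (2 * x) *\<^sub>R (cnj (T b) * T b) - cnj (T b) * u"
      by (simp add: algebra_simps)
    moreover have "Re (cnj (T b) * v) = x" "Re (cnj (T b) * u) = x"
      using vx by (simp_all add: x_def inner_complex_def algebra_simps)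
    moreover have "Im (cnj (T b) * v) = - Im (cnj (T b) * u)" using w by (simp add: wedge_def)
    ultimately show "Re (cnj (T b) * v) = Re (cnj (T b) * ((2 * x) *\<^sub>R T b - u))"
      "Im (cnj (T b) * v) = Im (cnj (T b) * ((2 * x) *\<^sub>R T b - u))" by auto
  qed
  then have "T b * cnj (T b) * v = T b * cnj (T b) * ((2 * x) *\<^sub>R T b - u)"
    by (simp only: mult.assoc)
  then have "v = (2 * x) *\<^sub>R T b - u" by (simp add: T_unit)
  then show ?thesis by (simp add: reflects_def Let_def u_def v_def x_def)
qed

lemma sum_generating: "(\<Sum>i\<in>{m..<n}. generating \<gamma> (s i) (s (i + 1))) = - len s m n"
  by (simp add: len_def generating_def r_def sum_negf)

lemma minimal_orbit_maximal: "minimal_orbit \<gamma> l s \<Longrightarrow> maximal s"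
  unfolding minimal_orbit_def maximal_def sum_generating
  by (auto simp: billiard_orbit_def adm_def l_pos less_imp_le)

lemma maximal_minimal_orbit:
  assumes s: "maximal s" and dev: "\<And>i j. \<bar>s j - s i - of_int (j - i) * \<omega> * l\<bar> \<le> l"
    and w: "0 < \<omega>" "\<omega> < 1"
  shows "minimal_orbit \<gamma> l s"
proof -
  note st = maximal_strict[OF s dev w]
  have "reflects \<gamma> (s (i - 1)) (s i) (s (i + 1))" for i
  proof (rule reflection_law)
    show "s (i - 1) < s i" "s i < s (i - 1) + l" using st[of "i - 1"] by auto
    show "s i < s (i + 1)" "s (i + 1) < s i + l" using st[of i] by auto
    fix b' assume "s (i - 1) \<le> b'" "b' \<le> s (i - 1) + l" "b' \<le> s (i + 1)" "s (i + 1) \<le> b' + l"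
    then show "r (s (i - 1)) b' + r b' (s (i + 1)) \<le> r (s (i - 1)) (s i) + r (s i) (s (i + 1))"
      using maximal_replace[OF s, of "i - 1" b']
      by (simp only: diff_add_cancel diff_add_eq[symmetric, of i 1 2]) (simp add: add.commute)
  qed
  with st have "billiard_orbit \<gamma> l s" by (simp add: billiard_orbit_def)
  moreover have "\<forall>m n t. m < n \<and> t m = s m \<and> t n = s n \<and>
        (\<forall>i \<in> {m..<n}. t i \<le> t (i + 1) \<and> t (i + 1) \<le> t i + l) \<longrightarrow> - len s m n \<le> - len t m n"
    using s unfolding maximal_def by auto
  ultimately show ?thesis by (simp add: minimal_orbit_def sum_generating)
qed


section \<open>Average lengths and the meaning of \<beta>\<close>

lemma rotation_growth:
  assumes rot: "has_rotation_number l s \<omega>" and d: "\<delta> > 0"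
  obtains N0 :: int where "N0 > 0"
    "\<And>N. N \<ge> N0 \<Longrightarrow> \<bar>s N - of_int N * \<omega> * l\<bar> \<le> \<delta> * of_int N \<and> \<bar>s (- N) + of_int N * \<omega> * l\<bar> \<le> \<delta> * of_int N"
proof -
  have d': "\<delta> / l > 0" using d l_pos by simp
  from rot have "((\<lambda>i. s i / (of_int i * l)) \<longlongrightarrow> \<omega>) at_top" "((\<lambda>i. s i / (of_int i * l)) \<longlongrightarrow> \<omega>) at_bot"
    by (auto simp: has_rotation_number_def)
  from tendstoD[OF this(1) d'] tendstoD[OF this(2) d'] obtain A B
    where A: "\<And>i. i \<ge> A \<Longrightarrow> \<bar>s i / (of_int i * l) - \<omega>\<bar> < \<delta> / l"
      and B: "\<And>i. i \<le> B \<Longrightarrow> \<bar>s i / (of_int i * l) - \<omega>\<bar> < \<delta> / l"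
    unfolding eventually_at_top_linorder eventually_at_bot_linorder dist_real_def by blast
  have *: "\<bar>s i - of_int i * \<omega> * l\<bar> \<le> \<delta> * \<bar>of_int i\<bar>"
    if "i \<noteq> 0" "\<bar>s i / (of_int i * l) - \<omega>\<bar> < \<delta> / l" for i
  proof -
    have "s i - of_int i * \<omega> * l = (s i / (of_int i * l) - \<omega>) * (of_int i * l)"
      using that l_pos by (simp add: field_simps)
    then have "\<bar>s i - of_int i * \<omega> * l\<bar> = \<bar>s i / (of_int i * l) - \<omega>\<bar> * (\<bar>of_int i\<bar> * l)"
      using l_pos by (simp add: abs_mult)
    also have "\<dots> \<le> \<delta> / l * (\<bar>of_int i\<bar> * l)"
      using that l_pos by (intro mult_right_mono) auto
    finally show ?thesis using l_pos by simp
  qed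
  show ?thesis
  proof (rule that[of "max 1 (max A (- B))"])
    fix N assume "N \<ge> max 1 (max A (- B))"
    then have N: "N \<ge> 1" "N \<ge> A" "- N \<le> B" by auto
    show "\<bar>s N - of_int N * \<omega> * l\<bar> \<le> \<delta> * of_int N \<and> \<bar>s (- N) + of_int N * \<omega> * l\<bar> \<le> \<delta> * of_int N"
      using *[OF _ A[OF N(2)]] *[OF _ B[OF N(3)]] N(1) by simp
  qed simp
qed

text \<open>Both sequences stay within \<open>\<delta> N\<close> of the same linear motion up to
  time \<open>N\<close>. So \<open>bridging\<close> applies with \<open>K\<close> about
  \<open>e' N\<close>, and its cost is a small multiple of \<open>N\<close>.\<close>

lemma comparison:
  assumes s: "maximal s" and t: "adm t"
    and rs: "has_rotation_number l s \<omega>" and rt: "has_rotation_number l t \<omega>"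
    and w: "0 < \<omega>" "\<omega> < 1" and e: "e > 0"
  shows "eventually (\<lambda>N. len t (- int N) (int N) \<le> len s (- int N) (int N) + e * real N) sequentially"
proof -
  \<comment> \<open>The ends of \<open>t\<close> and \<open>s\<close> may be up to
    \<open>2 * \<delta> * N\<close> apart relative to the rotation. In \<open>K\<close> steps a
    bridge can run ahead of the rotation, or fall behind it, by at least
    \<open>K * \<nu>\<close>.\<close>
  define \<nu> where "\<nu> = min \<omega> (1 - \<omega>) * l"
  have \<nu>: "\<nu> > 0" "\<nu> \<le> \<omega> * l" "\<nu> \<le> (1 - \<omega>) * l"
    using w l_pos by (auto simp: \<nu>_def intro!: mult_right_mono)
  define e' where "e' = min (1/4) (e / (4 * l))"
  have e': "e' > 0" "e' \<le> 1/4" "4 * l * e' \<le> e" using e l_pos by (auto simp: e'_def min_def field_simps)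
  define \<delta> where "\<delta> = e' * \<nu> / 2"
  have \<delta>: "\<delta> > 0" using e' \<nu> by (simp add: \<delta>_def)
  obtain A where A: "A > 0" "\<And>N. N \<ge> A \<Longrightarrow> \<bar>s N - of_int N * \<omega> * l\<bar> \<le> \<delta> * of_int N \<and> \<bar>s (- N) + of_int N * \<omega> * l\<bar> \<le> \<delta> * of_int N"
    using rotation_growth[OF rs \<delta>] by blast
  obtain B where B: "B > 0" "\<And>N. N \<ge> B \<Longrightarrow> \<bar>t N - of_int N * \<omega> * l\<bar> \<le> \<delta> * of_int N \<and> \<bar>t (- N) + of_int N * \<omega> * l\<bar> \<le> \<delta> * of_int N"
    using rotation_growth[OF rt \<delta>] by blast
  have *: "len t (- N) N \<le> len s (- N) N + e * of_int N"
    if N: "N \<ge> A" "N \<ge> 2 * B" "N \<ge> 4" "of_int N \<ge> 4 * l / e" for N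
  proof -
    define K where "K = \<lceil>e' * of_int N\<rceil>"
    have K: "e' * of_int N \<le> of_int K" "of_int K \<le> e' * of_int N + 1" unfolding K_def by linarith+
    have N0: "real_of_int N \<ge> 4" using N by simp
    then have e'N: "e' * of_int N > 0" "e' * of_int N \<le> of_int N / 4"
      using e' mult_right_mono[OF e'(2), of "of_int N"] by auto
    have "0 < real_of_int K" using K e'N by linarith
    then have K1: "K \<ge> 1" by simp
    have "2 * of_int K \<le> (of_int N :: real)" using K e'N N0 by linarith
    then have K2: "2 * K \<le> N" by linarith
    have NK: "N - K \<ge> B" using K2 N by linarith
    have dK: "2 * \<delta> * of_int N \<le> of_int K * \<nu>"
      using mult_right_mono[OF K(1), of \<nu>] \<nu> by (simp add: \<delta>_def algebra_simps)
    have dK1: "2 * \<delta> * of_int N \<le> of_int K * (\<omega> * l)" "2 * \<delta> * of_int N \<le> of_int K * ((1 - \<omega>) * l)"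
    proof -
      have "0 \<le> (of_int K :: real)" using K1 by simp
      then show "2 * \<delta> * of_int N \<le> of_int K * (\<omega> * l)" "2 * \<delta> * of_int N \<le> of_int K * ((1 - \<omega>) * l)"
        using dK mult_left_mono[OF \<nu>(2), of "of_int K"] mult_left_mono[OF \<nu>(3), of "of_int K"] by linarith+
    qed
    have d1: "\<delta> * of_int (N - K) \<le> \<delta> * of_int N" using \<delta> K1 by simp
    have tK: "\<bar>t (- N + K) + of_int (N - K) * \<omega> * l\<bar> \<le> \<delta> * of_int N"
      "\<bar>t (N - K) - of_int (N - K) * \<omega> * l\<bar> \<le> \<delta> * of_int N"
      using B(2)[OF NK] d1 by (auto simp: add.commute)
    have sN: "\<bar>s N - of_int N * \<omega> * l\<bar> \<le> \<delta> * of_int N" "\<bar>s (- N) + of_int N * \<omega> * l\<bar> \<le> \<delta> * of_int N"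
      using A(2)[OF N(1)] by auto
    define X Y where "X = of_int N * \<omega> * l" and "Y = of_int K * (\<omega> * l)"
    have XY: "of_int (N - K) * \<omega> * l = X - Y" "of_int K * ((1 - \<omega>) * l) = of_int K * l - Y"
      by (simp_all add: X_def Y_def algebra_simps)
    have "len t (- N) N \<le> len s (- N) N + 2 * of_int K * l"
    proof (rule bridging[OF s t K1])
      show "- N + K \<le> N - K" using K1 K2 by linarith
      show "s (- N) \<le> t (- N + K)" "t (- N + K) \<le> s (- N) + of_int K * l"
        "t (N - K) \<le> s N" "s N \<le> t (N - K) + of_int K * l"
        using tK sN dK1 unfolding XY X_def[symmetric] Y_def[symmetric] abs_le_iff by linarith+
    qed
    also have "2 * of_int K * l \<le> e * of_int N"
    proof -
      have "2 * of_int K * l \<le> 2 * (e' * of_int N + 1) * l" using K l_pos by (intro mult_right_mono) auto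
      also have "\<dots> = (4 * l * e') * (of_int N / 2) + 2 * l" by (simp add: algebra_simps)
      also have "\<dots> \<le> e * (of_int N / 2) + 2 * l" using e' N0 by (intro add_right_mono mult_right_mono) auto
      also have "2 * l \<le> e * (of_int N / 2)" using N(4) e by (simp add: field_simps)
      finally show ?thesis by simp
    qed
    finally show ?thesis by simp
  qed
  show ?thesis
    unfolding eventually_sequentially
  proof (intro exI allI impI)
    fix n assume n: "n \<ge> nat A + nat (2 * B) + 4 + nat \<lceil>4 * l / e\<rceil>"
    have "4 * l / e \<le> real n" using n by linarith
    moreover have "int n \<ge> A" "int n \<ge> 2 * B" "int n \<ge> 4" using n by linarith+
    ultimately show "len t (- int n) (int n) \<le> len s (- int n) (int n) + e * real n"
      using *[of "int n"] by simp
  qed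
qed

text \<open>Comparing \<open>f (n * m)\<close> with both \<open>n f m\<close> and
  \<open>m f n\<close> bounds the difference of the quotients at \<open>n\<close> and
  \<open>m\<close>, so they form a Cauchy sequence.\<close>

lemma quasi_additive_converges:
  fixes f :: "nat \<Rightarrow> real"
  assumes qa: "\<And>m n. \<bar>f (m + n) - f m - f n\<bar> \<le> C"
  shows "convergent (\<lambda>n. f n / real n)"
proof -
  have mul: "\<bar>f (n * m) - real n * f m\<bar> \<le> (real n + 1) * C" for n m
  proof (induction n)
    case 0
    then show ?case using qa[of 0 0] by simp
  next
    case (Suc n)
    have "\<bar>f (m + n * m) - f m - f (n * m)\<bar> \<le> C" by (rule qa)
    with Suc show ?case by (simp add: algebra_simps abs_le_iff)
  qed
  have C: "C \<ge> 0" using qa[of 0 0] by simp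
  have close: "\<bar>f n / real n - f m / real m\<bar> \<le> 2 * C / real n + 2 * C / real m"
    if "n > 0" "m > 0" for n m
  proof -
    have "\<bar>real n * f m - real m * f n\<bar> \<le> (real n + 1) * C + (real m + 1) * C"
      using mul[of n m] mul[of m n] by (simp add: mult.commute[of m n])
    also have "\<dots> \<le> (2 * real n) * C + (2 * real m) * C"
      using that C by (intro add_mono mult_right_mono) auto
    finally have "\<bar>real n * f m - real m * f n\<bar> / (real n * real m) \<le> ((2 * real n) * C + (2 * real m) * C) / (real n * real m)"
      by (intro divide_right_mono) auto
    moreover have "f n / real n - f m / real m = (real m * f n - real n * f m) / (real n * real m)"
      using that by (simp add: field_simps)
    then have "\<bar>f n / real n - f m / real m\<bar> = \<bar>real n * f m - real m * f n\<bar> / (real n * real m)"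
      by (simp add: abs_divide abs_mult abs_minus_commute)
    moreover have "((2 * real n) * C + (2 * real m) * C) / (real n * real m) = 2 * C / real n + 2 * C / real m"
      using that by (simp add: field_simps)
    ultimately show ?thesis by simp
  qed
  have "Cauchy (\<lambda>n. f n / real n)"
  proof (rule metric_CauchyI)
    fix e :: real assume e: "e > 0"
    obtain M :: nat where M: "real M > 4 * C / e + 1" using reals_Archimedean2 by blast
    have M0: "M > 0" using M C e by (cases M) (auto simp: field_simps)
    have small: "2 * C / real n < e / 2" if "n \<ge> M" for n
    proof -
      have "real n > 4 * C / e" using M that by linarith
      then have "4 * C < e * real n" using e by (simp add: field_simps)
      then show ?thesis using that M0 by (simp add: field_simps)
    qed
    show "\<exists>M. \<forall>m\<ge>M. \<forall>n\<ge>M. dist (f m / real m) (f n / real n) < e"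
    proof (intro exI allI impI)
      fix m n assume mn: "m \<ge> M" "n \<ge> M"
      then show "dist (f m / real m) (f n / real n) < e"
        using close[of m n] small[OF mn(1)] small[OF mn(2)] M0 by (simp add: dist_real_def)
    qed
  qed
  then show ?thesis by (rule Cauchy_convergent)
qed

lemma dev_rotation:
  assumes dev: "\<And>i j :: int. \<bar>s j - s i - of_int (j - i) * \<omega> * l\<bar> \<le> C"
  shows "has_rotation_number l s \<omega>"
proof -
  have C: "C \<ge> 0" using dev[of 0 0] by simp
  have bd: "\<bar>s i / (of_int i * l) - \<omega>\<bar> \<le> (C + \<bar>s 0\<bar>) / l * (1 / \<bar>of_int i\<bar>)" if "i \<noteq> 0" for i
  proof -
    have "s i / (of_int i * l) - \<omega> = (s i - of_int i * \<omega> * l) / (of_int i * l)"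
      using that l_pos by (simp add: field_simps)
    moreover have "\<bar>s i - of_int i * \<omega> * l\<bar> \<le> C + \<bar>s 0\<bar>" using dev[of i 0] by simp
    ultimately have "\<bar>s i / (of_int i * l) - \<omega>\<bar> \<le> (C + \<bar>s 0\<bar>) / (\<bar>of_int i\<bar> * l)"
      using l_pos by (simp add: abs_divide abs_mult divide_right_mono)
    then show ?thesis by (simp add: mult.commute)
  qed
  have *: "\<bar>s i / (of_int i * l) - \<omega>\<bar> < e" if "e > 0" "\<bar>of_int i\<bar> > (C + \<bar>s 0\<bar>) / l / e" "i \<noteq> 0" for e i
  proof -
    define X where "X = (C + \<bar>s 0\<bar>) / l"
    have "X / e < \<bar>of_int i\<bar>" using that(2) by (simp only: X_def)
    then have "X < \<bar>of_int i\<bar> * e" using that(1) by (simp only: pos_divide_less_eq)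
    then have "X * (1 / \<bar>of_int i\<bar>) < e" using that by (simp add: field_simps)
    then have "(C + \<bar>s 0\<bar>) / l * (1 / \<bar>of_int i\<bar>) < e" by (simp add: X_def)
    then show ?thesis using bd[OF that(3)] by linarith
  qed
  show ?thesis
    unfolding has_rotation_number_def tendsto_iff dist_real_def
  proof (intro conjI allI impI)
    fix e :: real assume e: "e > 0"
    define M where "M = max 1 (\<lceil>(C + \<bar>s 0\<bar>) / l / e\<rceil> + 1)"
    have M: "real_of_int M > (C + \<bar>s 0\<bar>) / l / e" "M \<ge> 1" unfolding M_def by linarith+
    have "\<bar>s i / (of_int i * l) - \<omega>\<bar> < e" if "i \<ge> M" for i
    proof (rule *[OF e])
      have "real_of_int M \<le> \<bar>of_int i\<bar>" using that M by linarith
      then show "\<bar>real_of_int i\<bar> > (C + \<bar>s 0\<bar>) / l / e" using M by linarith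
    qed (use that M in auto)
    then show "\<forall>\<^sub>F i in at_top. \<bar>s i / (of_int i * l) - \<omega>\<bar> < e"
      unfolding eventually_at_top_linorder by blast
    have "\<bar>s i / (of_int i * l) - \<omega>\<bar> < e" if "i \<le> - M" for i
    proof (rule *[OF e])
      have "real_of_int M \<le> \<bar>of_int i\<bar>" using that M by linarith
      then show "\<bar>real_of_int i\<bar> > (C + \<bar>s 0\<bar>) / l / e" using M by linarith
    qed (use that M in auto)
    then show "\<forall>\<^sub>F i in at_bot. \<bar>s i / (of_int i * l) - \<omega>\<bar> < e"
      unfolding eventually_at_bot_linorder by blast
  qed
qed

text \<open>With a bounded deviation, \<open>bridging\<close> compares any two blocks of equal
  length at a bounded cost \<open>C\<close>. The lengths are therefore quasi-additive.\<close>

lemma average_exists: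
  assumes s: "maximal s" and dev: "\<And>i j. \<bar>s j - s i - of_int (j - i) * \<omega> * l\<bar> \<le> l"
    and w: "0 < \<omega>" "\<omega> < 1"
  shows "\<exists>b. (\<lambda>N. len s (- int N) (int N) / (2 * real N)) \<longlonglongrightarrow> b"
proof -
  define \<nu> where "\<nu> = min \<omega> (1 - \<omega>)"
  have \<nu>: "\<nu> > 0" "\<nu> \<le> \<omega>" "\<nu> \<le> 1 - \<omega>" using w by (auto simp: \<nu>_def)
  \<comment> \<open>In \<open>K\<close> steps the rotation advances by at least \<open>4 * l\<close>
    and stays below the maximal advance \<open>K l\<close> by at least \<open>4 * l\<close>; this
    dominates the deviations, each at most \<open>l\<close>.\<close>
  define K where "K = \<lceil>4 / \<nu>\<rceil>"
  have "4 / \<nu> \<le> of_int K" unfolding K_def by linarith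
  then have K4: "4 \<le> of_int K * \<nu>" using \<nu> by (simp add: field_simps)
  then have "0 < real_of_int K * \<nu>" by linarith
  then have K1: "K \<ge> 1" using \<nu> by (simp add: zero_less_mult_iff)
  have Kw: "4 * l \<le> of_int K * \<omega> * l" "4 * l \<le> of_int K * l - of_int K * \<omega> * l"
  proof -
    have "4 \<le> of_int K * \<omega>" using K4 K1 mult_left_mono[OF \<nu>(2), of "of_int K"] by linarith
    then show "4 * l \<le> of_int K * \<omega> * l" using l_pos by (intro mult_right_mono) auto
    have "4 \<le> of_int K * (1 - \<omega>)" using K4 K1 mult_left_mono[OF \<nu>(3), of "of_int K"] by linarith
    then have "4 * l \<le> of_int K * (1 - \<omega>) * l" using l_pos by (intro mult_right_mono) auto
    then show "4 * l \<le> of_int K * l - of_int K * \<omega> * l" by (simp add: algebra_simps)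
  qed
  define C where "C = 2 * of_int K * l"
  have adm: "adm s" using s by (simp add: maximal_def)
  have block: "len s m' (m' + n) \<le> len s m (m + n) + C" if n: "n \<ge> 0" for m m' n
  proof (cases "n < 2 * K")
    case True
    have "len s m' (m' + n) \<le> of_int n * l" using len_le[OF adm, of m' "m' + n"] n by simp
    also have "\<dots> \<le> C" unfolding C_def using True l_pos by (intro mult_right_mono) linarith+
    also have "\<dots> \<le> len s m (m + n) + C" by simp
    finally show ?thesis .
  next
    case False
    define b where "b = - \<lfloor>(s m' - s m) / l\<rfloor>"
    define t where "t i = s (i + (m' - m)) + of_int b * l" for i
    define x where "x = s m' + of_int b * l - s m"
    have x: "0 \<le> x" "x \<le> l"
    proof -
      have "of_int \<lfloor>(s m' - s m) / l\<rfloor> \<le> (s m' - s m) / l" "(s m' - s m) / l \<le> of_int \<lfloor>(s m' - s m) / l\<rfloor> + 1"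
        by linarith+
      then have "of_int \<lfloor>(s m' - s m) / l\<rfloor> * l \<le> s m' - s m" "s m' - s m \<le> (of_int \<lfloor>(s m' - s m) / l\<rfloor> + 1) * l"
        using l_pos by (simp_all only: pos_le_divide_eq pos_divide_le_eq)
      then show "0 \<le> x" "x \<le> l" by (auto simp: x_def b_def algebra_simps)
    qed
    have "len t m (m + n) \<le> len s m (m + n) + 2 * of_int K * l"
    proof (rule bridging[OF s _ K1])
      show "adm t" unfolding t_def by (rule adm_shift[OF adm])
      show "m + K \<le> m + n - K" using False by simp
      have "t (m + K) - s m = s (m' + K) - s m' + x" by (simp add: t_def x_def add.commute)
      moreover have "\<bar>s (m' + K) - s m' - of_int K * \<omega> * l\<bar> \<le> l" using dev[of "m' + K" m'] by simp
      ultimately show "s m \<le> t (m + K)" "t (m + K) \<le> s m + of_int K * l" using x Kw l_pos by linarith+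
      have "s (m + n) - t (m + n - K) = (s (m + n) - s m) - (s (m' + (n - K)) - s m') - x"
        by (simp add: t_def x_def algebra_simps)
      moreover have "\<bar>s (m + n) - s m - of_int n * \<omega> * l\<bar> \<le> l" using dev[of "m + n" m] by simp
      moreover have "\<bar>s (m' + (n - K)) - s m' - of_int (n - K) * \<omega> * l\<bar> \<le> l" using dev[of "m' + (n - K)" m'] by simp
      moreover have "of_int (n - K) * \<omega> * l = of_int n * \<omega> * l - of_int K * \<omega> * l" by (simp add: algebra_simps)
      ultimately show "t (m + n - K) \<le> s (m + n)" "s (m + n) \<le> t (m + n - K) + of_int K * l"
        using x Kw l_pos by linarith+
    qed
    moreover have "len t m (m + n) = len s m' (m' + n)"
      unfolding t_def len_shift by (simp add: algebra_simps)
    ultimately show ?thesis by (simp add: C_def)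
  qed
  define f where "f n = len s 0 (int n)" for n
  have "\<bar>f (m + n) - f m - f n\<bar> \<le> C" for m n
  proof -
    have "f (m + n) = f m + len s (int m) (int m + int n)"
      unfolding f_def using len_split[of 0 "int m" "int m + int n" s] by simp
    then show ?thesis using block[of "int n" 0 "int m"] block[of "int n" "int m" 0]
      by (simp add: f_def abs_le_iff)
  qed
  then obtain b where b: "(\<lambda>n. f n / real n) \<longlonglongrightarrow> b"
    using quasi_additive_converges unfolding convergent_def by blast
  have "strict_mono (\<lambda>N::nat. 2 * N)" by (simp add: strict_mono_def)
  from LIMSEQ_subseq_LIMSEQ[OF b this] have b2: "(\<lambda>N. f (2 * N) / (2 * real N)) \<longlonglongrightarrow> b"
    by (simp add: o_def)
  have diff: "\<bar>len s (- int N) (int N) / (2 * real N) - f (2 * N) / (2 * real N)\<bar> \<le> C / (2 * real N)" for N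
  proof -
    have "\<bar>len s (- int N) (int N) - f (2 * N)\<bar> \<le> C"
      using block[of "2 * int N" 0 "- int N"] block[of "2 * int N" "- int N" 0]
      by (simp add: f_def abs_le_iff)
    then have "\<bar>len s (- int N) (int N) - f (2 * N)\<bar> / (2 * real N) \<le> C / (2 * real N)"
      by (intro divide_right_mono) auto
    then show ?thesis by (simp add: abs_divide flip: diff_divide_distrib)
  qed
  have "(\<lambda>N. C / 2 * (1 / real N)) \<longlonglongrightarrow> C / 2 * 0" by (intro tendsto_intros lim_1_over_n)
  then have "(\<lambda>N. C / (2 * real N)) \<longlonglongrightarrow> 0" by simp
  then have "(\<lambda>N. len s (- int N) (int N) / (2 * real N) - f (2 * N) / (2 * real N)) \<longlonglongrightarrow> 0"
    by (rule Lim_null_comparison[rotated]) (use diff in auto)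
  from tendsto_add[OF this b2] show ?thesis by auto
qed

lemma average_compare:
  assumes s: "maximal s" and t: "adm t"
    and rs: "has_rotation_number l s \<omega>" and rt: "has_rotation_number l t \<omega>"
    and w: "0 < \<omega>" "\<omega> < 1"
    and bs: "(\<lambda>N. len s (- int N) (int N) / (2 * real N)) \<longlonglongrightarrow> b"
    and bt: "\<And>N. N > 0 \<Longrightarrow> A N \<le> len t (- int N) (int N) / (2 * real N)" "A \<longlonglongrightarrow> b'"
  shows "b' \<le> b"
proof (rule field_le_epsilon)
  fix e :: real assume e: "e > 0"
  have "eventually (\<lambda>N. A N \<le> len s (- int N) (int N) / (2 * real N) + e) sequentially"
  proof -
    have "0 < 2 * e" using e by simp
    from comparison[OF s t rs rt w this] eventually_gt_at_top[of 0]
    show ?thesis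
  proof (eventually_elim)
    case (elim N)
    have "len t (- int N) (int N) / (2 * real N) \<le> (len s (- int N) (int N) + 2 * e * real N) / (2 * real N)"
      using elim by (intro divide_right_mono) auto
    also have "\<dots> = len s (- int N) (int N) / (2 * real N) + e" using elim by (simp add: field_simps)
    finally show ?case using bt(1)[of N] elim by simp
  qed
  qed
  then show "b' \<le> b + e"
    by (intro tendsto_le[OF _ tendsto_add[OF bs tendsto_const] bt(2)]) auto
qed

text \<open>A chord is at most the displacement of its step and also at most \<open>l\<close> minus
  this displacement. For \<omega> = 0 the first bound, for \<omega> = 1 the second, telescopes to a
  sublinear quantity.\<close>

lemma average_extreme:
  assumes adm: "adm s" and rot: "has_rotation_number l s \<omega>" and w: "\<omega> = 0 \<or> \<omega> = 1"
  shows "(\<lambda>N. len s (- int N) (int N) / (2 * real N)) \<longlonglongrightarrow> 0"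
proof (rule LIMSEQ_I)
  fix e :: real assume e: "e > 0"
  define \<delta> where "\<delta> = e / 2"
  obtain A where A: "A > 0" "\<And>N. N \<ge> A \<Longrightarrow> \<bar>s N - of_int N * \<omega> * l\<bar> \<le> \<delta> * of_int N \<and> \<bar>s (- N) + of_int N * \<omega> * l\<bar> \<le> \<delta> * of_int N"
    using rotation_growth[OF rot, of \<delta>] e by (auto simp: \<delta>_def)
  have tel: "(\<Sum>i\<in>{m..<n}. s (i + 1) - s i) = s n - s m" if "m \<le> n" for m n :: int
    using that
  proof (induction n rule: int_ge_induct)
    case (step i)
    then have "{m..<i + 1} = insert i {m..<i}" by auto
    with step show ?case by simp
  qed simp
  have up: "len s m n \<le> s n - s m" "len s m n \<le> of_int (n - m) * l - (s n - s m)" if "m \<le> n" for m n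
  proof -
    have st: "s i \<le> s (i + 1)" "s (i + 1) \<le> s i + l" for i using adm by (auto simp: adm_def)
    have "len s m n \<le> (\<Sum>i\<in>{m..<n}. s (i + 1) - s i)"
      unfolding len_def using r_le st by (intro sum_mono) (smt (verit, best))
    then show "len s m n \<le> s n - s m" using tel[OF that] by simp
    have "len s m n \<le> (\<Sum>i\<in>{m..<n}. l - (s (i + 1) - s i))"
      unfolding len_def using r_le_l[OF st] by (intro sum_mono) (simp add: algebra_simps)
    also have "\<dots> = of_int (n - m) * l - (s n - s m)"
      using sum_subtractf[of "\<lambda>_. l" "\<lambda>i. s (i + 1) - s i" "{m..<n}"] tel[OF that] that by simp
    finally show "len s m n \<le> of_int (n - m) * l - (s n - s m)" .
  qed
  show "\<exists>no. \<forall>n\<ge>no. norm (len s (- int n) (int n) / (2 * real n) - 0) < e"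
  proof (intro exI allI impI)
    fix n assume n: "n \<ge> nat A"
    then have n': "int n \<ge> A" "n > 0" using A by linarith+
    have X: "\<bar>s (int n) - real n * \<omega> * l\<bar> \<le> \<delta> * real n" "\<bar>s (- int n) + real n * \<omega> * l\<bar> \<le> \<delta> * real n"
      using A(2)[OF n'(1)] by auto
    have "len s (- int n) (int n) \<le> 2 * \<delta> * real n"
      using w
    proof
      assume "\<omega> = 0"
      then show ?thesis using X up(1)[of "- int n" "int n"] by simp
    next
      assume "\<omega> = 1"
      then show ?thesis using X up(2)[of "- int n" "int n"] by (simp add: algebra_simps)
    qed
    also have "\<dots> < e * (2 * real n)" using e n' by (simp add: \<delta>_def)
    finally show "norm (len s (- int n) (int n) / (2 * real n) - 0) < e"
      using n' by (simp add: field_simps abs_of_nonneg)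
  qed
qed

text \<open>This justifies the definite description in \<open>mather_beta\<close>: a minimal orbit
  of bounded deviation gives existence, and comparing any two minimal orbits in both directions
  gives uniqueness. At \<omega> = 0 and \<omega> = 1 all averages vanish.\<close>

lemma beta_spec:
  assumes w: "0 \<le> \<omega>" "\<omega> \<le> 1"
  obtains s where "maximal s" "\<And>i j. \<bar>s j - s i - of_int (j - i) * \<omega> * l\<bar> \<le> l"
    "(\<lambda>N. len s (- int N) (int N) / (2 * real N)) \<longlonglongrightarrow> - mather_beta \<gamma> l \<omega>"
proof -
  obtain s b where s: "minimal_orbit \<gamma> l s" "\<And>i j. \<bar>s j - s i - of_int (j - i) * \<omega> * l\<bar> \<le> l"
    "(\<lambda>N. len s (- int N) (int N) / (2 * real N)) \<longlonglongrightarrow> b"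
  proof (cases "0 < \<omega> \<and> \<omega> < 1")
    case True
    obtain s where s: "maximal s" "\<And>i j. \<bar>s j - s i - of_int (j - i) * \<omega> * l\<bar> \<le> l"
      using maximal_exists[OF w] by blast
    then show ?thesis
      using that maximal_minimal_orbit[OF s] average_exists[OF s] True by blast
  next
    case False
    then have w01: "\<omega> = 0 \<or> \<omega> = 1" using w by auto
    define s where "s i = of_int i * \<omega> * l" for i :: int
    have st: "s (i + 1) = s i + \<omega> * l" for i by (simp add: s_def algebra_simps)
    have adm: "adm s" using w01 l_pos by (auto simp: adm_def st)
    have dev: "\<bar>s j - s i - of_int (j - i) * \<omega> * l\<bar> \<le> l" for i j
      using l_pos by (simp add: s_def algebra_simps)
    have "billiard_orbit \<gamma> l s" using w01 by (auto simp: billiard_orbit_def st)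
    moreover have "len s m n = 0 \<and> len t m n = 0"
      if "m < n" "t m = s m" "t n = s n" "\<forall>i\<in>{m..<n}. t i \<le> t (i + 1) \<and> t (i + 1) \<le> t i + l" for m n t
    proof
      have "s n - s m = 0 \<or> s n - s m = of_int (n - m) * l"
        using w01 by (auto simp: s_def algebra_simps)
      then show "len s m n = 0" "len t m n = 0"
        using that adm by (auto intro!: len_extreme simp: adm_def)
    qed
    ultimately have "minimal_orbit \<gamma> l s"
      unfolding minimal_orbit_def sum_generating by (metis order_refl)
    then show ?thesis using that dev average_extreme[OF adm dev_rotation[OF dev] w01] by blast
  qed
  have rot: "has_rotation_number l s \<omega>" by (rule dev_rotation[OF s(2)])
  have uniq: "b' = - b" if t: "minimal_orbit \<gamma> l t" "has_rotation_number l t \<omega>"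
    "(\<lambda>N. (\<Sum>i \<in> {- int N..<int N}. generating \<gamma> (t i) (t (i + 1))) / (2 * real N)) \<longlonglongrightarrow> b'" for t b'
  proof -
    have bt: "(\<lambda>N. len t (- int N) (int N) / (2 * real N)) \<longlonglongrightarrow> - b'"
      using tendsto_minus[OF t(3)] by (simp add: sum_generating)
    have mt: "maximal t" "maximal s" using minimal_orbit_maximal t(1) s(1) by auto
    then have at: "adm t" "adm s" by (auto simp: maximal_def)
    show ?thesis
    proof (cases "0 < \<omega> \<and> \<omega> < 1")
      case True
      have "- b' \<le> b"
        by (rule average_compare[OF mt(2) at(1) rot t(2) _ _ s(3) order_refl bt]) (use True in auto)
      moreover have "b \<le> - b'"
        by (rule average_compare[OF mt(1) at(2) t(2) rot _ _ bt order_refl s(3)]) (use True in auto)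
      ultimately show ?thesis by simp
    next
      case False
      then have w01: "\<omega> = 0 \<or> \<omega> = 1" using w by auto
      have "- b' = 0" "b = 0"
        using LIMSEQ_unique[OF bt average_extreme[OF at(1) t(2) w01]]
          LIMSEQ_unique[OF s(3) average_extreme[OF at(2) rot w01]] by auto
      then show ?thesis by simp
    qed
  qed
  have "mather_beta \<gamma> l \<omega> = - b"
    unfolding mather_beta_def
  proof (rule the_equality)
    have "(\<lambda>N. (\<Sum>i \<in> {- int N..<int N}. generating \<gamma> (s i) (s (i + 1))) / (2 * real N)) \<longlonglongrightarrow> - b"
      using tendsto_minus[OF s(3)] by (simp add: sum_generating)
    then show "\<exists>s. minimal_orbit \<gamma> l s \<and> has_rotation_number l s \<omega> \<and>
        (\<lambda>N. (\<Sum>i \<in> {- int N..<int N}. generating \<gamma> (s i) (s (i + 1))) / (2 * real N)) \<longlonglongrightarrow> - b"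
      using s(1) rot by blast
  qed (use uniq in blast)
  then have "(\<lambda>N. len s (- int N) (int N) / (2 * real N)) \<longlonglongrightarrow> - mather_beta \<gamma> l \<omega>"
    using s(3) by simp
  with that[OF minimal_orbit_maximal[OF s(1)] s(2)] show ?thesis .
qed

text \<open>Weak KAM duality: the increments of \<open>S\<close> telescope along an orbit, so the
  mean length is at most the mean drift \<open>\<kappa> * l * \<omega>\<close> of \<open>S\<close>
  plus \<open>a\<close>.\<close>

lemma beta_ge_dual:
  assumes w: "0 \<le> \<omega>" "\<omega> \<le> 1"
    and S: "\<And>x. \<bar>S x - \<kappa> * x\<bar> \<le> C"
    and D: "\<And>x y. x \<le> y \<Longrightarrow> y \<le> x + l \<Longrightarrow> r x y \<le> S y - S x + a"
  shows "- (\<kappa> * l * \<omega> + a) \<le> mather_beta \<gamma> l \<omega>"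
proof -
  obtain s where s: "maximal s" "\<And>i j. \<bar>s j - s i - of_int (j - i) * \<omega> * l\<bar> \<le> l"
    "(\<lambda>N. len s (- int N) (int N) / (2 * real N)) \<longlonglongrightarrow> - mather_beta \<gamma> l \<omega>"
    using beta_spec[of \<omega>] w by auto
  have adm: "s i \<le> s (i + 1)" "s (i + 1) \<le> s i + l" for i using s(1) by (auto simp: maximal_def adm_def)
  have tel: "(\<Sum>i\<in>{m..<n}. S (s (i + 1)) - S (s i)) = S (s n) - S (s m)" if "m \<le> n" for m n :: int
    using that
  proof (induction n rule: int_ge_induct)
    case (step i)
    then have "{m..<i + 1} = insert i {m..<i}" by auto
    with step show ?case by simp
  qed simp
  have le: "len s (- int N) (int N) / (2 * real N) \<le> (2 * C + \<bar>\<kappa>\<bar> * l) / 2 * (1 / real N) + (\<kappa> * l * \<omega> + a)"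
    if N: "N > 0" for N
  proof -
    have "len s (- int N) (int N) \<le> (\<Sum>i\<in>{- int N..<int N}. (S (s (i + 1)) - S (s i)) + a)"
      unfolding len_def by (intro sum_mono D adm)
    also have "\<dots> = S (s (int N)) - S (s (- int N)) + 2 * real N * a"
      unfolding sum.distrib using tel[of "- int N" "int N"] by simp
    also have "\<dots> \<le> \<kappa> * (s (int N) - s (- int N)) + 2 * C + 2 * real N * a"
      using S[of "s (int N)"] S[of "s (- int N)"] by (simp add: algebra_simps abs_le_iff)
    also have "\<kappa> * (s (int N) - s (- int N)) \<le> \<kappa> * (2 * real N * \<omega> * l) + \<bar>\<kappa>\<bar> * l"
    proof -
      have "\<bar>s (int N) - s (- int N) - 2 * real N * \<omega> * l\<bar> \<le> l" using s(2)[of "int N" "- int N"] by simp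
      then have "\<bar>\<kappa> * (s (int N) - s (- int N) - 2 * real N * \<omega> * l)\<bar> \<le> \<bar>\<kappa>\<bar> * l"
        unfolding abs_mult by (intro mult_left_mono) auto
      then show ?thesis by (simp add: algebra_simps abs_le_iff)
    qed
    finally have "len s (- int N) (int N) \<le> (2 * C + \<bar>\<kappa>\<bar> * l) + 2 * real N * (\<kappa> * l * \<omega> + a)"
      by (simp add: algebra_simps)
    then have "len s (- int N) (int N) / (2 * real N) \<le> ((2 * C + \<bar>\<kappa>\<bar> * l) + 2 * real N * (\<kappa> * l * \<omega> + a)) / (2 * real N)"
      by (intro divide_right_mono) auto
    also have "\<dots> = (2 * C + \<bar>\<kappa>\<bar> * l) / 2 * (1 / real N) + (\<kappa> * l * \<omega> + a)" using N by (simp add: field_simps)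
    finally show ?thesis .
  qed
  have "(\<lambda>N. (2 * C + \<bar>\<kappa>\<bar> * l) / 2 * (1 / real N) + (\<kappa> * l * \<omega> + a)) \<longlonglongrightarrow>
      (2 * C + \<bar>\<kappa>\<bar> * l) / 2 * 0 + (\<kappa> * l * \<omega> + a)"
    by (intro tendsto_intros lim_1_over_n)
  then have lim: "(\<lambda>N. (2 * C + \<bar>\<kappa>\<bar> * l) / 2 * (1 / real N) + (\<kappa> * l * \<omega> + a)) \<longlonglongrightarrow> \<kappa> * l * \<omega> + a"
    by simp
  have "- mather_beta \<gamma> l \<omega> \<le> \<kappa> * l * \<omega> + a"
  proof (rule tendsto_le[OF trivial_limit_sequentially lim s(3)])
    show "\<forall>\<^sub>F N in sequentially. len s (- int N) (int N) / (2 * real N)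
        \<le> (2 * C + \<bar>\<kappa>\<bar> * l) / 2 * (1 / real N) + (\<kappa> * l * \<omega> + a)"
      using eventually_gt_at_top[of 0] by eventually_elim (rule le)
  qed
  then show ?thesis by simp
qed

end

subsection \<open>Formal expansions\<close>

text \<open>Congruence modulo the n-th power of the variable. Polynomials are preferred to formal
  power series because they are evaluated at t = \<epsilon>^2 later.\<close>

definition eqm :: "nat \<Rightarrow> 'a::comm_ring_1 poly \<Rightarrow> 'a poly \<Rightarrow> bool" where
  "eqm n p q \<longleftrightarrow> monom 1 n dvd (p - q)"

lemma eqm_coeff: "eqm n p q \<longleftrightarrow> (\<forall>k<n. coeff p k = coeff q k)"
  by (simp add: eqm_def monom_1_dvd_iff')

lemma eqm_refl [simp]: "eqm n p p"
  by (simp add: eqm_coeff)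

lemma eqm_trans [trans]: "eqm n p q \<Longrightarrow> eqm n q r \<Longrightarrow> eqm n p r"
  by (simp add: eqm_coeff)

lemma eqm_le: "eqm n p q \<Longrightarrow> m \<le> n \<Longrightarrow> eqm m p q"
  by (simp add: eqm_coeff)

lemma eqm_Suc: "eqm (Suc n) p q \<longleftrightarrow> eqm n p q \<and> coeff p n = coeff q n"
  by (auto simp: eqm_coeff less_Suc_eq)

lemma eqm_add: "eqm n p q \<Longrightarrow> eqm n p' q' \<Longrightarrow> eqm n (p + p') (q + q')"
  and eqm_diff: "eqm n p q \<Longrightarrow> eqm n p' q' \<Longrightarrow> eqm n (p - p') (q - q')"
  and eqm_smult: "eqm n p q \<Longrightarrow> eqm n (smult a p) (smult a q)"
  by (simp_all add: eqm_coeff)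

lemma eqm_mult: "eqm n p q \<Longrightarrow> eqm n p' q' \<Longrightarrow> eqm n (p * p') (q * q')"
  by (auto simp: eqm_coeff coeff_mult intro!: sum.cong)

lemma eqm_power: "eqm n p q \<Longrightarrow> eqm n (p ^ m) (q ^ m)"
  by (induction m) (auto intro: eqm_mult)

lemma eqm_sum: "(\<And>i. i \<in> A \<Longrightarrow> eqm n (f i) (g i)) \<Longrightarrow> eqm n (sum f A) (sum g A)"
  by (simp add: eqm_coeff coeff_sum)

lemma eqm_shift: "eqm n p q \<Longrightarrow> eqm (m + n) (monom 1 m * p) (monom 1 m * q)"
  by (auto simp: eqm_coeff coeff_monom_mult)

lemma eqm_monom_0: "n \<le> m \<Longrightarrow> eqm n (monom a m) 0"
  by (auto simp: eqm_coeff)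

lemma eqm_monom_mult: "eqm (Suc n) (monom a n * p) (monom (a * coeff p 0) n)"
  by (auto simp: eqm_coeff coeff_monom_mult)

text \<open>The coefficients of a central difference: f(m + \<delta>/2) - f(m - \<delta>/2) is
  formally the sum of \<open>cf j\<close> times \<delta>^(2j+1) times the derivative of f of order
  2j+1 at m.\<close>

definition cf :: "nat \<Rightarrow> real" where "cf j = 1 / (fact (2 * j + 1) * 4 ^ j)"

lemma cf_pos: "cf j > 0"
  by (simp add: cf_def)

lemma cf_0 [simp]: "cf 0 = 1"
  by (simp add: cf_def)

context period
begin

lemma eqm_dP: "eqm n p q \<Longrightarrow> eqm n ((dP ^^ m) p) ((dP ^^ m) q)"
  by (simp add: eqm_coeff)

text \<open>\<open>\<gamma>^(n+1) = (tp n + i tq n) \<gamma>'\<close> for a curve of curvature \<open>k\<close>, by the Frenet equations.\<close>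

primrec tpq :: "psm \<Rightarrow> nat \<Rightarrow> psm \<times> psm" where
  "tpq k 0 = (1, 0)"
| "tpq k (Suc n) = (d (fst (tpq k n)) - k * snd (tpq k n), d (snd (tpq k n)) + k * fst (tpq k n))"

abbreviation tp where "tp k n \<equiv> fst (tpq k n)"
abbreviation tq where "tq k n \<equiv> snd (tpq k n)"

text \<open>\<open>VP\<close> and \<open>VQ\<close> are the tangential and normal components, in the
  frame at the midpoint of an arc, of the chord divided by the length \<delta> of the arc. The
  variable is \<delta>^2.\<close>

definition VP :: "psm \<Rightarrow> nat \<Rightarrow> psm poly" where
  "VP k J = (\<Sum>j\<le>J. monom (cf j *\<^sub>R tp k (2 * j)) j)"
definition VQ :: "psm \<Rightarrow> nat \<Rightarrow> psm poly" where
  "VQ k J = (\<Sum>j\<le>J. monom (cf j *\<^sub>R tq k (2 * j)) j)"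

lemma coeff_VP: "coeff (VP k J) i = (if i \<le> J then cf i *\<^sub>R tp k (2 * i) else 0)"
  and coeff_VQ: "coeff (VQ k J) i = (if i \<le> J then cf i *\<^sub>R tq k (2 * i) else 0)"
  by (simp_all add: VP_def VQ_def coeff_sum)

definition V2 :: "psm \<Rightarrow> nat \<Rightarrow> psm poly" where "V2 k J = VP k J * VP k J + VQ k J * VQ k J"

text \<open>As \<open>S\<close> has constant term 1, adding \<open>t\<close> in degree
  \<open>n\<close> changes the square by \<open>2 t\<close> in this degree and leaves lower degrees
  alone.\<close>

lemma sqrt_step:
  fixes S V :: "psm poly"
  assumes S: "eqm n (S * S) V" "coeff S 0 = 1" "degree S < n" and n: "n \<ge> 1"
  obtains S' where "eqm (Suc n) (S' * S') V" "eqm n S' S" "degree S' < Suc n"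
proof -
  define t where "t = (1/2) *\<^sub>R (coeff V n - coeff (S * S) n)"
  define S' where "S' = S + monom t n"
  have "S' * S' = S * S + (monom t n * (S + S) + monom t n * monom t n)"
    by (simp add: S'_def algebra_simps)
  moreover have "eqm (Suc n) (monom t n * (S + S)) (monom (t * coeff (S + S) 0) n)"
    by (rule eqm_monom_mult)
  moreover have "eqm (Suc n) (monom t n * monom t n) 0"
    unfolding mult_monom using n by (intro eqm_monom_0) simp
  ultimately have *: "eqm (Suc n) (S' * S') (S * S + (monom (t * coeff (S + S) 0) n + 0))"
    by (metis eqm_add eqm_refl)
  have tt: "t * coeff (S + S) 0 = coeff V n - coeff (S * S) n"
  proof -
    have "t * coeff (S + S) 0 = t + t" by (simp only: coeff_add S(2) distrib_left mult_1_right)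
    also have "\<dots> = (1/2 + 1/2) *\<^sub>R (coeff V n - coeff (S * S) n)"
      unfolding t_def by (simp only: scaleR_add_left)
    finally show ?thesis by simp
  qed
  have "eqm (Suc n) (S * S + (monom (t * coeff (S + S) 0) n + 0)) V"
    unfolding tt using S(1) by (simp add: eqm_coeff less_Suc_eq)
  with * have "eqm (Suc n) (S' * S') V" by (rule eqm_trans)
  moreover have "eqm n S' S" by (simp add: S'_def eqm_coeff)
  moreover have "degree S' < Suc n"
    using S(3) degree_monom_le[of t n] unfolding S'_def
    by (intro le_imp_less_Suc degree_add_le) auto
  ultimately show ?thesis using that by blast
qed

lemma sqrt_exists:
  assumes S: "eqm n (S * S) (V :: psm poly)" "coeff S 0 = 1" "degree S < n" and n: "n \<ge> 1" "n \<le> m"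
  obtains S' where "eqm m (S' * S') V" "eqm n S' S" "degree S' < m"
proof -
  have "\<exists>S'. eqm m (S' * S') V \<and> eqm n S' S \<and> degree S' < m"
    using n(2)
  proof (induction m rule: dec_induct)
    case base
    show ?case using S by auto
  next
    case (step m)
    then obtain S1 where S1: "eqm m (S1 * S1) V" "eqm n S1 S" "degree S1 < m" by blast
    have "coeff S1 0 = 1" using S1(2) S(2) n by (auto simp: eqm_coeff)
    then obtain S2 where "eqm (Suc m) (S2 * S2) V" "eqm m S2 S1" "degree S2 < Suc m"
      using sqrt_step[OF S1(1) _ S1(3)] n step by auto
    then show ?case using S1 step(1) by (meson eqm_le eqm_trans)
  qed
  then show ?thesis using that by blast
qed

text \<open>The gap divided by \<epsilon>^3 on an arc of length \<epsilon> Y, expanded at its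
  midpoint: \<open>D i\<close> are the coefficients of the deficit of the chord, the other terms
  come from the integral of \<open>G\<close>. The variable is \<epsilon>^2.\<close>

definition Phi :: "(nat \<Rightarrow> psm) \<Rightarrow> nat \<Rightarrow> psm poly \<Rightarrow> psm poly \<Rightarrow> psm poly" where
  "Phi D I G Y = (\<Sum>i\<le>I. monom 1 i * (Y ^ (2 * i + 1) * (smult (D i) (Y ^ 2) - smult (of_real (cf i)) ((dP ^^ (2 * i)) G))))"

text \<open>The formal partial derivative of \<open>Phi\<close> with respect to
  \<open>Y\<close>.\<close>

definition PhiY :: "(nat \<Rightarrow> psm) \<Rightarrow> nat \<Rightarrow> psm poly \<Rightarrow> psm poly \<Rightarrow> psm poly" where
  "PhiY D I G Y = (\<Sum>i\<le>I. monom 1 i * (smult (of_nat (2 * i + 3) * D i) (Y ^ (2 * i + 2))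
     - smult (of_real (of_nat (2 * i + 1) * cf i)) (Y ^ (2 * i) * (dP ^^ (2 * i)) G)))"

text \<open>The summands with \<open>i > 0\<close> carry a factor that gains at least one order of
  precision, so in degree \<open>n\<close> only the summand for \<open>i = 0\<close> feels a
  change.\<close>

lemma eqm_Suc_sum:
  assumes "\<And>i. eqm n (f i) (g i)"
  shows "eqm (Suc n) (\<Sum>i\<le>I. monom 1 i * f i) ((f 0 - g 0) + (\<Sum>i\<le>I. monom 1 i * g i))"
proof -
  have "eqm (Suc n) (monom 1 i * f i) (if i = 0 then (f 0 - g 0) + monom 1 i * g i else monom 1 i * g i)" for i
  proof (cases "i = 0")
    case False
    have "eqm (i + n) (monom 1 i * f i) (monom 1 i * g i)" by (rule eqm_shift[OF assms])
    then show ?thesis using False by (auto intro: eqm_le)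
  qed (simp add: one_pCons[symmetric] flip: monom_0)
  then have "eqm (Suc n) (\<Sum>i\<le>I. monom 1 i * f i) (\<Sum>i\<le>I. if i = 0 then (f 0 - g 0) + monom 1 i * g i else monom 1 i * g i)"
    by (intro eqm_sum)
  also have "(\<Sum>i\<le>I. if i = 0 then (f 0 - g 0) + monom 1 i * g i else monom 1 i * g i)
      = (\<Sum>i\<le>I. (if i = 0 then f 0 - g 0 else 0) + monom 1 i * g i)"
    by (intro sum.cong) auto
  also have "\<dots> = (f 0 - g 0) + (\<Sum>i\<le>I. monom 1 i * g i)"
    by (simp add: sum.distrib)
  finally show ?thesis .
qed

text \<open>The Newton step: correcting \<open>G\<close> and \<open>Y\<close> in degree \<open>n\<close> changes \<open>Phi\<close> only through
  \<open>- Y u\<close>, because \<open>Phi\<close> is stationary in \<open>Y\<close>; so \<open>u\<close> and then \<open>v\<close> are determined algebraically.\<close>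

lemma newton_step:
  assumes P: "eqm n (Phi D I G Y) A" "eqm n (PhiY D I G Y) 0" and n: "n \<ge> 1"
    and y: "y' * coeff Y 0 = 1" and z: "z' * (6 * D 0 * coeff Y 0) = 1"
  obtains G' Y' where "eqm (Suc n) (Phi D I G' Y') A" "eqm (Suc n) (PhiY D I G' Y') 0"
    "eqm n G' G" "eqm n Y' Y"
proof -
  \<comment> \<open>In degree \<open>n\<close> the corrections add \<open>- (coeff Y 0 * u)\<close>
    to \<open>Phi\<close> and \<open>6 * D 0 * coeff Y 0 * v - u\<close> to \<open>PhiY\<close>;
    \<open>y'\<close> and \<open>z'\<close> are the inverses needed to solve for \<open>u\<close>
    and then for \<open>v\<close>.\<close>
  define u where "u = y' * (coeff (Phi D I G Y) n - coeff A n)"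
  define v where "v = z' * (u - coeff (PhiY D I G Y) n)"
  define G' where "G' = G + monom u n"
  define Y' where "Y' = Y + monom v n"
  have G': "eqm n G' G" and Y': "eqm n Y' Y" by (auto simp: G'_def Y'_def eqm_coeff)
  \<comment> \<open>Stationarity in lowest order: it removes the contribution of \<open>v\<close> to
    \<open>Phi\<close> in degree \<open>n\<close>.\<close>
  have crit: "3 * D 0 * coeff Y 0 * coeff Y 0 - coeff G 0 = 0"
  proof -
    have "coeff (PhiY D I G Y) 0 = 0" using P(2) n by (auto simp: eqm_coeff)
    also have "coeff (PhiY D I G Y) 0 = (\<Sum>i\<le>I. if i = 0 then 3 * D 0 * coeff Y 0 * coeff Y 0 - coeff G 0 else 0)"
      unfolding PhiY_def coeff_sum
      by (intro sum.cong) (auto simp: coeff_monom_mult power2_eq_square coeff_mult_0)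
    finally show ?thesis by simp
  qed
  \<comment> \<open>Products of two corrections have degree \<open>2 n\<close>, which exceeds
    \<open>n\<close> because of \<open>n \<ge> 1\<close>.\<close>
  have mm: "eqm (Suc n) (monom a n * monom b n) 0" for a b
    unfolding mult_monom using n by (intro eqm_monom_0) simp
  have mm': "eqm (Suc n) (p * (monom a n * monom b n)) 0" for a b and p :: "psm poly"
    using eqm_mult[OF eqm_refl mm] by simp
  define fY fY' where "fY i = smult (of_nat (2 * i + 3) * D i) (Y ^ (2 * i + 2)) - smult (of_real (of_nat (2 * i + 1) * cf i)) (Y ^ (2 * i) * (dP ^^ (2 * i)) G)" and "fY' i = smult (of_nat (2 * i + 3) * D i) (Y' ^ (2 * i + 2)) - smult (of_real (of_nat (2 * i + 1) * cf i)) (Y' ^ (2 * i) * (dP ^^ (2 * i)) G')" for i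
  have t10: "eqm (Suc n) ((smult (of_nat (2 * 0 + 3) * D 0) (Y' ^ (2 * 0 + 2)) - smult (of_real (of_nat (2 * 0 + 1) * cf 0)) (Y' ^ (2 * 0) * (dP ^^ (2 * 0)) G'))
      - (smult (of_nat (2 * 0 + 3) * D 0) (Y ^ (2 * 0 + 2)) - smult (of_real (of_nat (2 * 0 + 1) * cf 0)) (Y ^ (2 * 0) * (dP ^^ (2 * 0)) G)))
      (monom (6 * D 0 * coeff Y 0 * v - u) n)"
  proof -
    have "(smult (3 * D 0) (Y' ^ 2) - G') - (smult (3 * D 0) (Y ^ 2) - G)
        = smult (3 * D 0) (monom v n * (Y + Y) + monom v n * monom v n) - monom u n"
      by (simp add: G'_def Y'_def power2_eq_square algebra_simps smult_add_right smult_diff_right)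
    moreover have "eqm (Suc n) (smult (3 * D 0) (monom v n * (Y + Y) + monom v n * monom v n) - monom u n)
        (smult (3 * D 0) (monom (v * coeff (Y + Y) 0) n + 0) - monom u n)"
      by (intro eqm_diff eqm_smult eqm_add eqm_monom_mult mm eqm_refl)
    moreover have "smult (3 * D 0) (monom (v * coeff (Y + Y) 0) n + 0) - monom u n = monom (6 * D 0 * coeff Y 0 * v - u) n"
    proof -
      have "3 * D 0 * (v * (coeff Y 0 + coeff Y 0)) = 6 * D 0 * coeff Y 0 * v" by (simp add: algebra_simps)
      then show ?thesis by (simp only: coeff_add smult_monom add_0_right diff_monom)
    qed
    ultimately have "eqm (Suc n) ((smult (3 * D 0) (Y' ^ 2) - G') - (smult (3 * D 0) (Y ^ 2) - G)) (monom (6 * D 0 * coeff Y 0 * v - u) n)"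
      by (simp only:)
    then show ?thesis by (simp add: power2_eq_square)
  qed
  have c1: "eqm n (smult (of_nat (2 * i + 3) * D i) (Y' ^ (2 * i + 2)) - smult (of_real (of_nat (2 * i + 1) * cf i)) (Y' ^ (2 * i) * (dP ^^ (2 * i)) G'))
     (smult (of_nat (2 * i + 3) * D i) (Y ^ (2 * i + 2)) - smult (of_real (of_nat (2 * i + 1) * cf i)) (Y ^ (2 * i) * (dP ^^ (2 * i)) G))" for i
    by (intro eqm_diff eqm_smult eqm_mult eqm_power eqm_dP G' Y')
  have "eqm (Suc n) (PhiY D I G' Y') (monom (6 * D 0 * coeff Y 0 * v - u) n + PhiY D I G Y)"
  proof -
    have "eqm n (fY' i) (fY i)" for i unfolding fY_def fY'_def by (rule c1)
    then have "eqm (Suc n) (\<Sum>i\<le>I. monom 1 i * fY' i) ((fY' 0 - fY 0) + (\<Sum>i\<le>I. monom 1 i * fY i))"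
      by (rule eqm_Suc_sum)
    also have "eqm (Suc n) \<dots> (monom (6 * D 0 * coeff Y 0 * v - u) n + (\<Sum>i\<le>I. monom 1 i * fY i))"
      by (intro eqm_add eqm_refl) (use t10 in \<open>simp only: fY_def fY'_def\<close>)
    finally show ?thesis by (simp only: PhiY_def fY_def fY'_def)
  qed
  moreover have "6 * D 0 * coeff Y 0 * v - u = - coeff (PhiY D I G Y) n"
  proof -
    have "6 * D 0 * coeff Y 0 * v = (z' * (6 * D 0 * coeff Y 0)) * (u - coeff (PhiY D I G Y) n)"
      by (simp add: v_def mult_ac)
    then show ?thesis by (simp add: z)
  qed
  ultimately have R1: "eqm (Suc n) (PhiY D I G' Y') 0"
    using P(2) by (auto simp: eqm_coeff less_Suc_eq)
  define fP fP' where "fP i = Y ^ (2 * i + 1) * (smult (D i) (Y ^ 2) - smult (of_real (cf i)) ((dP ^^ (2 * i)) G))" and "fP' i = Y' ^ (2 * i + 1) * (smult (D i) (Y' ^ 2) - smult (of_real (cf i)) ((dP ^^ (2 * i)) G'))" for i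
  have t20: "eqm (Suc n) (Y' ^ (2 * 0 + 1) * (smult (D 0) (Y' ^ 2) - smult (of_real (cf 0)) ((dP ^^ (2 * 0)) G'))
      - Y ^ (2 * 0 + 1) * (smult (D 0) (Y ^ 2) - smult (of_real (cf 0)) ((dP ^^ (2 * 0)) G)))
      (monom (- (coeff Y 0 * u)) n)"
  proof -
    have e: "Y' * (smult (D 0) (Y' ^ 2) - G') - Y * (smult (D 0) (Y ^ 2) - G)
        = monom v n * (smult (3 * D 0) (Y * Y) - G) - monom u n * Y
          + (smult (3 * D 0) Y * (monom v n * monom v n) + smult (D 0) (monom v n) * (monom v n * monom v n)
             - 1 * (monom v n * monom u n))"
    proof -
      define C where "C = [:D 0:]"
      have "smult (D 0) p = C * p" "smult (3 * D 0) p = 3 * (C * p)" for p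
        by (simp_all add: C_def numeral_poly mult.commute)
      then show ?thesis by (simp add: G'_def Y'_def power2_eq_square algebra_simps)
    qed
    have "eqm (Suc n) (monom v n * (smult (3 * D 0) (Y * Y) - G) - monom u n * Y
          + (smult (3 * D 0) Y * (monom v n * monom v n) + smult (D 0) (monom v n) * (monom v n * monom v n)
             - 1 * (monom v n * monom u n)))
        (monom (v * coeff (smult (3 * D 0) (Y * Y) - G) 0) n - monom (u * coeff Y 0) n + (0 + 0 - 0))"
      by (intro eqm_diff eqm_add eqm_monom_mult mm')
    moreover have "coeff (smult (3 * D 0) (Y * Y) - G) 0 = 0" using crit by (simp add: coeff_mult_0 mult.assoc)
    ultimately show ?thesis using e by (simp add: mult.commute minus_monom)
  qed
  have c2: "eqm n (Y' ^ (2 * i + 1) * (smult (D i) (Y' ^ 2) - smult (of_real (cf i)) ((dP ^^ (2 * i)) G')))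
     (Y ^ (2 * i + 1) * (smult (D i) (Y ^ 2) - smult (of_real (cf i)) ((dP ^^ (2 * i)) G)))" for i
    by (intro eqm_diff eqm_smult eqm_mult eqm_power eqm_dP G' Y')
  have "eqm (Suc n) (Phi D I G' Y') (monom (- (coeff Y 0 * u)) n + Phi D I G Y)"
  proof -
    have "eqm n (fP' i) (fP i)" for i unfolding fP_def fP'_def by (rule c2)
    then have "eqm (Suc n) (\<Sum>i\<le>I. monom 1 i * fP' i) ((fP' 0 - fP 0) + (\<Sum>i\<le>I. monom 1 i * fP i))"
      by (rule eqm_Suc_sum)
    also have "eqm (Suc n) \<dots> (monom (- (coeff Y 0 * u)) n + (\<Sum>i\<le>I. monom 1 i * fP i))"
      by (intro eqm_add eqm_refl) (use t20 in \<open>simp only: fP_def fP'_def\<close>)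
    finally show ?thesis by (simp only: Phi_def fP_def fP'_def)
  qed
  moreover have "coeff Y 0 * u = coeff (Phi D I G Y) n - coeff A n"
  proof -
    have "coeff Y 0 * u = (y' * coeff Y 0) * (coeff (Phi D I G Y) n - coeff A n)"
      by (simp add: u_def mult_ac)
    then show ?thesis by (simp add: y)
  qed
  ultimately have "eqm (Suc n) (Phi D I G' Y') A"
    using P(1) by (auto simp: eqm_coeff less_Suc_eq)
  with R1 show ?thesis using that G' Y' by blast
qed

lemma newton:
  assumes P: "eqm n (Phi D I G Y) A" "eqm n (PhiY D I G Y) 0" and n: "n \<ge> 1" "n \<le> m"
    and y: "y' * coeff Y 0 = 1" and z: "z' * (6 * D 0 * coeff Y 0) = 1"
  obtains G' Y' where "eqm m (Phi D I G' Y') A" "eqm m (PhiY D I G' Y') 0"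
    "eqm n G' G" "eqm n Y' Y"
proof -
  have "\<exists>G' Y'. eqm m (Phi D I G' Y') A \<and> eqm m (PhiY D I G' Y') 0 \<and> eqm n G' G \<and> eqm n Y' Y"
    using n(2)
  proof (induction m rule: dec_induct)
    case base
    show ?case using P by (intro exI[of _ G] exI[of _ Y]) simp
  next
    case (step m)
    then obtain G1 Y1 where 1: "eqm m (Phi D I G1 Y1) A" "eqm m (PhiY D I G1 Y1) 0" "eqm n G1 G" "eqm n Y1 Y"
      by blast
    have "coeff Y1 0 = coeff Y 0" using 1(4) n by (auto simp: eqm_coeff)
    then obtain G2 Y2 where "eqm (Suc m) (Phi D I G2 Y2) A" "eqm (Suc m) (PhiY D I G2 Y2) 0"
      "eqm m G2 G1" "eqm m Y2 Y1"
      using newton_step[OF 1(1,2)] n step y z by (metis order_trans)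
    then show ?case using 1 step(1) by (meson eqm_le eqm_trans)
  qed
  then show ?thesis using that by blast
qed

end

section \<open>Tools for low-order coefficients\<close>

lemma coeff_mult_low:
  "coeff (p * q) 0 = coeff p 0 * coeff q 0"
  "coeff (p * q) 1 = coeff p 0 * coeff q 1 + coeff p 1 * coeff q 0"
  "coeff (p * q) 2 = coeff p 0 * coeff q 2 + coeff p 1 * coeff q 1 + coeff p 2 * coeff q 0"
  "coeff (p * q) 3 = coeff p 0 * coeff q 3 + coeff p 1 * coeff q 2 + coeff p 2 * coeff q 1 + coeff p 3 * coeff q 0"
  "coeff (p * q) 4 = coeff p 0 * coeff q 4 + coeff p 1 * coeff q 3 + coeff p 2 * coeff q 2
    + coeff p 3 * coeff q 1 + coeff p 4 * coeff q 0"
  by (simp_all add: coeff_mult numeral_eq_Suc add.assoc)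

lemma funpow_numeral: "(f ^^ numeral n) x = f ((f ^^ pred_numeral n) x)"
  by (simp add: numeral_eq_Suc)

lemma funpow_one: "(f ^^ 1) x = f x" for f :: "'a \<Rightarrow> 'a"
  by simp

lemma coeff_pCons_numeral:
  "coeff (pCons a p) (numeral n) = coeff p (pred_numeral n)" "coeff (pCons a p) 1 = coeff p 0"
  by (simp_all add: numeral_eq_Suc)

lemma coeff_sum_monom_mult:
  fixes f :: "nat \<Rightarrow> 'a::comm_ring_1 poly"
  assumes "n \<le> I"
  shows "coeff (\<Sum>i\<le>I. monom 1 i * f i) n = (\<Sum>i\<le>n. coeff (f i) (n - i))"
proof -
  have "coeff (\<Sum>i\<le>I. monom 1 i * f i) n = (\<Sum>i\<le>I. if i \<le> n then coeff (f i) (n - i) else 0)"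
    by (auto simp: coeff_sum coeff_monom_mult intro!: sum.cong)
  also have "\<dots> = (\<Sum>i\<le>n. coeff (f i) (n - i))"
    using assms by (intro sum.mono_neutral_cong_right) auto
  finally show ?thesis .
qed

lemma less_5_iff: "i < 5 \<longleftrightarrow> i = 0 \<or> i = 1 \<or> i = 2 \<or> i = 3 \<or> i = (4::nat)"
  and less_4_iff: "i < 4 \<longleftrightarrow> i = 0 \<or> i = 1 \<or> i = 2 \<or> i = (3::nat)"
  by auto

lemma atMost_numeral: "{..1::nat} = {0, 1}" "{..2::nat} = {0, 1, 2}" "{..3::nat} = {0, 1, 2, 3}"
  by auto

lemma cf_values: "cf (Suc 0) = 1 / 24" "cf 1 = 1 / 24" "cf 2 = 1 / 1920" "cf 3 = 1 / 322560" "cf 4 = 1 / 92897280"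
  by (simp_all add: cf_def fact_numeral)

lemma eqm_cancel_left:
  fixes p q :: "'a::comm_ring_1 poly"
  assumes "eqm n (p * q) 0" "y * coeff p 0 = 1"
  shows "eqm n q 0"
  using assms(1)
proof (induction n)
  case 0
  then show ?case by (simp add: eqm_coeff)
next
  case (Suc n)
  then have q: "eqm n q 0" and pq: "coeff (p * q) n = 0" by (auto simp: eqm_coeff)
  have "coeff (p * q) n = coeff p 0 * coeff q n"
  proof -
    have "coeff (p * q) n = (\<Sum>i\<le>n. if i = 0 then coeff p 0 * coeff q n else 0)"
      unfolding coeff_mult using q by (intro sum.cong) (auto simp: eqm_coeff)
    then show ?thesis by simp
  qed
  then have "y * coeff p 0 * coeff q n = 0" using pq by (simp add: mult.assoc)
  then show ?case using q assms(2) by (simp add: eqm_Suc)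
qed

section \<open>Explicit coefficients in normalized derivatives of \<open>w\<close>\<close>

locale frame = period l for l +
  fixes w v :: psm
  assumes wv: "w * v = 1"
begin

text \<open>In the application \<open>w = k^(1/3)\<close>. The quantities \<open>uu n\<close> are invariant under scaling of the table, and
  each coefficient of the formal expansions is a power of \<open>w\<close> times a polynomial in them.\<close>

definition u1 :: psm where "u1 = v ^ 4 * d w"

text \<open>The closed form of \<open>uu n\<close> is the derivative of \<open>w\<close> of order
  \<open>n + 1\<close> divided by \<open>w ^ (3 * n + 4)\<close>. The weight grows by 3 with each
  derivative, because \<open>w ^ 3\<close> is the curvature and has the dimension of an inverse
  length.\<close>

primrec uu :: "nat \<Rightarrow> psm" where
  "uu 0 = u1"
| "uu (Suc n) = v ^ 3 * d (uu n) + of_nat (3 * n + 4) * uu n * u1"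

abbreviation "u2 \<equiv> uu 1"
abbreviation "u3 \<equiv> uu 2"
abbreviation "u4 \<equiv> uu 3"
abbreviation "u5 \<equiv> uu 4"
abbreviation "u6 \<equiv> uu 5"
abbreviation "u7 \<equiv> uu 6"

lemma wv_cancel: "v ^ n * (w ^ n * x) = x" "w ^ n * (v ^ n * x) = x"
proof -
  have wvn: "w ^ n * v ^ n = 1" by (simp add: wv flip: power_mult_distrib)
  have "v ^ n * (w ^ n * x) = (w ^ n * v ^ n) * x" "w ^ n * (v ^ n * x) = (w ^ n * v ^ n) * x"
    by (simp_all only: mult_ac)
  then show "v ^ n * (w ^ n * x) = x" "w ^ n * (v ^ n * x) = x" by (simp_all add: wvn)
qed

lemma dw: "d w = w ^ 4 * u1"
  by (simp add: u1_def wv_cancel)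

lemma duu: "d (uu n) = w ^ 3 * (uu (Suc n) - of_nat (3 * n + 4) * uu n * u1)"
  by (simp add: wv_cancel)

lemma du:
  "d u1 = w ^ 3 * (u2 - 4 * u1 * u1)" "d u2 = w ^ 3 * (u3 - 7 * u2 * u1)"
  "d u3 = w ^ 3 * (u4 - 10 * u3 * u1)" "d u4 = w ^ 3 * (u5 - 13 * u4 * u1)"
  "d u5 = w ^ 3 * (u6 - 16 * u5 * u1)" "d u6 = w ^ 3 * (u7 - 19 * u6 * u1)"
  using duu[of 0] duu[of 1] duu[of 2] duu[of 3] duu[of 4] duu[of 5]
  by (simp_all del: uu.simps(2) One_nat_def add: Suc_1 One_nat_def [symmetric])

lemma d_power: "d (x ^ numeral n) = numeral n * (x ^ pred_numeral n * d x)"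
proof -
  have "d (x ^ Suc m) = of_nat (Suc m) * (x ^ m * d x)" for m
    by (induction m) (simp_all add: d_simps algebra_simps)
  then show ?thesis by (metis numeral_eq_Suc of_nat_numeral)
qed

lemma tp0: "tp (w ^ 3) 0 = 1" and tq0: "tq (w ^ 3) 0 = 0"
  by simp_all

lemma tp_numeral:
  "tp (w ^ 3) (numeral n) = d (tp (w ^ 3) (pred_numeral n)) - w ^ 3 * tq (w ^ 3) (pred_numeral n)"
  "tq (w ^ 3) (numeral n) = d (tq (w ^ 3) (pred_numeral n)) + w ^ 3 * tp (w ^ 3) (pred_numeral n)"
  by (simp_all add: numeral_eq_Suc)

lemma tp_one:
  "tp (w ^ 3) 1 = d (tp (w ^ 3) 0) - w ^ 3 * tq (w ^ 3) 0"
  "tq (w ^ 3) 1 = d (tq (w ^ 3) 0) + w ^ 3 * tp (w ^ 3) 0"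
  by (simp_all del: tpq.simps(1))

lemma Yh_pow: "p ^ 2 = p * p" "p ^ 3 = p ^ 2 * p" "p ^ 5 = p ^ 3 * p ^ 2" "p ^ 7 = p ^ 5 * p ^ 2" "p ^ 9 = p ^ 7 * p ^ 2"
  for p :: "psm poly"
  by (simp_all add: power2_eq_square numeral_eq_Suc mult.assoc mult.commute mult.left_commute)

text \<open>Evaluating both sides at a point with these rules leaves a polynomial identity in the
  real values of \<open>w\<close> and of the invariants, which \<open>algebra\<close>
  decides.\<close>

lemmas algs = d_simps d_power du dw val_simps pred_numeral_simps arith_simps numeral_One One_nat_def [symmetric]
  power_one_right power_0 mult_1_left mult_1_right funpow_0

section \<open>Higher derivatives of the curve in its moving frame\<close>

lemma tp1:
  "tp (w ^ 3) 1 = 0"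
  by (rule val_eqI, subst tp_one) (simp only: tp0 tq0 algs; algebra)

lemma tq1:
  "tq (w ^ 3) 1 = w ^ 3 * (1 *\<^sub>R 1)"
  by (rule val_eqI, subst tp_one) (simp only: tp0 tq0 algs; algebra)

lemma tp2:
  "tp (w ^ 3) 2 = w ^ 6 * ((- 1) *\<^sub>R 1)"
  by (rule val_eqI, subst tp_numeral) (simp only: tp1 tq1 algs; algebra)

lemma tq2:
  "tq (w ^ 3) 2 = w ^ 6 * (3 *\<^sub>R u1)"
  by (rule val_eqI, subst tp_numeral) (simp only: tp1 tq1 algs; algebra)

lemma tp3:
  "tp (w ^ 3) 3 = w ^ 9 * ((- 9) *\<^sub>R u1)"
  by (rule val_eqI, subst tp_numeral) (simp only: tp2 tq2 algs; algebra)

lemma tq3: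
  "tq (w ^ 3) 3 = w ^ 9 * ((- 1) *\<^sub>R 1 + 3 *\<^sub>R u2 + 6 *\<^sub>R (u1 ^ 2))"
  by (rule val_eqI, subst tp_numeral) (simp only: tp2 tq2 algs; algebra)

lemma tp4:
  "tp (w ^ 3) 4 = w ^ 12 * (1 *\<^sub>R 1 + (- 12) *\<^sub>R u2 + (- 51) *\<^sub>R (u1 ^ 2))"
  by (rule val_eqI, subst tp_numeral) (simp only: tp3 tq3 algs; algebra)

lemma tq4:
  "tq (w ^ 3) 4 = w ^ 12 * ((- 18) *\<^sub>R u1 + 3 *\<^sub>R u3 + 18 *\<^sub>R (u1 * u2) + 6 *\<^sub>R (u1 ^ 3))"
  by (rule val_eqI, subst tp_numeral) (simp only: tp3 tq3 algs; algebra)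

lemma tp5:
  "tp (w ^ 3) 5 = w ^ 15 * (30 *\<^sub>R u1 + (- 15) *\<^sub>R u3 + (- 180) *\<^sub>R (u1 * u2) + (- 210) *\<^sub>R (u1 ^ 3))"
  by (rule val_eqI, subst tp_numeral) (simp only: tp4 tq4 algs; algebra)

lemma tq5:
  "tq (w ^ 3) 5 = w ^ 15 * (1 *\<^sub>R 1
    + (- 30) *\<^sub>R u2
    + (- 195) *\<^sub>R (u1 ^ 2)
    + 3 *\<^sub>R u4
    + 18 *\<^sub>R (u2 ^ 2)
    + 24 *\<^sub>R (u1 * u3)
    + 36 *\<^sub>R (u1 ^ 2 * u2))"
  by (rule val_eqI, subst tp_numeral) (simp only: tp4 tq4 algs; algebra)

lemma tp6:
  "tp (w ^ 3) 6 = w ^ 18 * ((- 1) *\<^sub>R 1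
    + 60 *\<^sub>R u2
    + 525 *\<^sub>R (u1 ^ 2)
    + (- 18) *\<^sub>R u4
    + (- 198) *\<^sub>R (u2 ^ 2)
    + (- 279) *\<^sub>R (u1 * u3)
    + (- 1386) *\<^sub>R (u1 ^ 2 * u2)
    + (- 630) *\<^sub>R (u1 ^ 4))"
  by (rule val_eqI, subst tp_numeral) (simp only: tp5 tq5 algs; algebra)

lemma tq6:
  "tq (w ^ 3) 6 = w ^ 18 * (45 *\<^sub>R u1
    + (- 45) *\<^sub>R u3
    + (- 810) *\<^sub>R (u1 * u2)
    + (- 1575) *\<^sub>R (u1 ^ 3)
    + 3 *\<^sub>R u5
    + 60 *\<^sub>R (u2 * u3)
    + 30 *\<^sub>R (u1 * u4)
    + 90 *\<^sub>R (u1 * u2 ^ 2)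
    + 60 *\<^sub>R (u1 ^ 2 * u3))"
  by (rule val_eqI, subst tp_numeral) (simp only: tp5 tq5 algs; algebra)

lemma tp7:
  "tp (w ^ 3) 7 = w ^ 21 * ((- 63) *\<^sub>R u1
    + 105 *\<^sub>R u3
    + 2520 *\<^sub>R (u1 * u2)
    + 6825 *\<^sub>R (u1 ^ 3)
    + (- 21) *\<^sub>R u5
    + (- 735) *\<^sub>R (u2 * u3)
    + (- 399) *\<^sub>R (u1 * u4)
    + (- 3654) *\<^sub>R (u1 * u2 ^ 2)
    + (- 2562) *\<^sub>R (u1 ^ 2 * u3)
    + (- 6678) *\<^sub>R (u1 ^ 3 * u2)
    + (- 1260) *\<^sub>R (u1 ^ 5))"
  by (rule val_eqI, subst tp_numeral) (simp only: tp6 tq6 algs; algebra)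

lemma tq7:
  "tq (w ^ 3) 7 = w ^ 21 * ((- 1) *\<^sub>R 1
    + 105 *\<^sub>R u2
    + 1155 *\<^sub>R (u1 ^ 2)
    + (- 63) *\<^sub>R u4
    + (- 1008) *\<^sub>R (u2 ^ 2)
    + (- 1449) *\<^sub>R (u1 * u3)
    + (- 11781) *\<^sub>R (u1 ^ 2 * u2)
    + (- 10080) *\<^sub>R (u1 ^ 4)
    + 3 *\<^sub>R u6
    + 60 *\<^sub>R (u3 ^ 2)
    + 90 *\<^sub>R (u2 * u4)
    + 90 *\<^sub>R (u2 ^ 3)
    + 36 *\<^sub>R (u1 * u5)
    + 360 *\<^sub>R (u1 * u2 * u3)
    + 90 *\<^sub>R (u1 ^ 2 * u4))"
  by (rule val_eqI, subst tp_numeral) (simp only: tp6 tq6 algs; algebra)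

lemma tp8:
  "tp (w ^ 3) 8 = w ^ 24 * (1 *\<^sub>R 1
    + (- 168) *\<^sub>R u2
    + (- 2226) *\<^sub>R (u1 ^ 2)
    + 168 *\<^sub>R u4
    + 3528 *\<^sub>R (u2 ^ 2)
    + 5124 *\<^sub>R (u1 * u3)
    + 57456 *\<^sub>R (u1 ^ 2 * u2)
    + 71505 *\<^sub>R (u1 ^ 4)
    + (- 24) *\<^sub>R u6
    + (- 795) *\<^sub>R (u3 ^ 2)
    + (- 1224) *\<^sub>R (u2 * u4)
    + (- 3744) *\<^sub>R (u2 ^ 3)
    + (- 540) *\<^sub>R (u1 * u5)
    + (- 15732) *\<^sub>R (u1 * u2 * u3)
    + (- 4248) *\<^sub>R (u1 ^ 2 * u4)
    + (- 30996) *\<^sub>R (u1 ^ 2 * u2 ^ 2)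
    + (- 14364) *\<^sub>R (u1 ^ 3 * u3)
    + (- 19656) *\<^sub>R (u1 ^ 4 * u2)
    + (- 1260) *\<^sub>R (u1 ^ 6))"
  by (rule val_eqI, subst tp_numeral) (simp only: tp7 tq7 algs; algebra)

text \<open>The explicit coefficients of \<open>S\<close>, \<open>G\<close> and \<open>Y\<close> were found with computer algebra, by solving for one
  order after the other. Here \<open>1 + S1 t + S2 t^2 + ...\<close> is the ratio of chord to arc for an arc of
  length \<open>\<delta>\<close> with \<open>t = \<delta>^2\<close>, and \<open>Y\<close> is \<open>\<delta> / \<epsilon>\<close> at the minimum of the gap.\<close>

definition S1 :: psm where
  "S1 = w ^ 6 * ((- (1 / 24)) *\<^sub>R 1)"

definition S2 :: psm where
  "S2 = w ^ 12 * ((1 / 1920) *\<^sub>R 1 + (- (1 / 160)) *\<^sub>R u2 + (- (3 / 160)) *\<^sub>R (u1 ^ 2))"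

definition S3 :: psm where
  "S3 = w ^ 18 * ((- (1 / 322560)) *\<^sub>R 1
    + (1 / 5376) *\<^sub>R u2
    + (1 / 1280) *\<^sub>R (u1 ^ 2)
    + (- (1 / 17920)) *\<^sub>R u4
    + (- (11 / 17920)) *\<^sub>R (u2 ^ 2)
    + (- (3 / 4480)) *\<^sub>R (u1 * u3)
    + (- (1 / 320)) *\<^sub>R (u1 ^ 2 * u2)
    + (- (1 / 640)) *\<^sub>R (u1 ^ 4))"

definition S4 :: psm where
  "S4 = w ^ 24 * ((1 / 92897280) *\<^sub>R 1
    + (- (1 / 552960)) *\<^sub>R u2
    + (- (37 / 19353600)) *\<^sub>R (u1 ^ 2)
    + (1 / 552960) *\<^sub>R u4
    + (7 / 184320) *\<^sub>R (u2 ^ 2)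
    + (151 / 4838400) *\<^sub>R (u1 * u3)
    + (169 / 537600) *\<^sub>R (u1 ^ 2 * u2)
    + (149 / 460800) *\<^sub>R (u1 ^ 4)
    + (- (1 / 3870720)) *\<^sub>R u6
    + (- (71 / 9676800)) *\<^sub>R (u3 ^ 2)
    + (- (17 / 1290240)) *\<^sub>R (u2 * u4)
    + (- (13 / 322560)) *\<^sub>R (u2 ^ 3)
    + (- (1 / 215040)) *\<^sub>R (u1 * u5)
    + (- (53 / 403200)) *\<^sub>R (u1 * u2 * u3)
    + (- (11 / 322560)) *\<^sub>R (u1 ^ 2 * u4)
    + (- (137 / 537600)) *\<^sub>R (u1 ^ 2 * u2 ^ 2)
    + (- (17 / 134400)) *\<^sub>R (u1 ^ 3 * u3)
    + (- (7 / 38400)) *\<^sub>R (u1 ^ 4 * u2)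
    + (- (1 / 115200)) *\<^sub>R (u1 ^ 6))"

definition G0 :: psm where
  "G0 = w ^ 2 * ((1 / 2) *\<^sub>R 1)"

definition G1 :: psm where
  "G1 = w ^ 4 * ((- (1 / 120)) *\<^sub>R 1 + (- (1 / 15)) *\<^sub>R u2 + (2 / 15) *\<^sub>R (u1 ^ 2))"

definition G2 :: psm where
  "G2 = w ^ 6 * ((- (1 / 2800)) *\<^sub>R 1
    + (- (13 / 3150)) *\<^sub>R u2
    + (- (1 / 225)) *\<^sub>R (u1 ^ 2)
    + (2 / 315) *\<^sub>R u4
    + (- (23 / 350)) *\<^sub>R (u2 ^ 2)
    + (- (32 / 315)) *\<^sub>R (u1 * u3)
    + (18 / 25) *\<^sub>R (u1 ^ 2 * u2)
    + (- (18 / 25)) *\<^sub>R (u1 ^ 4))"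

definition G3 :: psm where
  "G3 = w ^ 8 * ((- (281 / 9072000)) *\<^sub>R 1
    + (- (31 / 63000)) *\<^sub>R u2
    + (- (187 / 94500)) *\<^sub>R (u1 ^ 2)
    + (4 / 4725) *\<^sub>R u4
    + (- (169 / 31500)) *\<^sub>R (u2 ^ 2)
    + (- (37 / 4725)) *\<^sub>R (u1 * u3)
    + (712 / 23625) *\<^sub>R (u1 ^ 2 * u2)
    + (- (41 / 3375)) *\<^sub>R (u1 ^ 4)
    + (- (1 / 1575)) *\<^sub>R u6
    + (8 / 315) *\<^sub>R (u3 ^ 2)
    + (8 / 189) *\<^sub>R (u2 * u4)
    + (- (17054 / 70875)) *\<^sub>R (u2 ^ 3)
    + (4 / 175) *\<^sub>R (u1 * u5)
    + (- (1072 / 945)) *\<^sub>R (u1 * u2 * u3)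
    + (- (10 / 27)) *\<^sub>R (u1 ^ 2 * u4)
    + (154708 / 23625) *\<^sub>R (u1 ^ 2 * u2 ^ 2)
    + (3296 / 945) *\<^sub>R (u1 ^ 3 * u3)
    + (- (70688 / 3375)) *\<^sub>R (u1 ^ 4 * u2)
    + (141376 / 10125) *\<^sub>R (u1 ^ 6))"

text \<open>The common factor k^(-2/3), that is \<open>v ^ 2\<close>, is split off from the
  coefficients of \<delta> / \<epsilon> and restored in \<open>Yp\<close>; so only nonnegative
  powers of \<open>w\<close> occur in the tables below.\<close>

definition Y0 :: psm where
  "Y0 = (2 *\<^sub>R 1)"

definition Y1 :: psm where
  "Y1 = w ^ 2 * ((1 / 15) *\<^sub>R 1 + (- (2 / 15)) *\<^sub>R u2 + (- (26 / 15)) *\<^sub>R (u1 ^ 2))"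

definition Y2 :: psm where
  "Y2 = w ^ 4 * ((41 / 6300) *\<^sub>R 1
    + (64 / 1575) *\<^sub>R u2
    + (2 / 75) *\<^sub>R (u1 ^ 2)
    + (- (13 / 630)) *\<^sub>R u4
    + (517 / 3150) *\<^sub>R (u2 ^ 2)
    + (62 / 315) *\<^sub>R (u1 * u3)
    + (- (572 / 225)) *\<^sub>R (u1 ^ 2 * u2)
    + (1742 / 225) *\<^sub>R (u1 ^ 4))"

definition Y3 :: psm where
  "Y3 = w ^ 6 * ((97 / 113400) *\<^sub>R 1
    + (233 / 18900) *\<^sub>R u2
    + (67 / 1260) *\<^sub>R (u1 ^ 2)
    + (- (2 / 675)) *\<^sub>R u4
    + (166 / 4725) *\<^sub>R (u2 ^ 2)
    + (422 / 4725) *\<^sub>R (u1 * u3)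
    + (- (502 / 945)) *\<^sub>R (u1 ^ 2 * u2)
    + (2 / 15) *\<^sub>R (u1 ^ 4)
    + (1 / 900) *\<^sub>R u6
    + (- (173 / 3150)) *\<^sub>R (u3 ^ 2)
    + (- (1549 / 18900)) *\<^sub>R (u2 * u4)
    + (1364 / 2835) *\<^sub>R (u2 ^ 3)
    + (- (191 / 3150)) *\<^sub>R (u1 * u5)
    + (13432 / 4725) *\<^sub>R (u1 * u2 * u3)
    + (5552 / 4725) *\<^sub>R (u1 ^ 2 * u4)
    + (- (91544 / 4725)) *\<^sub>R (u1 ^ 2 * u2 ^ 2)
    + (- (11224 / 945)) *\<^sub>R (u1 ^ 3 * u3)
    + (57064 / 675) *\<^sub>R (u1 ^ 4 * u2)
    + (- (170288 / 2025)) *\<^sub>R (u1 ^ 6))"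

section \<open>Derivatives of the coefficients of \<open>G\<close>\<close>

lemma dG0_1:
  "(d ^^ 1) G0 = w ^ 5 * (1 *\<^sub>R u1)"
  by (rule val_eqI, subst funpow_one) (simp only: G0_def algs; algebra)

lemma dG0_2:
  "(d ^^ 2) G0 = w ^ 8 * (1 *\<^sub>R u2 + 1 *\<^sub>R (u1 ^ 2))"
  by (rule val_eqI, subst funpow_numeral) (simp only: dG0_1 algs; algebra)

lemma dG0_3:
  "(d ^^ 3) G0 = w ^ 11 * (1 *\<^sub>R u3 + 3 *\<^sub>R (u1 * u2))"
  by (rule val_eqI, subst funpow_numeral) (simp only: dG0_2 algs; algebra)

lemma dG0_4:
  "(d ^^ 4) G0 = w ^ 14 * (1 *\<^sub>R u4 + 3 *\<^sub>R (u2 ^ 2) + 4 *\<^sub>R (u1 * u3))"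
  by (rule val_eqI, subst funpow_numeral) (simp only: dG0_3 algs; algebra)

lemma dG0_5:
  "(d ^^ 5) G0 = w ^ 17 * (1 *\<^sub>R u5 + 10 *\<^sub>R (u2 * u3) + 5 *\<^sub>R (u1 * u4))"
  by (rule val_eqI, subst funpow_numeral) (simp only: dG0_4 algs; algebra)

lemma dG0_6:
  "(d ^^ 6) G0 = w ^ 20 * (1 *\<^sub>R u6 + 10 *\<^sub>R (u3 ^ 2) + 15 *\<^sub>R (u2 * u4) + 6 *\<^sub>R (u1 * u5))"
  by (rule val_eqI, subst funpow_numeral) (simp only: dG0_5 algs; algebra)

lemma dG1_1:
  "(d ^^ 1) G1 = w ^ 7 * ((- (1 / 30)) *\<^sub>R u1 + (- (1 / 15)) *\<^sub>R u3 + (7 / 15) *\<^sub>R (u1 * u2) + (- (8 / 15)) *\<^sub>R (u1 ^ 3))"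
  by (rule val_eqI, subst funpow_one) (simp only: G1_def algs; algebra)

lemma dG1_2:
  "(d ^^ 2) G1 = w ^ 10 * ((- (1 / 30)) *\<^sub>R u2
    + (- (1 / 10)) *\<^sub>R (u1 ^ 2)
    + (- (1 / 15)) *\<^sub>R u4
    + (7 / 15) *\<^sub>R (u2 ^ 2)
    + (2 / 3) *\<^sub>R (u1 * u3)
    + (- (52 / 15)) *\<^sub>R (u1 ^ 2 * u2)
    + (8 / 3) *\<^sub>R (u1 ^ 4))"
  by (rule val_eqI, subst funpow_numeral) (simp only: dG1_1 algs; algebra)

lemma dG1_3:
  "(d ^^ 3) G1 = w ^ 13 * ((- (1 / 30)) *\<^sub>R u3
    + (- (3 / 10)) *\<^sub>R (u1 * u2)
    + (- (1 / 5)) *\<^sub>R (u1 ^ 3)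
    + (- (1 / 15)) *\<^sub>R u5
    + (8 / 5) *\<^sub>R (u2 * u3)
    + (13 / 15) *\<^sub>R (u1 * u4)
    + (- (44 / 5)) *\<^sub>R (u1 * u2 ^ 2)
    + (- (92 / 15)) *\<^sub>R (u1 ^ 2 * u3)
    + 28 *\<^sub>R (u1 ^ 3 * u2)
    + (- 16) *\<^sub>R (u1 ^ 5))"
  by (rule val_eqI, subst funpow_numeral) (simp only: dG1_2 algs; algebra)

lemma dG1_4:
  "(d ^^ 4) G1 = w ^ 16 * ((- (1 / 30)) *\<^sub>R u4
    + (- (3 / 10)) *\<^sub>R (u2 ^ 2)
    + (- (2 / 5)) *\<^sub>R (u1 * u3)
    + (- (6 / 5)) *\<^sub>R (u1 ^ 2 * u2)
    + (- (1 / 5)) *\<^sub>R (u1 ^ 4)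
    + (- (1 / 15)) *\<^sub>R u6
    + (8 / 5) *\<^sub>R (u3 ^ 2)
    + (37 / 15) *\<^sub>R (u2 * u4)
    + (- (44 / 5)) *\<^sub>R (u2 ^ 3)
    + (16 / 15) *\<^sub>R (u1 * u5)
    + (- (544 / 15)) *\<^sub>R (u1 * u2 * u3)
    + (- (48 / 5)) *\<^sub>R (u1 ^ 2 * u4)
    + 128 *\<^sub>R (u1 ^ 2 * u2 ^ 2)
    + (176 / 3) *\<^sub>R (u1 ^ 3 * u3)
    + (- 248) *\<^sub>R (u1 ^ 4 * u2)
    + 112 *\<^sub>R (u1 ^ 6))"
  by (rule val_eqI, subst funpow_numeral) (simp only: dG1_3 algs; algebra)

lemma dG2_1:
  "(d ^^ 1) G2 = w ^ 9 * ((- (3 / 1400)) *\<^sub>R u1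
    + (- (13 / 3150)) *\<^sub>R u3
    + (- (1 / 210)) *\<^sub>R (u1 * u2)
    + (2 / 225) *\<^sub>R (u1 ^ 3)
    + (2 / 315) *\<^sub>R u5
    + (- (367 / 1575)) *\<^sub>R (u2 * u3)
    + (- (46 / 315)) *\<^sub>R (u1 * u4)
    + (344 / 175) *\<^sub>R (u1 * u2 ^ 2)
    + (2414 / 1575) *\<^sub>R (u1 ^ 2 * u3)
    + (- (234 / 25)) *\<^sub>R (u1 ^ 3 * u2)
    + (36 / 5) *\<^sub>R (u1 ^ 5))"
  by (rule val_eqI, subst funpow_one) (simp only: G2_def algs; algebra)

lemma dG2_2:
  "(d ^^ 2) G2 = w ^ 12 * ((- (3 / 1400)) *\<^sub>R u2
    + (- (3 / 280)) *\<^sub>R (u1 ^ 2)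
    + (- (13 / 3150)) *\<^sub>R u4
    + (- (1 / 210)) *\<^sub>R (u2 ^ 2)
    + (- (1 / 1575)) *\<^sub>R (u1 * u3)
    + (19 / 525) *\<^sub>R (u1 ^ 2 * u2)
    + (- (2 / 75)) *\<^sub>R (u1 ^ 4)
    + (2 / 315) *\<^sub>R u6
    + (- (367 / 1575)) *\<^sub>R (u3 ^ 2)
    + (- (199 / 525)) *\<^sub>R (u2 * u4)
    + (344 / 175) *\<^sub>R (u2 ^ 3)
    + (- (4 / 21)) *\<^sub>R (u1 * u5)
    + (4652 / 525) *\<^sub>R (u1 * u2 * u3)
    + (1418 / 525) *\<^sub>R (u1 ^ 2 * u4)
    + (- (1602 / 35)) *\<^sub>R (u1 ^ 2 * u2 ^ 2)
    + (- (4052 / 175)) *\<^sub>R (u1 ^ 3 * u3)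
    + (648 / 5) *\<^sub>R (u1 ^ 4 * u2)
    + (- (396 / 5)) *\<^sub>R (u1 ^ 6))"
  by (rule val_eqI, subst funpow_numeral) (simp only: dG2_1 algs; algebra)

section \<open>Powers of the series for the optimal arc length\<close>

definition Yh :: "psm poly" where "Yh = [:Y0, Y1, Y2, Y3:]"

lemma Yh1: "coeff Yh 0 = Y0" "coeff Yh 1 = Y1" "coeff Yh 2 = Y2" "coeff Yh 3 = Y3"
  by (simp_all add: Yh_def coeff_pCons_numeral)

lemma Yh2_0:
  "coeff (Yh ^ 2) 0 = (4 *\<^sub>R 1)"
  by (rule val_eqI, subst Yh_pow(1)) (simp only: coeff_mult_low Yh1 Y0_def Yh1 Y0_def algs; algebra)

lemma Yh2_1:
  "coeff (Yh ^ 2) 1 = w ^ 2 * ((4 / 15) *\<^sub>R 1 + (- (8 / 15)) *\<^sub>R u2 + (- (104 / 15)) *\<^sub>R (u1 ^ 2))"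
  by (rule val_eqI, subst Yh_pow(1)) (simp only: coeff_mult_low Yh1 Y0_def Yh1 Y1_def Yh1 Y0_def Yh1 Y1_def algs; algebra)

lemma Yh2_2:
  "coeff (Yh ^ 2) 2 = w ^ 4 * ((16 / 525) *\<^sub>R 1
    + (76 / 525) *\<^sub>R u2
    + (- (28 / 225)) *\<^sub>R (u1 ^ 2)
    + (- (26 / 315)) *\<^sub>R u4
    + (118 / 175) *\<^sub>R (u2 ^ 2)
    + (248 / 315) *\<^sub>R (u1 * u3)
    + (- (728 / 75)) *\<^sub>R (u1 ^ 2 * u2)
    + (2548 / 75) *\<^sub>R (u1 ^ 4))"
  by (rule val_eqI, subst Yh_pow(1)) (simp only: coeff_mult_low Yh1 Y0_def Yh1 Y1_def Yh1 Y2_def Yh1 Y0_def Yh1 Y1_def Yh1 Y2_def algs; algebra)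

lemma Yh2_3:
  "coeff (Yh ^ 2) 3 = w ^ 6 * ((304 / 70875) *\<^sub>R 1
    + (1252 / 23625) *\<^sub>R u2
    + (4576 / 23625) *\<^sub>R (u1 ^ 2)
    + (- (23 / 1575)) *\<^sub>R u4
    + (3581 / 23625) *\<^sub>R (u2 ^ 2)
    + (604 / 1575) *\<^sub>R (u1 * u3)
    + (- (6856 / 2625)) *\<^sub>R (u1 ^ 2 * u2)
    + (4972 / 3375) *\<^sub>R (u1 ^ 4)
    + (1 / 225) *\<^sub>R u6
    + (- (346 / 1575)) *\<^sub>R (u3 ^ 2)
    + (- (1523 / 4725)) *\<^sub>R (u2 * u4)
    + (133298 / 70875) *\<^sub>R (u2 ^ 3)
    + (- (382 / 1575)) *\<^sub>R (u1 * u5)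
    + (1528 / 135) *\<^sub>R (u1 * u2 * u3)
    + (22546 / 4725) *\<^sub>R (u1 ^ 2 * u4)
    + (- (1828306 / 23625)) *\<^sub>R (u1 ^ 2 * u2 ^ 2)
    + (- (227704 / 4725)) *\<^sub>R (u1 ^ 3 * u3)
    + (1164056 / 3375) *\<^sub>R (u1 ^ 4 * u2)
    + (- (3677512 / 10125)) *\<^sub>R (u1 ^ 6))"
  by (rule val_eqI, subst Yh_pow(1)) (simp only: coeff_mult_low Yh1 Y0_def Yh1 Y1_def Yh1 Y2_def Yh1 Y3_def Yh1 Y0_def Yh1 Y1_def Yh1 Y2_def Yh1 Y3_def algs; algebra)

lemma Yh3_0:
  "coeff (Yh ^ 3) 0 = (8 *\<^sub>R 1)"
  by (rule val_eqI, subst Yh_pow(2)) (simp only: coeff_mult_low Yh2_0 Yh1 Y0_def algs; algebra)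

lemma Yh3_1:
  "coeff (Yh ^ 3) 1 = w ^ 2 * ((4 / 5) *\<^sub>R 1 + (- (8 / 5)) *\<^sub>R u2 + (- (104 / 5)) *\<^sub>R (u1 ^ 2))"
  by (rule val_eqI, subst Yh_pow(2)) (simp only: coeff_mult_low Yh2_0 Yh2_1 Yh1 Y0_def Yh1 Y1_def algs; algebra)

lemma Yh3_2:
  "coeff (Yh ^ 3) 2 = w ^ 4 * ((11 / 105) *\<^sub>R 1
    + (8 / 21) *\<^sub>R u2
    + (- (16 / 15)) *\<^sub>R (u1 ^ 2)
    + (- (26 / 105)) *\<^sub>R u4
    + (218 / 105) *\<^sub>R (u2 ^ 2)
    + (248 / 105) *\<^sub>R (u1 * u3)
    + (- (416 / 15)) *\<^sub>R (u1 ^ 2 * u2)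
    + (1664 / 15) *\<^sub>R (u1 ^ 4))"
  by (rule val_eqI, subst Yh_pow(2)) (simp only: coeff_mult_low Yh2_0 Yh2_1 Yh2_2 Yh1 Y0_def Yh1 Y1_def Yh1 Y2_def algs; algebra)

lemma Yh3_3:
  "coeff (Yh ^ 3) 3 = w ^ 6 * ((149 / 9450) *\<^sub>R 1
    + (53 / 315) *\<^sub>R u2
    + (263 / 525) *\<^sub>R (u1 ^ 2)
    + (- (82 / 1575)) *\<^sub>R u4
    + (86 / 175) *\<^sub>R (u2 ^ 2)
    + (1936 / 1575) *\<^sub>R (u1 * u3)
    + (- (4832 / 525)) *\<^sub>R (u1 ^ 2 * u2)
    + (196 / 25) *\<^sub>R (u1 ^ 4)
    + (1 / 75) *\<^sub>R u6
    + (- (346 / 525)) *\<^sub>R (u3 ^ 2)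
    + (- (499 / 525)) *\<^sub>R (u2 * u4)
    + (964 / 175) *\<^sub>R (u2 ^ 3)
    + (- (382 / 525)) *\<^sub>R (u1 * u5)
    + (17744 / 525) *\<^sub>R (u1 * u2 * u3)
    + (7628 / 525) *\<^sub>R (u1 ^ 2 * u4)
    + (- (40588 / 175)) *\<^sub>R (u1 ^ 2 * u2 ^ 2)
    + (- (76976 / 525)) *\<^sub>R (u1 ^ 3 * u3)
    + (26344 / 25) *\<^sub>R (u1 ^ 4 * u2)
    + (- (29384 / 25)) *\<^sub>R (u1 ^ 6))"
  by (rule val_eqI, subst Yh_pow(2)) (simp only: coeff_mult_low Yh2_0 Yh2_1 Yh2_2 Yh2_3 Yh1 Y0_def Yh1 Y1_def Yh1 Y2_def Yh1 Y3_def algs; algebra)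

text \<open>\<open>Yh ^ (2 * i + 3)\<close> enters \<open>Phi\<close> with the i-th power of the
  variable, so a total order 3 requires its coefficients up to degree \<open>3 - i\<close>
  only.\<close>

lemma Yh5_0:
  "coeff (Yh ^ 5) 0 = (32 *\<^sub>R 1)"
  by (rule val_eqI, subst Yh_pow(3)) (simp only: coeff_mult_low Yh3_0 Yh2_0 algs; algebra)

lemma Yh5_1:
  "coeff (Yh ^ 5) 1 = w ^ 2 * ((16 / 3) *\<^sub>R 1 + (- (32 / 3)) *\<^sub>R u2 + (- (416 / 3)) *\<^sub>R (u1 ^ 2))"
  by (rule val_eqI, subst Yh_pow(3)) (simp only: coeff_mult_low Yh3_0 Yh3_1 Yh2_0 Yh2_1 algs; algebra)

lemma Yh5_2:
  "coeff (Yh ^ 5) 2 = w ^ 4 * ((92 / 105) *\<^sub>R 1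
    + (64 / 35) *\<^sub>R u2
    + (- (736 / 45)) *\<^sub>R (u1 ^ 2)
    + (- (104 / 63)) *\<^sub>R u4
    + (1528 / 105) *\<^sub>R (u2 ^ 2)
    + (992 / 63) *\<^sub>R (u1 * u3)
    + (- (832 / 5)) *\<^sub>R (u1 ^ 2 * u2)
    + (12896 / 15) *\<^sub>R (u1 ^ 4))"
  by (rule val_eqI, subst Yh_pow(3)) (simp only: coeff_mult_low Yh3_0 Yh3_1 Yh3_2 Yh2_0 Yh2_1 Yh2_2 algs; algebra)

lemma Yh7_0:
  "coeff (Yh ^ 7) 0 = (128 *\<^sub>R 1)"
  by (rule val_eqI, subst Yh_pow(4)) (simp only: coeff_mult_low Yh5_0 Yh2_0 algs; algebra)

lemma Yh7_1:
  "coeff (Yh ^ 7) 1 = w ^ 2 * ((448 / 15) *\<^sub>R 1 + (- (896 / 15)) *\<^sub>R u2 + (- (11648 / 15)) *\<^sub>R (u1 ^ 2))"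
  by (rule val_eqI, subst Yh_pow(4)) (simp only: coeff_mult_low Yh5_0 Yh5_1 Yh2_0 Yh2_1 algs; algebra)

lemma Yh9_0:
  "coeff (Yh ^ 9) 0 = (512 *\<^sub>R 1)"
  by (rule val_eqI, subst Yh_pow(5)) (simp only: coeff_mult_low Yh7_0 Yh2_0 algs; algebra)

section \<open>The two kinds of summands of \<open>Phi\<close>, degree by degree\<close>

lemma A1_0_0:
  "- S1 * coeff (Yh ^ 3) 0 = w ^ 6 * (((1 / 3) *\<^sub>R 1))"
  by (rule val_eqI) (simp only: S1_def Yh3_0 algs; algebra)

text \<open>In these names the first index is the summand \<open>i\<close> of \<open>Phi\<close> and
  the second the degree. \<open>A1\<close> belongs to the deficit of the chord, \<open>A2\<close> to
  the integral of the density.\<close>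

lemma A2_0_0:
  "coeff Yh 0 * G0 = w ^ 2 * ((1 *\<^sub>R 1))"
  by (rule val_eqI) (simp only: Yh1 Y0_def G0_def algs; algebra)

lemma A1_0_1:
  "- S1 * coeff (Yh ^ 3) 1 = w ^ 6 * (w ^ 2 * ((1 / 30) *\<^sub>R 1 + (- (1 / 15)) *\<^sub>R u2 + (- (13 / 15)) *\<^sub>R (u1 ^ 2)))"
  by (rule val_eqI) (simp only: S1_def Yh3_1 algs; algebra)

lemma A2_0_1:
  "coeff Yh 0 * G1 + coeff Yh 1 * G0 = w ^ 2 * (w ^ 2 * ((1 / 60) *\<^sub>R 1 + (- (1 / 5)) *\<^sub>R u2 + (- (3 / 5)) *\<^sub>R (u1 ^ 2)))"
  by (rule val_eqI) (simp only: Yh1 Y0_def G1_def Yh1 Y1_def G0_def algs; algebra)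

lemma A1_0_2:
  "- S1 * coeff (Yh ^ 3) 2 = w ^ 6 * (w ^ 4 * ((11 / 2520) *\<^sub>R 1
    + (1 / 63) *\<^sub>R u2
    + (- (2 / 45)) *\<^sub>R (u1 ^ 2)
    + (- (13 / 1260)) *\<^sub>R u4
    + (109 / 1260) *\<^sub>R (u2 ^ 2)
    + (31 / 315) *\<^sub>R (u1 * u3)
    + (- (52 / 45)) *\<^sub>R (u1 ^ 2 * u2)
    + (208 / 45) *\<^sub>R (u1 ^ 4)))"
  by (rule val_eqI) (simp only: S1_def Yh3_2 algs; algebra)

lemma A2_0_2:
  "coeff Yh 0 * G2 + coeff Yh 1 * G1 + coeff Yh 2 * G0 = w ^ 2 * (w ^ 4 * ((1 / 504) *\<^sub>R 1
    + (11 / 1260) *\<^sub>R u2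
    + (1 / 36) *\<^sub>R (u1 ^ 2)
    + (1 / 420) *\<^sub>R u4
    + (- (17 / 420)) *\<^sub>R (u2 ^ 2)
    + (- (11 / 105)) *\<^sub>R (u1 * u3)
    + (4 / 15) *\<^sub>R (u1 ^ 2 * u2)
    + (11 / 5) *\<^sub>R (u1 ^ 4)))"
  by (rule val_eqI) (simp only: Yh1 Y0_def G2_def Yh1 Y1_def G1_def Yh1 Y2_def G0_def algs; algebra)

lemma A1_0_3:
  "- S1 * coeff (Yh ^ 3) 3 = w ^ 6 * (w ^ 6 * ((149 / 226800) *\<^sub>R 1
    + (53 / 7560) *\<^sub>R u2
    + (263 / 12600) *\<^sub>R (u1 ^ 2)
    + (- (41 / 18900)) *\<^sub>R u4
    + (43 / 2100) *\<^sub>R (u2 ^ 2)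
    + (242 / 4725) *\<^sub>R (u1 * u3)
    + (- (604 / 1575)) *\<^sub>R (u1 ^ 2 * u2)
    + (49 / 150) *\<^sub>R (u1 ^ 4)
    + (1 / 1800) *\<^sub>R u6
    + (- (173 / 6300)) *\<^sub>R (u3 ^ 2)
    + (- (499 / 12600)) *\<^sub>R (u2 * u4)
    + (241 / 1050) *\<^sub>R (u2 ^ 3)
    + (- (191 / 6300)) *\<^sub>R (u1 * u5)
    + (2218 / 1575) *\<^sub>R (u1 * u2 * u3)
    + (1907 / 3150) *\<^sub>R (u1 ^ 2 * u4)
    + (- (10147 / 1050)) *\<^sub>R (u1 ^ 2 * u2 ^ 2)
    + (- (9622 / 1575)) *\<^sub>R (u1 ^ 3 * u3)
    + (3293 / 75) *\<^sub>R (u1 ^ 4 * u2)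
    + (- (3673 / 75)) *\<^sub>R (u1 ^ 6)))"
  by (rule val_eqI) (simp only: S1_def Yh3_3 algs; algebra)

lemma A2_0_3:
  "coeff Yh 0 * G3 + coeff Yh 1 * G2 + coeff Yh 2 * G1 + coeff Yh 3 * G0 = w ^ 2 * (w ^ 6 * ((29 / 100800) *\<^sub>R 1
    + (79 / 18900) *\<^sub>R u2
    + (223 / 9450) *\<^sub>R (u1 ^ 2)
    + (61 / 75600) *\<^sub>R u4
    + (- (3 / 2800)) *\<^sub>R (u2 ^ 2)
    + (389 / 18900) *\<^sub>R (u1 * u3)
    + (- (131 / 1050)) *\<^sub>R (u1 ^ 2 * u2)
    + (- (53 / 900)) *\<^sub>R (u1 ^ 4)
    + (- (1 / 1400)) *\<^sub>R u6
    + (7 / 300) *\<^sub>R (u3 ^ 2)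
    + (557 / 12600) *\<^sub>R (u2 * u4)
    + (- (17 / 70)) *\<^sub>R (u2 ^ 3)
    + (97 / 6300) *\<^sub>R (u1 * u5)
    + (- (1334 / 1575)) *\<^sub>R (u1 * u2 * u3)
    + (- (263 / 1575)) *\<^sub>R (u1 ^ 2 * u4)
    + (76 / 21) *\<^sub>R (u1 ^ 2 * u2 ^ 2)
    + (1952 / 1575) *\<^sub>R (u1 ^ 3 * u3)
    + (- (122 / 75)) *\<^sub>R (u1 ^ 4 * u2)
    + (- (296 / 25)) *\<^sub>R (u1 ^ 6)))"
  by (rule val_eqI) (simp only: Yh1 Y0_def G3_def Yh1 Y1_def G2_def Yh1 Y2_def G1_def Yh1 Y3_def G0_def algs; algebra)

lemma A1_1_0:
  "- S2 * coeff (Yh ^ 5) 0 = w ^ 10 * (w ^ 2 * ((- (1 / 60)) *\<^sub>R 1 + (1 / 5) *\<^sub>R u2 + (3 / 5) *\<^sub>R (u1 ^ 2)))"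
  by (rule val_eqI) (simp only: S2_def Yh5_0 algs; algebra)

lemma A2_1_0:
  "coeff (Yh ^ 3) 0 * (d ^^ 2) G0 = w ^ 6 * (w ^ 2 * (8 *\<^sub>R u2 + 8 *\<^sub>R (u1 ^ 2)))"
  by (rule val_eqI) (simp only: Yh3_0 dG0_2 algs; algebra)

lemma A1_1_1:
  "- S2 * coeff (Yh ^ 5) 1 = w ^ 10 * (w ^ 4 * ((- (1 / 360)) *\<^sub>R 1
    + (7 / 180) *\<^sub>R u2
    + (31 / 180) *\<^sub>R (u1 ^ 2)
    + (- (1 / 15)) *\<^sub>R (u2 ^ 2)
    + (- (16 / 15)) *\<^sub>R (u1 ^ 2 * u2)
    + (- (13 / 5)) *\<^sub>R (u1 ^ 4)))"
  by (rule val_eqI) (simp only: S2_def Yh5_1 algs; algebra)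

lemma A2_1_1:
  "coeff (Yh ^ 3) 0 * (d ^^ 2) G1 + coeff (Yh ^ 3) 1 * (d ^^ 2) G0 = w ^ 6 * (w ^ 4 * ((8 / 15) *\<^sub>R u2
    + (- (8 / 15)) *\<^sub>R u4
    + (32 / 15) *\<^sub>R (u2 ^ 2)
    + (16 / 3) *\<^sub>R (u1 * u3)
    + (- (752 / 15)) *\<^sub>R (u1 ^ 2 * u2)
    + (8 / 15) *\<^sub>R (u1 ^ 4)))"
  by (rule val_eqI) (simp only: Yh3_0 dG1_2 Yh3_1 dG0_2 algs; algebra)

lemma A1_1_2:
  "- S2 * coeff (Yh ^ 5) 2 = w ^ 10 * (w ^ 6 * ((- (23 / 50400)) *\<^sub>R 1
    + (19 / 4200) *\<^sub>R u2
    + (943 / 37800) *\<^sub>R (u1 ^ 2)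
    + (13 / 15120) *\<^sub>R u4
    + (97 / 25200) *\<^sub>R (u2 ^ 2)
    + (- (31 / 3780)) *\<^sub>R (u1 * u3)
    + (59 / 3150) *\<^sub>R (u1 ^ 2 * u2)
    + (- (679 / 900)) *\<^sub>R (u1 ^ 4)
    + (- (13 / 1260)) *\<^sub>R (u2 * u4)
    + (191 / 2100) *\<^sub>R (u2 ^ 3)
    + (31 / 315) *\<^sub>R (u1 * u2 * u3)
    + (- (13 / 420)) *\<^sub>R (u1 ^ 2 * u4)
    + (- (537 / 700)) *\<^sub>R (u1 ^ 2 * u2 ^ 2)
    + (31 / 105) *\<^sub>R (u1 ^ 3 * u3)
    + (169 / 75) *\<^sub>R (u1 ^ 4 * u2)
    + (403 / 25) *\<^sub>R (u1 ^ 6)))"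
  by (rule val_eqI) (simp only: S2_def Yh5_2 algs; algebra)

lemma A2_1_2:
  "coeff (Yh ^ 3) 0 * (d ^^ 2) G2 + coeff (Yh ^ 3) 1 * (d ^^ 2) G1 + coeff (Yh ^ 3) 2 * (d ^^ 2) G0 = w ^ 6 * (w ^ 6 * ((32 / 525) *\<^sub>R u2
    + (- (32 / 525)) *\<^sub>R (u1 ^ 2)
    + (- (136 / 1575)) *\<^sub>R u4
    + (404 / 525) *\<^sub>R (u2 ^ 2)
    + (832 / 1575) *\<^sub>R (u1 * u3)
    + (- (1216 / 525)) *\<^sub>R (u1 ^ 2 * u2)
    + (44 / 15) *\<^sub>R (u1 ^ 4)
    + (16 / 315) *\<^sub>R u6
    + (- (2936 / 1575)) *\<^sub>R (u3 ^ 2)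
    + (- (238 / 75)) *\<^sub>R (u2 * u4)
    + (8954 / 525) *\<^sub>R (u2 ^ 3)
    + (- (32 / 21)) *\<^sub>R (u1 * u5)
    + (12632 / 175) *\<^sub>R (u1 * u2 * u3)
    + (1706 / 75) *\<^sub>R (u1 ^ 2 * u4)
    + (- (69298 / 175)) *\<^sub>R (u1 ^ 2 * u2 ^ 2)
    + (- (103288 / 525)) *\<^sub>R (u1 ^ 3 * u3)
    + (29696 / 25) *\<^sub>R (u1 ^ 4 * u2)
    + (- (8672 / 15)) *\<^sub>R (u1 ^ 6)))"
  by (rule val_eqI) (simp only: Yh3_0 dG2_2 Yh3_1 dG1_2 Yh3_2 dG0_2 algs; algebra)

lemma A1_2_0:
  "- S3 * coeff (Yh ^ 7) 0 = w ^ 14 * (w ^ 4 * ((1 / 2520) *\<^sub>R 1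
    + (- (1 / 42)) *\<^sub>R u2
    + (- (1 / 10)) *\<^sub>R (u1 ^ 2)
    + (1 / 140) *\<^sub>R u4
    + (11 / 140) *\<^sub>R (u2 ^ 2)
    + (3 / 35) *\<^sub>R (u1 * u3)
    + (2 / 5) *\<^sub>R (u1 ^ 2 * u2)
    + (1 / 5) *\<^sub>R (u1 ^ 4)))"
  by (rule val_eqI) (simp only: S3_def Yh7_0 algs; algebra)

lemma A2_2_0:
  "coeff (Yh ^ 5) 0 * (d ^^ 4) G0 = w ^ 10 * (w ^ 4 * (32 *\<^sub>R u4 + 96 *\<^sub>R (u2 ^ 2) + 128 *\<^sub>R (u1 * u3)))"
  by (rule val_eqI) (simp only: Yh5_0 dG0_4 algs; algebra)

lemma A1_2_1:
  "- S3 * coeff (Yh ^ 7) 1 = w ^ 14 * (w ^ 6 * ((1 / 10800) *\<^sub>R 1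
    + (- (31 / 5400)) *\<^sub>R u2
    + (- (139 / 5400)) *\<^sub>R (u1 ^ 2)
    + (1 / 600) *\<^sub>R u4
    + (53 / 1800) *\<^sub>R (u2 ^ 2)
    + (1 / 50) *\<^sub>R (u1 * u3)
    + (64 / 225) *\<^sub>R (u1 ^ 2 * u2)
    + (49 / 75) *\<^sub>R (u1 ^ 4)
    + (- (1 / 300)) *\<^sub>R (u2 * u4)
    + (- (11 / 300)) *\<^sub>R (u2 ^ 3)
    + (- (1 / 25)) *\<^sub>R (u1 * u2 * u3)
    + (- (13 / 300)) *\<^sub>R (u1 ^ 2 * u4)
    + (- (199 / 300)) *\<^sub>R (u1 ^ 2 * u2 ^ 2)
    + (- (13 / 25)) *\<^sub>R (u1 ^ 3 * u3)
    + (- (63 / 25)) *\<^sub>R (u1 ^ 4 * u2)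
    + (- (91 / 75)) *\<^sub>R (u1 ^ 6)))"
  by (rule val_eqI) (simp only: S3_def Yh7_1 algs; algebra)

lemma A2_2_1:
  "coeff (Yh ^ 5) 0 * (d ^^ 4) G1 + coeff (Yh ^ 5) 1 * (d ^^ 4) G0 = w ^ 10 * (w ^ 6 * ((64 / 15) *\<^sub>R u4
    + (32 / 5) *\<^sub>R (u2 ^ 2)
    + (128 / 15) *\<^sub>R (u1 * u3)
    + (- (192 / 5)) *\<^sub>R (u1 ^ 2 * u2)
    + (- (32 / 5)) *\<^sub>R (u1 ^ 4)
    + (- (32 / 15)) *\<^sub>R u6
    + (256 / 5) *\<^sub>R (u3 ^ 2)
    + (1024 / 15) *\<^sub>R (u2 * u4)
    + (- (1568 / 5)) *\<^sub>R (u2 ^ 3)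
    + (512 / 15) *\<^sub>R (u1 * u5)
    + (- (6016 / 5)) *\<^sub>R (u1 * u2 * u3)
    + (- (6688 / 15)) *\<^sub>R (u1 ^ 2 * u4)
    + 3680 *\<^sub>R (u1 ^ 2 * u2 ^ 2)
    + (3968 / 3) *\<^sub>R (u1 ^ 3 * u3)
    + (- 7936) *\<^sub>R (u1 ^ 4 * u2)
    + 3584 *\<^sub>R (u1 ^ 6)))"
  by (rule val_eqI) (simp only: Yh5_0 dG1_4 Yh5_1 dG0_4 algs; algebra)

lemma A1_3_0:
  "- S4 * coeff (Yh ^ 9) 0 = w ^ 18 * (w ^ 6 * ((- (1 / 181440)) *\<^sub>R 1
    + (1 / 1080) *\<^sub>R u2
    + (37 / 37800) *\<^sub>R (u1 ^ 2)
    + (- (1 / 1080)) *\<^sub>R u4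
    + (- (7 / 360)) *\<^sub>R (u2 ^ 2)
    + (- (151 / 9450)) *\<^sub>R (u1 * u3)
    + (- (169 / 1050)) *\<^sub>R (u1 ^ 2 * u2)
    + (- (149 / 900)) *\<^sub>R (u1 ^ 4)
    + (1 / 7560) *\<^sub>R u6
    + (71 / 18900) *\<^sub>R (u3 ^ 2)
    + (17 / 2520) *\<^sub>R (u2 * u4)
    + (13 / 630) *\<^sub>R (u2 ^ 3)
    + (1 / 420) *\<^sub>R (u1 * u5)
    + (106 / 1575) *\<^sub>R (u1 * u2 * u3)
    + (11 / 630) *\<^sub>R (u1 ^ 2 * u4)
    + (137 / 1050) *\<^sub>R (u1 ^ 2 * u2 ^ 2)
    + (34 / 525) *\<^sub>R (u1 ^ 3 * u3)
    + (7 / 75) *\<^sub>R (u1 ^ 4 * u2)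
    + (1 / 225) *\<^sub>R (u1 ^ 6)))"
  by (rule val_eqI) (simp only: S4_def Yh9_0 algs; algebra)

lemma A2_3_0:
  "coeff (Yh ^ 7) 0 * (d ^^ 6) G0 = w ^ 14 * (w ^ 6 * (128 *\<^sub>R u6 + 1280 *\<^sub>R (u3 ^ 2) + 1920 *\<^sub>R (u2 * u4) + 768 *\<^sub>R (u1 * u5)))"
  by (rule val_eqI) (simp only: Yh7_0 dG0_6 algs; algebra)

definition Sp :: "psm poly" where "Sp = [:1, S1, S2, S3, S4:]"

definition Gp :: "psm poly" where "Gp = [:G0, G1, G2, G3:]"

lemma Sp_coeff: "coeff Sp 0 = 1" "coeff Sp 1 = S1" "coeff Sp 2 = S2" "coeff Sp 3 = S3" "coeff Sp 4 = S4"
  by (simp_all add: Sp_def coeff_pCons_numeral)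

lemma Gp_coeff: "coeff Gp 0 = G0" "coeff Gp 1 = G1" "coeff Gp 2 = G2" "coeff Gp 3 = G3"
  by (simp_all add: Gp_def coeff_pCons_numeral)

text \<open>The powers of \<open>v\<close> come from the factor \<open>v ^ 2\<close> in
  \<open>Yp\<close>. They cancel the leading power of \<open>w\<close> in the preceding tables, so
  that all contributions to one order share the same power of \<open>w\<close>.\<close>

definition P1 where "P1 i m = v ^ (4 * i + 6) * (- coeff Sp (Suc i) * coeff (Yh ^ (2 * i + 3)) m)"

definition P2 where "P2 i m = v ^ (4 * i + 2) * coeff (Yh ^ (2 * i + 1) * (dP ^^ (2 * i)) Gp) m"

lemma P1_0_0:
  "P1 0 0 = ((1 / 3) *\<^sub>R 1)"
  proof -
    have "P1 0 0 = v ^ 6 * (- S1 * coeff (Yh ^ 3) 0)"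
      by (simp add: P1_def Sp_def coeff_pCons_numeral)
    then show ?thesis by (simp only: A1_0_0 wv_cancel)
  qed

lemma P2_0_0:
  "P2 0 0 = (1 *\<^sub>R 1)"
  proof -
    have "P2 0 0 = v ^ 2 * coeff (Yh * Gp) 0"
      by (simp add: P2_def power2_eq_square)
    then show ?thesis
      by (simp only: coeff_mult_low Gp_coeff coeff_dP_funpow A2_0_0 wv_cancel)
  qed

lemma P1_0_1:
  "P1 0 1 = w ^ 2 * ((1 / 30) *\<^sub>R 1 + (- (1 / 15)) *\<^sub>R u2 + (- (13 / 15)) *\<^sub>R (u1 ^ 2))"
  proof -
    have "P1 0 1 = v ^ 6 * (- S1 * coeff (Yh ^ 3) 1)"
      by (simp add: P1_def Sp_def coeff_pCons_numeral)
    then show ?thesis by (simp only: A1_0_1 wv_cancel)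
  qed

lemma P2_0_1:
  "P2 0 1 = w ^ 2 * ((1 / 60) *\<^sub>R 1 + (- (1 / 5)) *\<^sub>R u2 + (- (3 / 5)) *\<^sub>R (u1 ^ 2))"
  proof -
    have "P2 0 1 = v ^ 2 * coeff (Yh * Gp) 1"
      by (simp add: P2_def power2_eq_square)
    then show ?thesis
      by (simp only: coeff_mult_low Gp_coeff coeff_dP_funpow A2_0_1 wv_cancel)
  qed

lemma P1_0_2:
  "P1 0 2 = w ^ 4 * ((11 / 2520) *\<^sub>R 1
    + (1 / 63) *\<^sub>R u2
    + (- (2 / 45)) *\<^sub>R (u1 ^ 2)
    + (- (13 / 1260)) *\<^sub>R u4
    + (109 / 1260) *\<^sub>R (u2 ^ 2)
    + (31 / 315) *\<^sub>R (u1 * u3)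
    + (- (52 / 45)) *\<^sub>R (u1 ^ 2 * u2)
    + (208 / 45) *\<^sub>R (u1 ^ 4))"
  proof -
    have "P1 0 2 = v ^ 6 * (- S1 * coeff (Yh ^ 3) 2)"
      by (simp add: P1_def Sp_def coeff_pCons_numeral)
    then show ?thesis by (simp only: A1_0_2 wv_cancel)
  qed

lemma P2_0_2:
  "P2 0 2 = w ^ 4 * ((1 / 504) *\<^sub>R 1
    + (11 / 1260) *\<^sub>R u2
    + (1 / 36) *\<^sub>R (u1 ^ 2)
    + (1 / 420) *\<^sub>R u4
    + (- (17 / 420)) *\<^sub>R (u2 ^ 2)
    + (- (11 / 105)) *\<^sub>R (u1 * u3)
    + (4 / 15) *\<^sub>R (u1 ^ 2 * u2)
    + (11 / 5) *\<^sub>R (u1 ^ 4))"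
  proof -
    have "P2 0 2 = v ^ 2 * coeff (Yh * Gp) 2"
      by (simp add: P2_def power2_eq_square)
    then show ?thesis
      by (simp only: coeff_mult_low Gp_coeff coeff_dP_funpow A2_0_2 wv_cancel)
  qed

lemma P1_0_3:
  "P1 0 3 = w ^ 6 * ((149 / 226800) *\<^sub>R 1
    + (53 / 7560) *\<^sub>R u2
    + (263 / 12600) *\<^sub>R (u1 ^ 2)
    + (- (41 / 18900)) *\<^sub>R u4
    + (43 / 2100) *\<^sub>R (u2 ^ 2)
    + (242 / 4725) *\<^sub>R (u1 * u3)
    + (- (604 / 1575)) *\<^sub>R (u1 ^ 2 * u2)
    + (49 / 150) *\<^sub>R (u1 ^ 4)
    + (1 / 1800) *\<^sub>R u6
    + (- (173 / 6300)) *\<^sub>R (u3 ^ 2)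
    + (- (499 / 12600)) *\<^sub>R (u2 * u4)
    + (241 / 1050) *\<^sub>R (u2 ^ 3)
    + (- (191 / 6300)) *\<^sub>R (u1 * u5)
    + (2218 / 1575) *\<^sub>R (u1 * u2 * u3)
    + (1907 / 3150) *\<^sub>R (u1 ^ 2 * u4)
    + (- (10147 / 1050)) *\<^sub>R (u1 ^ 2 * u2 ^ 2)
    + (- (9622 / 1575)) *\<^sub>R (u1 ^ 3 * u3)
    + (3293 / 75) *\<^sub>R (u1 ^ 4 * u2)
    + (- (3673 / 75)) *\<^sub>R (u1 ^ 6))"
  proof -
    have "P1 0 3 = v ^ 6 * (- S1 * coeff (Yh ^ 3) 3)"
      by (simp add: P1_def Sp_def coeff_pCons_numeral)
    then show ?thesis by (simp only: A1_0_3 wv_cancel)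
  qed

lemma P2_0_3:
  "P2 0 3 = w ^ 6 * ((29 / 100800) *\<^sub>R 1
    + (79 / 18900) *\<^sub>R u2
    + (223 / 9450) *\<^sub>R (u1 ^ 2)
    + (61 / 75600) *\<^sub>R u4
    + (- (3 / 2800)) *\<^sub>R (u2 ^ 2)
    + (389 / 18900) *\<^sub>R (u1 * u3)
    + (- (131 / 1050)) *\<^sub>R (u1 ^ 2 * u2)
    + (- (53 / 900)) *\<^sub>R (u1 ^ 4)
    + (- (1 / 1400)) *\<^sub>R u6
    + (7 / 300) *\<^sub>R (u3 ^ 2)
    + (557 / 12600) *\<^sub>R (u2 * u4)
    + (- (17 / 70)) *\<^sub>R (u2 ^ 3)
    + (97 / 6300) *\<^sub>R (u1 * u5)
    + (- (1334 / 1575)) *\<^sub>R (u1 * u2 * u3)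
    + (- (263 / 1575)) *\<^sub>R (u1 ^ 2 * u4)
    + (76 / 21) *\<^sub>R (u1 ^ 2 * u2 ^ 2)
    + (1952 / 1575) *\<^sub>R (u1 ^ 3 * u3)
    + (- (122 / 75)) *\<^sub>R (u1 ^ 4 * u2)
    + (- (296 / 25)) *\<^sub>R (u1 ^ 6))"
  proof -
    have "P2 0 3 = v ^ 2 * coeff (Yh * Gp) 3"
      by (simp add: P2_def power2_eq_square)
    then show ?thesis
      by (simp only: coeff_mult_low Gp_coeff coeff_dP_funpow A2_0_3 wv_cancel)
  qed

lemma P1_1_0:
  "P1 1 0 = w ^ 2 * ((- (1 / 60)) *\<^sub>R 1 + (1 / 5) *\<^sub>R u2 + (3 / 5) *\<^sub>R (u1 ^ 2))"
  proof -
    have "P1 1 0 = v ^ 10 * (- S2 * coeff (Yh ^ 5) 0)"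
      by (simp add: P1_def Sp_def coeff_pCons_numeral)
    then show ?thesis by (simp only: A1_1_0 wv_cancel)
  qed

lemma P2_1_0:
  "P2 1 0 = w ^ 2 * (8 *\<^sub>R u2 + 8 *\<^sub>R (u1 ^ 2))"
  proof -
    have "P2 1 0 = v ^ 6 * coeff (Yh ^ 3 * (dP ^^ 2) Gp) 0"
      by (simp add: P2_def power2_eq_square)
    then show ?thesis
      by (simp only: coeff_mult_low Gp_coeff coeff_dP_funpow A2_1_0 wv_cancel)
  qed

lemma P1_1_1:
  "P1 1 1 = w ^ 4 * ((- (1 / 360)) *\<^sub>R 1
    + (7 / 180) *\<^sub>R u2
    + (31 / 180) *\<^sub>R (u1 ^ 2)
    + (- (1 / 15)) *\<^sub>R (u2 ^ 2)
    + (- (16 / 15)) *\<^sub>R (u1 ^ 2 * u2)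
    + (- (13 / 5)) *\<^sub>R (u1 ^ 4))"
  proof -
    have "P1 1 1 = v ^ 10 * (- S2 * coeff (Yh ^ 5) 1)"
      by (simp add: P1_def Sp_def coeff_pCons_numeral)
    then show ?thesis by (simp only: A1_1_1 wv_cancel)
  qed

lemma P2_1_1:
  "P2 1 1 = w ^ 4 * ((8 / 15) *\<^sub>R u2
    + (- (8 / 15)) *\<^sub>R u4
    + (32 / 15) *\<^sub>R (u2 ^ 2)
    + (16 / 3) *\<^sub>R (u1 * u3)
    + (- (752 / 15)) *\<^sub>R (u1 ^ 2 * u2)
    + (8 / 15) *\<^sub>R (u1 ^ 4))"
  proof -
    have "P2 1 1 = v ^ 6 * coeff (Yh ^ 3 * (dP ^^ 2) Gp) 1"
      by (simp add: P2_def power2_eq_square)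
    then show ?thesis
      by (simp only: coeff_mult_low Gp_coeff coeff_dP_funpow A2_1_1 wv_cancel)
  qed

lemma P1_1_2:
  "P1 1 2 = w ^ 6 * ((- (23 / 50400)) *\<^sub>R 1
    + (19 / 4200) *\<^sub>R u2
    + (943 / 37800) *\<^sub>R (u1 ^ 2)
    + (13 / 15120) *\<^sub>R u4
    + (97 / 25200) *\<^sub>R (u2 ^ 2)
    + (- (31 / 3780)) *\<^sub>R (u1 * u3)
    + (59 / 3150) *\<^sub>R (u1 ^ 2 * u2)
    + (- (679 / 900)) *\<^sub>R (u1 ^ 4)
    + (- (13 / 1260)) *\<^sub>R (u2 * u4)
    + (191 / 2100) *\<^sub>R (u2 ^ 3)
    + (31 / 315) *\<^sub>R (u1 * u2 * u3)
    + (- (13 / 420)) *\<^sub>R (u1 ^ 2 * u4)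
    + (- (537 / 700)) *\<^sub>R (u1 ^ 2 * u2 ^ 2)
    + (31 / 105) *\<^sub>R (u1 ^ 3 * u3)
    + (169 / 75) *\<^sub>R (u1 ^ 4 * u2)
    + (403 / 25) *\<^sub>R (u1 ^ 6))"
  proof -
    have "P1 1 2 = v ^ 10 * (- S2 * coeff (Yh ^ 5) 2)"
      by (simp add: P1_def Sp_def coeff_pCons_numeral)
    then show ?thesis by (simp only: A1_1_2 wv_cancel)
  qed

lemma P2_1_2:
  "P2 1 2 = w ^ 6 * ((32 / 525) *\<^sub>R u2
    + (- (32 / 525)) *\<^sub>R (u1 ^ 2)
    + (- (136 / 1575)) *\<^sub>R u4
    + (404 / 525) *\<^sub>R (u2 ^ 2)
    + (832 / 1575) *\<^sub>R (u1 * u3)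
    + (- (1216 / 525)) *\<^sub>R (u1 ^ 2 * u2)
    + (44 / 15) *\<^sub>R (u1 ^ 4)
    + (16 / 315) *\<^sub>R u6
    + (- (2936 / 1575)) *\<^sub>R (u3 ^ 2)
    + (- (238 / 75)) *\<^sub>R (u2 * u4)
    + (8954 / 525) *\<^sub>R (u2 ^ 3)
    + (- (32 / 21)) *\<^sub>R (u1 * u5)
    + (12632 / 175) *\<^sub>R (u1 * u2 * u3)
    + (1706 / 75) *\<^sub>R (u1 ^ 2 * u4)
    + (- (69298 / 175)) *\<^sub>R (u1 ^ 2 * u2 ^ 2)
    + (- (103288 / 525)) *\<^sub>R (u1 ^ 3 * u3)
    + (29696 / 25) *\<^sub>R (u1 ^ 4 * u2)
    + (- (8672 / 15)) *\<^sub>R (u1 ^ 6))"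
  proof -
    have "P2 1 2 = v ^ 6 * coeff (Yh ^ 3 * (dP ^^ 2) Gp) 2"
      by (simp add: P2_def power2_eq_square)
    then show ?thesis
      by (simp only: coeff_mult_low Gp_coeff coeff_dP_funpow A2_1_2 wv_cancel)
  qed

lemma P1_2_0:
  "P1 2 0 = w ^ 4 * ((1 / 2520) *\<^sub>R 1
    + (- (1 / 42)) *\<^sub>R u2
    + (- (1 / 10)) *\<^sub>R (u1 ^ 2)
    + (1 / 140) *\<^sub>R u4
    + (11 / 140) *\<^sub>R (u2 ^ 2)
    + (3 / 35) *\<^sub>R (u1 * u3)
    + (2 / 5) *\<^sub>R (u1 ^ 2 * u2)
    + (1 / 5) *\<^sub>R (u1 ^ 4))"
  proof -
    have "P1 2 0 = v ^ 14 * (- S3 * coeff (Yh ^ 7) 0)"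
      by (simp add: P1_def Sp_def coeff_pCons_numeral)
    then show ?thesis by (simp only: A1_2_0 wv_cancel)
  qed

lemma P2_2_0:
  "P2 2 0 = w ^ 4 * (32 *\<^sub>R u4 + 96 *\<^sub>R (u2 ^ 2) + 128 *\<^sub>R (u1 * u3))"
  proof -
    have "P2 2 0 = v ^ 10 * coeff (Yh ^ 5 * (dP ^^ 4) Gp) 0"
      by (simp add: P2_def power2_eq_square)
    then show ?thesis
      by (simp only: coeff_mult_low Gp_coeff coeff_dP_funpow A2_2_0 wv_cancel)
  qed

lemma P1_2_1:
  "P1 2 1 = w ^ 6 * ((1 / 10800) *\<^sub>R 1
    + (- (31 / 5400)) *\<^sub>R u2
    + (- (139 / 5400)) *\<^sub>R (u1 ^ 2)
    + (1 / 600) *\<^sub>R u4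
    + (53 / 1800) *\<^sub>R (u2 ^ 2)
    + (1 / 50) *\<^sub>R (u1 * u3)
    + (64 / 225) *\<^sub>R (u1 ^ 2 * u2)
    + (49 / 75) *\<^sub>R (u1 ^ 4)
    + (- (1 / 300)) *\<^sub>R (u2 * u4)
    + (- (11 / 300)) *\<^sub>R (u2 ^ 3)
    + (- (1 / 25)) *\<^sub>R (u1 * u2 * u3)
    + (- (13 / 300)) *\<^sub>R (u1 ^ 2 * u4)
    + (- (199 / 300)) *\<^sub>R (u1 ^ 2 * u2 ^ 2)
    + (- (13 / 25)) *\<^sub>R (u1 ^ 3 * u3)
    + (- (63 / 25)) *\<^sub>R (u1 ^ 4 * u2)
    + (- (91 / 75)) *\<^sub>R (u1 ^ 6))"
  proof -
    have "P1 2 1 = v ^ 14 * (- S3 * coeff (Yh ^ 7) 1)"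
      by (simp add: P1_def Sp_def coeff_pCons_numeral)
    then show ?thesis by (simp only: A1_2_1 wv_cancel)
  qed

lemma P2_2_1:
  "P2 2 1 = w ^ 6 * ((64 / 15) *\<^sub>R u4
    + (32 / 5) *\<^sub>R (u2 ^ 2)
    + (128 / 15) *\<^sub>R (u1 * u3)
    + (- (192 / 5)) *\<^sub>R (u1 ^ 2 * u2)
    + (- (32 / 5)) *\<^sub>R (u1 ^ 4)
    + (- (32 / 15)) *\<^sub>R u6
    + (256 / 5) *\<^sub>R (u3 ^ 2)
    + (1024 / 15) *\<^sub>R (u2 * u4)
    + (- (1568 / 5)) *\<^sub>R (u2 ^ 3)
    + (512 / 15) *\<^sub>R (u1 * u5)
    + (- (6016 / 5)) *\<^sub>R (u1 * u2 * u3)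
    + (- (6688 / 15)) *\<^sub>R (u1 ^ 2 * u4)
    + 3680 *\<^sub>R (u1 ^ 2 * u2 ^ 2)
    + (3968 / 3) *\<^sub>R (u1 ^ 3 * u3)
    + (- 7936) *\<^sub>R (u1 ^ 4 * u2)
    + 3584 *\<^sub>R (u1 ^ 6))"
  proof -
    have "P2 2 1 = v ^ 10 * coeff (Yh ^ 5 * (dP ^^ 4) Gp) 1"
      by (simp add: P2_def power2_eq_square)
    then show ?thesis
      by (simp only: coeff_mult_low Gp_coeff coeff_dP_funpow A2_2_1 wv_cancel)
  qed

lemma P1_3_0:
  "P1 3 0 = w ^ 6 * ((- (1 / 181440)) *\<^sub>R 1
    + (1 / 1080) *\<^sub>R u2
    + (37 / 37800) *\<^sub>R (u1 ^ 2)
    + (- (1 / 1080)) *\<^sub>R u4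
    + (- (7 / 360)) *\<^sub>R (u2 ^ 2)
    + (- (151 / 9450)) *\<^sub>R (u1 * u3)
    + (- (169 / 1050)) *\<^sub>R (u1 ^ 2 * u2)
    + (- (149 / 900)) *\<^sub>R (u1 ^ 4)
    + (1 / 7560) *\<^sub>R u6
    + (71 / 18900) *\<^sub>R (u3 ^ 2)
    + (17 / 2520) *\<^sub>R (u2 * u4)
    + (13 / 630) *\<^sub>R (u2 ^ 3)
    + (1 / 420) *\<^sub>R (u1 * u5)
    + (106 / 1575) *\<^sub>R (u1 * u2 * u3)
    + (11 / 630) *\<^sub>R (u1 ^ 2 * u4)
    + (137 / 1050) *\<^sub>R (u1 ^ 2 * u2 ^ 2)
    + (34 / 525) *\<^sub>R (u1 ^ 3 * u3)
    + (7 / 75) *\<^sub>R (u1 ^ 4 * u2)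
    + (1 / 225) *\<^sub>R (u1 ^ 6))"
  proof -
    have "P1 3 0 = v ^ 18 * (- S4 * coeff (Yh ^ 9) 0)"
      by (simp add: P1_def Sp_def coeff_pCons_numeral)
    then show ?thesis by (simp only: A1_3_0 wv_cancel)
  qed

lemma P2_3_0:
  "P2 3 0 = w ^ 6 * (128 *\<^sub>R u6 + 1280 *\<^sub>R (u3 ^ 2) + 1920 *\<^sub>R (u2 * u4) + 768 *\<^sub>R (u1 * u5))"
  proof -
    have "P2 3 0 = v ^ 14 * coeff (Yh ^ 7 * (dP ^^ 6) Gp) 0"
      by (simp add: P2_def power2_eq_square)
    then show ?thesis
      by (simp only: coeff_mult_low Gp_coeff coeff_dP_funpow A2_3_0 wv_cancel)
  qed

section \<open>The densities up to exact derivatives\<close>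

lemma G1_integral:
  "G1 = (- (1 / 1080)) *\<^sub>R (w ^ 4 * (9 *\<^sub>R 1 + 72 *\<^sub>R (u1 ^ 2)))
    + d (w ^ 1 * ((- (1 / 15)) *\<^sub>R u1))"
  by (rule val_eqI) (simp only: G1_def algs; algebra)

text \<open>Integration by parts in explicit form, as for \<open>G1\<close> and \<open>G3\<close>:
  the integral of the exact derivative over a period vanishes, and the rest is a multiple of the
  integrand of the invariant written in \<open>w\<close> and \<open>uu\<close>.\<close>

lemma G2_integral:
  "G2 = (- (1 / 25200)) *\<^sub>R (w ^ 6 * (9 *\<^sub>R 1
    + 216 *\<^sub>R (u1 ^ 2)
    + 216 *\<^sub>R (u2 ^ 2)
    + (- 3024) *\<^sub>R (u1 ^ 2 * u2)
    + 7344 *\<^sub>R (u1 ^ 4)))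
    + d (w ^ 3 * ((- (13 / 3150)) *\<^sub>R u1 + (2 / 315) *\<^sub>R u3 + (- (2 / 35)) *\<^sub>R (u1 * u2) + (1 / 21) *\<^sub>R (u1 ^ 3)))"
  by (rule val_eqI) (simp only: G2_def algs; algebra)

lemma G3_integral:
  "G3 = (- (2 / 405)) *\<^sub>R (w ^ 8 * ((281 / 44800) *\<^sub>R 1
    + (843 / 2800) *\<^sub>R (u1 ^ 2)
    + (501 / 1400) *\<^sub>R (u2 ^ 2)
    + (- (501 / 100)) *\<^sub>R (u1 ^ 2 * u2)
    + (1011 / 100) *\<^sub>R (u1 ^ 4)
    + (3 / 14) *\<^sub>R (u3 ^ 2)
    + (- (473 / 175)) *\<^sub>R (u2 ^ 3)
    + (- (72 / 7)) *\<^sub>R (u1 * u2 * u3)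
    + (24438 / 175) *\<^sub>R (u1 ^ 2 * u2 ^ 2)
    + 33 *\<^sub>R (u1 ^ 3 * u3)
    + (- (15543 / 25)) *\<^sub>R (u1 ^ 4 * u2)
    + (15037 / 25) *\<^sub>R (u1 ^ 6)))
    + d (w ^ 5 * ((- (31 / 63000)) *\<^sub>R u1
    + (4 / 4725) *\<^sub>R u3
    + (- (17 / 4725)) *\<^sub>R (u1 * u2)
    + (- (17 / 3150)) *\<^sub>R (u1 ^ 3)
    + (- (1 / 1575)) *\<^sub>R u5
    + (5 / 189) *\<^sub>R (u2 * u3)
    + (1 / 63) *\<^sub>R (u1 * u4)
    + (- (16 / 63)) *\<^sub>R (u1 * u2 ^ 2)
    + (- (34 / 189)) *\<^sub>R (u1 ^ 2 * u3)
    + (248 / 189) *\<^sub>R (u1 ^ 3 * u2)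
    + (- (254 / 225)) *\<^sub>R (u1 ^ 5)))"
  by (rule val_eqI) (simp only: G3_def algs; algebra)

section \<open>Verification to order three and continuation to any order\<close>

lemma sqrt_start:
  assumes J: "J \<ge> 4"
  shows "eqm 5 (Sp * Sp) (V2 (w ^ 3) J)"
proof -
  have VP: "coeff (VP (w ^ 3) J) 0 = tp (w ^ 3) 0" "coeff (VP (w ^ 3) J) 1 = (1 / 24) *\<^sub>R tp (w ^ 3) 2"
    "coeff (VP (w ^ 3) J) 2 = (1 / 1920) *\<^sub>R tp (w ^ 3) 4"
    "coeff (VP (w ^ 3) J) 3 = (1 / 322560) *\<^sub>R tp (w ^ 3) 6"
    "coeff (VP (w ^ 3) J) 4 = (1 / 92897280) *\<^sub>R tp (w ^ 3) 8"
    and VQ: "coeff (VQ (w ^ 3) J) 0 = tq (w ^ 3) 0" "coeff (VQ (w ^ 3) J) 1 = (1 / 24) *\<^sub>R tq (w ^ 3) 2"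
    "coeff (VQ (w ^ 3) J) 2 = (1 / 1920) *\<^sub>R tq (w ^ 3) 4"
    "coeff (VQ (w ^ 3) J) 3 = (1 / 322560) *\<^sub>R tq (w ^ 3) 6"
    using J by (simp_all add: coeff_VP coeff_VQ cf_values)
  have "coeff (Sp * Sp) 0 = coeff (V2 (w ^ 3) J) 0"
    unfolding V2_def by (rule val_eqI) (simp only: coeff_add coeff_mult_low VP VQ Sp_coeff tp0 tq0 algs; algebra)
  moreover have "coeff (Sp * Sp) 1 = coeff (V2 (w ^ 3) J) 1"
    unfolding V2_def by (rule val_eqI) (simp only: coeff_add coeff_mult_low VP VQ Sp_coeff tp0 tq0 tp2 tq2 S1_def algs; algebra)
  moreover have "coeff (Sp * Sp) 2 = coeff (V2 (w ^ 3) J) 2"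
    unfolding V2_def by (rule val_eqI) (simp only: coeff_add coeff_mult_low VP VQ Sp_coeff tp0 tq0 tp2 tq2 tp4 tq4
        S1_def S2_def algs; algebra)
  moreover have "coeff (Sp * Sp) 3 = coeff (V2 (w ^ 3) J) 3"
    unfolding V2_def by (rule val_eqI) (simp only: coeff_add coeff_mult_low VP VQ Sp_coeff tp0 tq0 tp2 tq2 tp4 tq4 tp6 tq6
        S1_def S2_def S3_def algs; algebra)
  moreover have "coeff (Sp * Sp) 4 = coeff (V2 (w ^ 3) J) 4"
    unfolding V2_def by (rule val_eqI) (simp only: coeff_add coeff_mult_low VP VQ Sp_coeff tp0 tq0 tp2 tq2 tp4 tq4 tp6 tq6 tp8
        S1_def S2_def S3_def S4_def algs mult_zero_left mult_zero_right add_0_left add_0_right; algebra)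
  ultimately show ?thesis unfolding eqm_coeff less_5_iff by auto
qed

abbreviation Yp :: "psm poly" where "Yp \<equiv> smult (v ^ 2) Yh"

text \<open>Multiplying \<open>PhiY\<close> by \<open>Yp\<close> brings its terms to the monomials
  of \<open>Phi\<close>. The two sums then differ only in the weights \<open>2 * i + 3\<close> and
  \<open>2 * i + 1\<close> of differentiation, so one set of tables serves both.\<close>

lemma Phi_coeff:
  assumes D: "\<And>i. i \<le> 3 \<Longrightarrow> D i = - coeff Sp (Suc i)" and I: "n \<le> 3" "3 \<le> I"
  shows "coeff (Phi D I Gp Yp) n = (\<Sum>i\<le>n. P1 i (n - i) - cf i *\<^sub>R P2 i (n - i))"
    and "coeff (Yp * PhiY D I Gp Yp) n
      = (\<Sum>i\<le>n. of_nat (2 * i + 3) *\<^sub>R P1 i (n - i) - (of_nat (2 * i + 1) * cf i) *\<^sub>R P2 i (n - i))"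
proof -
  have n: "n \<le> I" using I by simp
  have t: "coeff (Yp ^ (2 * i + 1) * (smult (D i) (Yp ^ 2) - smult (of_real (cf i)) ((dP ^^ (2 * i)) Gp))) m
      = P1 i m - cf i *\<^sub>R P2 i m" if "i \<le> n" for i m
  proof -
    have "Yp ^ (2 * i + 1) * (smult (D i) (Yp ^ 2) - smult (of_real (cf i)) ((dP ^^ (2 * i)) Gp))
      = smult (v ^ (4 * i + 6) * D i) (Yh ^ (2 * i + 3)) - smult (of_real (cf i) * v ^ (4 * i + 2)) (Yh ^ (2 * i + 1) * (dP ^^ (2 * i)) Gp)"
    proof -
      have e: "2 * i + 3 = (2 * i + 1) + 2" "4 * i + 6 = (4 * i + 2) + 4" by simp_all
      have "Yh ^ (2 * i + 3) = Yh ^ (2 * i + 1) * Yh ^ 2" "v ^ (4 * i + 6) = v ^ (4 * i + 2) * v ^ 4"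
        unfolding e power_add[of Yh "2 * i + 1" 2] power_add[of v "4 * i + 2" 4] by (rule refl)+
      moreover have "2 * (2 * i + 1) = 4 * i + 2" "2 * 2 = (4::nat)" by simp_all
      then have "(v ^ 2) ^ (2 * i + 1) = v ^ (4 * i + 2)" "(v ^ 2) ^ 2 = v ^ 4"
        by (simp_all only: power_mult [symmetric])
      ultimately show ?thesis by (simp only: smult_power right_diff_distrib mult_smult_left mult_smult_right smult_smult mult_ac)
    qed
    then show ?thesis
      using D[of i] that I by (simp only: coeff_diff coeff_smult P1_def P2_def) (simp add: scaleR_conv_of_real mult.assoc)
  qed
  have t': "coeff (Yp * (smult (of_nat (2 * i + 3) * D i) (Yp ^ (2 * i + 2))
       - smult (of_real (of_nat (2 * i + 1) * cf i)) (Yp ^ (2 * i) * (dP ^^ (2 * i)) Gp))) m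
      = of_nat (2 * i + 3) *\<^sub>R P1 i m - (of_nat (2 * i + 1) * cf i) *\<^sub>R P2 i m" if "i \<le> n" for i m
  proof -
    have "Yp * (smult (of_nat (2 * i + 3) * D i) (Yp ^ (2 * i + 2))
       - smult (of_real (of_nat (2 * i + 1) * cf i)) (Yp ^ (2 * i) * (dP ^^ (2 * i)) Gp))
      = smult (of_nat (2 * i + 3) * (v ^ (4 * i + 6) * D i)) (Yh ^ (2 * i + 3))
        - smult (of_real (of_nat (2 * i + 1) * cf i) * v ^ (4 * i + 2)) (Yh ^ (2 * i + 1) * (dP ^^ (2 * i)) Gp)"
    proof -
      have e: "2 * i + 3 = 1 + (2 * i + 2)" "2 * i + 1 = 1 + 2 * i" "4 * i + 6 = 2 + (4 * i + 4)" "4 * i + 2 = 2 + 4 * i"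
        by simp_all
      have "Yh ^ (2 * i + 3) = Yh * Yh ^ (2 * i + 2)" "Yh ^ (2 * i + 1) = Yh * Yh ^ (2 * i)"
        "v ^ (4 * i + 6) = v ^ 2 * v ^ (4 * i + 4)" "v ^ (4 * i + 2) = v ^ 2 * v ^ (4 * i)"
        unfolding e power_add[of Yh 1] power_add[of v 2] power_one_right by (rule refl)+
      moreover have "2 * (2 * i + 2) = 4 * i + 4" "2 * (2 * i) = 4 * i" by simp_all
      then have "(v ^ 2) ^ (2 * i + 2) = v ^ (4 * i + 4)" "(v ^ 2) ^ (2 * i) = v ^ (4 * i)"
        by (simp_all only: power_mult [symmetric])
      ultimately show ?thesis by (simp only: smult_power right_diff_distrib mult_smult_left mult_smult_right smult_smult mult_ac)
    qed
    then show ?thesis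
      using D[of i] that I by (simp only: coeff_diff coeff_smult P1_def P2_def) (simp add: scaleR_conv_of_real mult.assoc)
  qed
  show "coeff (Phi D I Gp Yp) n = (\<Sum>i\<le>n. P1 i (n - i) - cf i *\<^sub>R P2 i (n - i))"
    unfolding Phi_def coeff_sum_monom_mult[OF n] by (intro sum.cong t) auto
  have Q: "Yp * PhiY D I Gp Yp = (\<Sum>i\<le>I. monom 1 i * (Yp * (smult (of_nat (2 * i + 3) * D i) (Yp ^ (2 * i + 2))
       - smult (of_real (of_nat (2 * i + 1) * cf i)) (Yp ^ (2 * i) * (dP ^^ (2 * i)) Gp))))"
    unfolding PhiY_def sum_distrib_left by (intro sum.cong refl mult.left_commute)
  show "coeff (Yp * PhiY D I Gp Yp) n
      = (\<Sum>i\<le>n. of_nat (2 * i + 3) *\<^sub>R P1 i (n - i) - (of_nat (2 * i + 1) * cf i) *\<^sub>R P2 i (n - i))"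
    unfolding Q coeff_sum_monom_mult[OF n] by (intro sum.cong t') auto
qed

lemma Phi_start:
  assumes D: "\<And>i. i \<le> 3 \<Longrightarrow> D i = - coeff Sp (Suc i)" and I: "3 \<le> I"
  shows "eqm 4 (Phi D I Gp Yp) [:of_real (- 2 / 3):]" "eqm 4 (PhiY D I Gp Yp) 0"
proof -
  note E = Phi_coeff(1)[OF D _ I] and E' = Phi_coeff(2)[OF D _ I]
  have e0: "coeff (Phi D I Gp Yp) 0 = P1 0 0 - P2 0 0"
    using E[of 0] by simp
  have f0: "coeff (Yp * PhiY D I Gp Yp) 0 = 3 *\<^sub>R P1 0 0 - P2 0 0"
    using E'[of 0] by simp
  have e1: "coeff (Phi D I Gp Yp) 1 = P1 0 1 - P2 0 1 + (P1 1 0 - (1 / 24) *\<^sub>R P2 1 0)"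
    using E[of 1] by (simp add: cf_values)
  have f1: "coeff (Yp * PhiY D I Gp Yp) 1 = 3 *\<^sub>R P1 0 1 - P2 0 1 + (5 *\<^sub>R P1 1 0 - (3 / 24) *\<^sub>R P2 1 0)"
    using E'[of 1] by (simp add: cf_values)
  have e2: "coeff (Phi D I Gp Yp) 2 = P1 0 2 - P2 0 2 + (P1 1 1 - (1 / 24) *\<^sub>R P2 1 1)
      + (P1 2 0 - (1 / 1920) *\<^sub>R P2 2 0)"
    using E[of 2] by (simp add: atMost_numeral cf_values add.assoc)
  have f2: "coeff (Yp * PhiY D I Gp Yp) 2 = 3 *\<^sub>R P1 0 2 - P2 0 2 + (5 *\<^sub>R P1 1 1 - (3 / 24) *\<^sub>R P2 1 1)
      + (7 *\<^sub>R P1 2 0 - (5 / 1920) *\<^sub>R P2 2 0)"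
    using E'[of 2] by (simp add: atMost_numeral cf_values add.assoc)
  have e3: "coeff (Phi D I Gp Yp) 3 = P1 0 3 - P2 0 3 + (P1 1 2 - (1 / 24) *\<^sub>R P2 1 2)
      + (P1 2 1 - (1 / 1920) *\<^sub>R P2 2 1) + (P1 3 0 - (1 / 322560) *\<^sub>R P2 3 0)"
    using E[of 3] by (simp add: atMost_numeral cf_values add.assoc)
  have f3: "coeff (Yp * PhiY D I Gp Yp) 3 = 3 *\<^sub>R P1 0 3 - P2 0 3 + (5 *\<^sub>R P1 1 2 - (3 / 24) *\<^sub>R P2 1 2)
      + (7 *\<^sub>R P1 2 1 - (5 / 1920) *\<^sub>R P2 2 1) + (9 *\<^sub>R P1 3 0 - (7 / 322560) *\<^sub>R P2 3 0)"
    using E'[of 3] by (simp add: atMost_numeral cf_values add.assoc)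
  have "coeff (Phi D I Gp Yp) 0 = of_real (- 2 / 3)" "coeff (Yp * PhiY D I Gp Yp) 0 = 0"
    unfolding e0 f0 by (rule val_eqI; simp only: P1_0_0 P2_0_0 algs; algebra)+
  moreover have "coeff (Phi D I Gp Yp) 1 = 0" "coeff (Yp * PhiY D I Gp Yp) 1 = 0"
    unfolding e1 f1 by (rule val_eqI; simp only: P1_0_1 P2_0_1 P1_1_0 P2_1_0 algs; algebra)+
  moreover have "coeff (Phi D I Gp Yp) 2 = 0" "coeff (Yp * PhiY D I Gp Yp) 2 = 0"
    unfolding e2 f2 by (rule val_eqI; simp only: P1_0_2 P2_0_2 P1_1_1 P2_1_1 P1_2_0 P2_2_0 algs; algebra)+
  moreover have "coeff (Phi D I Gp Yp) 3 = 0" "coeff (Yp * PhiY D I Gp Yp) 3 = 0"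
    unfolding e3 f3 by (rule val_eqI; simp only: P1_0_3 P2_0_3 P1_1_2 P2_1_2 P1_2_1 P2_2_1 P1_3_0 P2_3_0 algs; algebra)+
  ultimately have P: "eqm 4 (Phi D I Gp Yp) [:of_real (- 2 / 3):]" and Q: "eqm 4 (Yp * PhiY D I Gp Yp) 0"
    unfolding eqm_coeff less_4_iff by (auto simp: coeff_pCons_numeral)
  \<comment> \<open>The constant term \<open>2 v ^ 2\<close> of \<open>Yp\<close> is a unit, so the
    factor \<open>Yp\<close> can be cancelled.\<close>
  have "(1 / 2) *\<^sub>R w ^ 2 * coeff Yp 0 = 1"
    using wv_cancel(2)[of 2 1] by (simp add: Yh1 Y0_def)
  from P eqm_cancel_left[OF Q this]
  show "eqm 4 (Phi D I Gp Yp) [:of_real (- 2 / 3):]" "eqm 4 (PhiY D I Gp Yp) 0" .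
qed

text \<open>The explicit solution modulo the fourth power starts the iteration and fixes
  \<open>G0\<close> to \<open>G3\<close>. Beyond that only existence matters, and the Newton steps
  supply it.\<close>

theorem formal_solution:
  assumes I: "3 \<le> I"
  obtains S G Y where "degree S < I + 2" "coeff S 0 = 1" "eqm (I + 2) (S * S) (V2 (w ^ 3) (I + 1))"
    "eqm (I + 1) (Phi (\<lambda>i. - coeff S (Suc i)) I G Y) [:of_real (- 2 / 3):]"
    "eqm (I + 1) (PhiY (\<lambda>i. - coeff S (Suc i)) I G Y) 0"
    "coeff G 0 = G0" "coeff G 1 = G1" "coeff G 2 = G2" "coeff G 3 = G3" "coeff Y 0 = 2 *\<^sub>R v ^ 2"
    "coeff S 1 = - (1 / 24) *\<^sub>R w ^ 6"
proof -
  have "degree Sp < 5" by (simp add: Sp_def)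
  moreover have "eqm 5 (Sp * Sp) (V2 (w ^ 3) (I + 1))" using I by (intro sqrt_start) simp
  moreover have "5 \<le> I + 2" using I by simp
  ultimately obtain S where S: "eqm (I + 2) (S * S) (V2 (w ^ 3) (I + 1))" "eqm 5 S Sp" "degree S < I + 2"
    using sqrt_exists[of 5 Sp "V2 (w ^ 3) (I + 1)" "I + 2"] Sp_coeff by auto
  define D where "D i = - coeff S (Suc i)" for i
  have D: "D i = - coeff Sp (Suc i)" if "i \<le> 3" for i using S(2) that by (auto simp: D_def eqm_coeff)
  note P = Phi_start[OF D I]
  have y: "(1 / 2) *\<^sub>R w ^ 2 * coeff Yp 0 = 1"
    using wv_cancel(2)[of 2 1] by (simp add: Yh1 Y0_def)
  \<comment> \<open>With D 0 = w^6/24 and constant term 2 v^2 of \<open>Yp\<close>, the product to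
    be inverted is w^4/2.\<close>
  have z: "2 *\<^sub>R v ^ 4 * (6 * D 0 * coeff Yp 0) = 1"
  proof (rule val_eqI)
    fix x
    have "val w x * val v x = 1" using wv by (metis val_simps(2,5))
    then have "val v x ^ 4 * (val w x ^ 6 * (val v x)\<^sup>2) = 1" by algebra
    then show "val (2 *\<^sub>R v ^ 4 * (6 * D 0 * coeff Yp 0)) x = val 1 x"
      using D[of 0] by (simp add: Sp_coeff[simplified] S1_def Yh1 Y0_def)
  qed
  obtain G Y where GY: "eqm (I + 1) (Phi D I G Y) [:of_real (- 2 / 3):]" "eqm (I + 1) (PhiY D I G Y) 0"
    "eqm 4 G Gp" "eqm 4 Y Yp"
    using newton[OF P _ _ y z, of "I + 1"] I by auto
  show ?thesis
  proof (rule that[of S G Y])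
    show "coeff S 0 = 1" using S(2) Sp_coeff by (simp add: eqm_coeff)
    show "coeff S 1 = - (1 / 24) *\<^sub>R w ^ 6" using S(2) Sp_coeff S1_def by (simp add: eqm_coeff)
    show "coeff G 0 = G0" "coeff G 1 = G1" "coeff G 2 = G2" "coeff G 3 = G3"
      using GY(3) Gp_coeff by (simp_all add: eqm_coeff)
    show "coeff Y 0 = 2 *\<^sub>R v ^ 2" using GY(4) by (simp add: eqm_coeff Yh1 Y0_def)
  qed (use S GY in \<open>simp_all add: D_def[abs_def]\<close>)
qed

end

subsection \<open>Estimates for the gap\<close>

lemma sum_odd_only:
  fixes a :: "nat \<Rightarrow> real"
  assumes "\<And>j. even j \<Longrightarrow> a j = 0"
  shows "(\<Sum>j<2 * I + 3. a j) = (\<Sum>i\<le>I. a (2 * i + 1))"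
proof (induction I)
  case 0
  have "{..<3::nat} = {0, 1, 2}" by auto
  then show ?case using assms[of 0] assms[of 2] by simp
next
  case (Suc I)
  have "2 * Suc I + 3 = Suc (Suc (2 * I + 3))" by simp
  then have "(\<Sum>j<2 * Suc I + 3. a j) = (\<Sum>j<2 * I + 3. a j) + a (2 * I + 3) + a (Suc (2 * I + 3))"
    by (simp only: sum.lessThan_Suc)
  then show ?case using Suc assms[of "Suc (2 * I + 3)"] by (simp add: numeral_3_eq_3)
qed

lemma eqm_bounded:
  assumes "eqm n p q"
  shows "\<exists>C\<ge>0. \<forall>t x. 0 \<le> t \<longrightarrow> t \<le> 1 \<longrightarrow> \<bar>ev (poly p (of_real t)) x - ev (poly q (of_real t)) x\<bar> \<le> C * t ^ n"
  using poly_dvd_bounded[of n "p - q"] assms by (simp add: eqm_def)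

context period
begin

text \<open>The bridge from formal to analytic statements: a congruence becomes an error bound that
  is uniform in the base point.\<close>

lemma eqm_pval_bounded:
  assumes "eqm n p q"
  obtains C where "C \<ge> 0" "\<And>t x. 0 \<le> t \<Longrightarrow> t \<le> 1 \<Longrightarrow> \<bar>pval p t x - pval q t x\<bar> \<le> C * t ^ n"
  using eqm_bounded[OF assms] that unfolding val_def by blast

text \<open>The central difference is an odd function of the half length, so its even Maclaurin
  coefficients vanish and the remainder directly has the next odd order.\<close>

lemma sym_taylor:
  assumes f: "\<And>x. (f has_real_derivative val q x) (at x)"
    and B: "\<And>x. \<bar>val ((d ^^ (2 * I + 2)) q) x\<bar> \<le> B"
  shows "\<bar>f (m + \<delta> / 2) - f (m - \<delta> / 2) - (\<Sum>i\<le>I. \<delta> ^ (2 * i + 1) * (cf i * val ((d ^^ (2 * i)) q) m))\<bar>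
    \<le> B * \<bar>\<delta>\<bar> ^ (2 * I + 3)"
proof -
  define g where "g h = f (m + h) - f (m - h)" for h
  define diff where "diff n h = (if n = 0 then g h
    else val ((d ^^ (n - 1)) q) (m + h) - (- 1) ^ n * val ((d ^^ (n - 1)) q) (m - h))" for n h
  have D: "(diff n has_real_derivative diff (Suc n) h) (at h)" for n h
  proof (cases n)
    case 0
    have "((\<lambda>h. f (m + h) - f (m - h)) has_real_derivative val q (m + h) * 1 - val q (m - h) * (- 1)) (at h)"
      by (intro DERIV_diff DERIV_chain2[OF f]) (auto intro!: derivative_eq_intros)
    then show ?thesis using 0 by (simp add: diff_def[abs_def] g_def[abs_def])
  next
    case (Suc k)
    have v: "(val ((d ^^ k) q) has_real_derivative val ((d ^^ Suc k) q) x) (at x)" for x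
      using val_deriv[of "(d ^^ k) q"] by simp
    have "((\<lambda>h. val ((d ^^ k) q) (m + h) - (- 1) ^ Suc k * val ((d ^^ k) q) (m - h)) has_real_derivative
        val ((d ^^ Suc k) q) (m + h) * 1 - (- 1) ^ Suc k * (val ((d ^^ Suc k) q) (m - h) * (- 1))) (at h)"
      by (intro DERIV_diff DERIV_cmult DERIV_chain2[OF v]) (auto intro!: derivative_eq_intros)
    then show ?thesis using Suc by (simp add: diff_def[abs_def])
  qed
  have "\<exists>t. \<bar>t\<bar> \<le> \<bar>\<delta> / 2\<bar> \<and> g (\<delta> / 2) = (\<Sum>j<2 * I + 3. (diff j 0 / fact j) * (\<delta> / 2) ^ j)
      + (diff (2 * I + 3) t / fact (2 * I + 3)) * (\<delta> / 2) ^ (2 * I + 3)"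
  proof (rule Maclaurin_all_le)
    show "diff 0 = g" by (rule ext) (simp add: diff_def)
  qed (use D in blast)
  then obtain t where t: "g (\<delta> / 2) = (\<Sum>j<2 * I + 3. (diff j 0 / fact j) * (\<delta> / 2) ^ j)
      + (diff (2 * I + 3) t / fact (2 * I + 3)) * (\<delta> / 2) ^ (2 * I + 3)" by blast
  have "(\<Sum>j<2 * I + 3. (diff j 0 / fact j) * (\<delta> / 2) ^ j)
      = (\<Sum>i\<le>I. (diff (2 * i + 1) 0 / fact (2 * i + 1)) * (\<delta> / 2) ^ (2 * i + 1))"
    by (rule sum_odd_only) (auto simp: diff_def g_def)
  also have "\<dots> = (\<Sum>i\<le>I. \<delta> ^ (2 * i + 1) * (cf i * val ((d ^^ (2 * i)) q) m))"
  proof (intro sum.cong refl)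
    fix i
    have "(\<delta> / 2) ^ (2 * i + 1) = \<delta> ^ (2 * i + 1) / (2 * 4 ^ i)"
      by (simp add: power_divide power_mult)
    moreover have "diff (2 * i + 1) 0 = 2 * val ((d ^^ (2 * i)) q) m" by (simp add: diff_def)
    ultimately show "(diff (2 * i + 1) 0 / fact (2 * i + 1)) * (\<delta> / 2) ^ (2 * i + 1)
        = \<delta> ^ (2 * i + 1) * (cf i * val ((d ^^ (2 * i)) q) m)"
      by (simp only: cf_def) (simp add: field_simps)
  qed
  finally have e: "f (m + \<delta> / 2) - f (m - \<delta> / 2) - (\<Sum>i\<le>I. \<delta> ^ (2 * i + 1) * (cf i * val ((d ^^ (2 * i)) q) m))
      = (diff (2 * I + 3) t / fact (2 * I + 3)) * (\<delta> / 2) ^ (2 * I + 3)"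
    using t by (simp add: g_def)
  have B2: "\<bar>diff (2 * I + 3) t\<bar> \<le> 2 * B"
  proof -
    have "2 * I + 3 - 1 = 2 * I + 2" "odd (2 * I + 3)" by simp_all
    then have "diff (2 * I + 3) t = val ((d ^^ (2 * I + 2)) q) (m + t) + val ((d ^^ (2 * I + 2)) q) (m - t)"
      unfolding diff_def by simp
    then show ?thesis using B[of "m + t"] B[of "m - t"] by linarith
  qed
  have B0: "B \<ge> 0" using B[of 0] by linarith
  have "\<bar>(diff (2 * I + 3) t / fact (2 * I + 3)) * (\<delta> / 2) ^ (2 * I + 3)\<bar>
      = \<bar>diff (2 * I + 3) t\<bar> / fact (2 * I + 3) * (\<bar>\<delta>\<bar> ^ (2 * I + 3) / 2 ^ (2 * I + 3))"
    by (simp add: abs_mult power_abs power_divide)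
  also have "\<dots> \<le> (2 * B / 1) * (\<bar>\<delta>\<bar> ^ (2 * I + 3) / 2)"
  proof (intro mult_mono divide_left_mono frac_le)
    show "(2::real) \<le> 2 ^ (2 * I + 3)" using power_increasing[of 1 "2 * I + 3" "2::real"] by simp
  qed (use B2 B0 fact_ge_1 in auto)
  finally show ?thesis unfolding e by simp
qed

section \<open>Primitives of periodic functions\<close>

definition prim :: "psm \<Rightarrow> real \<Rightarrow> real" where
  "prim q = (SOME F. F 0 = 0 \<and> (\<forall>x. (F has_real_derivative val q x) (at x)))"

lemma prim: "prim q 0 = 0" "(prim q has_real_derivative val q x) (at x)"
proof -
  have "\<exists>F. \<forall>x::real. - \<infinity> < ereal x \<longrightarrow> ereal x < \<infinity> \<longrightarrow> (F has_vector_derivative val q x) (at x)"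
    by (rule einterval_antiderivative) (use val_continuous[of UNIV q] in \<open>auto simp: continuous_on_eq_continuous_at\<close>)
  then obtain F where F: "\<And>x. (F has_real_derivative val q x) (at x)"
    by (auto simp: has_real_derivative_iff_has_vector_derivative)
  have "\<exists>F. F 0 = 0 \<and> (\<forall>x. (F has_real_derivative val q x) (at x))"
    by (rule exI[of _ "\<lambda>x. F x - F 0"]) (auto intro!: derivative_eq_intros F)
  from someI_ex[OF this] show "prim q 0 = 0" "(prim q has_real_derivative val q x) (at x)"
    by (auto simp: prim_def)
qed

lemma prim_unique:
  assumes "\<And>x. (F has_real_derivative val q x) (at x)"
  shows "prim q x = F x - F 0"
proof -
  have "((\<lambda>x. prim q x - F x) has_real_derivative 0) (at x)" for x
    using DERIV_diff[OF prim(2)[of q] assms] by simp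
  then have "prim q x - F x = prim q 0 - F 0"
    using DERIV_const_ratio_const2 by (metis DERIV_isconst_all)
  then show ?thesis by (simp add: prim)
qed

lemma prim_diff_unique:
  assumes "\<And>x. (F has_real_derivative val q x) (at x)"
  shows "prim q y - prim q x = F y - F x"
  using prim_unique[OF assms] by simp

lemma prim_sum_powers: "prim (poly p (of_real t)) x = (\<Sum>i\<le>degree p. prim (coeff p i) x * t ^ i)"
proof -
  have "((\<lambda>x. \<Sum>i\<le>degree p. prim (coeff p i) x * t ^ i) has_real_derivative
      (\<Sum>i\<le>degree p. val (coeff p i) x * t ^ i)) (at x)" for x
    by (intro DERIV_sum DERIV_cmult_right prim)
  then show ?thesis using prim_unique[of "\<lambda>x. \<Sum>i\<le>degree p. prim (coeff p i) x * t ^ i" "poly p (of_real t)" x]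
    by (simp add: pval_sum prim)
qed

lemma prim_shift: "prim q (x + l) = prim q x + prim q l"
proof -
  have "((\<lambda>x. prim q (x + l)) has_real_derivative val q x) (at x)" for x
  proof -
    have "((\<lambda>x. prim q (x + l)) has_real_derivative val q (x + l) * 1) (at x)"
      by (rule DERIV_chain2[OF prim(2)]) (auto intro!: derivative_eq_intros)
    then show ?thesis using val_periodic_int[of q x 1] by simp
  qed
  from prim_unique[OF this, of x] show ?thesis by simp
qed

lemma prim_shift_int: "prim q (x + of_int n * l) = prim q x + of_int n * prim q l"
proof (induction n rule: int_induct[where k = 0])
  case (step1 i)
  then show ?case using prim_shift[of q "x + of_int i * l"] by (simp add: algebra_simps)
next
  case (step2 i)
  then show ?case using prim_shift[of q "x + of_int (i - 1) * l"] by (simp add: algebra_simps)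
qed simp

lemma prim_integral: "prim q l = integral {0..l} (val q)"
proof -
  have "(val q has_integral prim q l - prim q 0) {0..l}"
    using l_pos prim(2)[of q]
    by (intro fundamental_theorem_of_calculus)
       (auto simp: has_real_derivative_iff_has_vector_derivative[symmetric] intro: has_field_derivative_at_within)
  then show ?thesis by (simp add: prim integral_unique)
qed

lemma prim_lipschitz:
  assumes "\<And>z. \<bar>val q z\<bar> \<le> B" "x \<le> y"
  shows "\<bar>prim q y - prim q x\<bar> \<le> B * (y - x)"
proof (cases "x = y")
  case False
  then obtain z where "prim q y - prim q x = (y - x) * val q z"
    using MVT2[of x y "prim q" "val q"] assms(2) prim(2) by auto
  moreover have "(y - x) * \<bar>val q z\<bar> \<le> (y - x) * B" using assms by (intro mult_left_mono) auto
  ultimately show ?thesis using assms by (simp add: abs_mult mult.commute)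
qed simp

lemma prim_lower:
  assumes "\<And>z. b \<le> val q z" "x \<le> y"
  shows "b * (y - x) \<le> prim q y - prim q x"
proof (cases "x = y")
  case False
  then obtain z where "prim q y - prim q x = (y - x) * val q z"
    using MVT2[of x y "prim q" "val q"] assms(2) prim(2) by auto
  moreover have "(y - x) * b \<le> (y - x) * val q z" using assms by (intro mult_left_mono) auto
  ultimately show ?thesis by (simp add: mult.commute)
qed simp

text \<open>Over each full period the primitive grows by the same amount. On the remainder of less
  than a period, it and the linear function are bounded.\<close>

lemma prim_linear_deviation: "\<exists>C. \<forall>x. \<bar>prim q x - prim q l / l * x\<bar> \<le> C"
proof -
  obtain B where B: "B \<ge> 0" "\<And>x. \<bar>val q x\<bar> \<le> B" using val_bounded by blast
  have "\<bar>prim q x - prim q l / l * x\<bar> \<le> B * l + \<bar>prim q l\<bar>" for x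
  proof -
    define n where "n = \<lfloor>x / l\<rfloor>"
    define y where "y = x - of_int n * l"
    have "of_int n \<le> x / l" "x / l \<le> of_int n + 1" unfolding n_def by linarith+
    then have "of_int n * l \<le> x" "x \<le> (of_int n + 1) * l"
      using l_pos by (simp_all only: pos_le_divide_eq pos_divide_le_eq)
    then have y: "0 \<le> y" "y \<le> l" by (auto simp: y_def algebra_simps)
    have x: "x = y + of_int n * l" by (simp add: y_def)
    have "prim q x - prim q l / l * x = prim q y - prim q l * (y / l)"
      using l_pos unfolding x prim_shift_int by (simp add: field_simps)
    moreover have "\<bar>prim q y\<bar> \<le> B * l"
    proof -
      have "\<bar>prim q y - prim q 0\<bar> \<le> B * (y - 0)" by (rule prim_lipschitz[OF B(2) y(1)])
      also have "\<dots> \<le> B * l" using y B by (intro mult_left_mono) auto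
      finally show ?thesis by (simp add: prim)
    qed
    moreover have "\<bar>prim q l * (y / l)\<bar> \<le> \<bar>prim q l\<bar> * 1"
      unfolding abs_mult using y l_pos by (intro mult_left_mono) auto
    ultimately show ?thesis by linarith
  qed
  then show ?thesis by blast
qed

lemma val_positive_lower:
  assumes "\<And>x. val q x > 0"
  shows "\<exists>b>0. \<forall>x. b \<le> val q x"
proof -
  obtain x0 where x0: "\<And>x. x \<in> {0..l} \<Longrightarrow> val q x0 \<le> val q x"
  proof -
    have "\<exists>x\<in>{0..l}. \<forall>y\<in>{0..l}. val q x \<le> val q y"
      using l_pos by (intro continuous_attains_inf val_continuous) auto
    then show thesis using that by blast
  qed
  have "val q x0 \<le> val q x" for x
  proof -
    define n where "n = \<lfloor>x / l\<rfloor>"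
    have "of_int n \<le> x / l" "x / l \<le> of_int n + 1" unfolding n_def by linarith+
    then have "of_int n * l \<le> x" "x \<le> (of_int n + 1) * l"
      using l_pos by (simp_all only: pos_le_divide_eq pos_divide_le_eq)
    then have "x - of_int n * l \<in> {0..l}" by (auto simp: algebra_simps)
    from x0[OF this] show ?thesis using val_periodic_int[of q "x - of_int n * l" n] by simp
  qed
  then show ?thesis using assms by blast
qed

lemma pval_positive_lower:
  assumes "\<And>x. val (coeff p 0) x > 0"
  obtains b t0 where "b > 0" "0 < t0" "t0 \<le> 1" "\<And>t x. 0 \<le> t \<Longrightarrow> t \<le> t0 \<Longrightarrow> b \<le> pval p t x"
proof -
  obtain b where b: "b > 0" "\<And>x. b \<le> val (coeff p 0) x" using val_positive_lower[OF assms] by blast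
  have "eqm 1 p [:coeff p 0:]" by (simp add: eqm_coeff)
  then obtain C where C: "C \<ge> 0" "\<And>t x. 0 \<le> t \<Longrightarrow> t \<le> 1 \<Longrightarrow> \<bar>pval p t x - pval [:coeff p 0:] t x\<bar> \<le> C * t ^ 1"
    by (rule eqm_pval_bounded) blast
  define t0 where "t0 = min 1 (b / (2 * (C + 1)))"
  have t0: "0 < t0" "t0 \<le> 1" "t0 \<le> b / (2 * (C + 1))" using b C by (auto simp: t0_def)
  have "b / 2 \<le> pval p t x" if "0 \<le> t" "t \<le> t0" for t x
  proof -
    have "C * t \<le> (C + 1) * (b / (2 * (C + 1)))" using that t0 C b by (intro mult_mono) auto
    also have "\<dots> = b / 2" using C by (simp add: field_simps)
    finally have "C * t \<le> b / 2" .
    moreover have "\<bar>pval p t x - val (coeff p 0) x\<bar> \<le> C * t" using C(2)[of t x] that t0 by simp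
    ultimately show ?thesis using b(2)[of x] by linarith
  qed
  then show ?thesis using that[of "b / 2" t0] b t0 by simp
qed

end

text \<open>The second-order Taylor remainder of a power with an explicit constant. In
  \<open>phi_convex\<close> it measures how much the terms of higher order in \<open>t\<close> can
  disturb convexity.\<close>

lemma power_second_order:
  fixes y z M :: real
  assumes "0 \<le> y" "y \<le> M" "0 \<le> z" "z \<le> M" "1 \<le> M"
  shows "\<bar>y ^ Suc n - z ^ Suc n - real (Suc n) * z ^ n * (y - z)\<bar> \<le> (real (Suc n))\<^sup>2 * M ^ Suc n * (y - z)\<^sup>2"
proof (induction n)
  case 0
  then show ?case using assms by simp
next
  case (Suc n)
  define \<Delta> where "\<Delta> = y ^ Suc n - z ^ Suc n - real (Suc n) * z ^ n * (y - z)"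
  have "y ^ Suc (Suc n) - z ^ Suc (Suc n) - real (Suc (Suc n)) * z ^ Suc n * (y - z)
      = y * \<Delta> + real (Suc n) * z ^ n * (y - z)\<^sup>2"
    by (simp add: \<Delta>_def algebra_simps power2_eq_square)
  also have "\<bar>\<dots>\<bar> \<le> \<bar>y * \<Delta>\<bar> + \<bar>real (Suc n) * z ^ n * (y - z)\<^sup>2\<bar>" by (rule abs_triangle_ineq)
  also have "\<bar>y * \<Delta>\<bar> \<le> M * ((real (Suc n))\<^sup>2 * M ^ Suc n * (y - z)\<^sup>2)"
    unfolding abs_mult using assms Suc by (intro mult_mono) (auto simp: \<Delta>_def)
  also have "\<bar>real (Suc n) * z ^ n * (y - z)\<^sup>2\<bar> \<le> real (Suc n) * M ^ Suc (Suc n) * (y - z)\<^sup>2"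
  proof -
    have "z ^ n \<le> M ^ n" using assms by (intro power_mono) auto
    also have "M ^ n \<le> M ^ Suc (Suc n)" using assms by (intro power_increasing) auto
    finally show ?thesis using assms by (simp add: abs_mult mult_left_mono mult_right_mono)
  qed
  also have "M * ((real (Suc n))\<^sup>2 * M ^ Suc n * (y - z)\<^sup>2) + real (Suc n) * M ^ Suc (Suc n) * (y - z)\<^sup>2
      = ((real (Suc n))\<^sup>2 + real (Suc n)) * (M ^ Suc (Suc n) * (y - z)\<^sup>2)"
    by (simp add: algebra_simps)
  also have "\<dots> \<le> (real (Suc (Suc n)))\<^sup>2 * (M ^ Suc (Suc n) * (y - z)\<^sup>2)"
  proof (rule mult_right_mono)
    show "(real (Suc n))\<^sup>2 + real (Suc n) \<le> (real (Suc (Suc n)))\<^sup>2" by (simp add: power2_eq_square algebra_simps)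
    show "0 \<le> M ^ Suc (Suc n) * (y - z)\<^sup>2" using assms by simp
  qed
  finally show ?case by (simp only: mult.assoc)
qed

text \<open>Here the formal data \<open>w\<close> and \<open>v\<close> are tied to an actual table;
  \<open>tx\<close> and \<open>ty\<close> are the coordinates of its unit tangent.\<close>

locale billiard_frame = table \<Omega> \<gamma> l + frame l w v for \<Omega> \<gamma> l w v +
  fixes tx ty :: psm
  assumes val_tx: "\<And>s. val tx s = Re (velocity \<gamma> s)" and val_ty: "\<And>s. val ty s = Im (velocity \<gamma> s)"
    and val_w3: "\<And>s. val w s ^ 3 = curvature \<gamma> s" and w_pos: "\<And>s. val w s > 0"
begin

lemma Re_deriv: "((\<lambda>s. Re (\<gamma> s)) has_real_derivative val tx s) (at s)"
  and Im_deriv: "((\<lambda>s. Im (\<gamma> s)) has_real_derivative val ty s) (at s)"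
  unfolding has_real_derivative_iff_has_vector_derivative val_tx val_ty
  using bounded_linear.has_vector_derivative[OF bounded_linear_Re gamma_deriv]
    bounded_linear.has_vector_derivative[OF bounded_linear_Im gamma_deriv] by auto

lemma d_tx: "d tx = - (w ^ 3 * ty)" and d_ty: "d ty = w ^ 3 * tx"
proof -
  have "((\<lambda>s. Re (velocity \<gamma> s)) has_real_derivative Re (velocity (velocity \<gamma>) s)) (at s)"
    "((\<lambda>s. Im (velocity \<gamma> s)) has_real_derivative Im (velocity (velocity \<gamma>) s)) (at s)" for s
    unfolding has_real_derivative_iff_has_vector_derivative
    using bounded_linear.has_vector_derivative[OF bounded_linear_Re T_deriv]
      bounded_linear.has_vector_derivative[OF bounded_linear_Im T_deriv] by auto
  moreover have "val tx = (\<lambda>s. Re (velocity \<gamma> s))" "val ty = (\<lambda>s. Im (velocity \<gamma> s))"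
    by (auto simp: val_tx val_ty)
  ultimately show "d tx = - (w ^ 3 * ty)" "d ty = w ^ 3 * tx"
    by (auto intro!: d_eqI simp: T' val_w3)
qed

lemma d_pow_T:
  "(d ^^ n) tx = tp (w ^ 3) n * tx - tq (w ^ 3) n * ty"
  "(d ^^ n) ty = tp (w ^ 3) n * ty + tq (w ^ 3) n * tx"
proof (induction n)
  case (Suc n)
  have "(d ^^ Suc n) tx = d (tp (w ^ 3) n * tx - tq (w ^ 3) n * ty)"
    "(d ^^ Suc n) ty = d (tp (w ^ 3) n * ty + tq (w ^ 3) n * tx)"
    by (simp_all add: Suc)
  then show "(d ^^ Suc n) tx = tp (w ^ 3) (Suc n) * tx - tq (w ^ 3) (Suc n) * ty"
    "(d ^^ Suc n) ty = tp (w ^ 3) (Suc n) * ty + tq (w ^ 3) (Suc n) * tx"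
    by (simp_all only: d_simps d_tx d_ty tpq.simps fst_conv snd_conv) (simp_all add: algebra_simps)
qed simp_all

lemma pval_V:
  "pval (VP (w ^ 3) J) t m = (\<Sum>j\<le>J. cf j * val (tp (w ^ 3) (2 * j)) m * t ^ j)"
  "pval (VQ (w ^ 3) J) t m = (\<Sum>j\<le>J. cf j * val (tq (w ^ 3) (2 * j)) m * t ^ j)"
  by (simp_all add: VP_def VQ_def poly_sum poly_monom mult.assoc flip: of_real_power)

end

text \<open>A formal solution of order \<open>I\<close> for a given table. The order stays
  arbitrary, as each order of the asymptotic expansions uses its own solution.\<close>

locale billiard_formal = billiard_frame +
  fixes I :: nat and S G Y :: "psm poly"
  assumes deg_S: "degree S < I + 2" and S_0: "coeff S 0 = 1"
    and S_sq: "eqm (I + 2) (S * S) (V2 (w ^ 3) (I + 1))"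
    and Phi_eq: "eqm (I + 1) (Phi (\<lambda>i. - coeff S (Suc i)) I G Y) [:of_real (- 2 / 3):]"
    and PhiY_eq: "eqm (I + 1) (PhiY (\<lambda>i. - coeff S (Suc i)) I G Y) 0"
    and G_0: "coeff G 0 = G0" and Y_0: "coeff Y 0 = 2 *\<^sub>R v ^ 2" and S_1: "coeff S 1 = - (1 / 24) *\<^sub>R w ^ 6"
begin

definition Dd :: "nat \<Rightarrow> psm" where "Dd i = - coeff S (Suc i)"

lemma pval_S: "pval S t m = 1 - (\<Sum>i\<le>I. val (Dd i) m * t ^ (i + 1))"
proof -
  have "pval S t m = (\<Sum>i\<le>Suc I. val (coeff S i) m * t ^ i)"
    unfolding pval_sum using deg_S by (intro sum.mono_neutral_left) (auto simp: coeff_eq_0)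
  also have "\<dots> = 1 + (\<Sum>i\<le>I. val (coeff S (Suc i)) m * t ^ Suc i)"
    by (subst sum.atMost_Suc_shift) (simp add: S_0)
  finally show ?thesis by (simp add: Dd_def sum_negf)
qed

text \<open>The Taylor polynomial \<open>A\<close> of the chord has norm \<delta> times the root of
  \<open>V\<close>, and the square of \<open>S\<close> agrees with \<open>V\<close> to the required
  order. Dividing the difference of squares by the lower bound \<open>b\<close> of \<open>S\<close>
  gives the difference of the roots.\<close>

lemma chord_expand:
  obtains C \<delta>1 where "C \<ge> 0" "0 < \<delta>1" "\<delta>1 \<le> 1"
    "\<And>m \<delta>. 0 \<le> \<delta> \<Longrightarrow> \<delta> \<le> \<delta>1 \<Longrightarrow>
      \<bar>\<delta> - r (m - \<delta> / 2) (m + \<delta> / 2) - (\<Sum>i\<le>I. val (Dd i) m * \<delta> ^ (2 * i + 3))\<bar> \<le> C * \<delta> ^ (2 * I + 5)"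
proof -
  define J where "J = I + 1"
  obtain Bx where Bx: "Bx \<ge> 0" "\<And>x. \<bar>val ((d ^^ (2 * J + 2)) tx) x\<bar> \<le> Bx" using val_bounded by blast
  obtain By where By: "By \<ge> 0" "\<And>x. \<bar>val ((d ^^ (2 * J + 2)) ty) x\<bar> \<le> By" using val_bounded by blast
  obtain C where C: "C \<ge> 0" "\<And>t x. 0 \<le> t \<Longrightarrow> t \<le> 1 \<Longrightarrow> \<bar>pval (S * S) t x - pval (V2 (w ^ 3) J) t x\<bar> \<le> C * t ^ (I + 2)"
    using eqm_pval_bounded[OF S_sq] unfolding J_def by blast
  have "\<And>x. val (coeff S 0) x > 0" by (simp add: S_0)
  then obtain b t0 where b: "b > 0" "0 < t0" "t0 \<le> 1" "\<And>t x. 0 \<le> t \<Longrightarrow> t \<le> t0 \<Longrightarrow> b \<le> pval S t x"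
    by (rule pval_positive_lower) blast
  have est: "\<bar>\<delta> - r (m - \<delta> / 2) (m + \<delta> / 2) - (\<Sum>i\<le>I. val (Dd i) m * \<delta> ^ (2 * i + 3))\<bar>
      \<le> (Bx + By + C / b) * \<delta> ^ (2 * I + 5)" if \<delta>: "0 \<le> \<delta>" "\<delta> \<le> t0" for m \<delta>
  proof -
    define t where "t = \<delta>\<^sup>2"
    have t: "0 \<le> t" "t \<le> t0" "t \<le> 1"
    proof -
      have "\<delta> * \<delta> \<le> 1 * t0" using \<delta> b by (intro mult_mono) auto
      then show "0 \<le> t" "t \<le> t0" "t \<le> 1" using b by (auto simp: t_def power2_eq_square)
    qed
    define P where "P = pval (VP (w ^ 3) J) t m"
    define Q where "Q = pval (VQ (w ^ 3) J) t m"
    define A where "A = \<delta> *\<^sub>R (Complex P Q * T m)"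
    define c where "c = \<gamma> (m + \<delta> / 2) - \<gamma> (m - \<delta> / 2)"
    have pw: "\<delta> ^ (2 * j + 1) = \<delta> * t ^ j" for j by (simp add: t_def power_mult)
    have "(\<Sum>i\<le>J. \<delta> ^ (2 * i + 1) * (cf i * val ((d ^^ (2 * i)) tx) m)) = Re A"
      unfolding d_pow_T A_def P_def Q_def pval_V pw
      by (simp add: val_tx val_ty sum_distrib_left sum_distrib_right sum_subtractf [symmetric] algebra_simps)
    moreover have "(\<Sum>i\<le>J. \<delta> ^ (2 * i + 1) * (cf i * val ((d ^^ (2 * i)) ty) m)) = Im A"
      unfolding d_pow_T A_def P_def Q_def pval_V pw
      by (simp add: val_tx val_ty sum_distrib_left sum_distrib_right sum.distrib [symmetric] algebra_simps)
    ultimately have "\<bar>Re c - Re A\<bar> \<le> Bx * \<delta> ^ (2 * J + 3)" "\<bar>Im c - Im A\<bar> \<le> By * \<delta> ^ (2 * J + 3)"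
      using sym_taylor[OF Re_deriv Bx(2), of m \<delta>] sym_taylor[OF Im_deriv By(2), of m \<delta>] \<delta>
      by (simp_all add: c_def)
    then have "norm (c - A) \<le> (Bx + By) * \<delta> ^ (2 * J + 3)"
      using cmod_le[of "c - A"] by (simp add: algebra_simps)
    then have cA: "\<bar>norm c - norm A\<bar> \<le> (Bx + By) * \<delta> ^ (2 * J + 3)"
      using norm_triangle_ineq3[of c A] by linarith
    define V where "V = P\<^sup>2 + Q\<^sup>2"
    have nA: "norm A = \<delta> * sqrt V"
      using \<delta> by (simp add: A_def norm_mult complex_norm V_def)
    define \<sigma> where "\<sigma> = pval S t m"
    have \<sigma>: "b \<le> \<sigma>" unfolding \<sigma>_def using b(4) t by blast
    have V0: "0 \<le> V" by (simp add: V_def)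
    have "\<bar>\<sigma>\<^sup>2 - V\<bar> \<le> C * t ^ (I + 2)"
      using C(2)[OF t(1,3), of m] by (simp add: \<sigma>_def V_def V2_def P_def Q_def power2_eq_square)
    moreover have "\<bar>\<sigma> - sqrt V\<bar> * b \<le> \<bar>\<sigma>\<^sup>2 - V\<bar>"
    proof -
      have "\<sigma>\<^sup>2 - V = (\<sigma> - sqrt V) * (\<sigma> + sqrt V)" using V0 by (simp add: algebra_simps power2_eq_square)
      then have "\<bar>\<sigma>\<^sup>2 - V\<bar> = \<bar>\<sigma> - sqrt V\<bar> * \<bar>\<sigma> + sqrt V\<bar>" by (simp add: abs_mult)
      moreover have "b \<le> \<bar>\<sigma> + sqrt V\<bar>" using \<sigma> V0 real_sqrt_ge_zero[OF V0] by linarith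
      ultimately show ?thesis by (simp add: mult_left_mono)
    qed
    ultimately have "\<bar>\<sigma> - sqrt V\<bar> * b \<le> C * t ^ (I + 2)" by linarith
    then have "\<bar>\<sigma> - sqrt V\<bar> \<le> C / b * t ^ (I + 2)" using b(1) by (simp add: field_simps)
    then have "\<delta> * \<bar>\<sigma> - sqrt V\<bar> \<le> \<delta> * (C / b * t ^ (I + 2))" using \<delta> by (intro mult_left_mono)
    moreover have "\<delta> * t ^ (I + 2) = \<delta> ^ (2 * J + 3)"
    proof -
      have "2 * (I + 2) + 1 = 2 * J + 3" by (simp add: J_def)
      then show ?thesis using pw[of "I + 2"] by (simp only:)
    qed
    then have "\<delta> * (C / b * t ^ (I + 2)) = C / b * \<delta> ^ (2 * J + 3)" by (simp add: mult.left_commute)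
    moreover have "\<bar>\<delta> * \<sigma> - \<delta> * sqrt V\<bar> = \<delta> * \<bar>\<sigma> - sqrt V\<bar>"
      using \<delta> by (simp add: abs_mult flip: right_diff_distrib)
    ultimately have "\<bar>\<delta> * \<sigma> - \<delta> * sqrt V\<bar> \<le> C / b * \<delta> ^ (2 * J + 3)" by (simp only:)
    then have "\<bar>norm c - \<delta> * \<sigma>\<bar> \<le> (Bx + By) * \<delta> ^ (2 * J + 3) + C / b * \<delta> ^ (2 * J + 3)"
      using cA unfolding nA by linarith
    then have "\<bar>norm c - \<delta> * \<sigma>\<bar> \<le> (Bx + By + C / b) * \<delta> ^ (2 * J + 3)"
      by (simp only: distrib_right)
    moreover have "r (m - \<delta> / 2) (m + \<delta> / 2) = norm c" by (simp add: r_def c_def norm_minus_commute)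
    moreover have "\<delta> * \<sigma> = \<delta> - (\<Sum>i\<le>I. val (Dd i) m * \<delta> ^ (2 * i + 3))"
    proof -
      have "\<delta> * t ^ (i + 1) = \<delta> ^ (2 * i + 3)" for i
      proof -
        have "2 * (i + 1) + 1 = 2 * i + 3" by simp
        then show ?thesis using pw[of "i + 1"] by (simp only:)
      qed
      then have "\<delta> * (a * t ^ (i + 1)) = a * \<delta> ^ (2 * i + 3)" for a i
        by (simp only: mult.left_commute [of \<delta>])
      then show ?thesis unfolding \<sigma>_def pval_S
        by (simp only: right_diff_distrib sum_distrib_left mult_1_right)
    qed
    moreover have "2 * J + 3 = 2 * I + 5" by (simp add: J_def)
    ultimately show ?thesis by (simp add: abs_minus_commute)
  qed
  show ?thesis by (rule that[OF _ b(2,3) est]) (use Bx By C b in auto)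
qed

lemma val_Dd_0: "val (Dd 0) m = val w m ^ 6 / 24"
  using S_1 by (simp add: Dd_def)

text \<open>On short arcs the leading coefficient k^2/24 dominates the expansion; on long ones
  compactness and \<open>r_less\<close> give a positive minimum. The local expansion alone would not
  control arcs of up to a full turn.\<close>

lemma cubic_lower_bound:
  obtains \<kappa> where "\<kappa> > 0" "\<And>x y. x \<le> y \<Longrightarrow> y \<le> x + l \<Longrightarrow> \<kappa> * (y - x) ^ 3 \<le> y - x - r x y"
proof -
  obtain C \<delta>1 where C: "C \<ge> 0" "0 < \<delta>1" "\<delta>1 \<le> 1"
    "\<And>m \<delta>. 0 \<le> \<delta> \<Longrightarrow> \<delta> \<le> \<delta>1 \<Longrightarrow>
      \<bar>\<delta> - r (m - \<delta> / 2) (m + \<delta> / 2) - (\<Sum>i\<le>I. val (Dd i) m * \<delta> ^ (2 * i + 3))\<bar> \<le> C * \<delta> ^ (2 * I + 5)"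
    using chord_expand by blast
  have "val (Dd 0) x > 0" for x
    unfolding val_Dd_0 using zero_less_power[OF w_pos[of x], of 6] by simp
  then obtain c0 where c0: "c0 > 0" "\<And>x. c0 \<le> val (Dd 0) x" using val_positive_lower[of "Dd 0"] by blast
  have "\<exists>B\<ge>0. \<forall>x. \<bar>val (Dd i) x\<bar> \<le> B" for i by (rule val_bounded)
  then obtain B where B: "\<And>i. B i \<ge> 0" "\<And>i x. \<bar>val (Dd i) x\<bar> \<le> B i" by metis
  define E where "E = (\<Sum>i\<in>{1..I}. B i) + C + 1"
  have E: "E > 0" using B(1) C(1) by (simp add: E_def sum_nonneg add_nonneg_pos)
  define \<delta>2 where "\<delta>2 = min \<delta>1 (c0 / (2 * E))"
  have \<delta>2: "0 < \<delta>2" "\<delta>2 \<le> \<delta>1" "\<delta>2 \<le> c0 / (2 * E)" using C c0 E by (auto simp: \<delta>2_def)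
  have near: "c0 / 2 * (y - x) ^ 3 \<le> y - x - r x y" if "x \<le> y" "y - x \<le> \<delta>2" for x y
  proof -
    define \<delta> m where "\<delta> = y - x" and "m = (x + y) / 2"
    have \<delta>: "0 \<le> \<delta>" "\<delta> \<le> \<delta>2" "\<delta> \<le> \<delta>1" "\<delta> \<le> 1" using that \<delta>2 C by (auto simp: \<delta>_def)
    have xy: "m - \<delta> / 2 = x" "m + \<delta> / 2 = y" by (simp_all add: \<delta>_def m_def field_simps)
    have p4: "\<delta> ^ n \<le> \<delta> ^ 4" if "n \<ge> 4" for n using \<delta> that by (intro power_decreasing) auto
    have "\<bar>\<Sum>i\<in>{1..I}. val (Dd i) m * \<delta> ^ (2 * i + 3)\<bar> \<le> (\<Sum>i\<in>{1..I}. B i * \<delta> ^ 4)"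
    proof (rule order_trans[OF sum_abs], rule sum_mono)
      fix i assume "i \<in> {1..I}"
      then show "\<bar>val (Dd i) m * \<delta> ^ (2 * i + 3)\<bar> \<le> B i * \<delta> ^ 4"
        unfolding abs_mult using B p4[of "2 * i + 3"] \<delta> by (intro mult_mono) auto
    qed
    moreover have "(\<Sum>i\<le>I. val (Dd i) m * \<delta> ^ (2 * i + 3))
        = val (Dd 0) m * \<delta> ^ 3 + (\<Sum>i\<in>{1..I}. val (Dd i) m * \<delta> ^ (2 * i + 3))"
    proof -
      have "{..I} = insert 0 {1..I}" by auto
      then show ?thesis by simp
    qed
    moreover have "C * \<delta> ^ (2 * I + 5) \<le> C * \<delta> ^ 4" using p4 C by (intro mult_left_mono) auto
    moreover have "c0 * \<delta> ^ 3 \<le> val (Dd 0) m * \<delta> ^ 3" using c0 \<delta> by (intro mult_right_mono) auto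
    moreover have "E * \<delta> ^ 4 \<le> c0 / 2 * \<delta> ^ 3"
    proof -
      have "E * \<delta> \<le> E * (c0 / (2 * E))" using \<delta> \<delta>2 E by (intro mult_left_mono) auto
      also have "\<dots> = c0 / 2" using E by simp
      finally have "E * \<delta> * \<delta> ^ 3 \<le> c0 / 2 * \<delta> ^ 3" using \<delta> by (intro mult_right_mono) auto
      then show ?thesis by (simp add: eval_nat_numeral mult.assoc)
    qed
    moreover have "E * \<delta> ^ 4 = (\<Sum>i\<in>{1..I}. B i * \<delta> ^ 4) + C * \<delta> ^ 4 + \<delta> ^ 4"
      by (simp add: E_def distrib_right sum_distrib_right)
    moreover have "0 \<le> \<delta> ^ 4" using \<delta> by simp
    ultimately show ?thesis
      using C(4)[OF \<delta>(1,3), of m] unfolding xy \<delta>_def[symmetric] abs_le_iff by linarith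
  qed
  \<comment> \<open>The period in \<open>x\<close> reduces the long arcs to a compact rectangle,
    which is empty if \<open>\<delta>2\<close> exceeds \<open>l\<close>.\<close>
  have "\<exists>\<mu>>0. \<forall>x y. x + \<delta>2 \<le> y \<longrightarrow> y \<le> x + l \<longrightarrow> \<mu> \<le> y - x - r x y"
  proof (cases "\<delta>2 \<le> l")
    case True
    define f where "f p = snd p - r (fst p) (fst p + snd p)" for p :: "real \<times> real"
    have cont: "continuous_on ({0..l} \<times> {\<delta>2..l}) f"
      unfolding f_def r_def
      by (intro continuous_intros continuous_on_compose2[OF gamma_continuous[of UNIV]]) auto
    have "{0..l} \<times> {\<delta>2..l} \<noteq> {}" using True l_pos by auto
    then obtain p0 where p0: "p0 \<in> {0..l} \<times> {\<delta>2..l}" "\<And>p. p \<in> {0..l} \<times> {\<delta>2..l} \<Longrightarrow> f p0 \<le> f p"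
      using continuous_attains_inf[OF _ _ cont] compact_Times[of "{0..l}" "{\<delta>2..l}"] by auto
    have "f p0 > 0" using p0(1) \<delta>2 r_less[of "fst p0" "fst p0 + snd p0"] by (auto simp: f_def)
    moreover have "f p0 \<le> y - x - r x y" if xy: "x + \<delta>2 \<le> y" "y \<le> x + l" for x y
    proof -
      define n where "n = \<lfloor>x / l\<rfloor>"
      have "of_int n \<le> x / l" "x / l \<le> of_int n + 1" unfolding n_def by linarith+
      then have "of_int n * l \<le> x" "x \<le> (of_int n + 1) * l"
        using l_pos by (simp_all only: pos_le_divide_eq pos_divide_le_eq)
      then have "(x - of_int n * l, y - x) \<in> {0..l} \<times> {\<delta>2..l}" using xy by (auto simp: algebra_simps)
      from p0(2)[OF this] show ?thesis
        using r_period(1)[of "x - of_int n * l" n "x - of_int n * l + (y - x)"]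
          r_period(2)[of x "x - of_int n * l + (y - x)" n] by (simp add: f_def)
    qed
    ultimately show ?thesis by blast
  next
    case False
    then show ?thesis by (intro exI[of _ 1]) auto
  qed
  then obtain \<mu> where \<mu>: "\<mu> > 0" "\<And>x y. x + \<delta>2 \<le> y \<Longrightarrow> y \<le> x + l \<Longrightarrow> \<mu> \<le> y - x - r x y" by blast
  define \<kappa> where "\<kappa> = min (c0 / 2) (\<mu> / l ^ 3)"
  have \<kappa>: "\<kappa> > 0" using c0 \<mu> l_pos by (simp add: \<kappa>_def)
  have \<kappa>1: "\<kappa> \<le> c0 / 2" unfolding \<kappa>_def by (rule min.cobounded1)
  have \<kappa>2: "\<kappa> \<le> \<mu> / l ^ 3" unfolding \<kappa>_def by (rule min.cobounded2)
  have "\<kappa> * (y - x) ^ 3 \<le> y - x - r x y" if xy: "x \<le> y" "y \<le> x + l" for x y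
  proof (cases "y - x \<le> \<delta>2")
    case True
    have "\<kappa> * (y - x) ^ 3 \<le> c0 / 2 * (y - x) ^ 3" using \<kappa>1 xy by (intro mult_right_mono) auto
    then show ?thesis using near[OF xy(1) True] by linarith
  next
    case False
    have "\<kappa> * (y - x) ^ 3 \<le> \<mu> / l ^ 3 * l ^ 3" using \<kappa> \<kappa>2 \<mu>(1) l_pos xy by (intro mult_mono power_mono) auto
    also have "\<dots> = \<mu>" using l_pos by simp
    finally show ?thesis using \<mu>(2)[of x y] False xy by simp
  qed
  then show ?thesis using that \<kappa> by blast
qed

text \<open>The analytic version of \<open>Phi\<close> with a free real \<open>y\<close> in place of
  the series \<open>Y\<close>, since the gap has to be minimized over all arc lengths \<epsilon>
  y.\<close>

definition phi :: "real \<Rightarrow> real \<Rightarrow> real \<Rightarrow> real" where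
  "phi m t y = (\<Sum>i\<le>I. t ^ i * (val (Dd i) m * y ^ (2 * i + 3) - cf i * pval ((dP ^^ (2 * i)) G) t m * y ^ (2 * i + 1)))"

definition phiY :: "real \<Rightarrow> real \<Rightarrow> real \<Rightarrow> real" where
  "phiY m t y = (\<Sum>i\<le>I. t ^ i * (val (Dd i) m * (real (2 * i + 3) * y ^ (2 * i + 2))
     - cf i * pval ((dP ^^ (2 * i)) G) t m * (real (2 * i + 1) * y ^ (2 * i))))"

lemma pval_Phi: "pval (Phi Dd I G Y) t m = phi m t (pval Y t m)"
proof -
  have "pval Y t m ^ (2 * i + 1) * (val (Dd i) m * (pval Y t m)\<^sup>2 - g)
      = val (Dd i) m * pval Y t m ^ (2 * i + 3) - g * pval Y t m ^ (2 * i + 1)" for i g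
    by (simp add: algebra_simps power2_eq_square numeral_3_eq_3)
  then show ?thesis
    unfolding Phi_def phi_def
    by (simp add: poly_sum poly_monom del: power_Suc power_add flip: of_real_power)
qed

lemma pval_PhiY: "pval (PhiY Dd I G Y) t m = phiY m t (pval Y t m)"
  unfolding PhiY_def phiY_def
  by (simp add: poly_sum poly_monom algebra_simps flip: of_real_power)

text \<open>This is \<open>S y - S x - r x y\<close> for
  \<open>S x = x - t * prim (poly G (of_real t)) x\<close>. Lower bounds on it feed
  \<open>beta_ge_dual\<close>, upper bounds feed \<open>beta_le_trial_deviation\<close>.\<close>

definition gap :: "real \<Rightarrow> real \<Rightarrow> real \<Rightarrow> real" where
  "gap t x y = y - x - r x y - t * (prim (poly G (of_real t)) y - prim (poly G (of_real t)) x)"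

text \<open>For \<delta> = \<epsilon> y the terms \<delta>^(2i+3) of the chord and \<epsilon>^2
  \<delta>^(2i+1) of the density have the same order \<epsilon>^(2i+3); this balance is why arcs of
  length proportional to \<epsilon> matter.\<close>

lemma gap_expand:
  assumes M: "M \<ge> 0"
  obtains C \<delta>1 where "C \<ge> 0" "0 < \<delta>1"
    "\<And>\<epsilon> y m. 0 < \<epsilon> \<Longrightarrow> \<epsilon> \<le> 1 \<Longrightarrow> 0 \<le> y \<Longrightarrow> y \<le> M \<Longrightarrow> \<epsilon> * y \<le> \<delta>1 \<Longrightarrow>
      \<bar>gap (\<epsilon>\<^sup>2) (m - \<epsilon> * y / 2) (m + \<epsilon> * y / 2) - \<epsilon> ^ 3 * phi m (\<epsilon>\<^sup>2) y\<bar> \<le> C * \<epsilon> ^ (2 * I + 5)"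
proof -
  obtain C \<delta>1 where C: "C \<ge> 0" "0 < \<delta>1" "\<delta>1 \<le> 1"
    "\<And>m \<delta>. 0 \<le> \<delta> \<Longrightarrow> \<delta> \<le> \<delta>1 \<Longrightarrow>
      \<bar>\<delta> - r (m - \<delta> / 2) (m + \<delta> / 2) - (\<Sum>i\<le>I. val (Dd i) m * \<delta> ^ (2 * i + 3))\<bar> \<le> C * \<delta> ^ (2 * I + 5)"
    using chord_expand by blast
  obtain B where B: "B \<ge> 0" "\<And>t x. 0 \<le> t \<Longrightarrow> t \<le> 1 \<Longrightarrow> \<bar>pval ((dP ^^ (2 * I + 2)) G) t x\<bar> \<le> B"
    using pval_bounded[of "(dP ^^ (2 * I + 2)) G"] by blast
  have "\<bar>gap (\<epsilon>\<^sup>2) (m - \<epsilon> * y / 2) (m + \<epsilon> * y / 2) - \<epsilon> ^ 3 * phi m (\<epsilon>\<^sup>2) y\<bar>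
      \<le> (C * M ^ (2 * I + 5) + B * M ^ (2 * I + 3)) * \<epsilon> ^ (2 * I + 5)"
    if \<epsilon>: "0 < \<epsilon>" "\<epsilon> \<le> 1" and y: "0 \<le> y" "y \<le> M" and \<delta>1: "\<epsilon> * y \<le> \<delta>1" for \<epsilon> y m
  proof -
    define t where "t = \<epsilon>\<^sup>2"
    define \<delta> where "\<delta> = \<epsilon> * y"
    have t: "0 \<le> t" "t \<le> 1" using \<epsilon> by (auto simp: t_def power_le_one)
    have \<delta>: "0 \<le> \<delta>" "\<delta> \<le> \<delta>1" using \<epsilon> y \<delta>1 by (auto simp: \<delta>_def)
    define q where "q = poly G (of_real t)"
    define e1 where "e1 = \<delta> - r (m - \<delta> / 2) (m + \<delta> / 2) - (\<Sum>i\<le>I. val (Dd i) m * \<delta> ^ (2 * i + 3))"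
    define e2 where "e2 = prim q (m + \<delta> / 2) - prim q (m - \<delta> / 2) - (\<Sum>i\<le>I. \<delta> ^ (2 * i + 1) * (cf i * val ((d ^^ (2 * i)) q) m))"
    have e1: "\<bar>e1\<bar> \<le> C * \<delta> ^ (2 * I + 5)" unfolding e1_def by (rule C(4)[OF \<delta>])
    have "\<bar>val ((d ^^ (2 * I + 2)) q) x\<bar> \<le> B" for x
      unfolding q_def d_funpow_poly_of_real using B(2)[OF t] .
    then have e2: "\<bar>e2\<bar> \<le> B * \<delta> ^ (2 * I + 3)"
      unfolding e2_def using sym_taylor[OF prim(2), where q = q and m = m and \<delta> = \<delta> and I = I and B = B] \<delta> by simp
    have "\<epsilon> ^ 3 * phi m t y = (\<Sum>i\<le>I. val (Dd i) m * \<delta> ^ (2 * i + 3)) - t * (\<Sum>i\<le>I. \<delta> ^ (2 * i + 1) * (cf i * val ((d ^^ (2 * i)) q) m))"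
    proof -
      have "\<epsilon> ^ 3 * (t ^ i * (a * y ^ (2 * i + 3) - b * y ^ (2 * i + 1))) = a * \<delta> ^ (2 * i + 3) - t * (\<delta> ^ (2 * i + 1) * b)" for i a b
      proof -
        have a: "\<epsilon> ^ (2 * i) = t ^ i" by (simp add: t_def power_mult)
        have b: "\<epsilon> ^ 3 = t * \<epsilon>" by (simp add: t_def power2_eq_square power3_eq_cube)
        have "\<epsilon> ^ (2 * i + 3) = \<epsilon> ^ 3 * t ^ i" "t * \<epsilon> ^ (2 * i + 1) = \<epsilon> ^ 3 * t ^ i"
          by (simp_all only: power_add a b power_one_right) (simp_all add: mult_ac)
        then show ?thesis unfolding \<delta>_def power_mult_distrib
          by (simp only: mult.assoc[symmetric]) (simp add: algebra_simps)
      qed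
      then show ?thesis
        unfolding phi_def q_def d_funpow_poly_of_real
        by (simp add: sum_distrib_left sum_subtractf[symmetric])
    qed
    then have "gap t (m - \<delta> / 2) (m + \<delta> / 2) - \<epsilon> ^ 3 * phi m t y = e1 - t * e2"
      by (simp add: gap_def e1_def e2_def q_def algebra_simps)
    moreover have "\<bar>e1 - t * e2\<bar> \<le> \<bar>e1\<bar> + t * \<bar>e2\<bar>"
      using abs_triangle_ineq4[of e1 "t * e2"] t by (simp add: abs_mult)
    moreover have "C * \<delta> ^ (2 * I + 5) \<le> C * M ^ (2 * I + 5) * \<epsilon> ^ (2 * I + 5)"
    proof -
      have "\<delta> ^ (2 * I + 5) \<le> (M * \<epsilon>) ^ (2 * I + 5)"
        using \<delta> y \<epsilon> by (intro power_mono) (auto simp: \<delta>_def mult.commute mult_left_mono)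
      then show ?thesis using C by (simp add: power_mult_distrib mult_left_mono mult.assoc)
    qed
    moreover have "t * \<bar>e2\<bar> \<le> B * M ^ (2 * I + 3) * \<epsilon> ^ (2 * I + 5)"
    proof -
      have "\<delta> ^ (2 * I + 3) \<le> (M * \<epsilon>) ^ (2 * I + 3)"
        using \<delta> y \<epsilon> by (intro power_mono) (auto simp: \<delta>_def mult.commute mult_left_mono)
      then have "\<bar>e2\<bar> \<le> B * (M ^ (2 * I + 3) * \<epsilon> ^ (2 * I + 3))"
        using e2 B by (smt (verit) mult_left_mono power_mult_distrib)
      then have "t * \<bar>e2\<bar> \<le> t * (B * (M ^ (2 * I + 3) * \<epsilon> ^ (2 * I + 3)))" using t by (intro mult_left_mono)
      also have "\<dots> = B * M ^ (2 * I + 3) * (\<epsilon>\<^sup>2 * \<epsilon> ^ (2 * I + 3))" by (simp add: t_def)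
      also have "\<epsilon>\<^sup>2 * \<epsilon> ^ (2 * I + 3) = \<epsilon> ^ (2 * I + 5)"
        by (simp add: add.commute flip: power_add)
      finally show ?thesis .
    qed
    ultimately show ?thesis using e1 unfolding t_def[symmetric] \<delta>_def[symmetric]
      by (simp add: distrib_right)
  qed
  then show ?thesis using that[of "C * M ^ (2 * I + 5) + B * M ^ (2 * I + 3)" \<delta>1] C B M by simp
qed

end

context table
begin

text \<open>The counterpart of \<open>beta_ge_dual\<close>. By \<open>average_compare\<close> an
  admissible sequence of the right rotation number is on average no longer than a minimal orbit, so
  one that satisfies the reflection law only approximately still bounds \<beta>.\<close>

lemma beta_le_trial_deviation:
  assumes w: "0 < \<omega>" "\<omega> < 1" and t: "adm t"
    and dev: "\<And>i j :: int. \<bar>t j - t i - of_int (j - i) * \<omega> * l\<bar> \<le> C'"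
    and S: "\<And>x. \<bar>S x - \<kappa> * x\<bar> \<le> C"
    and A: "\<And>i. S (t (i + 1)) - S (t i) + A \<le> r (t i) (t (i + 1))"
  shows "mather_beta \<gamma> l \<omega> \<le> - (\<kappa> * l * \<omega> + A)"
proof -
  obtain s where s: "maximal s" "\<And>i j. \<bar>s j - s i - of_int (j - i) * \<omega> * l\<bar> \<le> l"
    "(\<lambda>N. len s (- int N) (int N) / (2 * real N)) \<longlonglongrightarrow> - mather_beta \<gamma> l \<omega>"
    using beta_spec[of \<omega>] w by auto
  have tel: "(\<Sum>i\<in>{m..<n}. S (t (i + 1)) - S (t i)) = S (t n) - S (t m)" if "m \<le> n" for m n :: int
    using that
  proof (induction n rule: int_ge_induct)
    case (step i)
    then have "{m..<i + 1} = insert i {m..<i}" by auto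
    with step show ?case by simp
  qed simp
  define E where "E = (2 * C + \<bar>\<kappa>\<bar> * C') / 2"
  have le: "(\<kappa> * l * \<omega> + A) - E * (1 / real N) \<le> len t (- int N) (int N) / (2 * real N)"
    if N: "N > 0" for N
  proof -
    have "(\<Sum>i\<in>{- int N..<int N}. (S (t (i + 1)) - S (t i)) + A) \<le> len t (- int N) (int N)"
      unfolding len_def by (intro sum_mono A)
    also have "(\<Sum>i\<in>{- int N..<int N}. (S (t (i + 1)) - S (t i)) + A) = S (t (int N)) - S (t (- int N)) + 2 * real N * A"
      unfolding sum.distrib using tel[of "- int N" "int N"] by simp
    finally have "S (t (int N)) - S (t (- int N)) + 2 * real N * A \<le> len t (- int N) (int N)" .
    moreover have "\<kappa> * (t (int N) - t (- int N)) - 2 * C \<le> S (t (int N)) - S (t (- int N))"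
      using S[of "t (int N)"] S[of "t (- int N)"] by (simp add: algebra_simps abs_le_iff)
    moreover have "\<kappa> * (2 * real N * \<omega> * l) - \<bar>\<kappa>\<bar> * C' \<le> \<kappa> * (t (int N) - t (- int N))"
    proof -
      have "\<bar>t (int N) - t (- int N) - 2 * real N * \<omega> * l\<bar> \<le> C'" using dev[of "int N" "- int N"] by simp
      then have "\<bar>\<kappa> * (t (int N) - t (- int N) - 2 * real N * \<omega> * l)\<bar> \<le> \<bar>\<kappa>\<bar> * C'"
        unfolding abs_mult by (intro mult_left_mono) auto
      then show ?thesis by (simp add: algebra_simps abs_le_iff)
    qed
    moreover have "2 * E = 2 * C + \<bar>\<kappa>\<bar> * C'" by (simp add: E_def)
    moreover have "2 * real N * (\<kappa> * l * \<omega> + A) = \<kappa> * (2 * real N * \<omega> * l) + 2 * real N * A"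
      by (simp add: algebra_simps)
    ultimately have "2 * real N * (\<kappa> * l * \<omega> + A) - 2 * E \<le> len t (- int N) (int N)"
      by linarith
    then have "(2 * real N * (\<kappa> * l * \<omega> + A) - 2 * E) / (2 * real N) \<le> len t (- int N) (int N) / (2 * real N)"
      by (intro divide_right_mono) auto
    moreover have "(2 * real N * (\<kappa> * l * \<omega> + A) - 2 * E) / (2 * real N) = (\<kappa> * l * \<omega> + A) - E * (1 / real N)"
      using N by (simp add: field_simps)
    ultimately show ?thesis by simp
  qed
  have "(\<lambda>N. (\<kappa> * l * \<omega> + A) - E * (1 / real N)) \<longlonglongrightarrow> (\<kappa> * l * \<omega> + A) - E * 0"
    by (intro tendsto_intros lim_1_over_n)
  then have "(\<lambda>N. (\<kappa> * l * \<omega> + A) - E * (1 / real N)) \<longlonglongrightarrow> \<kappa> * l * \<omega> + A" by simp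
  from average_compare[OF s(1) t dev_rotation[OF s(2)] dev_rotation[OF dev] w s(3) le this]
  show ?thesis by simp
qed

end

context billiard_formal
begin

lemma val_v: "val v x = 1 / val w x"
proof -
  have "val w x * val v x = 1" using wv by (metis val_simps(2,5))
  then show ?thesis using w_pos[of x] by (simp add: field_simps)
qed

lemma v_pos: "val v x > 0"
  using w_pos[of x] by (simp add: val_v)

text \<open>The formal equations as estimates: at \<open>Y\<close> the value is -2/3 and the slope
  is 0 up to errors which, multiplied by \<epsilon>^3, have the order \<epsilon>^(2I+5) of the other
  errors.\<close>

lemma phi_at_Y:
  obtains C where "C \<ge> 0"
    "\<And>t m. 0 \<le> t \<Longrightarrow> t \<le> 1 \<Longrightarrow> \<bar>phi m t (pval Y t m) + 2 / 3\<bar> \<le> C * t ^ (I + 1)"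
    "\<And>t m. 0 \<le> t \<Longrightarrow> t \<le> 1 \<Longrightarrow> \<bar>phiY m t (pval Y t m)\<bar> \<le> C * t ^ (I + 1)"
proof -
  have D: "Dd = (\<lambda>i. - coeff S (Suc i))" by (simp add: Dd_def[abs_def])
  obtain C1 where C1: "C1 \<ge> 0" "\<And>t x. 0 \<le> t \<Longrightarrow> t \<le> 1 \<Longrightarrow> \<bar>pval (Phi Dd I G Y) t x - pval [:of_real (- 2 / 3):] t x\<bar> \<le> C1 * t ^ (I + 1)"
    using eqm_pval_bounded[OF Phi_eq] unfolding D by blast
  obtain C2 where C2: "C2 \<ge> 0" "\<And>t x. 0 \<le> t \<Longrightarrow> t \<le> 1 \<Longrightarrow> \<bar>pval (PhiY Dd I G Y) t x - pval 0 t x\<bar> \<le> C2 * t ^ (I + 1)"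
    using eqm_pval_bounded[OF PhiY_eq] unfolding D by blast
  show ?thesis
  proof (rule that[of "C1 + C2"])
    fix t m :: real assume t: "0 \<le> t" "t \<le> 1"
    have nn: "0 \<le> C1 * t ^ (I + 1)" "0 \<le> C2 * t ^ (I + 1)"
      using t C1(1) C2(1) by (auto intro!: mult_nonneg_nonneg)
    have "pval [:of_real (- 2 / 3):] t m = - 2 / 3"
      by (simp only: poly_pCons poly_0 mult_zero_right add_0_right val_simps)
    then show "\<bar>phi m t (pval Y t m) + 2 / 3\<bar> \<le> (C1 + C2) * t ^ (I + 1)"
      using C1(2)[OF t, of m] nn unfolding pval_Phi distrib_right by linarith
    have "pval 0 t m = 0" by simp
    then show "\<bar>phiY m t (pval Y t m)\<bar> \<le> (C1 + C2) * t ^ (I + 1)"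
      using C2(2)[OF t, of m] nn unfolding pval_PhiY distrib_right by linarith
  qed (use C1 C2 in auto)
qed

lemma Y_lower:
  obtains b t0 where "b > 0" "0 < t0" "t0 \<le> 1" "\<And>t x. 0 \<le> t \<Longrightarrow> t \<le> t0 \<Longrightarrow> b \<le> pval Y t x"
proof (rule pval_positive_lower[of Y])
  show "val (coeff Y 0) x > 0" for x using v_pos[of x] by (simp add: Y_0)
qed (use that in blast)

text \<open>For \<open>i = 0\<close> the linear term drops out of the second-order remainder, and
  the cubic one leaves \<open>(y + 2 * z) * (y - z)\<^sup>2\<close> times a positive coefficient,
  with \<open>z\<close> bounded below. All other remainders also contain the square of
  \<open>y - z\<close> and a factor \<open>t\<close>.\<close>

lemma phi_convex:
  assumes M: "1 \<le> M" "\<And>t m. 0 \<le> t \<Longrightarrow> t \<le> 1 \<Longrightarrow> pval Y t m \<le> M"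
  obtains t1 where "0 < t1" "t1 \<le> 1"
    "\<And>t m y. 0 \<le> t \<Longrightarrow> t \<le> t1 \<Longrightarrow> 0 \<le> y \<Longrightarrow> y \<le> M \<Longrightarrow>
      phi m t (pval Y t m) + phiY m t (pval Y t m) * (y - pval Y t m) \<le> phi m t y"
proof -
  obtain b t0 where b: "b > 0" "0 < t0" "t0 \<le> 1" "\<And>t x. 0 \<le> t \<Longrightarrow> t \<le> t0 \<Longrightarrow> b \<le> pval Y t x"
    by (rule Y_lower) blast
  have "val (Dd 0) x > 0" for x
    unfolding val_Dd_0 using zero_less_power[OF w_pos[of x], of 6] by simp
  then obtain c0 where c0: "c0 > 0" "\<And>x. c0 \<le> val (Dd 0) x" using val_positive_lower[of "Dd 0"] by blast
  have "\<exists>B\<ge>0. \<forall>x. \<bar>val (Dd i) x\<bar> \<le> B" for i by (rule val_bounded)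
  then obtain B where B: "\<And>i. B i \<ge> 0" "\<And>i x. \<bar>val (Dd i) x\<bar> \<le> B i" by metis
  have "\<exists>B\<ge>0. \<forall>t x. 0 \<le> t \<longrightarrow> t \<le> 1 \<longrightarrow> \<bar>pval ((dP ^^ (2 * i)) G) t x\<bar> \<le> B" for i by (rule pval_bounded)
  then obtain B' where B': "\<And>i. B' i \<ge> 0"
    "\<And>i t x. 0 \<le> t \<Longrightarrow> t \<le> 1 \<Longrightarrow> \<bar>pval ((dP ^^ (2 * i)) G) t x\<bar> \<le> B' i" by metis
  define K where "K i = B i * ((real (2 * i + 3))\<^sup>2 * M ^ (2 * i + 3)) + cf i * B' i * ((real (2 * i + 1))\<^sup>2 * M ^ (2 * i + 1))" for i
  have K0: "K i \<ge> 0" for i using B B' M cf_pos[of i] by (auto simp: K_def intro!: add_nonneg_nonneg mult_nonneg_nonneg)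
  define E where "E = (\<Sum>i\<in>{1..I}. K i) + 1"
  have E: "E > 0" using K0 by (simp add: E_def sum_nonneg add_nonneg_pos)
  \<comment> \<open>For \<open>t \<le> t1\<close> the perturbation \<open>t * E\<close> is at most
    the convexity constant \<open>2 * c0 * b\<close>.\<close>
  define t1 where "t1 = min t0 (2 * c0 * b / E)"
  have t1: "0 < t1" "t1 \<le> t0" "t1 \<le> 2 * c0 * b / E" using b c0 E by (auto simp: t1_def)
  have "phi m t (pval Y t m) + phiY m t (pval Y t m) * (y - pval Y t m) \<le> phi m t y"
    if t: "0 \<le> t" "t \<le> t1" and y: "0 \<le> y" "y \<le> M" for t m y
  proof -
    have t1': "t \<le> 1" "t \<le> t0" using t t1 b by auto
    define z where "z = pval Y t m"
    have z: "b \<le> z" "0 \<le> z" "z \<le> M" using b(4)[of t m] b(1) M(2)[of t m] t t1' by (auto simp: z_def)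
    define \<Delta> where "\<Delta> n = y ^ Suc n - z ^ Suc n - real (Suc n) * z ^ n * (y - z)" for n
    define s where "s = (y - z)\<^sup>2"
    have s0: "s \<ge> 0" by (simp add: s_def)
    have \<Delta>: "\<bar>\<Delta> n\<bar> \<le> (real (Suc n))\<^sup>2 * M ^ Suc n * s" for n
      unfolding \<Delta>_def s_def by (rule power_second_order) (use y z M in auto)
    define g where "g i = pval ((dP ^^ (2 * i)) G) t m" for i
    define R where "R i = t ^ i * (val (Dd i) m * \<Delta> (2 * i + 2) - cf i * g i * \<Delta> (2 * i))" for i
    have "phi m t y - phi m t z - phiY m t z * (y - z) = (\<Sum>i\<le>I. R i)"
    proof -
      have "phi m t y - phi m t z - phiY m t z * (y - z)
        = (\<Sum>i\<le>I. t ^ i * (val (Dd i) m * y ^ (2 * i + 3) - cf i * g i * y ^ (2 * i + 1))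
          - t ^ i * (val (Dd i) m * z ^ (2 * i + 3) - cf i * g i * z ^ (2 * i + 1))
          - t ^ i * (val (Dd i) m * (real (2 * i + 3) * z ^ (2 * i + 2)) - cf i * g i * (real (2 * i + 1) * z ^ (2 * i))) * (y - z))"
        unfolding phi_def phiY_def g_def sum_subtractf sum_distrib_right ..
      also have "\<dots> = (\<Sum>i\<le>I. R i)"
      proof (intro sum.cong refl)
        fix i
        have "\<Delta> (2 * i + 2) = y ^ (2 * i + 3) - z ^ (2 * i + 3) - real (2 * i + 3) * z ^ (2 * i + 2) * (y - z)"
          "\<Delta> (2 * i) = y ^ (2 * i + 1) - z ^ (2 * i + 1) - real (2 * i + 1) * z ^ (2 * i) * (y - z)"
          unfolding \<Delta>_def by (simp_all add: numeral_3_eq_3)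
        then show "t ^ i * (val (Dd i) m * y ^ (2 * i + 3) - cf i * g i * y ^ (2 * i + 1))
          - t ^ i * (val (Dd i) m * z ^ (2 * i + 3) - cf i * g i * z ^ (2 * i + 1))
          - t ^ i * (val (Dd i) m * (real (2 * i + 3) * z ^ (2 * i + 2)) - cf i * g i * (real (2 * i + 1) * z ^ (2 * i))) * (y - z) = R i"
          unfolding R_def by (simp only:) (simp only: right_diff_distrib left_diff_distrib mult_ac; simp)
      qed
      finally show ?thesis .
    qed
    also have "\<dots> = R 0 + (\<Sum>i\<in>{1..I}. R i)"
    proof -
      have "{..I} = insert 0 {1..I}" by auto
      then show ?thesis by simp
    qed
    finally have eq: "phi m t y - phi m t z - phiY m t z * (y - z) = R 0 + (\<Sum>i\<in>{1..I}. R i)" .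
    have R0: "2 * c0 * b * s \<le> R 0"
    proof -
      have "\<Delta> 2 = (y + 2 * z) * s" by (simp add: \<Delta>_def s_def power2_eq_square eval_nat_numeral algebra_simps)
      moreover have "\<Delta> 0 = 0" by (simp add: \<Delta>_def)
      then have "R 0 = val (Dd 0) m * \<Delta> 2" by (simp add: R_def numeral_2_eq_2)
      ultimately have "R 0 = val (Dd 0) m * (y + 2 * z) * s" by simp
      moreover have "c0 * (2 * b) \<le> val (Dd 0) m * (y + 2 * z)"
        using c0 y z b by (intro mult_mono) (auto intro: order_trans[OF less_imp_le[OF c0(1)]])
      ultimately show ?thesis using s0 by (metis mult.assoc mult.commute mult_right_mono)
    qed
    have "\<bar>\<Sum>i\<in>{1..I}. R i\<bar> \<le> (\<Sum>i\<in>{1..I}. t * (K i * s))"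
    proof (rule order_trans[OF sum_abs], rule sum_mono)
      fix i assume i: "i \<in> {1..I}"
      have "t ^ i \<le> t ^ 1" using i t t1' by (intro power_decreasing) auto
      moreover have "\<bar>val (Dd i) m * \<Delta> (2 * i + 2) - cf i * g i * \<Delta> (2 * i)\<bar> \<le> K i * s"
      proof -
        have "\<bar>val (Dd i) m * \<Delta> (2 * i + 2)\<bar> \<le> B i * ((real (2 * i + 3))\<^sup>2 * M ^ (2 * i + 3) * s)"
          unfolding abs_mult using B \<Delta>[of "2 * i + 2"] by (intro mult_mono) (auto simp: numeral_3_eq_3)
        moreover have "\<bar>cf i * g i * \<Delta> (2 * i)\<bar> \<le> cf i * B' i * ((real (2 * i + 1))\<^sup>2 * M ^ (2 * i + 1) * s)"
          unfolding abs_mult using B' cf_pos[of i] \<Delta>[of "2 * i"] t t1'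
          by (intro mult_mono) (auto simp: g_def)
        ultimately show ?thesis
          using abs_triangle_ineq4[of "val (Dd i) m * \<Delta> (2 * i + 2)" "cf i * g i * \<Delta> (2 * i)"]
          by (simp only: K_def distrib_right mult.assoc)
      qed
      ultimately show "\<bar>R i\<bar> \<le> t * (K i * s)"
        unfolding R_def abs_mult using t by (intro mult_mono) auto
    qed
    also have "\<dots> \<le> t * (E * s)"
      unfolding E_def sum_distrib_left[symmetric] sum_distrib_right[symmetric] using t s0
      by (intro mult_left_mono mult_right_mono) auto
    also have "\<dots> \<le> 2 * c0 * b / E * (E * s)" using t t1 E s0 by (intro mult_right_mono) auto
    also have "\<dots> = 2 * c0 * b * s" using E by simp
    finally show ?thesis using R0 eq unfolding z_def[symmetric] by linarith
  qed
  then show ?thesis using that t1 b by fastforce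
qed

lemma Y_bounded: obtains Ymax where "1 \<le> Ymax" "\<And>t m. 0 \<le> t \<Longrightarrow> t \<le> 1 \<Longrightarrow> \<bar>pval Y t m\<bar> \<le> Ymax"
proof -
  obtain C where C: "C \<ge> 0" "\<And>t m. 0 \<le> t \<Longrightarrow> t \<le> 1 \<Longrightarrow> \<bar>pval Y t m\<bar> \<le> C"
    using pval_bounded[of Y] by blast
  have "\<bar>pval Y t m\<bar> \<le> C + 1" if "0 \<le> t" "t \<le> 1" for t m using C(2)[OF that, of m] by linarith
  then show ?thesis using that[of "C + 1"] C(1) by auto
qed

lemma eps_powers: "\<epsilon> ^ 3 * (\<epsilon>\<^sup>2) ^ (I + 1) = \<epsilon> ^ (2 * I + 5)" for \<epsilon> :: real
proof -
  have "3 + 2 * (I + 1) = 2 * I + 5" by simp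
  then show ?thesis by (metis power_add power_mult)
qed

text \<open>Up to arc length \<open>M * \<epsilon>\<close>, convexity keeps \<open>phi\<close> above
  its tangent at \<open>Y\<close>, which is almost horizontal at height -2/3. For longer arcs the
  cubic deficit exceeds the integral of the density, and the gap is nonnegative.\<close>

lemma gap_lower:
  obtains C \<epsilon>0 where "C \<ge> 0" "0 < \<epsilon>0" "\<epsilon>0 \<le> 1"
    "\<And>\<epsilon> x y. 0 < \<epsilon> \<Longrightarrow> \<epsilon> \<le> \<epsilon>0 \<Longrightarrow> x \<le> y \<Longrightarrow> y \<le> x + l \<Longrightarrow>
      - (2 / 3 * \<epsilon> ^ 3 + C * \<epsilon> ^ (2 * I + 5)) \<le> gap (\<epsilon>\<^sup>2) x y"
proof -
  obtain \<kappa> where \<kappa>: "\<kappa> > 0" "\<And>x y. x \<le> y \<Longrightarrow> y \<le> x + l \<Longrightarrow> \<kappa> * (y - x) ^ 3 \<le> y - x - r x y"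
    using cubic_lower_bound by blast
  obtain CG where CG: "CG \<ge> 0" "\<And>t m. 0 \<le> t \<Longrightarrow> t \<le> 1 \<Longrightarrow> \<bar>pval G t m\<bar> \<le> CG"
    using pval_bounded[of G] by blast
  obtain Ymax where Ymax: "1 \<le> Ymax" "\<And>t m. 0 \<le> t \<Longrightarrow> t \<le> 1 \<Longrightarrow> \<bar>pval Y t m\<bar> \<le> Ymax"
    using Y_bounded by blast
  \<comment> \<open>The first summand keeps \<open>Y\<close> inside the range of convexity; the
    second, together with \<open>M \<ge> 1\<close>, makes the cubic bound win from
    \<open>M * \<epsilon>\<close> on.\<close>
  define M where "M = Ymax + CG / \<kappa>"
  have "0 \<le> CG / \<kappa>" using CG \<kappa> by simp
  then have M: "1 \<le> M" "Ymax \<le> M" "CG / \<kappa> \<le> M" using Ymax unfolding M_def by linarith+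
  have MY: "pval Y t m \<le> M" if "0 \<le> t" "t \<le> 1" for t m using Ymax(2)[OF that, of m] M by linarith
  obtain t1 where t1: "0 < t1" "t1 \<le> 1" "\<And>t m y. 0 \<le> t \<Longrightarrow> t \<le> t1 \<Longrightarrow> 0 \<le> y \<Longrightarrow> y \<le> M \<Longrightarrow>
      phi m t (pval Y t m) + phiY m t (pval Y t m) * (y - pval Y t m) \<le> phi m t y"
    using phi_convex[OF M(1) MY] by blast
  have "M \<ge> 0" using M by simp
  then obtain C \<delta>1 where C: "C \<ge> 0" "0 < \<delta>1"
    "\<And>\<epsilon> y m. 0 < \<epsilon> \<Longrightarrow> \<epsilon> \<le> 1 \<Longrightarrow> 0 \<le> y \<Longrightarrow> y \<le> M \<Longrightarrow> \<epsilon> * y \<le> \<delta>1 \<Longrightarrow>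
      \<bar>gap (\<epsilon>\<^sup>2) (m - \<epsilon> * y / 2) (m + \<epsilon> * y / 2) - \<epsilon> ^ 3 * phi m (\<epsilon>\<^sup>2) y\<bar> \<le> C * \<epsilon> ^ (2 * I + 5)"
    using gap_expand by blast
  obtain C1 where C1: "C1 \<ge> 0"
    "\<And>t m. 0 \<le> t \<Longrightarrow> t \<le> 1 \<Longrightarrow> \<bar>phi m t (pval Y t m) + 2 / 3\<bar> \<le> C1 * t ^ (I + 1)"
    "\<And>t m. 0 \<le> t \<Longrightarrow> t \<le> 1 \<Longrightarrow> \<bar>phiY m t (pval Y t m)\<bar> \<le> C1 * t ^ (I + 1)"
    using phi_at_Y by blast
  define \<epsilon>0 where "\<epsilon>0 = min t1 (\<delta>1 / M)"
  have \<epsilon>0: "0 < \<epsilon>0" "\<epsilon>0 \<le> t1" "\<epsilon>0 \<le> \<delta>1 / M" using t1 C M by (auto simp: \<epsilon>0_def)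
  have "- (2 / 3 * \<epsilon> ^ 3 + (C1 + 2 * M * C1 + C) * \<epsilon> ^ (2 * I + 5)) \<le> gap (\<epsilon>\<^sup>2) x y"
    if \<epsilon>: "0 < \<epsilon>" "\<epsilon> \<le> \<epsilon>0" and xy: "x \<le> y" "y \<le> x + l" for \<epsilon> x y
  proof -
    define t where "t = \<epsilon>\<^sup>2"
    define \<delta> where "\<delta> = y - x"
    have \<epsilon>1: "\<epsilon> \<le> 1" "\<epsilon> \<le> t1" using \<epsilon> \<epsilon>0 t1 by auto
    have "\<epsilon> * \<epsilon> \<le> 1 * t1" using \<epsilon> \<epsilon>1 by (intro mult_mono) auto
    then have t: "0 \<le> t" "t \<le> t1" "t \<le> 1" using t1 by (auto simp: t_def power2_eq_square)
    have \<delta>0: "\<delta> \<ge> 0" using xy by (simp add: \<delta>_def)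
    show ?thesis
    proof (cases "M * \<epsilon> \<le> \<delta>")
      case True
      have "CG \<le> \<kappa> * M" using M(3) \<kappa> by (simp add: field_simps)
      also have "\<dots> \<le> \<kappa> * M\<^sup>2" using M \<kappa> by (simp add: power2_eq_square)
      finally have "CG * t \<le> \<kappa> * M\<^sup>2 * t" using t by (intro mult_right_mono)
      also have "\<dots> = \<kappa> * (M * \<epsilon>)\<^sup>2" by (simp add: t_def power_mult_distrib)
      also have "\<dots> \<le> \<kappa> * \<delta>\<^sup>2" using True \<kappa> M \<epsilon> by (intro mult_left_mono power_mono) auto
      finally have "CG * t * \<delta> \<le> \<kappa> * \<delta>\<^sup>2 * \<delta>" using \<delta>0 by (intro mult_right_mono)
      then have "CG * t * \<delta> \<le> \<kappa> * \<delta> ^ 3" by (simp add: power2_eq_square power3_eq_cube mult.assoc)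
      moreover have "t * (prim (poly G (of_real t)) y - prim (poly G (of_real t)) x) \<le> t * (CG * \<delta>)"
      proof -
        have "\<bar>prim (poly G (of_real t)) y - prim (poly G (of_real t)) x\<bar> \<le> CG * (y - x)"
          by (rule prim_lipschitz) (use CG t xy in auto)
        then show ?thesis using t unfolding \<delta>_def by (intro mult_left_mono) auto
      qed
      ultimately have "0 \<le> gap t x y"
        using \<kappa>(2)[OF xy] unfolding gap_def \<delta>_def by (simp add: algebra_simps)
      moreover have "0 \<le> 2 / 3 * \<epsilon> ^ 3 + (C1 + 2 * M * C1 + C) * \<epsilon> ^ (2 * I + 5)"
        using \<epsilon> C C1 M by (intro add_nonneg_nonneg mult_nonneg_nonneg) auto
      ultimately show ?thesis by (simp add: t_def)
    next
      case False
      define m where "m = (x + y) / 2"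
      define u where "u = \<delta> / \<epsilon>"
      have eu: "\<epsilon> * u = \<delta>" using \<epsilon> by (simp add: u_def)
      have u: "0 \<le> u" "u \<le> M" using False \<epsilon> \<delta>0 by (auto simp: u_def field_simps)
      have "\<epsilon> * u \<le> \<delta>1 / M * M" using \<epsilon> \<epsilon>0 u M C by (intro mult_mono) auto
      then have "\<epsilon> * u \<le> \<delta>1" using M by simp
      from C(3)[OF \<epsilon>(1) \<epsilon>1(1) u this, of m]
      have ge: "\<bar>gap t x y - \<epsilon> ^ 3 * phi m t u\<bar> \<le> C * \<epsilon> ^ (2 * I + 5)"
        unfolding eu t_def m_def \<delta>_def by (simp add: field_simps)
      define z where "z = pval Y t m"
      have "\<bar>u - z\<bar> \<le> 2 * M" using u Ymax(2)[OF t(1,3), of m] M by (auto simp: z_def abs_le_iff)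
      then have "\<bar>phiY m t z * (u - z)\<bar> \<le> C1 * t ^ (I + 1) * (2 * M)"
        unfolding abs_mult using C1(3)[OF t(1,3), of m] t C1(1)
        by (intro mult_mono) (auto simp: z_def)
      moreover have "\<bar>phi m t z + 2 / 3\<bar> \<le> C1 * t ^ (I + 1)"
        using C1(2)[OF t(1,3), of m] by (simp add: z_def)
      moreover have "phi m t z + phiY m t z * (u - z) \<le> phi m t u"
        using t1(3)[OF t(1,2) u, of m] by (simp add: z_def)
      moreover have "(C1 + 2 * M * C1) * t ^ (I + 1) = C1 * t ^ (I + 1) + C1 * t ^ (I + 1) * (2 * M)"
        by (simp add: algebra_simps)
      ultimately have "- 2 / 3 - (C1 + 2 * M * C1) * t ^ (I + 1) \<le> phi m t u" by linarith
      then have "\<epsilon> ^ 3 * (- 2 / 3 - (C1 + 2 * M * C1) * t ^ (I + 1)) \<le> \<epsilon> ^ 3 * phi m t u"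
        using \<epsilon> by (intro mult_left_mono) auto
      moreover have "\<epsilon> ^ 3 * (- 2 / 3 - (C1 + 2 * M * C1) * t ^ (I + 1))
          = - (2 / 3 * \<epsilon> ^ 3) - (C1 + 2 * M * C1) * \<epsilon> ^ (2 * I + 5)"
      proof -
        have "e * (- 2 / 3 - X * P) = - (2 / 3 * e) - X * (e * P)" for e X P :: real
          by (simp add: algebra_simps)
        then show ?thesis unfolding t_def eps_powers[of \<epsilon>, symmetric] by (simp only:)
      qed
      ultimately show ?thesis using ge unfolding t_def[symmetric]
        by (simp only: distrib_right)
    qed
  qed
  then show ?thesis using that[of "C1 + 2 * M * C1 + C" \<epsilon>0] C C1 M \<epsilon>0 t1 by simp
qed


text \<open>\<open>t * H\<close> is, up to a factor of \<open>\<epsilon>\<close>, the derivative in \<open>\<epsilon>\<close> of \<open>t * G\<close> where \<open>t = \<epsilon>^2\<close>; it is the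
  density of the approximately invariant measure.\<close>

definition H :: "psm poly" where
  "H = (\<Sum>i\<le>degree G. monom (real (2 * (i + 1)) *\<^sub>R coeff G i) i)"

lemma coeff_H: "coeff H i = real (2 * (i + 1)) *\<^sub>R coeff G i"
  by (simp add: H_def coeff_sum coeff_eq_0)

lemma pval_H: "pval H t x = (\<Sum>i\<le>degree G. real (2 * (i + 1)) * val (coeff G i) x * t ^ i)"
  by (simp add: H_def poly_sum poly_monom mult.assoc flip: of_real_power)

lemma prim_H_diff:
  "prim (poly H (of_real t)) y - prim (poly H (of_real t)) x
    = (\<Sum>i\<le>degree G. real (2 * (i + 1)) * (prim (coeff G i) y - prim (coeff G i) x) * t ^ i)"
proof -
  have "((\<lambda>x. \<Sum>i\<le>degree G. real (2 * (i + 1)) * prim (coeff G i) x * t ^ i) has_real_derivative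
      pval H t x) (at x)" for x
    unfolding pval_H by (intro DERIV_sum DERIV_cmult_right DERIV_cmult prim)
  from prim_diff_unique[OF this, of y x] show ?thesis
    by (simp add: sum_subtractf[symmetric] algebra_simps)
qed

lemma prim_G_diff:
  "prim (poly G (of_real t)) y - prim (poly G (of_real t)) x
    = (\<Sum>i\<le>degree G. (prim (coeff G i) y - prim (coeff G i) x) * t ^ i)"
  by (simp add: prim_sum_powers sum_subtractf[symmetric] left_diff_distrib)

lemma H_lower:
  obtains h tH where "h > 0" "0 < tH" "tH \<le> 1" "\<And>t x. 0 \<le> t \<Longrightarrow> t \<le> tH \<Longrightarrow> h \<le> pval H t x"
proof (rule pval_positive_lower[of H])
  show "val (coeff H 0) x > 0" for x using w_pos[of x] by (simp add: coeff_H G_0 G0_def)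
qed (use that in blast)

text \<open>The envelope argument. For fixed \<open>x\<close> and \<open>y\<close> let
  \<open>E e\<close> be the gap at parameter \<open>e\<close> plus 2/3 e^3. Its derivative is
  \<open>e * k e\<close> with \<open>k\<close> increasing, and the hypothesis on \<open>H\<close>
  says that \<open>k\<close> vanishes at \<epsilon>; so \<epsilon> minimizes \<open>E\<close>. For
  some other \<open>e\<close> the given arc is the optimal one, and there \<open>E\<close> is
  O(e^(2I+5)). In this way no formal identity between \<open>Y\<close> and \<open>H\<close> has to
  be proved.\<close>

lemma gap_upper:
  obtains C \<epsilon>0 where "C \<ge> 0" "0 < \<epsilon>0" "\<epsilon>0 \<le> 1"
    "\<And>\<epsilon> x y. 0 < \<epsilon> \<Longrightarrow> \<epsilon> \<le> \<epsilon>0 \<Longrightarrow> x \<le> y \<Longrightarrow> y \<le> x + l \<Longrightarrow>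
      prim (poly H (of_real (\<epsilon>\<^sup>2))) y - prim (poly H (of_real (\<epsilon>\<^sup>2))) x = 2 * \<epsilon> \<Longrightarrow>
      gap (\<epsilon>\<^sup>2) x y \<le> - (2 / 3 * \<epsilon> ^ 3) + C * \<epsilon> ^ (2 * I + 5)"
proof -
  obtain h tH where h: "h > 0" "0 < tH" "tH \<le> 1" "\<And>t x. 0 \<le> t \<Longrightarrow> t \<le> tH \<Longrightarrow> h \<le> pval H t x"
    by (rule H_lower) blast
  obtain b t0 where b: "b > 0" "0 < t0" "t0 \<le> 1" "\<And>t x. 0 \<le> t \<Longrightarrow> t \<le> t0 \<Longrightarrow> b \<le> pval Y t x"
    by (rule Y_lower) blast
  obtain M where M: "1 \<le> M" "\<And>t m. 0 \<le> t \<Longrightarrow> t \<le> 1 \<Longrightarrow> \<bar>pval Y t m\<bar> \<le> M"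
    by (rule Y_bounded) blast
  have "M \<ge> 0" using M by simp
  then obtain C \<delta>1 where C: "C \<ge> 0" "0 < \<delta>1"
    "\<And>\<epsilon> y m. 0 < \<epsilon> \<Longrightarrow> \<epsilon> \<le> 1 \<Longrightarrow> 0 \<le> y \<Longrightarrow> y \<le> M \<Longrightarrow> \<epsilon> * y \<le> \<delta>1 \<Longrightarrow>
      \<bar>gap (\<epsilon>\<^sup>2) (m - \<epsilon> * y / 2) (m + \<epsilon> * y / 2) - \<epsilon> ^ 3 * phi m (\<epsilon>\<^sup>2) y\<bar> \<le> C * \<epsilon> ^ (2 * I + 5)"
    using gap_expand by blast
  obtain C1 where C1: "C1 \<ge> 0"
    "\<And>t m. 0 \<le> t \<Longrightarrow> t \<le> 1 \<Longrightarrow> \<bar>phi m t (pval Y t m) + 2 / 3\<bar> \<le> C1 * t ^ (I + 1)"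
    by (rule phi_at_Y) blast
  have "\<exists>B\<ge>0. \<forall>x. \<bar>val (coeff G i) x\<bar> \<le> B" for i by (rule val_bounded)
  then obtain B where B: "\<And>i. B i \<ge> 0" "\<And>i x. \<bar>val (coeff G i) x\<bar> \<le> B i" by metis
  define n where "n = degree G"
  define Q where "Q = (\<Sum>i\<le>n. real (2 * (i + 1)) * real (2 * i) * B i) + 1"
  have Q: "Q > 0" using B by (auto simp: Q_def intro!: add_nonneg_pos sum_nonneg)
  \<comment> \<open>The bounds serve the expansion of the gap, the monotonicity of \<open>k\<close>
    (its derivative is at least 1 for arcs up to \<open>1 / Q\<close>) and the intermediate value
    argument on \<open>[0, t0]\<close>.\<close>
  define \<delta>0 where "\<delta>0 = min (min \<delta>1 (1 / Q)) (t0 * b)"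
  have \<delta>0: "0 < \<delta>0" "\<delta>0 \<le> \<delta>1" "\<delta>0 \<le> 1 / Q" "\<delta>0 \<le> t0 * b" using C Q b by (auto simp: \<delta>0_def)
  define \<epsilon>0 where "\<epsilon>0 = min tH (\<delta>0 * h / 2)"
  have \<epsilon>0: "0 < \<epsilon>0" "\<epsilon>0 \<le> tH" "\<epsilon>0 \<le> \<delta>0 * h / 2" using h \<delta>0 by (auto simp: \<epsilon>0_def)
  define K where "K = 2 / (h * b)"
  have "gap (\<epsilon>\<^sup>2) x y \<le> - (2 / 3 * \<epsilon> ^ 3) + ((C + C1) * K ^ (2 * I + 5)) * \<epsilon> ^ (2 * I + 5)"
    if \<epsilon>: "0 < \<epsilon>" "\<epsilon> \<le> \<epsilon>0" and xy: "x \<le> y" "y \<le> x + l"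
      and HH: "prim (poly H (of_real (\<epsilon>\<^sup>2))) y - prim (poly H (of_real (\<epsilon>\<^sup>2))) x = 2 * \<epsilon>" for \<epsilon> x y
  proof -
    have \<epsilon>1: "\<epsilon> \<le> 1" "\<epsilon> \<le> tH" using \<epsilon> \<epsilon>0 h by auto
    define \<delta> where "\<delta> = y - x"
    have "\<epsilon> * \<epsilon> \<le> 1 * tH" using \<epsilon> \<epsilon>1 by (intro mult_mono) auto
    then have "\<epsilon>\<^sup>2 \<le> tH" by (simp add: power2_eq_square)
    then have "h * (y - x) \<le> prim (poly H (of_real (\<epsilon>\<^sup>2))) y - prim (poly H (of_real (\<epsilon>\<^sup>2))) x"
      using h(4)[of "\<epsilon>\<^sup>2"] xy by (intro prim_lower) (simp_all del: of_real_power)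
    then have h\<delta>: "h * \<delta> \<le> 2 * \<epsilon>" using HH by (simp add: \<delta>_def)
    have "h * \<delta> \<le> h * \<delta>0" using h\<delta> \<epsilon>(2) \<epsilon>0(3) by (simp add: mult.commute)
    then have \<delta>: "\<delta> \<le> \<delta>0" using h by simp
    have "x \<noteq> y" using HH \<epsilon> by auto
    then have \<delta>pos: "\<delta> > 0" using xy by (simp add: \<delta>_def)
    define g where "g i = prim (coeff G i) y - prim (coeff G i) x" for i
    have g: "\<bar>g i\<bar> \<le> B i * \<delta>" for i
      unfolding g_def \<delta>_def by (rule prim_lipschitz) (use B xy in auto)
    define k where "k e = 2 * e - (\<Sum>i\<le>n. real (2 * (i + 1)) * g i * e ^ (2 * i))" for e
    have k0: "k \<epsilon> = 0"
      using HH unfolding prim_H_diff k_def g_def n_def by (simp add: power_mult)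
    have k': "\<exists>d. (k has_real_derivative d) (at e) \<and> 0 \<le> d" if e: "0 \<le> e" "e \<le> 1" for e
    proof -
      define S' where "S' = (\<Sum>i\<le>n. real (2 * (i + 1)) * g i * (real (2 * i) * e ^ (2 * i - 1)))"
      have "(k has_real_derivative 2 - S') (at e)"
        unfolding k_def S'_def
        by (intro DERIV_diff DERIV_sum DERIV_cmult DERIV_cmult_Id) (auto intro!: derivative_eq_intros)
      moreover have "S' \<le> 2"
      proof -
        have "S' \<le> (\<Sum>i\<le>n. real (2 * (i + 1)) * real (2 * i) * B i * \<delta>)"
          unfolding S'_def
        proof (rule sum_mono)
          fix i
          have "g i * e ^ (2 * i - 1) \<le> \<bar>g i\<bar> * \<bar>e ^ (2 * i - 1)\<bar>" by (metis abs_ge_self abs_mult)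
          also have "\<dots> \<le> B i * \<delta> * 1"
            using g e B(1)[of i] \<delta>pos by (intro mult_mono) (auto simp: power_le_one)
          finally have "(real (2 * (i + 1)) * real (2 * i)) * (g i * e ^ (2 * i - 1)) \<le> (real (2 * (i + 1)) * real (2 * i)) * (B i * \<delta>)"
            by (intro mult_left_mono) auto
          then show "real (2 * (i + 1)) * g i * (real (2 * i) * e ^ (2 * i - 1)) \<le> real (2 * (i + 1)) * real (2 * i) * B i * \<delta>"
            by (simp only: mult_ac)
        qed
        also have "\<dots> \<le> Q * \<delta>" using \<delta>pos by (simp add: Q_def distrib_right sum_distrib_right)
        also have "\<dots> \<le> Q * (1 / Q)" using \<delta> \<delta>0 Q by (intro mult_left_mono) auto
        also have "\<dots> = 1" using Q by simp
        finally show ?thesis by simp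
      qed
      ultimately show ?thesis by (intro exI[of _ "2 - S'"]) simp
    qed
    define E where "E e = y - x - r x y + 2 / 3 * e ^ 3 - (\<Sum>i\<le>n. g i * e ^ (2 * i + 2))" for e
    have Egap: "E e = gap (e\<^sup>2) x y + 2 / 3 * e ^ 3" for e
    proof -
      have "c * e ^ (2 * i + 2) = e\<^sup>2 * (c * (e\<^sup>2) ^ i)" for c i
        by (simp add: power_mult power_add[of e "2 * i" 2] power2_eq_square)
      then show ?thesis
        unfolding E_def gap_def prim_G_diff g_def n_def sum_distrib_left by (simp only:)
    qed
    have E': "(E has_real_derivative e * k e) (at e)" for e
    proof -
      have "(E has_real_derivative 0 + 2 / 3 * (3 * e ^ 2) - (\<Sum>i\<le>n. g i * (real (2 * i + 2) * e ^ (2 * i + 1)))) (at e)"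
        unfolding E_def
      proof (intro DERIV_diff DERIV_add DERIV_sum DERIV_cmult DERIV_const)
        show "((\<lambda>e. e ^ 3) has_real_derivative 3 * e ^ 2) (at e)" using DERIV_pow[of 3 e] by simp
        show "((\<lambda>e. e ^ (2 * i + 2)) has_real_derivative real (2 * i + 2) * e ^ (2 * i + 1)) (at e)" for i
          using DERIV_pow[of "2 * i + 2" e] by simp
      qed
      moreover have "0 + 2 / 3 * (3 * e ^ 2) - (\<Sum>i\<le>n. g i * (real (2 * i + 2) * e ^ (2 * i + 1))) = e * k e"
        by (simp add: k_def right_diff_distrib sum_distrib_left power2_eq_square mult_ac)
      ultimately show ?thesis by simp
    qed
    have Emin: "E \<epsilon> \<le> E e" if e: "0 \<le> e" "e \<le> 1" for e
    proof (cases "\<epsilon> \<le> e")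
      case True
      show ?thesis
      proof (rule DERIV_nonneg_imp_nondecreasing[OF True])
        fix z assume z: "\<epsilon> \<le> z" "z \<le> e"
        have "k \<epsilon> \<le> k z"
          by (rule DERIV_nonneg_imp_nondecreasing[OF z(1)]) (use k' z e \<epsilon> in auto)
        then show "\<exists>d. (E has_real_derivative d) (at z) \<and> 0 \<le> d"
          using E'[of z] k0 z \<epsilon> by (intro exI[of _ "z * k z"]) auto
      qed
    next
      case False
      then have le: "e \<le> \<epsilon>" by simp
      show ?thesis
      proof (rule DERIV_nonpos_imp_nonincreasing[OF le])
        fix z assume z: "e \<le> z" "z \<le> \<epsilon>"
        have "k z \<le> k \<epsilon>"
          by (rule DERIV_nonneg_imp_nondecreasing[OF z(2)]) (use k' z e \<epsilon> \<epsilon>1 in auto)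
        then show "\<exists>d. (E has_real_derivative d) (at z) \<and> d \<le> 0"
          using E'[of z] k0 z e by (intro exI[of _ "z * k z"]) (auto intro: mult_nonneg_nonpos)
      qed
    qed
    define m where "m = (x + y) / 2"
    \<comment> \<open>The parameter \<open>e\<close> for which the arc from \<open>x\<close> to
      \<open>y\<close> has the optimal length at its midpoint.\<close>
    have "\<exists>e\<ge>0. e \<le> t0 \<and> e * pval Y (e\<^sup>2) m = \<delta>"
    proof (rule IVT')
      show "0 * pval Y (0\<^sup>2) m \<le> \<delta>" using \<delta>pos by simp
      have "t0 * t0 \<le> 1 * t0" using b by (intro mult_right_mono) auto
      then have "b \<le> pval Y (t0\<^sup>2) m" using b by (intro b(4)) (auto simp: power2_eq_square)
      then have "t0 * b \<le> t0 * pval Y (t0\<^sup>2) m" using b by (intro mult_left_mono) auto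
      then show "\<delta> \<le> t0 * pval Y (t0\<^sup>2) m" using \<delta> \<delta>0 by linarith
      show "0 \<le> t0" using b by simp
      show "continuous_on {0..t0} (\<lambda>e. e * pval Y (e\<^sup>2) m)"
        unfolding pval_sum by (intro continuous_intros)
    qed
    then obtain e where e: "0 \<le> e" "e \<le> t0" "e * pval Y (e\<^sup>2) m = \<delta>" by blast
    have epos: "e > 0" using e \<delta>pos by (cases "e = 0") auto
    have e1: "e \<le> 1" using e b by simp
    have "e * e \<le> 1 * t0" using e e1 by (intro mult_mono) auto
    then have et: "e\<^sup>2 \<le> t0" "e\<^sup>2 \<le> 1" using b by (auto simp: power2_eq_square)
    define u where "u = pval Y (e\<^sup>2) m"
    have u: "b \<le> u" "u \<le> M" using b(4)[of "e\<^sup>2" m] M(2)[of "e\<^sup>2" m] et by (auto simp: u_def)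
    have "e * b \<le> e * u" using u epos by (intro mult_left_mono) auto
    then have "h * (e * b) \<le> h * \<delta>" using e h by (intro mult_left_mono) (auto simp: u_def)
    then have "e * (h * b) \<le> 2 * \<epsilon>" using h\<delta> by (simp add: mult_ac)
    \<comment> \<open>Errors in terms of \<open>e\<close> are thereby errors in terms of
      \<epsilon>.\<close>
    then have eK: "e \<le> K * \<epsilon>" using h b by (simp add: K_def field_simps)
    have "\<bar>gap (e\<^sup>2) (m - e * u / 2) (m + e * u / 2) - e ^ 3 * phi m (e\<^sup>2) u\<bar> \<le> C * e ^ (2 * I + 5)"
      using epos e1 u b e \<delta> \<delta>0 by (intro C(3)) (auto simp: u_def)
    moreover have "m - e * u / 2 = x" "m + e * u / 2 = y"
      using e(3) by (auto simp: u_def m_def \<delta>_def field_simps)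
    ultimately have "gap (e\<^sup>2) x y \<le> e ^ 3 * phi m (e\<^sup>2) u + C * e ^ (2 * I + 5)" by (simp add: abs_le_iff)
    moreover have "e ^ 3 * phi m (e\<^sup>2) u \<le> e ^ 3 * (- 2 / 3 + C1 * (e\<^sup>2) ^ (I + 1))"
      using C1(2)[of "e\<^sup>2" m] et epos by (intro mult_left_mono) (auto simp: u_def abs_le_iff)
    moreover have "e ^ 3 * (- 2 / 3 + C1 * (e\<^sup>2) ^ (I + 1)) = - (2 / 3 * e ^ 3) + C1 * e ^ (2 * I + 5)"
      using eps_powers[of e] by (simp only: distrib_left mult.left_commute[of "e ^ 3" C1])
    ultimately have "E e \<le> (C + C1) * e ^ (2 * I + 5)"
      unfolding Egap distrib_right by linarith
    also have "\<dots> \<le> (C + C1) * (K * \<epsilon>) ^ (2 * I + 5)"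
      using C C1 eK epos by (intro mult_left_mono power_mono) auto
    finally have "E \<epsilon> \<le> (C + C1) * (K * \<epsilon>) ^ (2 * I + 5)" using Emin[OF e(1) e1] by linarith
    then show ?thesis unfolding Egap power_mult_distrib by (simp only: mult.assoc)
  qed
  then show ?thesis
    using that[of "(C + C1) * K ^ (2 * I + 5)" \<epsilon>0] C C1 h b \<epsilon>0 by (simp add: K_def)
qed

section \<open>Mean values and two-sided bounds for \<alpha> and \<beta>\<close>

definition Gbar :: "real \<Rightarrow> real" where "Gbar t = (\<Sum>i\<le>degree G. prim (coeff G i) l * t ^ i)"

definition Hbar :: "real \<Rightarrow> real" where "Hbar t = (\<Sum>i\<le>degree G. real (2 * (i + 1)) * prim (coeff G i) l * t ^ i)"

lemma Gbar_prim: "Gbar t = prim (poly G (of_real t)) l"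
  by (simp add: Gbar_def prim_sum_powers)

lemma Hbar_prim: "Hbar t = prim (poly H (of_real t)) l"
  using prim_H_diff[of t l 0] by (simp add: Hbar_def prim)

text \<open>The lower bound for \<beta> is linear in the rotation number and holds for all of them
  at once, so it bounds the supremum defining \<alpha>. The trial sequence matches it at \<omega> =
  2 \<epsilon> / Hbar, which therefore almost attains the supremum.\<close>

theorem main_bounds:
  obtains C \<epsilon>0 where "C \<ge> 0" "0 < \<epsilon>0" "\<epsilon>0 \<le> 1"
    "\<And>\<epsilon>. 0 < \<epsilon> \<Longrightarrow> \<epsilon> \<le> \<epsilon>0 \<Longrightarrow> 0 < Hbar (\<epsilon>\<^sup>2)"
    "\<And>\<epsilon>. 0 < \<epsilon> \<Longrightarrow> \<epsilon> \<le> \<epsilon>0 \<Longrightarrow>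
      \<bar>mather_beta \<gamma> l (2 * \<epsilon> / Hbar (\<epsilon>\<^sup>2)) - ((\<epsilon>\<^sup>2 * Gbar (\<epsilon>\<^sup>2) - l) * (2 * \<epsilon> / Hbar (\<epsilon>\<^sup>2)) - 2 / 3 * \<epsilon> ^ 3)\<bar> \<le> C * \<epsilon> ^ (2 * I + 5)"
    "\<And>\<epsilon>. 0 < \<epsilon> \<Longrightarrow> \<epsilon> \<le> \<epsilon>0 \<Longrightarrow>
      \<bar>mather_alpha \<gamma> l (\<epsilon>\<^sup>2 * Gbar (\<epsilon>\<^sup>2) - l) - 2 / 3 * \<epsilon> ^ 3\<bar> \<le> C * \<epsilon> ^ (2 * I + 5)"
proof -
  obtain h tH where h: "h > 0" "0 < tH" "tH \<le> 1" "\<And>t x. 0 \<le> t \<Longrightarrow> t \<le> tH \<Longrightarrow> h \<le> pval H t x"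
    by (rule H_lower) blast
  obtain CL \<epsilon>L where L: "CL \<ge> 0" "0 < \<epsilon>L" "\<epsilon>L \<le> 1"
    "\<And>\<epsilon> x y. 0 < \<epsilon> \<Longrightarrow> \<epsilon> \<le> \<epsilon>L \<Longrightarrow> x \<le> y \<Longrightarrow> y \<le> x + l \<Longrightarrow>
      - (2 / 3 * \<epsilon> ^ 3 + CL * \<epsilon> ^ (2 * I + 5)) \<le> gap (\<epsilon>\<^sup>2) x y"
    by (rule gap_lower) blast
  obtain CU \<epsilon>U where U: "CU \<ge> 0" "0 < \<epsilon>U" "\<epsilon>U \<le> 1"
    "\<And>\<epsilon> x y. 0 < \<epsilon> \<Longrightarrow> \<epsilon> \<le> \<epsilon>U \<Longrightarrow> x \<le> y \<Longrightarrow> y \<le> x + l \<Longrightarrow>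
      prim (poly H (of_real (\<epsilon>\<^sup>2))) y - prim (poly H (of_real (\<epsilon>\<^sup>2))) x = 2 * \<epsilon> \<Longrightarrow>
      gap (\<epsilon>\<^sup>2) x y \<le> - (2 / 3 * \<epsilon> ^ 3) + CU * \<epsilon> ^ (2 * I + 5)"
    by (rule gap_upper) blast
  \<comment> \<open>The bound \<open>h * l / 4\<close> ensures 2 \<epsilon> < Hbar, so that \<omega>
    < 1 and the steps of the trial sequence do not exceed \<open>l\<close>.\<close>
  define \<epsilon>0 where "\<epsilon>0 = min (min \<epsilon>L \<epsilon>U) (min tH (h * l / 4))"
  have \<epsilon>0: "0 < \<epsilon>0" "\<epsilon>0 \<le> \<epsilon>L" "\<epsilon>0 \<le> \<epsilon>U" "\<epsilon>0 \<le> tH" "\<epsilon>0 \<le> h * l / 4"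
    using L U h l_pos by (auto simp: \<epsilon>0_def)
  have *: "0 < Hbar (\<epsilon>\<^sup>2) \<and>
      \<bar>mather_beta \<gamma> l (2 * \<epsilon> / Hbar (\<epsilon>\<^sup>2)) - ((\<epsilon>\<^sup>2 * Gbar (\<epsilon>\<^sup>2) - l) * (2 * \<epsilon> / Hbar (\<epsilon>\<^sup>2)) - 2 / 3 * \<epsilon> ^ 3)\<bar>
        \<le> (CL + CU) * \<epsilon> ^ (2 * I + 5) \<and>
      \<bar>mather_alpha \<gamma> l (\<epsilon>\<^sup>2 * Gbar (\<epsilon>\<^sup>2) - l) - 2 / 3 * \<epsilon> ^ 3\<bar> \<le> (CL + CU) * \<epsilon> ^ (2 * I + 5)"
    if \<epsilon>: "0 < \<epsilon>" "\<epsilon> \<le> \<epsilon>0" for \<epsilon>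
  proof -
    define t where "t = \<epsilon>\<^sup>2"
    have "\<epsilon> * \<epsilon> \<le> 1 * tH" using \<epsilon> \<epsilon>0 h by (intro mult_mono) auto
    then have t: "0 \<le> t" "t \<le> tH" "0 < t" using \<epsilon> by (auto simp: t_def power2_eq_square)
    define q where "q = poly G (of_real t)"
    define K where "K = prim (poly H (of_real t))"
    define N where "N = \<epsilon> ^ (2 * I + 5)"
    have N0: "N \<ge> 0" using \<epsilon> by (simp add: N_def)
    have Kl: "h * (y - x) \<le> K y - K x" if "x \<le> y" for x y
      unfolding K_def by (rule prim_lower) (use h(4) t that in auto)
    define Hb where "Hb = Hbar t"
    have Hb: "K l = Hb" "K 0 = 0" by (simp_all add: Hb_def Hbar_prim K_def prim)
    have Hb_ge: "h * l \<le> Hb" using Kl[of 0 l] l_pos Hb by simp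
    have hl: "0 < h * l" using h l_pos by simp
    have Hbp: "0 < Hb" using Hb_ge hl by linarith
    have 2: "2 * \<epsilon> < Hb" using \<epsilon> \<epsilon>0 Hb_ge hl by linarith
    define \<omega> where "\<omega> = 2 * \<epsilon> / Hb"
    have w: "0 < \<omega>" "\<omega> < 1" using \<epsilon> Hbp 2 by (auto simp: \<omega>_def)
    define S where "S x = x - t * prim q x" for x
    define \<kappa> where "\<kappa> = 1 - t * (Gbar t / l)"
    have \<kappa>l: "\<kappa> * l = l - t * Gbar t" using l_pos by (simp add: \<kappa>_def left_diff_distrib)
    obtain CS where CS: "\<And>x. \<bar>prim q x - prim q l / l * x\<bar> \<le> CS" using prim_linear_deviation by blast
    have S: "\<bar>S x - \<kappa> * x\<bar> \<le> t * CS" for x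
    proof -
      have "S x - \<kappa> * x = - (t * (prim q x - prim q l / l * x))"
        by (simp add: S_def \<kappa>_def Gbar_prim q_def algebra_simps)
      then have "\<bar>S x - \<kappa> * x\<bar> = t * \<bar>prim q x - prim q l / l * x\<bar>" using t by (simp add: abs_mult)
      then show ?thesis using CS[of x] t by (simp add: mult_left_mono)
    qed
    have gS: "gap t x y = S y - S x - r x y" for x y
      by (simp add: gap_def S_def q_def algebra_simps)
    have lower: "(t * Gbar t - l) * w' - (2 / 3 * \<epsilon> ^ 3 + CL * N) \<le> mather_beta \<gamma> l w'"
      if w': "0 \<le> w'" "w' \<le> 1" for w'
    proof -
      have D: "r x y \<le> S y - S x + (2 / 3 * \<epsilon> ^ 3 + CL * N)" if "x \<le> y" "y \<le> x + l" for x y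
        using L(4)[of \<epsilon> x y] \<epsilon> \<epsilon>0 that unfolding t_def[symmetric] gS N_def[symmetric] by linarith
      from beta_ge_dual[OF w' S D] show ?thesis unfolding \<kappa>l by (simp add: algebra_simps)
    qed
    have K_shift: "K (x + l) = K x + Hb" for x using prim_shift[of "poly H (of_real t)" x] Hb by (simp add: K_def)
    have K_cont: "continuous_on A K" for A
      unfolding K_def by (meson DERIV_isCont continuous_at_imp_continuous_on prim(2))
    have "\<exists>x. K x = z" for z
    proof -
      define a where "a = \<bar>z\<bar> / h"
      have a: "0 \<le> a" "h * a = \<bar>z\<bar>" using h by (auto simp: a_def)
      have "K (- a) \<le> z" "z \<le> K a" using Kl[of "- a" 0] Kl[of 0 a] a Hb by (auto simp: abs_le_iff)
      then show ?thesis using IVT'[of K "- a" z a] a K_cont by auto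
    qed
    then have "\<forall>i::int. \<exists>x. K x = 2 * \<epsilon> * of_int i" by blast
    \<comment> \<open>\<open>K\<close> is increasing and grows by \<open>Hb\<close> over a period,
      so equal spacing in \<open>K\<close> is a rotation by \<omega> in this coordinate.\<close>
    from choice[OF this] obtain s where s: "\<And>i::int. K (s i) = 2 * \<epsilon> * of_int i" by blast
    have Kmono: "x \<le> y" if "K x \<le> K y" for x y
    proof (rule ccontr)
      assume "\<not> x \<le> y"
      then have "0 < h * (x - y)" using h by simp
      then show False using Kl[of y x] \<open>\<not> x \<le> y\<close> that by simp
    qed
    have adm: "adm s" unfolding adm_def
    proof (intro allI conjI)
      fix i
      show "s i \<le> s (i + 1)" by (rule Kmono) (use s \<epsilon> in simp)
      have "K (s (i + 1)) = 2 * \<epsilon> * of_int i + 2 * \<epsilon>" unfolding s by (simp add: distrib_left)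
      then have "K (s (i + 1)) \<le> K (s i + l)" using 2 unfolding K_shift s[of i] by linarith
      then show "s (i + 1) \<le> s i + l" by (rule Kmono)
    qed
    obtain CK where CK: "\<And>x. \<bar>K x - K l / l * x\<bar> \<le> CK" unfolding K_def using prim_linear_deviation by blast
    have dev: "\<bar>s j - s i - of_int (j - i) * \<omega> * l\<bar> \<le> 2 * CK * l / Hb" for i j
    proof -
      have X: "\<bar>s i - l / Hb * (2 * \<epsilon> * of_int i)\<bar> \<le> l / Hb * CK" for i
      proof -
        have "s i - l / Hb * (2 * \<epsilon> * of_int i) = - (l / Hb * (K (s i) - K l / l * s i))"
          using Hbp l_pos by (simp add: s Hb field_simps)
        then have "\<bar>s i - l / Hb * (2 * \<epsilon> * of_int i)\<bar> = l / Hb * \<bar>K (s i) - K l / l * s i\<bar>"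
          using Hbp l_pos by (simp add: abs_mult)
        then show ?thesis using CK[of "s i"] Hbp l_pos by (simp add: mult_left_mono divide_right_mono)
      qed
      have "of_int (j - i) * \<omega> * l = l / Hb * (2 * \<epsilon> * of_int j) - l / Hb * (2 * \<epsilon> * of_int i)"
        by (simp add: \<omega>_def algebra_simps diff_divide_distrib)
      moreover have "2 * CK * l / Hb = l / Hb * CK + l / Hb * CK" by simp
      moreover have "\<bar>b - a - (b' - a')\<bar> \<le> B + B" if "\<bar>a - a'\<bar> \<le> B" "\<bar>b - b'\<bar> \<le> B" for a a' b b' B :: real
        using that by linarith
      ultimately show ?thesis using X[of i] X[of j] by metis
    qed
    have A: "S (s (i + 1)) - S (s i) + (2 / 3 * \<epsilon> ^ 3 - CU * N) \<le> r (s i) (s (i + 1))" for i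
    proof -
      have "gap t (s i) (s (i + 1)) \<le> - (2 / 3 * \<epsilon> ^ 3) + CU * N"
        unfolding t_def N_def
      proof (rule U(4))
        show "s i \<le> s (i + 1)" "s (i + 1) \<le> s i + l" using adm by (auto simp: adm_def)
        show "prim (poly H (of_real (\<epsilon>\<^sup>2))) (s (i + 1)) - prim (poly H (of_real (\<epsilon>\<^sup>2))) (s i) = 2 * \<epsilon>"
          using s[of i] s[of "i + 1"] unfolding K_def t_def by (simp add: algebra_simps)
      qed (use \<epsilon> \<epsilon>0 in auto)
      then show ?thesis unfolding gS by linarith
    qed
    have upper: "mather_beta \<gamma> l \<omega> \<le> (t * Gbar t - l) * \<omega> - (2 / 3 * \<epsilon> ^ 3 - CU * N)"
      using beta_le_trial_deviation[OF w adm dev S A] unfolding \<kappa>l by (simp add: algebra_simps)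
    define c where "c = t * Gbar t - l"
    define F where "F w' = w' * c - mather_beta \<gamma> l w'" for w'
    have F: "F w' \<le> 2 / 3 * \<epsilon> ^ 3 + CL * N" if "w' \<in> {0..1}" for w'
      using lower[of w'] that by (simp add: F_def c_def algebra_simps)
    have bdd: "bdd_above (F ` {0..1})" by (rule bdd_aboveI2[OF F])
    have "mather_alpha \<gamma> l c \<le> 2 / 3 * \<epsilon> ^ 3 + CL * N"
      unfolding mather_alpha_def F_def[symmetric] by (rule cSUP_least) (use F in auto)
    moreover have "F \<omega> \<le> mather_alpha \<gamma> l c"
      unfolding mather_alpha_def F_def[symmetric] by (rule cSUP_upper[OF _ bdd]) (use w in auto)
    moreover have "2 / 3 * \<epsilon> ^ 3 - CU * N \<le> F \<omega>" using upper by (simp add: F_def c_def algebra_simps)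
    moreover have "c * \<omega> - (2 / 3 * \<epsilon> ^ 3 + CL * N) \<le> mather_beta \<gamma> l \<omega>"
      using lower[of \<omega>] w by (simp add: c_def)
    moreover have "(CL + CU) * N = CL * N + CU * N" "0 \<le> CL * N" "0 \<le> CU * N"
      using L U N0 by (auto simp: distrib_right)
    ultimately have "\<bar>mather_alpha \<gamma> l c - 2 / 3 * \<epsilon> ^ 3\<bar> \<le> (CL + CU) * N"
      "\<bar>mather_beta \<gamma> l \<omega> - (c * \<omega> - 2 / 3 * \<epsilon> ^ 3)\<bar> \<le> (CL + CU) * N"
      using upper unfolding c_def[symmetric] abs_le_iff by linarith+
    then show ?thesis using Hbp unfolding c_def \<omega>_def Hb_def t_def N_def by blast
  qed
  show ?thesis
    by (rule that[of "CL + CU" \<epsilon>0]) (use * L U \<epsilon>0 h in auto)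
qed

end

subsection \<open>Asymptotic series\<close>

definition asymp_series :: "(real \<Rightarrow> real) \<Rightarrow> nat \<Rightarrow> (nat \<Rightarrow> real) \<Rightarrow> bool" where
  "asymp_series f n a \<longleftrightarrow> (\<lambda>x. f x - (\<Sum>k\<le>n. a k * x ^ k)) \<in> O[at_right 0](\<lambda>x. x ^ (n + 1))"

lemma power_bigo_at_right_0: "m \<le> n \<Longrightarrow> (\<lambda>x::real. x ^ n) \<in> O[at_right 0](\<lambda>x. x ^ m)"
proof (rule landau_o.big_mono)
  assume "m \<le> n"
  have "\<forall>\<^sub>F x::real in at_right 0. x \<in> {0<..<1}" by (rule eventually_at_right_real) simp
  then show "\<forall>\<^sub>F x::real in at_right 0. norm (x ^ n) \<le> norm (x ^ m)"
    by eventually_elim (use \<open>m \<le> n\<close> in \<open>auto simp: power_decreasing\<close>)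
qed

lemma asymp_series_le:
  assumes "asymp_series f m a" "n \<le> m"
  shows "asymp_series f n a"
proof -
  have "(\<lambda>x. f x - (\<Sum>k\<le>m. a k * x ^ k)) \<in> O[at_right 0](\<lambda>x. x ^ (n + 1))"
    using assms power_bigo_at_right_0[of "n + 1" "m + 1"] unfolding asymp_series_def
    by (meson landau_o.big.trans add_le_mono1)
  moreover have "(\<lambda>x. \<Sum>k\<in>{n<..m}. a k * x ^ k) \<in> O[at_right 0](\<lambda>x. x ^ (n + 1))"
  proof (intro big_sum_in_bigo)
    fix k assume "k \<in> {n<..m}"
    then have "(\<lambda>x. x ^ k) \<in> O[at_right 0](\<lambda>x::real. x ^ (n + 1))" by (intro power_bigo_at_right_0) auto
    then show "(\<lambda>x. a k * x ^ k) \<in> O[at_right 0](\<lambda>x::real. x ^ (n + 1))" by simp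
  qed
  ultimately have "(\<lambda>x. (f x - (\<Sum>k\<le>m. a k * x ^ k)) + (\<Sum>k\<in>{n<..m}. a k * x ^ k)) \<in> O[at_right 0](\<lambda>x. x ^ (n + 1))"
    by (rule sum_in_bigo)
  moreover have "(\<Sum>k\<le>m. a k * x ^ k) = (\<Sum>k\<le>n. a k * x ^ k) + (\<Sum>k\<in>{n<..m}. a k * x ^ k)" for x
    using assms(2) by (subst sum.union_disjoint[symmetric]) (auto intro!: sum.cong)
  ultimately show ?thesis by (simp add: asymp_series_def)
qed

text \<open>At the first disagreement the difference of the two expansions is a multiple of x^k
  which is also O(x^(k+1)).\<close>

lemma asymp_series_unique:
  assumes "asymp_series f n a" "asymp_series f n b" "k \<le> n"
  shows "a k = b k"
  using assms(3)
proof (induction k rule: less_induct)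
  case (less k)
  have "asymp_series f k a" "asymp_series f k b" using assms less asymp_series_le by blast+
  then have "(\<lambda>x. (f x - (\<Sum>k\<le>k. b k * x ^ k)) - (f x - (\<Sum>k\<le>k. a k * x ^ k))) \<in> O[at_right 0](\<lambda>x. x ^ (k + 1))"
    unfolding asymp_series_def by (rule sum_in_bigo(2)[rotated])
  moreover have "(f x - (\<Sum>k\<le>k. b k * x ^ k)) - (f x - (\<Sum>k\<le>k. a k * x ^ k)) = (a k - b k) * x ^ k" for x
  proof -
    have "(\<Sum>i<k. a i * x ^ i) = (\<Sum>i<k. b i * x ^ i)" using less by (intro sum.cong) auto
    then show ?thesis by (simp add: lessThan_Suc_atMost[symmetric] algebra_simps)
  qed
  ultimately have "(\<lambda>x. (a k - b k) * x ^ k) \<in> O[at_right 0](\<lambda>x. x ^ (k + 1))" by simp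
  then obtain C where C: "C > 0" "\<forall>\<^sub>F x in at_right 0. norm ((a k - b k) * x ^ k) \<le> C * norm (x ^ (k + 1))"
    by (elim landau_o.bigE)
  from C(2) eventually_at_right_less[of 0] have ev: "\<forall>\<^sub>F x in at_right 0. \<bar>a k - b k\<bar> \<le> C * x"
    by eventually_elim (auto simp: abs_mult)
  have "((\<lambda>x. C * x) \<longlongrightarrow> C * 0) (at_right 0)" by (intro tendsto_intros)
  from tendsto_le[OF _ this tendsto_const ev] show ?case by simp
qed

text \<open>Each order may come with its own list of coefficients; by uniqueness the lists are
  compatible, and the diagonal serves every order.\<close>

lemma asymp_series_glue:
  assumes "\<And>n. \<exists>a. asymp_series f n a"
  obtains a where "\<And>n. asymp_series f n a"
proof -
  obtain A where A: "\<And>n. asymp_series f n (A n)" using assms by metis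
  have "asymp_series f n (\<lambda>k. A k k)" for n
  proof -
    have "A k k = A n k" if "k \<le> n" for k
      by (rule asymp_series_unique[OF A asymp_series_le[OF A that]]) simp
    then show ?thesis using A[of n] unfolding asymp_series_def by (simp cong: sum.cong_simp)
  qed
  then show ?thesis using that by blast
qed

text \<open>An expansion along the curve \<open>x = \<eta> q(\<eta>)\<close> is an expansion in \<open>x\<close>, as the curve covers a
  right neighbourhood of \<open>0\<close>.\<close>

lemma asymp_series_transfer:
  assumes q: "continuous_on {0..\<eta>0} q" "q 0 > 0" "\<eta>0 > 0"
    and C: "\<And>\<eta>. 0 < \<eta> \<Longrightarrow> \<eta> \<le> \<eta>0 \<Longrightarrow> \<bar>f (\<eta> * q \<eta>) - (\<Sum>k\<le>n. a k * (\<eta> * q \<eta>) ^ k)\<bar> \<le> C * \<eta> ^ (n + 1)"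
  shows "asymp_series f n a"
proof -
  obtain e where e: "e > 0" "\<And>x. x \<in> {0..\<eta>0} \<Longrightarrow> dist x 0 < e \<Longrightarrow> dist (q x) (q 0) < q 0 / 2"
    using q unfolding continuous_on_iff by (metis atLeastAtMost_iff half_gt_zero less_imp_le order_refl)
  define \<eta>1 where "\<eta>1 = min \<eta>0 (e / 2)"
  have \<eta>1: "0 < \<eta>1" "\<eta>1 \<le> \<eta>0" "\<eta>1 < e" using e q by (auto simp: \<eta>1_def)
  have low: "q 0 / 2 \<le> q x" if "0 \<le> x" "x \<le> \<eta>1" for x
    proof -
    have "\<bar>q x - q 0\<bar> < q 0 / 2" using e(2)[of x] that \<eta>1 by (auto simp: dist_real_def)
    then show ?thesis by linarith
  qed
  have "\<forall>\<^sub>F x in at_right 0. x \<in> {0<..<\<eta>1 * (q 0 / 2)}"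
    using \<eta>1 q by (intro eventually_at_right_real) auto
  then have "\<forall>\<^sub>F x in at_right 0. norm (f x - (\<Sum>k\<le>n. a k * x ^ k)) \<le> (\<bar>C\<bar> * (2 / q 0) ^ (n + 1)) * norm (x ^ (n + 1))"
  proof eventually_elim
    case (elim x)
    have "\<exists>\<eta>\<ge>0. \<eta> \<le> \<eta>1 \<and> \<eta> * q \<eta> = x"
    proof (rule IVT')
      have "\<eta>1 * (q 0 / 2) \<le> \<eta>1 * q \<eta>1" using low[of \<eta>1] \<eta>1 by (intro mult_left_mono) auto
      then show "x \<le> \<eta>1 * q \<eta>1" using elim by auto
      show "continuous_on {0..\<eta>1} (\<lambda>\<eta>. \<eta> * q \<eta>)"
        using continuous_on_subset[OF q(1), of "{0..\<eta>1}"] \<eta>1 by (intro continuous_intros) auto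
    qed (use elim \<eta>1 in auto)
    then obtain \<eta> where \<eta>: "0 \<le> \<eta>" "\<eta> \<le> \<eta>1" "\<eta> * q \<eta> = x" by blast
    have "\<eta> \<noteq> 0" using \<eta> elim by auto
    \<comment> \<open>\<open>q\<close> stays above half of its value at 0, so \<eta> and
      \<open>x\<close> are comparable.\<close>
    have "\<eta> * (q 0 / 2) \<le> x" using low[OF \<eta>(1,2)] mult_left_mono[OF _ \<eta>(1)] \<eta>(3) by blast
    then have "\<eta> \<le> 2 / q 0 * x" using q by (simp add: field_simps)
    then have "\<eta> ^ (n + 1) \<le> (2 / q 0 * x) ^ (n + 1)" using \<eta> by (intro power_mono) auto
    moreover have "\<bar>f x - (\<Sum>k\<le>n. a k * x ^ k)\<bar> \<le> C * \<eta> ^ (n + 1)"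
      using C[of \<eta>] \<eta> \<open>\<eta> \<noteq> 0\<close> \<eta>1 by auto
    moreover have "C * \<eta> ^ (n + 1) \<le> \<bar>C\<bar> * \<eta> ^ (n + 1)" using \<eta> by (intro mult_right_mono) auto
    ultimately have "\<bar>f x - (\<Sum>k\<le>n. a k * x ^ k)\<bar> \<le> \<bar>C\<bar> * (2 / q 0 * x) ^ (n + 1)"
      by (meson abs_ge_zero mult_left_mono order_trans)
    then show ?case using elim unfolding power_mult_distrib by (simp add: mult.assoc)
  qed
  then show ?thesis unfolding asymp_series_def by (rule bigoI)
qed

section \<open>Elimination of \<epsilon> from the parametric expansions\<close>

lemma poly_bounded_01: "\<exists>C\<ge>0. \<forall>t. 0 \<le> t \<longrightarrow> t \<le> 1 \<longrightarrow> \<bar>poly p t\<bar> \<le> C" for p :: "real poly"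
proof (induction p)
  case (pCons a p)
  then obtain C where C: "C \<ge> 0" "\<And>t. 0 \<le> t \<Longrightarrow> t \<le> 1 \<Longrightarrow> \<bar>poly p t\<bar> \<le> C" by auto
  have "\<bar>poly (pCons a p) t\<bar> \<le> \<bar>a\<bar> + C" if "0 \<le> t" "t \<le> 1" for t
  proof -
    have "\<bar>t * poly p t\<bar> \<le> 1 * C" unfolding abs_mult using that C by (intro mult_mono) auto
    then show ?thesis by simp
  qed
  then show ?case using C(1) by (intro exI[of _ "\<bar>a\<bar> + C"]) auto
qed auto

lemma eqm_poly_bounded:
  fixes p q :: "real poly"
  assumes "eqm n p q"
  obtains C where "C \<ge> 0" "\<And>t. 0 \<le> t \<Longrightarrow> t \<le> 1 \<Longrightarrow> \<bar>poly p t - poly q t\<bar> \<le> C * t ^ n"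
proof -
  from assms obtain V where V: "p - q = monom 1 n * V" unfolding eqm_def by (elim dvdE)
  obtain C where C: "C \<ge> 0" "\<And>t. 0 \<le> t \<Longrightarrow> t \<le> 1 \<Longrightarrow> \<bar>poly V t\<bar> \<le> C" using poly_bounded_01 by blast
  have "\<bar>poly p t - poly q t\<bar> \<le> C * t ^ n" if "0 \<le> t" "t \<le> 1" for t
  proof -
    have "poly p t - poly q t = t ^ n * poly V t"
      using arg_cong[OF V, of "\<lambda>p. poly p t"] by (simp add: poly_monom)
    then show ?thesis using mult_left_mono[OF C(2)[OF that], of "t ^ n"] that
      by (simp add: abs_mult mult.commute)
  qed
  then show ?thesis using that C(1) by blast
qed

text \<open>The truncated series with coefficients \<open>a\<close> in the new variable x = t P(t),
  rewritten in \<open>t\<close>.\<close>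

definition revert :: "real poly \<Rightarrow> (nat \<Rightarrow> real) \<Rightarrow> nat \<Rightarrow> real poly" where
  "revert P a n = (\<Sum>k\<le>n. smult (a k) ((monom 1 1 * P) ^ k))"

lemma poly_revert: "poly (revert P a n) t = (\<Sum>k\<le>n. a k * (t * poly P t) ^ k)"
  by (simp add: revert_def poly_sum poly_monom)

lemma coeff_revert_0: "coeff (revert P a n) 0 = a 0"
proof -
  have "coeff (revert P a n) 0 = poly (revert P a n) 0" by (simp add: poly_0_coeff_0)
  also have "\<dots> = (\<Sum>k\<le>n. if k = 0 then a 0 else 0)" unfolding poly_revert by (intro sum.cong) auto
  finally show ?thesis by simp
qed

text \<open>With c + l = t P(t) and t = \<epsilon>^2, the quotient of 2/3 \<epsilon>^3 by (c +
  l)^(3/2) is 2/3 P^(-3/2). Squaring keeps the equation for its expansion polynomial, and the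
  positive \<open>a 0\<close> selects the root.\<close>

lemma alpha_series_exists:
  fixes P :: "real poly"
  assumes P: "coeff P 0 > 0"
  obtains a where "a 0 = 2 / 3 * coeff P 0 powr (-3/2)"
    "eqm (n + 1) ((revert P a n)\<^sup>2 * P ^ 3) [:4/9:]"
proof -
  define a0 where "a0 = 2 / 3 * coeff P 0 powr (-3/2)"
  have a0: "a0 \<noteq> 0" using P by (simp add: a0_def)
  have "\<exists>a. a 0 = a0 \<and> eqm (n + 1) ((revert P a n)\<^sup>2 * P ^ 3) [:4/9:]"
  proof (induction n)
    case 0
    have "(coeff P 0 powr (-3/2))\<^sup>2 * coeff P 0 ^ 3 = coeff P 0 powr (-3) * coeff P 0 powr 3"
      using P by (simp add: powr_power)
    also have "\<dots> = 1" by (subst powr_add[symmetric]) (use P in simp)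
    finally have "a0\<^sup>2 * coeff P 0 ^ 3 = 4 / 9" unfolding a0_def by algebra
    then show ?case
      by (intro exI[of _ "\<lambda>_. a0"]) (simp add: eqm_coeff revert_def coeff_mult coeff_0_power power2_eq_square)
  next
    case (Suc n)
    then obtain a where a: "a 0 = a0" "eqm (Suc n) ((revert P a n)\<^sup>2 * P ^ 3) [:4/9:]" by auto
    define R where "R = revert P a n"
    \<comment> \<open>The factor with which a new coefficient \<open>z\<close> enters in degree
      \<open>n + 1\<close>: twice the constant term of \<open>R\<close>, times that of
      \<open>P\<close> to the power (n + 1) + 3.\<close>
    define c where "c = 2 * a0 * coeff P 0 ^ (n + 4)"
    have c: "c \<noteq> 0" using a0 P by (simp add: c_def)
    define z where "z = - (coeff (R\<^sup>2 * P ^ 3) (Suc n) - coeff [:4/9::real:] (Suc n)) / c"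
    define a' where "a' = a(Suc n := z)"
    have "revert P a' (Suc n) = R + smult z ((monom 1 1 * P) ^ Suc n)"
      by (simp add: revert_def R_def a'_def del: power_Suc)
    also have "smult z ((monom 1 1 * P) ^ Suc n) = monom z (Suc n) * P ^ Suc n"
      unfolding power_mult_distrib monom_power
      by (simp add: smult_monom flip: mult_smult_left del: power_Suc)
    finally have "(revert P a' (Suc n))\<^sup>2 * P ^ 3 =
        R\<^sup>2 * P ^ 3 + (monom z (Suc n) * (2 * R * P ^ Suc n * P ^ 3) + monom z (Suc n) * monom z (Suc n) * (P ^ Suc n * P ^ Suc n * P ^ 3))"
      by (simp only: power2_eq_square) (simp add: algebra_simps del: power_Suc)
    moreover have "eqm (Suc (Suc n)) (monom z (Suc n) * (2 * R * P ^ Suc n * P ^ 3)) (monom (z * c) (Suc n))"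
    proof -
      have "coeff (2 * R * P ^ Suc n * P ^ 3) 0 = c"
        using coeff_revert_0[of P a n] a(1)
        by (simp add: coeff_mult coeff_0_power c_def R_def power_add mult_ac numeral_poly eval_nat_numeral)
      then show ?thesis using eqm_monom_mult[of "Suc n" z "2 * R * P ^ Suc n * P ^ 3"] by simp
    qed
    moreover have "eqm (Suc (Suc n)) (monom z (Suc n) * monom z (Suc n) * (P ^ Suc n * P ^ Suc n * P ^ 3)) 0"
      using eqm_mult[OF eqm_monom_0[of "Suc (Suc n)" "Suc n + Suc n" "z * z"] eqm_refl] by (simp add: mult_monom)
    ultimately have *: "eqm (Suc (Suc n)) ((revert P a' (Suc n))\<^sup>2 * P ^ 3) (R\<^sup>2 * P ^ 3 + (monom (z * c) (Suc n) + 0))"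
      by (metis eqm_add eqm_refl)
    have "eqm (Suc (Suc n)) (R\<^sup>2 * P ^ 3 + (monom (z * c) (Suc n) + 0)) [:4/9:]"
      using a(2) c unfolding eqm_Suc[of "Suc n"] R_def[symmetric]
      by (auto simp: eqm_coeff z_def)
    with * have "eqm (Suc n + 1) ((revert P a' (Suc n))\<^sup>2 * P ^ 3) [:4/9:]"
      unfolding Suc_eq_plus1[symmetric] by (rule eqm_trans)
    moreover have "a' 0 = a0" using a by (simp add: a'_def)
    ultimately show ?case by blast
  qed
  then show ?thesis using that unfolding a0_def by blast
qed

text \<open>The variable is y = \<omega>^2 = 4 t / A with \<open>A\<close> the square of Hbar;
  multiplication by \<open>A ^ n\<close> clears the denominators of the sum of a_k y^k.\<close>

lemma beta_series_exists:
  fixes A W :: "real poly"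
  assumes A: "coeff A 0 \<noteq> 0"
  obtains a where "eqm (n + 1) (\<Sum>k\<le>n. monom (4 ^ k * a k) k * A ^ (n - k)) (W * A ^ n)"
proof -
  have "\<exists>a. eqm (n + 1) (\<Sum>k\<le>n. monom (4 ^ k * a k) k * A ^ (n - k)) (W * A ^ n)"
  proof (induction n)
    case 0
    show ?case by (intro exI[of _ "\<lambda>_. coeff W 0"]) (simp add: eqm_coeff)
  next
    case (Suc n)
    then obtain a where a: "eqm (Suc n) (\<Sum>k\<le>n. monom (4 ^ k * a k) k * A ^ (n - k)) (W * A ^ n)" by auto
    define B where "B = (\<Sum>k\<le>n. monom (4 ^ k * a k) k * A ^ (n - k)) * A"
    have B: "eqm (Suc n) B (W * A ^ Suc n)"
      using eqm_mult[OF a eqm_refl[of "Suc n" A]] by (simp add: B_def mult_ac)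
    define z where "z = (coeff (W * A ^ Suc n) (Suc n) - coeff B (Suc n)) / 4 ^ Suc n"
    define a' where "a' = a(Suc n := z)"
    have "(\<Sum>k\<le>Suc n. monom (4 ^ k * a' k) k * A ^ (Suc n - k)) = B + monom (4 ^ Suc n * z) (Suc n)"
      by (simp add: B_def a'_def sum_distrib_right Suc_diff_le mult_ac del: power_Suc cong: sum.cong_simp)
         (simp add: sum_distrib_left mult_ac)
    moreover have "eqm (Suc (Suc n)) (B + monom (4 ^ Suc n * z) (Suc n)) (W * A ^ Suc n)"
      using B unfolding eqm_Suc[of "Suc n"] by (auto simp: eqm_coeff z_def)
    ultimately show ?case by (intro exI[of _ a']) (simp only: Suc_eq_plus1[symmetric])
  qed
  then show ?thesis using that by blast
qed

lemma coeff_revert_3: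
  "coeff (revert P a 3) 0 = a 0" "coeff (revert P a 3) 1 = a 1 * coeff P 0"
  "coeff (revert P a 3) 2 = a 1 * coeff P 1 + a 2 * coeff P 0 ^ 2"
  "coeff (revert P a 3) 3 = a 1 * coeff P 2 + 2 * a 2 * coeff P 0 * coeff P 1 + a 3 * coeff P 0 ^ 3"
proof -
  have X: "coeff (monom 1 1 * q) 0 = 0" "coeff (monom 1 1 * q) 1 = coeff q 0"
    "coeff (monom 1 1 * q) 2 = coeff q 1" "coeff (monom 1 1 * q) 3 = coeff q 2" for q :: "real poly"
    by (simp_all add: coeff_monom_mult)
  have R: "revert P a 3 = smult (a 0) 1 + smult (a 1) (monom 1 1 * P) + smult (a 2) ((monom 1 1 * P) * (monom 1 1 * P))
      + smult (a 3) ((monom 1 1 * P) * (monom 1 1 * P) * (monom 1 1 * P))"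
    by (simp add: revert_def atMost_numeral power2_eq_square power3_eq_cube mult.assoc add.assoc)
  show "coeff (revert P a 3) 0 = a 0" "coeff (revert P a 3) 1 = a 1 * coeff P 0"
    "coeff (revert P a 3) 2 = a 1 * coeff P 1 + a 2 * coeff P 0 ^ 2"
    "coeff (revert P a 3) 3 = a 1 * coeff P 2 + 2 * a 2 * coeff P 0 * coeff P 1 + a 3 * coeff P 0 ^ 3"
    unfolding R coeff_add coeff_smult coeff_mult_low X
    by (simp_all add: power2_eq_square power3_eq_cube)
qed

lemma alpha_coeffs:
  fixes P :: "real poly" and a :: "nat \<Rightarrow> real"
  defines "c \<equiv> coeff P"
  assumes eq: "eqm 4 ((revert P a 3)\<^sup>2 * P ^ 3) [:4/9:]" and P: "c 0 \<noteq> 0" and a: "a 0 \<noteq> 0"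
  shows "a 1 * c 0 ^ 2 = - (3 / 2) * a 0 * c 1"
    "a 2 * c 0 ^ 4 = a 0 * (- (3 / 2) * c 2 * c 0 + 27 / 8 * c 1 ^ 2)"
    "a 3 * c 0 ^ 6 = a 0 * (- (3 / 2) * c 3 * c 0 ^ 2 + 33 / 4 * c 1 * c 2 * c 0 - 143 / 16 * c 1 ^ 3)"
proof -
  have E: "coeff ((revert P a 3)\<^sup>2 * P ^ 3) i = 0" if "i \<in> {1, 2, 3}" for i
    using eq that by (auto simp: eqm_coeff coeff_eq_0)
  note X = power2_eq_square[of "revert P a 3"] power3_eq_cube[of P] coeff_mult_low coeff_revert_3 c_def[symmetric]
  have E1: "coeff ((revert P a 3)\<^sup>2 * P ^ 3) 1 = 0" "coeff ((revert P a 3)\<^sup>2 * P ^ 3) 2 = 0"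
    "coeff ((revert P a 3)\<^sup>2 * P ^ 3) 3 = 0" by (rule E; simp)+
  note F = E1[unfolded X]
  \<comment> \<open>Each coefficient equation is linear in its new unknown; \<open>algebra\<close>
    derives the result up to a nonzero factor, which is then cancelled.\<close>
  have "a 0 * c 0 ^ 2 * (a 1 * c 0 ^ 2 - - (3 / 2) * a 0 * c 1) = 0" using F(1) by algebra
  then show 1: "a 1 * c 0 ^ 2 = - (3 / 2) * a 0 * c 1" using a P by simp
  have "a 0 * c 0 ^ 3 * (a 2 * c 0 ^ 4 - a 0 * (- (3 / 2) * c 2 * c 0 + 27 / 8 * c 1 ^ 2)) = 0"
    using F(2) 1 by algebra
  then show 2: "a 2 * c 0 ^ 4 = a 0 * (- (3 / 2) * c 2 * c 0 + 27 / 8 * c 1 ^ 2)" using a P by simp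
  have "a 0 * c 0 ^ 4 * (a 3 * c 0 ^ 6 - a 0 * (- (3 / 2) * c 3 * c 0 ^ 2 + 33 / 4 * c 1 * c 2 * c 0 - 143 / 16 * c 1 ^ 3)) = 0"
    using F(3) 1 2 by algebra
  then show "a 3 * c 0 ^ 6 = a 0 * (- (3 / 2) * c 3 * c 0 ^ 2 + 33 / 4 * c 1 * c 2 * c 0 - 143 / 16 * c 1 ^ 3)"
    using a P by simp
qed

lemma beta_coeffs:
  fixes P H :: "real poly" and a :: "nat \<Rightarrow> real"
  defines "c \<equiv> coeff P"
  assumes H: "\<And>i. coeff H i = real (2 * (i + 1)) * coeff P i"
    and eq: "eqm 4 (\<Sum>k\<le>3. monom (4 ^ k * a k) k * (H * H) ^ (3 - k)) (smult (1/12) ((3 * P - H) * (H * H)) * (H * H) ^ 3)"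
    and P: "c 0 \<noteq> 0"
  shows "a 0 = c 0 ^ 3 / 3" "a 1 = c 0 ^ 4 * c 1" "a 2 = c 0 ^ 6 * c 2 + 4 * c 0 ^ 5 * c 1 ^ 2"
    "a 3 = c 0 ^ 8 * c 3 + 12 * c 0 ^ 7 * c 1 * c 2 + 56 / 3 * c 0 ^ 6 * c 1 ^ 3"
proof -
  define A where "A = H * H"
  have Ac: "coeff A 0 = 4 * c 0 ^ 2" "coeff A 1 = 16 * c 0 * c 1" "coeff A 2 = 24 * c 0 * c 2 + 16 * c 1 ^ 2"
    "coeff A 3 = 32 * c 0 * c 3 + 48 * c 1 * c 2"
    unfolding A_def coeff_mult_low H c_def by (simp_all add: power2_eq_square)
  define A2 where "A2 = A * A"
  have A2c: "coeff A2 0 = 16 * c 0 ^ 4" "coeff A2 1 = 128 * c 0 ^ 3 * c 1"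
    "coeff A2 2 = 192 * c 0 ^ 3 * c 2 + 384 * c 0 ^ 2 * c 1 ^ 2"
    "coeff A2 3 = 256 * c 0 ^ 3 * c 3 + 1152 * c 0 ^ 2 * c 1 * c 2 + 512 * c 0 * c 1 ^ 3"
    unfolding A2_def coeff_mult_low Ac by (algebra, algebra, algebra, algebra)
  have three: "3 * P = smult 3 P" by (simp add: numeral_poly)
  have W: "coeff (3 * P - H) 0 = c 0" "coeff (3 * P - H) 1 = - c 1" "coeff (3 * P - H) 2 = - 3 * c 2"
    "coeff (3 * P - H) 3 = - 5 * c 3"
    unfolding coeff_diff H c_def three coeff_smult by simp_all
  have X: "coeff (monom z 1 * q) 0 = 0" "coeff (monom z 1 * q) 1 = z * coeff q 0"
    "coeff (monom z 1 * q) 2 = z * coeff q 1" "coeff (monom z 1 * q) 3 = z * coeff q 2"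
    "coeff (monom z 2 * q) 0 = 0" "coeff (monom z 2 * q) 1 = 0"
    "coeff (monom z 2 * q) 2 = z * coeff q 0" "coeff (monom z 2 * q) 3 = z * coeff q 1"
    for z and q :: "real poly"
    by (simp_all add: coeff_monom_mult)
  have L: "(\<Sum>k\<le>3. monom (4 ^ k * a k) k * (H * H) ^ (3 - k)) =
      smult (a 0) (A2 * A) + monom (4 * a 1) 1 * A2 + monom (16 * a 2) 2 * A + monom (64 * a 3) 3"
    by (simp add: atMost_numeral A_def A2_def power2_eq_square power3_eq_cube monom_0 add.assoc)
  have R: "smult (1/12) ((3 * P - H) * (H * H)) * (H * H) ^ 3 = smult (1/12) ((3 * P - H) * (A2 * A2))"
    by (simp add: A_def A2_def power3_eq_cube mult_ac)
  have E: "coeff (smult (a 0) (A2 * A) + monom (4 * a 1) 1 * A2 + monom (16 * a 2) 2 * A + monom (64 * a 3) 3) i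
      = coeff (smult (1/12) ((3 * P - H) * (A2 * A2))) i" if "i < 4" for i
    using eq that unfolding L R eqm_coeff by blast
  note simps = coeff_add coeff_smult coeff_mult_low X coeff_monom Ac W
  show "a 0 = c 0 ^ 3 / 3" "a 1 = c 0 ^ 4 * c 1" "a 2 = c 0 ^ 6 * c 2 + 4 * c 0 ^ 5 * c 1 ^ 2"
    "a 3 = c 0 ^ 8 * c 3 + 12 * c 0 ^ 7 * c 1 * c 2 + 56 / 3 * c 0 ^ 6 * c 1 ^ 3"
  proof -
    have c0: "c 0 \<noteq> 0" by (rule P)
    have "c 0 ^ 6 * (a 0 - c 0 ^ 3 / 3) = 0" using E[of 0] unfolding simps A2c by (simp; algebra)
    then show 0: "a 0 = c 0 ^ 3 / 3" using c0 by simp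
    have "c 0 ^ 4 * (a 1 - c 0 ^ 4 * c 1) = 0" using E[of 1] unfolding simps A2c 0 by (simp; algebra)
    then show 1: "a 1 = c 0 ^ 4 * c 1" using c0 by simp
    have "c 0 ^ 2 * (a 2 - (c 0 ^ 6 * c 2 + 4 * c 0 ^ 5 * c 1 ^ 2)) = 0"
      using E[of 2] unfolding simps A2c 0 1 by (simp; algebra)
    then show 2: "a 2 = c 0 ^ 6 * c 2 + 4 * c 0 ^ 5 * c 1 ^ 2" using c0 by simp
    show "a 3 = c 0 ^ 8 * c 3 + 12 * c 0 ^ 7 * c 1 * c 2 + 56 / 3 * c 0 ^ 6 * c 1 ^ 3"
      using E[of 3] unfolding simps A2c 0 1 2 by (simp; algebra)
  qed
qed

lemma poly_gt_near_0:
  fixes p :: "real poly"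
  assumes "poly p 0 > b"
  obtains \<delta> where "\<delta> > 0" "\<And>t. 0 \<le> t \<Longrightarrow> t \<le> \<delta> \<Longrightarrow> poly p t > b"
proof -
  have "isCont (poly p) 0" by simp
  then obtain \<delta> where \<delta>: "\<delta> > 0" "\<And>t. \<bar>t\<bar> < \<delta> \<Longrightarrow> \<bar>poly p t - poly p 0\<bar> < poly p 0 - b"
    unfolding continuous_at_eps_delta dist_real_def using assms by (metis diff_gt_0_iff_gt diff_zero)
  have "poly p t > b" if "0 \<le> t" "t \<le> \<delta> / 2" for t
  proof -
    have "\<bar>poly p t - poly p 0\<bar> < poly p 0 - b" using \<delta> that by (intro \<delta>(2)) auto
    then show ?thesis by linarith
  qed
  then show ?thesis using that[of "\<delta> / 2"] \<delta>(1) by auto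
qed

section \<open>Asymptotic series of \<alpha> and \<beta> to a fixed order\<close>

context billiard_formal
begin

definition Gpoly :: "real poly" where "Gpoly = (\<Sum>i\<le>degree G. monom (prim (coeff G i) l) i)"

definition Hpoly :: "real poly" where
  "Hpoly = (\<Sum>i\<le>degree G. monom (real (2 * (i + 1)) * prim (coeff G i) l) i)"

lemma prim_0: "prim 0 x = 0"
  using prim_unique[of "\<lambda>_. 0" 0 x] by simp

lemma coeff_Gpoly: "coeff Gpoly i = prim (coeff G i) l"
  by (simp add: Gpoly_def coeff_sum coeff_eq_0 prim_0)

lemma coeff_Hpoly: "coeff Hpoly i = real (2 * (i + 1)) * coeff Gpoly i"
  by (simp add: Hpoly_def coeff_Gpoly coeff_sum coeff_eq_0 prim_0)

lemma poly_Gpoly: "poly Gpoly t = Gbar t" and poly_Hpoly: "poly Hpoly t = Hbar t"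
  by (simp_all add: Gpoly_def Hpoly_def Gbar_def Hbar_def poly_sum poly_monom)

lemma coeff_Gpoly_pos: "coeff Gpoly 0 > 0"
proof -
  have "val (coeff G 0) x > 0" for x using w_pos[of x] by (simp add: G_0 G0_def)
  then obtain b where b: "b > 0" "\<And>x. b \<le> val (coeff G 0) x"
    using val_positive_lower[of "coeff G 0"] by blast
  have "0 < b * (l - 0)" using b l_pos by simp
  also have "\<dots> \<le> prim (coeff G 0) l - prim (coeff G 0) 0"
    using b l_pos by (intro prim_lower) auto
  finally show ?thesis by (simp add: coeff_Gpoly prim)
qed

text \<open>Both \<open>R\<close> and \<open>2 / 3 * s\<close> with \<open>s = g powr (-3/2)\<close>
  nearly solve the squared equation. Their difference of squares factors, and \<open>R > 0\<close>
  allows division by the sum.\<close>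

lemma alpha_asymp:
  assumes n: "n \<le> I" and a: "a 0 = 2 / 3 * coeff Gpoly 0 powr (-3/2)"
    and eq: "eqm (n + 1) ((revert Gpoly a n)\<^sup>2 * Gpoly ^ 3) [:4/9:]"
  shows "asymp_series (\<lambda>x. x powr (-3/2) * mather_alpha \<gamma> l (x - l)) n a"
proof -
  define c0 where "c0 = coeff Gpoly 0"
  have c0: "c0 > 0" using coeff_Gpoly_pos by (simp add: c0_def)
  obtain C \<epsilon>0 where C: "C \<ge> 0" "0 < \<epsilon>0" "\<epsilon>0 \<le> 1"
    "\<And>\<epsilon>. 0 < \<epsilon> \<Longrightarrow> \<epsilon> \<le> \<epsilon>0 \<Longrightarrow>
      \<bar>mather_alpha \<gamma> l (\<epsilon>\<^sup>2 * Gbar (\<epsilon>\<^sup>2) - l) - 2 / 3 * \<epsilon> ^ 3\<bar> \<le> C * \<epsilon> ^ (2 * I + 5)"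
    by (rule main_bounds) blast
  obtain C2 where C2: "C2 \<ge> 0"
    "\<And>t. 0 \<le> t \<Longrightarrow> t \<le> 1 \<Longrightarrow> \<bar>poly ((revert Gpoly a n)\<^sup>2 * Gpoly ^ 3) t - poly [:4/9:] t\<bar> \<le> C2 * t ^ (n + 1)"
    by (rule eqm_poly_bounded[OF eq]) blast
  have "poly Gpoly 0 > c0 / 2" using c0 by (simp add: poly_0_coeff_0 c0_def)
  then obtain \<delta>1 where \<delta>1: "\<delta>1 > 0" "\<And>t. 0 \<le> t \<Longrightarrow> t \<le> \<delta>1 \<Longrightarrow> poly Gpoly t > c0 / 2"
    by (rule poly_gt_near_0) blast
  have "poly (revert Gpoly a n) 0 > 0" using c0 by (simp add: poly_0_coeff_0 coeff_revert_0 a c0_def)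
  then obtain \<delta>2 where \<delta>2: "\<delta>2 > 0" "\<And>t. 0 \<le> t \<Longrightarrow> t \<le> \<delta>2 \<Longrightarrow> poly (revert Gpoly a n) t > 0"
    by (rule poly_gt_near_0) blast
  define \<eta>0 where "\<eta>0 = min (\<epsilon>0\<^sup>2) (min \<delta>1 \<delta>2)"
  have \<eta>0: "0 < \<eta>0" "\<eta>0 \<le> \<epsilon>0\<^sup>2" "\<eta>0 \<le> \<delta>1" "\<eta>0 \<le> \<delta>2" using C \<delta>1 \<delta>2 by (auto simp: \<eta>0_def)
  have "\<epsilon>0\<^sup>2 \<le> 1" using C by (simp add: power_le_one)
  then have \<eta>01: "\<eta>0 \<le> 1" using \<eta>0 by linarith
  define S where "S = (c0 / 2) powr (-3/2)"
  show ?thesis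
  proof (rule asymp_series_transfer)
    show "continuous_on {0..\<eta>0} (poly Gpoly)" by (intro continuous_intros)
    show "poly Gpoly 0 > 0" using c0 by (simp add: poly_0_coeff_0 c0_def)
    show "\<eta>0 > 0" by (rule \<eta>0)
    fix \<eta> assume \<eta>: "0 < \<eta>" "\<eta> \<le> \<eta>0"
    define \<epsilon> where "\<epsilon> = sqrt \<eta>"
    have \<epsilon>: "\<epsilon> > 0" "\<epsilon>\<^sup>2 = \<eta>" "\<epsilon> \<le> 1" using \<eta> \<eta>01 by (auto simp: \<epsilon>_def)
    have "\<epsilon> \<le> \<epsilon>0" using \<eta> \<eta>0 C unfolding \<epsilon>_def by (intro real_le_lsqrt) auto
    define g where "g = poly Gpoly \<eta>"
    have g: "g > c0 / 2" using \<delta>1(2)[of \<eta>] \<eta> \<eta>0 by (simp add: g_def)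
    then have g0: "g > 0" using c0 by linarith
    define s where "s = g powr (-3/2)"
    have s0: "s > 0" using g0 by (simp add: s_def)
    have sS: "s \<le> S" unfolding s_def S_def using g c0 by (intro powr_mono2') auto
    have s2: "s\<^sup>2 * g ^ 3 = 1"
    proof -
      have "s\<^sup>2 * g ^ 3 = g powr (-3) * g powr 3" using g0 by (simp add: s_def powr_power)
      also have "\<dots> = 1" by (subst powr_add[symmetric]) (use g0 in simp)
      finally show ?thesis .
    qed
    have xp: "(\<eta> * g) powr (-3/2) = s / \<epsilon> ^ 3"
    proof -
      have "\<eta> powr (-3/2) = 1 / \<epsilon> ^ 3"
      proof -
        have "\<eta> powr (-3/2) = \<epsilon> powr (-3)"
          unfolding \<epsilon>(2)[symmetric] using \<epsilon>(1) by (simp add: powr_powr flip: powr_numeral)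
        also have "\<dots> = 1 / \<epsilon> ^ 3" using \<epsilon>(1) by (simp add: powr_minus_divide)
        finally show ?thesis .
      qed
      then show ?thesis using \<eta> g0 by (simp add: powr_mult s_def)
    qed
    define \<alpha> where "\<alpha> = mather_alpha \<gamma> l (\<eta> * g - l)"
    have "\<bar>\<alpha> - 2 / 3 * \<epsilon> ^ 3\<bar> \<le> C * \<epsilon> ^ (2 * I + 5)"
      using C(4)[OF \<epsilon>(1) \<open>\<epsilon> \<le> \<epsilon>0\<close>] by (simp only: \<epsilon>(2) \<alpha>_def g_def poly_Gpoly)
    then have "s / \<epsilon> ^ 3 * \<bar>\<alpha> - 2 / 3 * \<epsilon> ^ 3\<bar> \<le> s / \<epsilon> ^ 3 * (C * \<epsilon> ^ (2 * I + 5))"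
      using s0 \<epsilon> by (intro mult_left_mono) auto
    also have "\<epsilon> ^ (2 * I + 5) = \<epsilon> ^ 3 * \<eta> ^ (I + 1)" using eps_powers[of \<epsilon>] \<epsilon>(2) by simp
    also have "s / \<epsilon> ^ 3 * (C * (\<epsilon> ^ 3 * \<eta> ^ (I + 1))) = s * (C * \<eta> ^ (I + 1))" using \<epsilon> by simp
    also have "\<dots> \<le> S * (C * \<eta> ^ (n + 1))"
      using sS s0 C \<eta> \<eta>01 n by (intro mult_mono power_decreasing mult_nonneg_nonneg) auto
    also have "s / \<epsilon> ^ 3 * \<bar>\<alpha> - 2 / 3 * \<epsilon> ^ 3\<bar> = \<bar>s / \<epsilon> ^ 3 * \<alpha> - 2 / 3 * s\<bar>"
    proof -
      have "s / \<epsilon> ^ 3 * (\<alpha> - 2 / 3 * \<epsilon> ^ 3) = s / \<epsilon> ^ 3 * \<alpha> - 2 / 3 * s" using \<epsilon> by (simp add: field_simps)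
      then show ?thesis using s0 \<epsilon> by (metis abs_mult abs_of_pos divide_pos_pos zero_less_power)
    qed
    finally have 1: "\<bar>s / \<epsilon> ^ 3 * \<alpha> - 2 / 3 * s\<bar> \<le> S * (C * \<eta> ^ (n + 1))" .
    define R where "R = poly (revert Gpoly a n) \<eta>"
    have R: "R > 0" using \<delta>2(2)[of \<eta>] \<eta> \<eta>0 by (simp add: R_def)
    have "\<bar>R\<^sup>2 * g ^ 3 - 4 / 9\<bar> \<le> C2 * \<eta> ^ (n + 1)"
      using C2(2)[of \<eta>] \<eta> \<eta>01 by (simp add: R_def g_def)
    then have "s\<^sup>2 * \<bar>R\<^sup>2 * g ^ 3 - 4 / 9\<bar> \<le> s\<^sup>2 * (C2 * \<eta> ^ (n + 1))" by (intro mult_left_mono) auto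
    moreover have "s\<^sup>2 * \<bar>R\<^sup>2 * g ^ 3 - 4 / 9\<bar> = \<bar>R - 2 / 3 * s\<bar> * (R + 2 / 3 * s)"
    proof -
      have "s\<^sup>2 * (R\<^sup>2 * g ^ 3 - 4 / 9) = (R - 2 / 3 * s) * (R + 2 / 3 * s)" using s2 by algebra
      then have "\<bar>s\<^sup>2 * (R\<^sup>2 * g ^ 3 - 4 / 9)\<bar> = \<bar>(R - 2 / 3 * s) * (R + 2 / 3 * s)\<bar>" by simp
      then show ?thesis unfolding abs_mult using R s0 by simp
    qed
    moreover have "\<bar>R - 2 / 3 * s\<bar> * (2 / 3 * s) \<le> \<bar>R - 2 / 3 * s\<bar> * (R + 2 / 3 * s)"
      using R by (intro mult_left_mono) auto
    ultimately have "s * (2 / 3 * \<bar>R - 2 / 3 * s\<bar>) \<le> s * (s * (C2 * \<eta> ^ (n + 1)))"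
      by (simp add: power2_eq_square mult_ac)
    then have "2 / 3 * \<bar>R - 2 / 3 * s\<bar> \<le> s * (C2 * \<eta> ^ (n + 1))" using s0 by simp
    moreover have "s * (C2 * \<eta> ^ (n + 1)) \<le> S * (C2 * \<eta> ^ (n + 1))"
      using sS C2 \<eta> by (intro mult_right_mono) auto
    moreover have "z \<le> 3 / 2 * M" if "2 / 3 * z \<le> N" "N \<le> M" for z N M :: real using that by linarith
    ultimately have "\<bar>R - 2 / 3 * s\<bar> \<le> 3 / 2 * (S * (C2 * \<eta> ^ (n + 1)))" by blast
    with 1 have "\<bar>s / \<epsilon> ^ 3 * \<alpha> - R\<bar> \<le> S * (C * \<eta> ^ (n + 1)) + 3 / 2 * (S * (C2 * \<eta> ^ (n + 1)))"
      by linarith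
    then have "\<bar>s / \<epsilon> ^ 3 * \<alpha> - R\<bar> \<le> (S * (C + 3 / 2 * C2)) * \<eta> ^ (n + 1)"
      by (simp add: algebra_simps)
    moreover have Req: "R = (\<Sum>k\<le>n. a k * (\<eta> * g) ^ k)" by (simp add: R_def poly_revert g_def)
    ultimately show "\<bar>(\<eta> * poly Gpoly \<eta>) powr (-3/2) * mather_alpha \<gamma> l (\<eta> * poly Gpoly \<eta> - l)
        - (\<Sum>k\<le>n. a k * (\<eta> * poly Gpoly \<eta>) ^ k)\<bar> \<le> (S * (C + 3 / 2 * C2)) * \<eta> ^ (n + 1)"
      unfolding g_def[symmetric] Req[symmetric] \<alpha>_def[symmetric] xp by blast
  qed
qed

text \<open>From \<beta> + l \<omega> = t Gbar \<omega> - 2/3 \<epsilon>^3 and \<omega> = 2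
  \<epsilon> / Hbar, the quotient by \<omega>^3 is (3 Gbar - Hbar) Hbar^2 / 12. It is a function of
  \<open>t\<close> alone, hence has a series in y = \<omega>^2.\<close>

lemma beta_asymp:
  assumes n: "n \<le> I"
    and eq: "eqm (n + 1) (\<Sum>k\<le>n. monom (4 ^ k * a k) k * (Hpoly * Hpoly) ^ (n - k))
      (smult (1/12) ((3 * Gpoly - Hpoly) * (Hpoly * Hpoly)) * (Hpoly * Hpoly) ^ n)"
  shows "asymp_series (\<lambda>y. (mather_beta \<gamma> l (sqrt y) + l * sqrt y) / sqrt y ^ 3) n a"
proof -
  define c0 where "c0 = coeff Gpoly 0"
  have c0: "c0 > 0" using coeff_Gpoly_pos by (simp add: c0_def)
  obtain C \<epsilon>0 where C: "C \<ge> 0" "0 < \<epsilon>0" "\<epsilon>0 \<le> 1"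
    "\<And>\<epsilon>. 0 < \<epsilon> \<Longrightarrow> \<epsilon> \<le> \<epsilon>0 \<Longrightarrow>
      \<bar>mather_beta \<gamma> l (2 * \<epsilon> / Hbar (\<epsilon>\<^sup>2)) - ((\<epsilon>\<^sup>2 * Gbar (\<epsilon>\<^sup>2) - l) * (2 * \<epsilon> / Hbar (\<epsilon>\<^sup>2)) - 2 / 3 * \<epsilon> ^ 3)\<bar> \<le> C * \<epsilon> ^ (2 * I + 5)"
    by (rule main_bounds) blast
  obtain C2 where C2: "C2 \<ge> 0"
    "\<And>t. 0 \<le> t \<Longrightarrow> t \<le> 1 \<Longrightarrow> \<bar>poly (\<Sum>k\<le>n. monom (4 ^ k * a k) k * (Hpoly * Hpoly) ^ (n - k)) t -
      poly (smult (1/12) ((3 * Gpoly - Hpoly) * (Hpoly * Hpoly)) * (Hpoly * Hpoly) ^ n) t\<bar> \<le> C2 * t ^ (n + 1)"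
    by (rule eqm_poly_bounded[OF eq]) blast
  obtain B where B: "B \<ge> 0" "\<And>t. 0 \<le> t \<Longrightarrow> t \<le> 1 \<Longrightarrow> \<bar>poly Hpoly t\<bar> \<le> B" using poly_bounded_01 by blast
  have "poly Hpoly 0 = 2 * c0" by (simp add: poly_0_coeff_0 coeff_Hpoly c0_def)
  then have "poly Hpoly 0 > c0" using c0 by simp
  then obtain \<delta> where \<delta>: "\<delta> > 0" "\<And>t. 0 \<le> t \<Longrightarrow> t \<le> \<delta> \<Longrightarrow> poly Hpoly t > c0"
    by (rule poly_gt_near_0) blast
  define \<eta>0 where "\<eta>0 = min (\<epsilon>0\<^sup>2) \<delta>"
  have \<eta>0: "0 < \<eta>0" "\<eta>0 \<le> \<epsilon>0\<^sup>2" "\<eta>0 \<le> \<delta>" using C \<delta> by (auto simp: \<eta>0_def)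
  have "\<epsilon>0\<^sup>2 \<le> 1" using C by (simp add: power_le_one)
  then have \<eta>01: "\<eta>0 \<le> 1" using \<eta>0 by linarith
  have H: "poly Hpoly t > c0" if "0 \<le> t" "t \<le> \<eta>0" for t using \<delta>(2) that \<eta>0 by simp
  define q where "q \<eta> = 4 / (poly Hpoly \<eta>)\<^sup>2" for \<eta>
  show ?thesis
  proof (rule asymp_series_transfer)
    show "continuous_on {0..\<eta>0} q"
      unfolding q_def using H c0 by (intro continuous_intros) force
    show "q 0 > 0" using H[of 0] c0 \<eta>0 by (simp add: q_def)
    show "\<eta>0 > 0" by (rule \<eta>0)
    fix \<eta> assume \<eta>: "0 < \<eta>" "\<eta> \<le> \<eta>0"
    define \<epsilon> where "\<epsilon> = sqrt \<eta>"
    have \<epsilon>: "\<epsilon> > 0" "\<epsilon>\<^sup>2 = \<eta>" "\<epsilon> \<le> 1" using \<eta> \<eta>01 by (auto simp: \<epsilon>_def)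
    have "\<epsilon> \<le> \<epsilon>0" using \<eta> \<eta>0 C unfolding \<epsilon>_def by (intro real_le_lsqrt) auto
    define h g where "h = poly Hpoly \<eta>" and "g = poly Gpoly \<eta>"
    have h: "h > c0" "\<bar>h\<bar> \<le> B" using H[of \<eta>] B(2)[of \<eta>] \<eta> \<eta>01 by (auto simp: h_def)
    then have h0: "h > 0" using c0 by linarith
    define \<omega> where "\<omega> = 2 * \<epsilon> / h"
    have \<omega>: "\<omega> > 0" using \<epsilon> h0 by (simp add: \<omega>_def)
    have sq: "sqrt (\<eta> * q \<eta>) = \<omega>"
    proof -
      have "\<eta> * q \<eta> = \<omega>\<^sup>2" by (simp add: q_def \<omega>_def h_def power_divide power_mult_distrib \<epsilon>(2))
      then show ?thesis using \<omega> by simp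
    qed
    define \<beta> where "\<beta> = mather_beta \<gamma> l \<omega>"
    define W where "W = (3 * g - h) * h\<^sup>2 / 12"
    have b: "\<bar>\<beta> - ((\<eta> * g - l) * \<omega> - 2 / 3 * \<epsilon> ^ 3)\<bar> \<le> C * \<epsilon> ^ (2 * I + 5)"
      using C(4)[OF \<epsilon>(1) \<open>\<epsilon> \<le> \<epsilon>0\<close>] unfolding \<epsilon>(2) \<beta>_def g_def h_def \<omega>_def poly_Gpoly poly_Hpoly .
    have 1: "\<bar>(\<beta> + l * \<omega>) / \<omega> ^ 3 - W\<bar> \<le> C * B ^ 3 / 8 * \<eta> ^ (n + 1)"
    proof -
      have w3: "\<omega> ^ 3 = 8 * \<epsilon> ^ 3 / h ^ 3" by (simp add: \<omega>_def power_divide power_mult_distrib)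
      have "\<omega> ^ 3 * W = \<eta> * g * \<omega> - 2 / 3 * \<epsilon> ^ 3"
        unfolding w3 W_def \<omega>_def \<epsilon>(2)[symmetric] using h0 by (simp add: field_simps power2_eq_square power3_eq_cube)
      moreover have "(\<beta> + l * \<omega>) / \<omega> ^ 3 - W = (\<beta> + l * \<omega> - \<omega> ^ 3 * W) / \<omega> ^ 3"
        using \<omega> by (simp add: diff_divide_distrib)
      moreover have "\<beta> + l * \<omega> - (\<eta> * g * \<omega> - 2 / 3 * \<epsilon> ^ 3) = \<beta> - ((\<eta> * g - l) * \<omega> - 2 / 3 * \<epsilon> ^ 3)"
        by (simp add: left_diff_distrib)
      ultimately have "(\<beta> + l * \<omega>) / \<omega> ^ 3 - W = (\<beta> - ((\<eta> * g - l) * \<omega> - 2 / 3 * \<epsilon> ^ 3)) / \<omega> ^ 3"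
        by simp
      then have "\<bar>(\<beta> + l * \<omega>) / \<omega> ^ 3 - W\<bar> = \<bar>\<beta> - ((\<eta> * g - l) * \<omega> - 2 / 3 * \<epsilon> ^ 3)\<bar> / \<omega> ^ 3"
        using \<omega> by (simp add: abs_divide)
      also have "\<dots> \<le> C * \<epsilon> ^ (2 * I + 5) / \<omega> ^ 3" using b \<omega> by (intro divide_right_mono) auto
      also have "\<dots> = C * (\<epsilon> ^ 3 * \<eta> ^ (I + 1)) / \<omega> ^ 3" using eps_powers[of \<epsilon>] \<epsilon>(2) by simp
      also have "\<dots> = C * (h ^ 3 / 8 * \<eta> ^ (I + 1))" unfolding w3 using \<epsilon> h0 by (simp add: field_simps)
      also have "\<dots> \<le> C * (B ^ 3 / 8 * \<eta> ^ (n + 1))"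
        using C h h0 n \<eta> \<eta>01
        by (intro mult_left_mono mult_mono divide_right_mono power_mono power_decreasing) auto
      finally show ?thesis by simp
    qed
    have "\<bar>(\<Sum>k\<le>n. a k * (\<eta> * q \<eta>) ^ k) - W\<bar> \<le> C2 / (c0\<^sup>2) ^ n * \<eta> ^ (n + 1)"
    proof -
      define A where "A = h * h"
      have A: "A > 0" using h0 by (simp add: A_def)
      have "c0\<^sup>2 \<le> A" using h c0 by (simp add: A_def power2_eq_square mult_mono)
      have "(\<Sum>k\<le>n. a k * (\<eta> * q \<eta>) ^ k) * A ^ n = (\<Sum>k\<le>n. 4 ^ k * a k * \<eta> ^ k * A ^ (n - k))"
        unfolding sum_distrib_right
      proof (intro sum.cong refl)
        fix k assume "k \<in> {..n}"
        then have "A ^ n = A ^ k * A ^ (n - k)" by (simp flip: power_add)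
        moreover have "\<eta> * q \<eta> = 4 * \<eta> / A" by (simp add: q_def A_def h_def power2_eq_square)
        ultimately show "a k * (\<eta> * q \<eta>) ^ k * A ^ n = 4 ^ k * a k * \<eta> ^ k * A ^ (n - k)"
          using A by (simp add: power_divide power_mult_distrib)
      qed
      moreover have "W = 1 / 12 * ((3 * g - h) * A)" by (simp add: W_def A_def power2_eq_square)
      ultimately have "((\<Sum>k\<le>n. a k * (\<eta> * q \<eta>) ^ k) - W) * A ^ n
          = (\<Sum>k\<le>n. 4 ^ k * a k * \<eta> ^ k * A ^ (n - k)) - 1 / 12 * ((3 * g - h) * A) * A ^ n"
        by (metis left_diff_distrib)
      moreover have "\<bar>(\<Sum>k\<le>n. 4 ^ k * a k * \<eta> ^ k * A ^ (n - k)) - 1 / 12 * ((3 * g - h) * A) * A ^ n\<bar> \<le> C2 * \<eta> ^ (n + 1)"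
        using C2(2)[of \<eta>] \<eta> \<eta>01 by (simp add: poly_sum poly_monom A_def g_def h_def)
      ultimately have "\<bar>((\<Sum>k\<le>n. a k * (\<eta> * q \<eta>) ^ k) - W) * A ^ n\<bar> \<le> C2 * \<eta> ^ (n + 1)"
        by (simp only:)
      then have "\<bar>(\<Sum>k\<le>n. a k * (\<eta> * q \<eta>) ^ k) - W\<bar> \<le> C2 * \<eta> ^ (n + 1) / A ^ n"
        using A by (simp add: abs_mult pos_le_divide_eq)
      also have "\<dots> \<le> C2 * \<eta> ^ (n + 1) / (c0\<^sup>2) ^ n"
        using C2 \<eta> c0 \<open>c0\<^sup>2 \<le> A\<close> by (intro divide_left_mono power_mono mult_pos_pos) (auto simp: A)
      finally show ?thesis by simp
    qed
    with 1 have "\<bar>(\<beta> + l * \<omega>) / \<omega> ^ 3 - (\<Sum>k\<le>n. a k * (\<eta> * q \<eta>) ^ k)\<bar>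
        \<le> C * B ^ 3 / 8 * \<eta> ^ (n + 1) + C2 / (c0\<^sup>2) ^ n * \<eta> ^ (n + 1)" by linarith
    then show "\<bar>(mather_beta \<gamma> l (sqrt (\<eta> * q \<eta>)) + l * sqrt (\<eta> * q \<eta>)) / sqrt (\<eta> * q \<eta>) ^ 3
        - (\<Sum>k\<le>n. a k * (\<eta> * q \<eta>) ^ k)\<bar> \<le> (C * B ^ 3 / 8 + C2 / (c0\<^sup>2) ^ n) * \<eta> ^ (n + 1)"
      unfolding sq \<beta>_def distrib_right .
  qed
qed

end

section \<open>From the table to the formal data\<close>

context table
begin

text \<open>The statement is general enough for its own coinduction: differentiation multiplies
  \<open>c\<close> by \<open>l\<close> and raises \<open>n\<close>. The factor \<open>z\<close>
  selects the real part for 1 and the imaginary part for \<open>- \<i>\<close>.\<close>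

lemma psmooth_velocity: "psmooth (\<lambda>x. c * Re (z * (velocity ^^ n) \<gamma> (l * x)))"
proof (coinduction arbitrary: c n)
  case psmooth
  have der: "((\<lambda>x. c * Re (z * (velocity ^^ n) \<gamma> (l * x))) has_real_derivative
      (c * l) * Re (z * (velocity ^^ Suc n) \<gamma> (l * x))) (at x)" for x
  proof -
    have "((\<lambda>s. Re (z * (velocity ^^ n) \<gamma> s)) has_real_derivative Re (z * (velocity ^^ Suc n) \<gamma> (l * x))) (at (l * x))"
      unfolding has_real_derivative_iff_has_vector_derivative
      by (intro bounded_linear.has_vector_derivative[OF bounded_linear_Re]
          bounded_linear.has_vector_derivative[OF bounded_linear_mult_right] velocity_deriv)
    then have "((\<lambda>x. Re (z * (velocity ^^ n) \<gamma> (l * x))) has_real_derivative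
        Re (z * (velocity ^^ Suc n) \<gamma> (l * x)) * l) (at x)"
      by (rule DERIV_chain2[where g = "\<lambda>x. l * x"]) (rule DERIV_cmult_Id)
    from DERIV_cmult[OF this, of c] show ?thesis by (simp add: mult_ac)
  qed
  have per: "(velocity ^^ n) \<gamma> (l * (x + 1)) = (velocity ^^ n) \<gamma> (l * x)" for x
    using velocity_pow_period[of n "l * x"] by (simp add: distrib_left)
  show ?case
    by (rule exI[of _ "\<lambda>x. c * Re (z * (velocity ^^ n) \<gamma> (l * x))"],
        rule exI[of _ "\<lambda>x. (c * l) * Re (z * (velocity ^^ Suc n) \<gamma> (l * x))"])
       (intro conjI allI refl der disjI1 exI[of _ "c * l"] exI[of _ "Suc n"], simp only: per)
qed

text \<open>The curvature is built from the tangent coordinates inside the ring of smooth periodic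
  functions. Being positive, it has real powers there, and its powers 1/3 and -1/3 are
  \<open>w\<close> and \<open>v\<close>.\<close>

theorem billiard_frame_exists: obtains w v tx ty where "billiard_frame \<Omega> \<gamma> l w v tx ty"
proof -
  interpret period l by standard (rule l_pos)
  define tx where "tx = Abs_psm (\<lambda>x. Re (T (l * x)))"
  define ty where "ty = Abs_psm (\<lambda>x. Im (T (l * x)))"
  have "psmooth (\<lambda>x. Re (T (l * x)))" using psmooth_velocity[of 1 1 1] by simp
  then have tx: "val tx s = Re (T s)" for s using l_pos by (simp add: val_def tx_def Abs_psm_inverse)
  have "psmooth (\<lambda>x. Im (T (l * x)))" using psmooth_velocity[of 1 "- \<i>" 1] by simp
  then have ty: "val ty s = Im (T s)" for s using l_pos by (simp add: val_def ty_def Abs_psm_inverse)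
  have "((\<lambda>s. Re (velocity \<gamma> s)) has_real_derivative Re (velocity (velocity \<gamma>) s)) (at s)"
    "((\<lambda>s. Im (velocity \<gamma> s)) has_real_derivative Im (velocity (velocity \<gamma>) s)) (at s)" for s
    unfolding has_real_derivative_iff_has_vector_derivative
    using bounded_linear.has_vector_derivative[OF bounded_linear_Re T_deriv]
      bounded_linear.has_vector_derivative[OF bounded_linear_Im T_deriv] by auto
  moreover have "val tx = (\<lambda>s. Re (velocity \<gamma> s))" "val ty = (\<lambda>s. Im (velocity \<gamma> s))"
    by (auto simp: tx ty)
  ultimately have d: "val (d tx) s = Re (velocity T s)" "val (d ty) s = Im (velocity T s)" for s
    using val_deriv DERIV_unique by metis+
  define \<kappa> where "\<kappa> = tx * d ty - ty * d tx"
  have \<kappa>: "val \<kappa> s = curvature \<gamma> s" for s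
    by (simp add: \<kappa>_def d tx ty curvature_def)
  have ev\<kappa>: "ev \<kappa> x > 0" for x
    using curv_pos[of "l * x"] \<kappa>[of "l * x"] l_pos by (simp add: val_def)
  obtain w where w: "\<And>x. ev w x = ev \<kappa> x powr (1/3)" using psm_powr[OF ev\<kappa>] by blast
  obtain v where v: "\<And>x. ev v x = ev \<kappa> x powr (- (1/3))" using psm_powr[OF ev\<kappa>] by blast
  have "billiard_frame \<Omega> \<gamma> l w v tx ty"
  proof unfold_locales
    show "w * v = 1"
    proof (rule psm_eqI)
      fix x
      show "ev (w * v) x = ev 1 x" using ev\<kappa>[of x] by (simp add: w v flip: powr_add)
    qed
    show "val tx s = Re (T s)" "val ty s = Im (T s)" for s by (rule tx ty)+
    show "val w s ^ 3 = curvature \<gamma> s" for s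
    proof -
      have "ev w (s / l) ^ 3 = ev \<kappa> (s / l) powr (3 * (1/3))"
        unfolding w using ev\<kappa> by (subst powr_power) (auto simp: less_imp_neq[symmetric])
      then show ?thesis using \<kappa>[of s] ev\<kappa>[of "s / l"] by (simp add: val_def)
    qed
    show "0 < val w s" for s using ev\<kappa>[of "s / l"] by (simp add: val_def w)
  qed
  then show ?thesis by (rule that)
qed

end

section \<open>Identification of the integrals\<close>

context period
begin

lemma prim_add: "prim (p + q) l = prim p l + prim q l"
  and prim_scaleR: "prim (c *\<^sub>R p) l = c * prim p l"
  and prim_d: "prim (d p) l = 0"
proof -
  have "prim (p + q) l = (prim p l + prim q l) - (prim p 0 + prim q 0)"
    by (rule prim_unique) (auto intro!: derivative_eq_intros prim)
  then show "prim (p + q) l = prim p l + prim q l" by (simp add: prim)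
  have "prim (c *\<^sub>R p) l = c * prim p l - c * prim p 0"
    by (rule prim_unique) (auto intro!: derivative_eq_intros prim)
  then show "prim (c *\<^sub>R p) l = c * prim p l" by (simp add: prim)
  have "prim (d p) l = val p l - val p 0" by (rule prim_unique[OF val_deriv])
  also have "\<dots> = 0" using val_periodic_int[of p 0 1] by simp
  finally show "prim (d p) l = 0" .
qed

end

lemma cube_powr: "0 < x \<Longrightarrow> (x ^ 3) powr (real m / 3) = x ^ m" for x :: real
  by (simp add: powr_powr powr_realpow flip: powr_numeral)

lemmas cube_powr_numeral = cube_powr[of _ "numeral n" for n, simplified]

context billiard_frame
begin

lemma curvature_val: "curvature \<gamma> = val (w ^ 3)"
  by (simp add: fun_eq_iff val_w3)

lemma deriv_val: "deriv (val p) = val (d p)"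
  using DERIV_imp_deriv val_deriv by blast

text \<open>The dictionary between derivatives of the curvature, in which the invariants are stated,
  and \<open>uu\<close>.\<close>

lemma curvature_derivs:
  "deriv (curvature \<gamma>) = val (w ^ 6 * (3 *\<^sub>R u1))"
  "(deriv ^^ 2) (curvature \<gamma>) = val (w ^ 9 * (3 *\<^sub>R u2 + 6 *\<^sub>R u1 ^ 2))"
  "(deriv ^^ 3) (curvature \<gamma>) = val (w ^ 12 * (3 *\<^sub>R u3 + 18 *\<^sub>R (u1 * u2) + 6 *\<^sub>R u1 ^ 3))"
proof -
  have 1: "d (w ^ 3) = w ^ 6 * (3 *\<^sub>R u1)"
    by (rule val_eqI) (simp only: algs; algebra)
  have 2: "d (w ^ 6 * (3 *\<^sub>R u1)) = w ^ 9 * (3 *\<^sub>R u2 + 6 *\<^sub>R u1 ^ 2)"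
    by (rule val_eqI) (simp only: algs; algebra)
  have 3: "d (w ^ 9 * (3 *\<^sub>R u2 + 6 *\<^sub>R u1 ^ 2)) = w ^ 12 * (3 *\<^sub>R u3 + 18 *\<^sub>R (u1 * u2) + 6 *\<^sub>R u1 ^ 3)"
    by (rule val_eqI) (simp only: algs; algebra)
  have pow: "(deriv ^^ 2) f = deriv (deriv f)" "(deriv ^^ 3) f = deriv (deriv (deriv f))" for f :: "real \<Rightarrow> real"
    by (simp_all add: numeral_2_eq_2 numeral_3_eq_3)
  show "deriv (curvature \<gamma>) = val (w ^ 6 * (3 *\<^sub>R u1))"
    "(deriv ^^ 2) (curvature \<gamma>) = val (w ^ 9 * (3 *\<^sub>R u2 + 6 *\<^sub>R u1 ^ 2))"
    "(deriv ^^ 3) (curvature \<gamma>) = val (w ^ 12 * (3 *\<^sub>R u3 + 18 *\<^sub>R (u1 * u2) + 6 *\<^sub>R u1 ^ 3))"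
    unfolding curvature_val pow deriv_val 1 2 3 by (rule refl)+
qed

lemma prim_G0: "prim G0 l = I3 (curvature \<gamma>) l / 2"
proof -
  have "I3 (curvature \<gamma>) l = integral {0..l} (val (w ^ 2))"
    unfolding I3_def by (rule integral_cong) (use w_pos cube_powr_numeral in \<open>simp flip: val_w3\<close>)
  moreover have "G0 = (1/2) *\<^sub>R w ^ 2" by (rule val_eqI) (simp add: G0_def)
  then have "prim G0 l = prim (w ^ 2) l / 2" by (simp only: prim_scaleR)
  ultimately show ?thesis by (simp only: prim_integral)
qed

lemma prim_G1: "prim G1 l = - I5 (curvature \<gamma>) l / 1080"
proof -
  have "I5 (curvature \<gamma>) l = integral {0..l} (val (w ^ 4 * (9 *\<^sub>R 1 + 72 *\<^sub>R (u1 ^ 2))))"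
    unfolding I5_def Let_def
  proof (rule integral_cong)
    fix s
    define z a where "z = val w s" and "a = val u1 s"
    have z: "z > 0" by (simp add: z_def w_pos)
    show "9 * curvature \<gamma> s powr (4/3) + 8 * (deriv (curvature \<gamma>) s)\<^sup>2 / curvature \<gamma> s powr (8/3)
      = val (w ^ 4 * (9 *\<^sub>R 1 + 72 *\<^sub>R (u1 ^ 2))) s"
      unfolding curvature_derivs val_simps val_w3[symmetric] z_def[symmetric] a_def[symmetric] cube_powr_numeral[OF z]
      using z by (simp add: field_simps)
  qed
  then show ?thesis unfolding G1_integral prim_add prim_scaleR prim_d by (simp only: prim_integral)
qed

text \<open>By homogeneity every summand has the factor z^6: the derivative of the curvature of
  order j has weight 3 j + 3 in \<open>w\<close>.\<close>

lemma I7_integrand: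
  fixes z A B :: real
  assumes "z > 0"
  shows "9 * (z ^ 3)\<^sup>2 + 24 * (z ^ 6 * A)\<^sup>2 / (z ^ 3)\<^sup>2 + 24 * (z ^ 9 * B)\<^sup>2 / (z ^ 3) ^ 4
      - 144 * (z ^ 6 * A)\<^sup>2 * (z ^ 9 * B) / (z ^ 3) ^ 5 + 176 * (z ^ 6 * A) ^ 4 / (z ^ 3) ^ 6
    = z ^ 6 * (9 + 24 * A\<^sup>2 + 24 * B\<^sup>2 - 144 * A\<^sup>2 * B + 176 * A ^ 4)"
proof -
  have 1: "9 * (z ^ 3)\<^sup>2 = z ^ 6 * 9" "24 * (z ^ 6 * A)\<^sup>2 / (z ^ 3)\<^sup>2 = z ^ 6 * (24 * A\<^sup>2)"
    "24 * (z ^ 9 * B)\<^sup>2 / (z ^ 3) ^ 4 = z ^ 6 * (24 * B\<^sup>2)"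
    "144 * (z ^ 6 * A)\<^sup>2 * (z ^ 9 * B) / (z ^ 3) ^ 5 = z ^ 6 * (144 * A\<^sup>2 * B)"
    "176 * (z ^ 6 * A) ^ 4 / (z ^ 3) ^ 6 = z ^ 6 * (176 * A ^ 4)"
    using assms by (simp_all add: power_mult_distrib field_simps flip: power_mult)
  show ?thesis unfolding 1 by (simp only: distrib_left right_diff_distrib)
qed

lemma prim_G2: "prim G2 l = - I7 (curvature \<gamma>) l / 25200"
proof -
  define q where "q = w ^ 6 * (9 *\<^sub>R 1 + 216 *\<^sub>R (u1 ^ 2) + 216 *\<^sub>R (u2 ^ 2) + (- 3024) *\<^sub>R (u1 ^ 2 * u2) + 7344 *\<^sub>R (u1 ^ 4))"
  have "I7 (curvature \<gamma>) l = integral {0..l} (val q)"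
    unfolding I7_def Let_def
  proof (rule integral_cong)
    fix s
    define z a b where "z = val w s" and "a = val u1 s" and "b = val u2 s"
    have z: "z > 0" by (simp add: z_def w_pos)
    show "9 * (curvature \<gamma> s)\<^sup>2 + 24 * (deriv (curvature \<gamma>) s)\<^sup>2 / (curvature \<gamma> s)\<^sup>2
        + 24 * ((deriv ^^ 2) (curvature \<gamma>) s)\<^sup>2 / curvature \<gamma> s ^ 4
        - 144 * (deriv (curvature \<gamma>) s)\<^sup>2 * (deriv ^^ 2) (curvature \<gamma>) s / curvature \<gamma> s ^ 5
        + 176 * deriv (curvature \<gamma>) s ^ 4 / curvature \<gamma> s ^ 6 = val q s"
      unfolding q_def curvature_derivs val_simps val_w3[symmetric] z_def[symmetric] a_def[symmetric] b_def[symmetric]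
        I7_integrand[OF z] by algebra
  qed
  then show ?thesis unfolding G2_integral prim_add prim_scaleR prim_d q_def[symmetric] by (simp only: prim_integral)
qed

lemma I9_integrand:
  fixes z A B C :: real
  assumes "z > 0"
  shows "281/44800 * z ^ 8
        + 281 * (z ^ 6 * A)^2 / (8400 * z ^ 4)
        + 167 * (z ^ 9 * B)^2 / (4200 * z ^ 10)
        - 167 * (z ^ 6 * A)^2 * (z ^ 9 * B) / (700 * z ^ 13)
        + (z ^ 12 * C)^2 / (42 * z ^ 16)
        + 559 * (z ^ 6 * A)^4 / (2100 * z ^ 16)
        - 473 * (z ^ 9 * B)^3 / (4725 * z ^ 19)
        - 10 * (z ^ 12 * C) * (z ^ 6 * A) * (z ^ 9 * B) / (21 * z ^ 19)
        + 5 * (z ^ 12 * C) * (z ^ 6 * A)^3 / (7 * z ^ 22)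
        + 13142 * (z ^ 6 * A)^2 * (z ^ 9 * B)^2 / (4725 * z ^ 22)
        - 10777 * (z ^ 6 * A)^4 * (z ^ 9 * B) / (1575 * z ^ 25)
        + 521897 * (z ^ 6 * A)^6 / (127575 * z ^ 28)
    = z ^ 8 * (281/44800 + 281/8400 * A^2 + 167/4200 * B^2 - 167/700 * A^2 * B + 1/42 * C^2 + 559/2100 * A^4
        - 473/4725 * B^3 - 10/21 * C * A * B + 5/7 * C * A^3 + 13142/4725 * A^2 * B^2 - 10777/1575 * A^4 * B + 521897/127575 * A^6)"
proof -
  have 1: "281 * (z ^ 6 * A)^2 / (8400 * z ^ 4) = z ^ 8 * (281/8400 * A^2)"
    "167 * (z ^ 9 * B)^2 / (4200 * z ^ 10) = z ^ 8 * (167/4200 * B^2)"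
    "167 * (z ^ 6 * A)^2 * (z ^ 9 * B) / (700 * z ^ 13) = z ^ 8 * (167/700 * A^2 * B)"
    "(z ^ 12 * C)^2 / (42 * z ^ 16) = z ^ 8 * (1/42 * C^2)"
    "559 * (z ^ 6 * A)^4 / (2100 * z ^ 16) = z ^ 8 * (559/2100 * A^4)"
    "473 * (z ^ 9 * B)^3 / (4725 * z ^ 19) = z ^ 8 * (473/4725 * B^3)"
    "10 * (z ^ 12 * C) * (z ^ 6 * A) * (z ^ 9 * B) / (21 * z ^ 19) = z ^ 8 * (10/21 * C * A * B)"
    "5 * (z ^ 12 * C) * (z ^ 6 * A)^3 / (7 * z ^ 22) = z ^ 8 * (5/7 * C * A^3)"
    "13142 * (z ^ 6 * A)^2 * (z ^ 9 * B)^2 / (4725 * z ^ 22) = z ^ 8 * (13142/4725 * A^2 * B^2)"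
    "10777 * (z ^ 6 * A)^4 * (z ^ 9 * B) / (1575 * z ^ 25) = z ^ 8 * (10777/1575 * A^4 * B)"
    "521897 * (z ^ 6 * A)^6 / (127575 * z ^ 28) = z ^ 8 * (521897/127575 * A^6)"
    using assms by (simp_all add: power_mult_distrib field_simps flip: power_mult)
  show ?thesis unfolding 1 by (simp only: distrib_left right_diff_distrib mult.commute[of "281/44800"])
qed

lemma prim_G3: "prim G3 l = - (2 / 405) * I9 (curvature \<gamma>) l"
proof -
  define q where "q = w ^ 8 * ((281 / 44800) *\<^sub>R 1
    + (843 / 2800) *\<^sub>R (u1 ^ 2)
    + (501 / 1400) *\<^sub>R (u2 ^ 2)
    + (- (501 / 100)) *\<^sub>R (u1 ^ 2 * u2)
    + (1011 / 100) *\<^sub>R (u1 ^ 4)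
    + (3 / 14) *\<^sub>R (u3 ^ 2)
    + (- (473 / 175)) *\<^sub>R (u2 ^ 3)
    + (- (72 / 7)) *\<^sub>R (u1 * u2 * u3)
    + (24438 / 175) *\<^sub>R (u1 ^ 2 * u2 ^ 2)
    + 33 *\<^sub>R (u1 ^ 3 * u3)
    + (- (15543 / 25)) *\<^sub>R (u1 ^ 4 * u2)
    + (15037 / 25) *\<^sub>R (u1 ^ 6))"
  have "I9 (curvature \<gamma>) l = integral {0..l} (val q)"
    unfolding I9_def Let_def
  proof (rule integral_cong)
    fix s
    define z a b c where "z = val w s" and "a = val u1 s" and "b = val u2 s" and "c = val u3 s"
    have z: "z > 0" by (simp add: z_def w_pos)
    show "281 / 44800 * curvature \<gamma> s powr (8/3)
        + 281 * (deriv (curvature \<gamma>) s)^2 / (8400 * curvature \<gamma> s powr (4/3))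
        + 167 * ((deriv ^^ 2) (curvature \<gamma>) s)^2 / (4200 * curvature \<gamma> s powr (10/3))
        - 167 * (deriv (curvature \<gamma>) s)^2 * (deriv ^^ 2) (curvature \<gamma>) s / (700 * curvature \<gamma> s powr (13/3))
        + ((deriv ^^ 3) (curvature \<gamma>) s)^2 / (42 * curvature \<gamma> s powr (16/3))
        + 559 * (deriv (curvature \<gamma>) s)^4 / (2100 * curvature \<gamma> s powr (16/3))
        - 473 * ((deriv ^^ 2) (curvature \<gamma>) s)^3 / (4725 * curvature \<gamma> s powr (19/3))
        - 10 * (deriv ^^ 3) (curvature \<gamma>) s * deriv (curvature \<gamma>) s * (deriv ^^ 2) (curvature \<gamma>) s / (21 * curvature \<gamma> s powr (19/3))
        + 5 * (deriv ^^ 3) (curvature \<gamma>) s * (deriv (curvature \<gamma>) s)^3 / (7 * curvature \<gamma> s powr (22/3))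
        + 13142 * (deriv (curvature \<gamma>) s)^2 * ((deriv ^^ 2) (curvature \<gamma>) s)^2 / (4725 * curvature \<gamma> s powr (22/3))
        - 10777 * (deriv (curvature \<gamma>) s)^4 * (deriv ^^ 2) (curvature \<gamma>) s / (1575 * curvature \<gamma> s powr (25/3))
        + 521897 * (deriv (curvature \<gamma>) s)^6 / (127575 * curvature \<gamma> s powr (28/3)) = val q s"
      unfolding q_def curvature_derivs val_simps val_w3[symmetric] z_def[symmetric] a_def[symmetric] b_def[symmetric]
        c_def[symmetric] cube_powr_numeral[OF z] I9_integrand[OF z] by algebra
  qed
  then show ?thesis unfolding G3_integral prim_add prim_scaleR prim_d q_def[symmetric] by (simp only: prim_integral)
qed

end

section \<open>The coefficients and the final expansions\<close>

context billiard_formal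
begin

lemma alpha_local:
  assumes "n \<le> I"
  shows "\<exists>a. asymp_series (\<lambda>x. x powr (-3/2) * mather_alpha \<gamma> l (x - l)) n a"
proof -
  obtain a where "a 0 = 2 / 3 * coeff Gpoly 0 powr (-3/2)" "eqm (n + 1) ((revert Gpoly a n)\<^sup>2 * Gpoly ^ 3) [:4/9:]"
    by (rule alpha_series_exists[OF coeff_Gpoly_pos]) blast
  from alpha_asymp[OF assms this] show ?thesis by blast
qed

lemma alpha_local_3:
  assumes "3 \<le> I"
  defines "c i \<equiv> prim (coeff G i) l"
  shows "\<exists>a. asymp_series (\<lambda>x. x powr (-3/2) * mather_alpha \<gamma> l (x - l)) 3 a \<and>
    a 0 = 2 / 3 * c 0 powr (-3/2) \<and> a 1 * c 0 ^ 2 = - (3 / 2) * a 0 * c 1 \<and>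
    a 2 * c 0 ^ 4 = a 0 * (- (3 / 2) * c 2 * c 0 + 27 / 8 * c 1 ^ 2) \<and>
    a 3 * c 0 ^ 6 = a 0 * (- (3 / 2) * c 3 * c 0 ^ 2 + 33 / 4 * c 1 * c 2 * c 0 - 143 / 16 * c 1 ^ 3)"
proof -
  obtain a where a: "a 0 = 2 / 3 * coeff Gpoly 0 powr (-3/2)" "eqm (3 + 1) ((revert Gpoly a 3)\<^sup>2 * Gpoly ^ 3) [:4/9:]"
    by (rule alpha_series_exists[OF coeff_Gpoly_pos]) blast
  have 4: "eqm 4 ((revert Gpoly a 3)\<^sup>2 * Gpoly ^ 3) [:4/9:]" using a(2) by simp
  have "coeff Gpoly 0 \<noteq> 0" "a 0 \<noteq> 0" using coeff_Gpoly_pos by (auto simp: a(1))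
  from alpha_coeffs[OF 4 this] alpha_asymp[OF assms(1) a] a(1)
  show ?thesis unfolding c_def coeff_Gpoly by blast
qed

lemma beta_local:
  assumes "n \<le> I"
  shows "\<exists>a. asymp_series (\<lambda>y. (mather_beta \<gamma> l (sqrt y) + l * sqrt y) / sqrt y ^ 3) n a"
proof -
  have "coeff (Hpoly * Hpoly) 0 \<noteq> 0" using coeff_Gpoly_pos by (simp add: coeff_mult_low coeff_Hpoly)
  then obtain a where "eqm (n + 1) (\<Sum>k\<le>n. monom (4 ^ k * a k) k * (Hpoly * Hpoly) ^ (n - k))
      (smult (1/12) ((3 * Gpoly - Hpoly) * (Hpoly * Hpoly)) * (Hpoly * Hpoly) ^ n)"
    by (rule beta_series_exists) blast
  from beta_asymp[OF assms this] show ?thesis by blast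
qed

lemma beta_local_3:
  assumes "3 \<le> I"
  defines "c i \<equiv> prim (coeff G i) l"
  shows "\<exists>a. asymp_series (\<lambda>y. (mather_beta \<gamma> l (sqrt y) + l * sqrt y) / sqrt y ^ 3) 3 a \<and>
    a 0 = c 0 ^ 3 / 3 \<and> a 1 = c 0 ^ 4 * c 1 \<and> a 2 = c 0 ^ 6 * c 2 + 4 * c 0 ^ 5 * c 1 ^ 2 \<and>
    a 3 = c 0 ^ 8 * c 3 + 12 * c 0 ^ 7 * c 1 * c 2 + 56 / 3 * c 0 ^ 6 * c 1 ^ 3"
proof -
  have "coeff (Hpoly * Hpoly) 0 \<noteq> 0" using coeff_Gpoly_pos by (simp add: coeff_mult_low coeff_Hpoly)
  then obtain a where a: "eqm (3 + 1) (\<Sum>k\<le>3. monom (4 ^ k * a k) k * (Hpoly * Hpoly) ^ (3 - k))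
      (smult (1/12) ((3 * Gpoly - Hpoly) * (Hpoly * Hpoly)) * (Hpoly * Hpoly) ^ 3)"
    by (rule beta_series_exists) blast
  have 4: "eqm 4 (\<Sum>k\<le>3. monom (4 ^ k * a k) k * (Hpoly * Hpoly) ^ (3 - k))
      (smult (1/12) ((3 * Gpoly - Hpoly) * (Hpoly * Hpoly)) * (Hpoly * Hpoly) ^ 3)"
    using a by simp
  have "coeff Gpoly 0 \<noteq> 0" using coeff_Gpoly_pos by simp
  from beta_coeffs[OF coeff_Hpoly 4 this] beta_asymp[OF assms(1) a]
  show ?thesis unfolding c_def coeff_Gpoly by blast
qed

end

context billiard_frame
begin

lemma billiard_formal_exists:
  assumes "3 \<le> I"
  obtains S G Y where "billiard_formal \<Omega> \<gamma> l w v tx ty I S G Y"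
    "coeff G 0 = G0" "coeff G 1 = G1" "coeff G 2 = G2" "coeff G 3 = G3"
proof -
  obtain S G Y where *: "degree S < I + 2" "coeff S 0 = 1" "eqm (I + 2) (S * S) (V2 (w ^ 3) (I + 1))"
    "eqm (I + 1) (Phi (\<lambda>i. - coeff S (Suc i)) I G Y) [:of_real (- 2 / 3):]"
    "eqm (I + 1) (PhiY (\<lambda>i. - coeff S (Suc i)) I G Y) 0"
    "coeff G 0 = G0" "coeff G 1 = G1" "coeff G 2 = G2" "coeff G 3 = G3" "coeff Y 0 = 2 *\<^sub>R v ^ 2"
    "coeff S 1 = - (1 / 24) *\<^sub>R w ^ 6"
    by (rule formal_solution[OF assms]) blast
  have "billiard_formal \<Omega> \<gamma> l w v tx ty I S G Y"
    by unfold_locales (fact *)+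
  with * show ?thesis by (intro that)
qed

lemma alpha_series:
  assumes J: "J3 = I3 (curvature \<gamma>) l" "J5 = I5 (curvature \<gamma>) l" "J7 = I7 (curvature \<gamma>) l" "J9 = I9 (curvature \<gamma>) l"
  obtains a where "\<And>n. asymp_series (\<lambda>x. x powr (-3/2) * mather_alpha \<gamma> l (x - l)) n a"
    "a 0 = 4 * sqrt 2 / 3 * J3 powr (-3/2)"
    "a 1 = sqrt 2 / 135 * J3 powr (-7/2) * J5"
    "a 2 = 1 / (56700 * sqrt 2) * ((72 * J3 * J7 + 7 * J5^2) / J3 powr (11/2))"
    "a 3 = 1 / (826686000 * sqrt 2)
      * ((261273600 * J3^2 * J9 + 21384 * J3 * J5 * J7 + 1001 * J5^3) / J3 powr (15/2))"
proof -
  let ?f = "\<lambda>x. x powr (-3/2) * mather_alpha \<gamma> l (x - l)"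
  have "\<exists>a. asymp_series ?f n a" for n
  proof -
    \<comment> \<open>Order \<open>n\<close> is needed for the expansion, and order 3 is the least
      at which the formal solution starts.\<close>
    obtain S G Y where "billiard_formal \<Omega> \<gamma> l w v tx ty (max 3 n) S G Y"
      by (rule billiard_formal_exists[of "max 3 n"]) auto
    from billiard_formal.alpha_local[OF this, of n] show ?thesis by simp
  qed
  then obtain a where a: "\<And>n. asymp_series ?f n a" by (rule asymp_series_glue) blast
  obtain S G Y where SGY: "billiard_formal \<Omega> \<gamma> l w v tx ty 3 S G Y"
    "coeff G 0 = G0" "coeff G 1 = G1" "coeff G 2 = G2" "coeff G 3 = G3"
    by (rule billiard_formal_exists[of 3]) auto
  interpret billiard_formal \<Omega> \<gamma> l w v tx ty 3 S G Y by (rule SGY)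
  note C = SGY(2-5) prim_G0 prim_G1 prim_G2 prim_G3 J[symmetric]
  obtain b where b: "asymp_series ?f 3 b" "b 0 = 2 / 3 * (J3 / 2) powr (-3/2)"
    "b 1 * (J3 / 2) ^ 2 = - (3 / 2) * b 0 * (- J5 / 1080)"
    "b 2 * (J3 / 2) ^ 4 = b 0 * (- (3 / 2) * (- J7 / 25200) * (J3 / 2) + 27 / 8 * (- J5 / 1080) ^ 2)"
    "b 3 * (J3 / 2) ^ 6 = b 0 * (- (3 / 2) * (- (2 / 405) * J9) * (J3 / 2) ^ 2
      + 33 / 4 * (- J5 / 1080) * (- J7 / 25200) * (J3 / 2) - 143 / 16 * (- J5 / 1080) ^ 3)"
    using alpha_local_3 unfolding C by auto
  have ab: "a k = b k" if "k \<le> 3" for k by (rule asymp_series_unique[OF a b(1) that])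
  have J3: "J3 > 0"
    using coeff_Gpoly_pos unfolding coeff_Gpoly C by simp
  define p where "p = J3 powr (-3/2)"
  define q where "q = sqrt 2"
  have q: "q * q = 2" "q > 0" by (auto simp: q_def)
  have p: "p > 0" using J3 by (simp add: p_def)
  \<comment> \<open>The mean of \<open>G0\<close> is \<open>J3 / 2\<close>; the factor 2^(3/2) is
    the source of the root of 2 in the coefficients of \<alpha>.\<close>
  have b0: "b 0 = 4 * q / 3 * p"
  proof -
    have "(J3 / 2) powr (-3/2) = p * 2 powr (3/2)"
      using J3 by (simp add: p_def powr_divide powr_minus field_simps)
    also have "2 powr (3/2) = 2 * q"
    proof -
      have "(2::real) powr (3/2) = 2 powr 1 * 2 powr (1/2)" using powr_add[of "2::real" 1 "1/2"] by simp
      then show ?thesis by (simp add: q_def powr_half_sqrt)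
    qed
    finally show ?thesis using b(2) by simp
  qed
  have P: "J3 powr (- 7 / 2) = p / J3 ^ 2" "1 / J3 powr (11/2) = p / J3 ^ 4" "1 / J3 powr (15/2) = p / J3 ^ 6"
  proof -
    have "J3 powr (-7/2) = J3 powr (-3/2 - 2)" "J3 powr (-11/2) = J3 powr (-3/2 - 4)" "J3 powr (-15/2) = J3 powr (-3/2 - 6)"
      by simp_all
    then show "J3 powr (- 7 / 2) = p / J3 ^ 2" "1 / J3 powr (11/2) = p / J3 ^ 4" "1 / J3 powr (15/2) = p / J3 ^ 6"
      using J3 unfolding powr_diff p_def by (simp_all add: powr_minus field_simps)
  qed
  have Q: "1 / (x * q) = q / (2 * x)" for x
    using q by (cases "x = 0") (auto simp: field_simps)
  show ?thesis
  proof (rule that[OF a])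
    show "a 0 = 4 * sqrt 2 / 3 * J3 powr (-3/2)"
      using b0 ab[of 0] by (simp add: p_def q_def)
    show "a 1 = sqrt 2 / 135 * J3 powr (-7/2) * J5"
      using b(3) b0 ab[of 1] J3 unfolding P q_def[symmetric] by (simp add: field_simps)
    have "a 2 = q / (2 * 56700) * ((72 * J3 * J7 + 7 * J5^2) * (p / J3 ^ 4))"
      using b(4) b0 ab[of 2] J3 by (simp add: field_simps)
    then show "a 2 = 1 / (56700 * sqrt 2) * ((72 * J3 * J7 + 7 * J5^2) / J3 powr (11/2))"
      unfolding P(2)[symmetric] Q[symmetric] unfolding q_def by simp
    have "a 3 = q / (2 * 826686000) * ((261273600 * J3^2 * J9 + 21384 * J3 * J5 * J7 + 1001 * J5^3) * (p / J3 ^ 6))"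
      using b(5) b0 ab[of 3] J3 by (simp add: field_simps)
    then show "a 3 = 1 / (826686000 * sqrt 2)
      * ((261273600 * J3^2 * J9 + 21384 * J3 * J5 * J7 + 1001 * J5^3) / J3 powr (15/2))"
      unfolding P(3)[symmetric] Q[symmetric] unfolding q_def by simp
  qed
qed

text \<open>The factors 6, 120, 5040 and 362880 are 3!, 5!, 7! and 9!, because \<open>a i\<close> is
  the plain coefficient of \<omega>^(2i+3).\<close>

lemma beta_series:
  assumes J: "J3 = I3 (curvature \<gamma>) l" "J5 = I5 (curvature \<gamma>) l" "J7 = I7 (curvature \<gamma>) l" "J9 = I9 (curvature \<gamma>) l"
  obtains a where "\<And>n. asymp_series (\<lambda>y. (mather_beta \<gamma> l (sqrt y) + l * sqrt y) / sqrt y ^ 3) n a"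
    "6 * a 0 = J3 ^ 3 / 4" "120 * a 1 = - (J3 ^ 4 * J5 / 144)"
    "5040 * a 2 = J3^5 * (14 * J5^2 - 81 * J3 * J7) / 25920"
    "362880 * a 3 = - 7 * J3^6 * (J3^2 * J9 - J3 * J5 * J7 / 5600 + 7/583200 * J5^3)"
proof -
  let ?f = "\<lambda>y. (mather_beta \<gamma> l (sqrt y) + l * sqrt y) / sqrt y ^ 3"
  have "\<exists>a. asymp_series ?f n a" for n
  proof -
    obtain S G Y where "billiard_formal \<Omega> \<gamma> l w v tx ty (max 3 n) S G Y"
      by (rule billiard_formal_exists[of "max 3 n"]) auto
    from billiard_formal.beta_local[OF this, of n] show ?thesis by simp
  qed
  then obtain a where a: "\<And>n. asymp_series ?f n a" by (rule asymp_series_glue) blast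
  obtain S G Y where SGY: "billiard_formal \<Omega> \<gamma> l w v tx ty 3 S G Y"
    "coeff G 0 = G0" "coeff G 1 = G1" "coeff G 2 = G2" "coeff G 3 = G3"
    by (rule billiard_formal_exists[of 3]) auto
  interpret billiard_formal \<Omega> \<gamma> l w v tx ty 3 S G Y by (rule SGY)
  note C = SGY(2-5) prim_G0 prim_G1 prim_G2 prim_G3 J[symmetric]
  obtain b where b: "asymp_series ?f 3 b" "b 0 = (J3 / 2) ^ 3 / 3" "b 1 = (J3 / 2) ^ 4 * (- J5 / 1080)"
    "b 2 = (J3 / 2) ^ 6 * (- J7 / 25200) + 4 * (J3 / 2) ^ 5 * (- J5 / 1080) ^ 2"
    "b 3 = (J3 / 2) ^ 8 * (- (2 / 405) * J9) + 12 * (J3 / 2) ^ 7 * (- J5 / 1080) * (- J7 / 25200)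
      + 56 / 3 * (J3 / 2) ^ 6 * (- J5 / 1080) ^ 3"
    using beta_local_3 unfolding C by auto
  have ab: "a k = b k" if "k \<le> 3" for k by (rule asymp_series_unique[OF a b(1) that])
  have "a 0 = b 0" "a 1 = b 1" "a 2 = b 2" "a 3 = b 3" by (rule ab; simp)+
  note A = this[unfolded b(2-5)]
  show ?thesis
  proof (rule that[OF a])
    show "6 * a 0 = J3 ^ 3 / 4" unfolding A by (simp add: field_simps eval_nat_numeral)
    show "120 * a 1 = - (J3 ^ 4 * J5 / 144)" unfolding A by (simp add: field_simps eval_nat_numeral)
    show "5040 * a 2 = J3^5 * (14 * J5^2 - 81 * J3 * J7) / 25920" unfolding A by (simp add: field_simps eval_nat_numeral)
    show "362880 * a 3 = - 7 * J3^6 * (J3^2 * J9 - J3 * J5 * J7 / 5600 + 7/583200 * J5^3)" unfolding A by (simp add: field_simps eval_nat_numeral)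
  qed
qed

end

text \<open>By hypothesis \<beta> + l \<omega> is \<omega>^3 times a series in \<omega>^2, so only
  odd powers occur. The expansion for all \<omega> tending to 0+ restricts to the rotation numbers
  of caustics.\<close>

lemma beta_expansionI:
  assumes \<rho>: "\<And>n. asymp_series (\<lambda>y. (mather_beta \<gamma> l (sqrt y) + l * sqrt y) / sqrt y ^ 3) n \<rho>"
    and b: "\<And>j. b (2 * j) = 0" "b 1 = - l" "\<And>i. b (2 * i + 3) = fact (2 * i + 3) * \<rho> i"
  shows "beta_expansion \<Omega> \<gamma> l b"
proof -
  \<comment> \<open>Stopping at the even index \<open>2 * m + 4\<close>, whose coefficient vanishes,
    matches the remainder of order 3 + 2 (m + 1) exactly.\<close>
  have sum: "(\<Sum>k\<le>2 * m + 4. b k / fact k * \<omega> ^ k) = - (l * \<omega>) + \<omega> ^ 3 * (\<Sum>i\<le>m. \<rho> i * (\<omega>\<^sup>2) ^ i)" for m \<omega>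
  proof (induction m)
    case 0
    have "{..4::nat} = {0, 1, 2, 3, 4}" by auto
    then show ?case using b(1)[of 0] b(1)[of 1] b(1)[of 2] b(2) b(3)[of 0] by simp
  next
    case (Suc m)
    have "2 * Suc m + 4 = Suc (Suc (2 * m + 4))" by simp
    then have "(\<Sum>k\<le>2 * Suc m + 4. b k / fact k * \<omega> ^ k) = (\<Sum>k\<le>2 * m + 4. b k / fact k * \<omega> ^ k)
        + b (2 * Suc m + 3) / fact (2 * Suc m + 3) * \<omega> ^ (2 * Suc m + 3) + b (2 * (m + 3)) / fact (2 * (m + 3)) * \<omega> ^ (2 * (m + 3))"
      by (simp only: sum.atMost_Suc) (simp add: numeral_eq_Suc)
    moreover have "\<omega> ^ (2 * Suc m + 3) = \<omega> ^ 3 * (\<omega>\<^sup>2) ^ Suc m"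
      unfolding power_add power_mult by (rule mult.commute)
    ultimately show ?case unfolding b(1) b(3) Suc by (simp add: distrib_left)
  qed
  have sq: "filterlim (\<lambda>\<omega>::real. \<omega>\<^sup>2) (at_right 0) (at_right 0)" by real_asymp
  have 1: "asymp_series (mather_beta \<gamma> l) (2 * m + 4) (\<lambda>k. b k / fact k)" for m
  proof -
    let ?g = "\<lambda>y. (mather_beta \<gamma> l (sqrt y) + l * sqrt y) / sqrt y ^ 3 - (\<Sum>i\<le>m. \<rho> i * y ^ i)"
    have "(\<lambda>\<omega>. ?g (\<omega>\<^sup>2)) \<in> O[at_right 0](\<lambda>\<omega>. (\<omega>\<^sup>2) ^ (m + 1))"
      using landau_o.big.compose[OF \<rho>[of m, unfolded asymp_series_def] sq] .
    then have "(\<lambda>\<omega>. \<omega> ^ 3 * ?g (\<omega>\<^sup>2)) \<in> O[at_right 0](\<lambda>\<omega>. \<omega> ^ 3 * (\<omega>\<^sup>2) ^ (m + 1))"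
      by (intro landau_o.big.mult landau_o.big_refl)
    moreover have "\<omega> ^ 3 * (\<omega>\<^sup>2) ^ (m + 1) = \<omega> ^ (2 * m + 4 + 1)" for \<omega> :: real
      unfolding power_mult[symmetric] power_add[symmetric] by (rule arg_cong[where f = "(^) \<omega>"]) simp
    ultimately have "(\<lambda>\<omega>. \<omega> ^ 3 * ?g (\<omega>\<^sup>2)) \<in> O[at_right 0](\<lambda>\<omega>. \<omega> ^ (2 * m + 4 + 1))" by simp
    moreover have "\<forall>\<^sub>F \<omega> in at_right 0. \<omega> ^ 3 * ?g (\<omega>\<^sup>2) = mather_beta \<gamma> l \<omega> - (\<Sum>k\<le>2 * m + 4. b k / fact k * \<omega> ^ k)"
      using eventually_at_right_less[of 0]
    proof eventually_elim
      case (elim \<omega>)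
      then show ?case using sum[of \<omega> m] by (simp add: right_diff_distrib)
    qed
    ultimately show ?thesis unfolding asymp_series_def by (subst (asm) landau_o.big.in_cong)
  qed
  have 2: "asymp_series (mather_beta \<gamma> l) n (\<lambda>k. b k / fact k)" for n
    by (rule asymp_series_le[OF 1[of n]]) simp
  show ?thesis
    unfolding beta_expansion_def
  proof
    fix n
    have "at 0 within ({0<..} \<inter> caustic_rotation_numbers \<Omega> \<gamma> l) \<le> at_right (0::real)"
      by (rule at_le) auto
    from landau_o.big.filter_mono[OF this 2[of n, unfolded asymp_series_def]]
    show "(\<lambda>\<omega>. mather_beta \<gamma> l \<omega> - (\<Sum>k\<le>n. b k * \<omega> ^ k / fact k))
        \<in> O[at 0 within ({0<..} \<inter> caustic_rotation_numbers \<Omega> \<gamma> l)](\<lambda>\<omega>. \<omega> ^ (n + 1))" by simp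
  qed
qed

text \<open>The expression depends on the pair only through \<open>c\<close>. Along the filter c + l
  tends to 0+, so composing the one-variable expansion with this map suffices.\<close>

lemma alpha_expansionI:
  assumes a: "\<And>n. asymp_series (\<lambda>x. x powr (-3/2) * mather_alpha \<gamma> l (x - l)) n a"
  shows "alpha_expansion \<Omega> \<gamma> l a"
  unfolding alpha_expansion_def
proof
  fix n
  have "filterlim snd (at_right (- l)) (at_right (0::real) \<times>\<^sub>F at_right (- l))" by (rule filterlim_snd)
  then have "filterlim snd (at_right (- l)) (caustic_length_filter \<Omega> \<gamma> l)"
    unfolding caustic_length_filter_def by (rule filterlim_mono) auto
  moreover have "filterlim (\<lambda>c. c + l) (at_right 0) (at_right (- l))"
    by (simp add: filterlim_at_right_to_0[of _ _ "- l"] filterlim_ident)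
  ultimately have "filterlim (\<lambda>p. snd p + l) (at_right 0) (caustic_length_filter \<Omega> \<gamma> l)"
    by (rule filterlim_compose[rotated])
  from landau_o.big.compose[OF a[of n, unfolded asymp_series_def] this]
  show "(\<lambda>(\<omega>, c). (c + l) powr (-3/2) * mather_alpha \<gamma> l c - (\<Sum>k\<le>n. a k * (c + l) ^ k))
      \<in> O[caustic_length_filter \<Omega> \<gamma> l](\<lambda>(\<omega>, c). (c + l) ^ (n + 1))"
    by (simp add: case_prod_unfold)
qed

theorem theorem1:
  fixes \<Omega> :: "complex set" and \<gamma> :: "real \<Rightarrow> complex" and l :: real
    and k :: "real \<Rightarrow> real" and J1 J3 J5 J7 J9 :: real
  assumes "billiard_table \<Omega> \<gamma> l"
    and "k = curvature \<gamma>"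
    and "J1 = I1 l" and "J3 = I3 k l" and "J5 = I5 k l" and "J7 = I7 k l" and "J9 = I9 k l"
  shows "(\<exists>b. beta_expansion \<Omega> \<gamma> l b \<and>
            (\<forall>j. b (2 * j) = 0) \<and>
            b 1 = - J1 \<and>
            b 3 = J3^3 / 4 \<and>
            b 5 = - (J3^4 * J5 / 144) \<and>
            b 7 = J3^5 * (14 * J5^2 - 81 * J3 * J7) / 25920 \<and>
            b 9 = - 7 * J3^6 * (J3^2 * J9 - J3 * J5 * J7 / 5600 + 7/583200 * J5^3))
       \<and> (\<exists>a. alpha_expansion \<Omega> \<gamma> l a \<and>
            a 0 = 4 * sqrt 2 / 3 * J3 powr (-3/2) \<and>
            a 1 = sqrt 2 / 135 * J3 powr (-7/2) * J5 \<and>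
            a 2 = 1 / (56700 * sqrt 2) * ((72 * J3 * J7 + 7 * J5^2) / J3 powr (11/2)) \<and>
            a 3 = 1 / (826686000 * sqrt 2)
                    * ((261273600 * J3^2 * J9 + 21384 * J3 * J5 * J7 + 1001 * J5^3)
                       / J3 powr (15/2)))"
proof -
  interpret table \<Omega> \<gamma> l by standard (rule assms(1))
  obtain w v tx ty where "billiard_frame \<Omega> \<gamma> l w v tx ty" by (rule billiard_frame_exists)
  then interpret billiard_frame \<Omega> \<gamma> l w v tx ty .
  note J = assms(4-7)[unfolded assms(2)]
  have J1: "J1 = l" using l_pos by (simp add: assms(3) I1_def)
  obtain \<rho> where \<rho>: "\<And>n. asymp_series (\<lambda>y. (mather_beta \<gamma> l (sqrt y) + l * sqrt y) / sqrt y ^ 3) n \<rho>"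
    "6 * \<rho> 0 = J3 ^ 3 / 4" "120 * \<rho> 1 = - (J3 ^ 4 * J5 / 144)"
    "5040 * \<rho> 2 = J3^5 * (14 * J5^2 - 81 * J3 * J7) / 25920"
    "362880 * \<rho> 3 = - 7 * J3^6 * (J3^2 * J9 - J3 * J5 * J7 / 5600 + 7/583200 * J5^3)"
    by (rule beta_series[OF J]) blast
  obtain a where a: "\<And>n. asymp_series (\<lambda>x. x powr (-3/2) * mather_alpha \<gamma> l (x - l)) n a"
    "a 0 = 4 * sqrt 2 / 3 * J3 powr (-3/2)"
    "a 1 = sqrt 2 / 135 * J3 powr (-7/2) * J5"
    "a 2 = 1 / (56700 * sqrt 2) * ((72 * J3 * J7 + 7 * J5^2) / J3 powr (11/2))"
    "a 3 = 1 / (826686000 * sqrt 2)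
      * ((261273600 * J3^2 * J9 + 21384 * J3 * J5 * J7 + 1001 * J5^3) / J3 powr (15/2))"
    by (rule alpha_series[OF J]) blast
  define b where "b n = (if even n then 0 else if n = 1 then - l else fact n * \<rho> ((n - 3) div 2))" for n
  have b: "b (2 * j) = 0" "b 1 = - l" "b (2 * i + 3) = fact (2 * i + 3) * \<rho> i" for i j
    by (simp_all add: b_def)
  have "b 3 = 6 * \<rho> 0" "b 5 = 120 * \<rho> 1" "b 7 = 5040 * \<rho> 2" "b 9 = 362880 * \<rho> 3"
    using b(3)[of 0] b(3)[of 1] b(3)[of 2] b(3)[of 3] by (simp_all add: fact_numeral)
  then have "beta_expansion \<Omega> \<gamma> l b \<and>
            (\<forall>j. b (2 * j) = 0) \<and>
            b 1 = - J1 \<and>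
            b 3 = J3^3 / 4 \<and>
            b 5 = - (J3^4 * J5 / 144) \<and>
            b 7 = J3^5 * (14 * J5^2 - 81 * J3 * J7) / 25920 \<and>
            b 9 = - 7 * J3^6 * (J3^2 * J9 - J3 * J5 * J7 / 5600 + 7/583200 * J5^3)"
    unfolding \<rho>(2-5) J1 using beta_expansionI[OF \<rho>(1) b] b(1,2) by blast
  moreover have "alpha_expansion \<Omega> \<gamma> l a" by (rule alpha_expansionI[OF a(1)])
  ultimately show ?thesis using a(2-5) by blast
qed

end
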